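(* Let $(M,\omega)$ be a symplectic manifold of dimension $2n$. For each integer $p$ with $0\le p\le n$ there exists a natural equivalence of $A_\infty$-algebras $$\mathcal F_p(M)\simeq \mathrm{Cone}(\omega^{p+1}),$$ where $\mathcal F_p(M)$ is the $A_\infty$-algebra of $p$-filtered forms on $(M,\omega)$ and the commutative differential graded algebra $\mathrm{Cone}(\omega^{p+1})$ is regarded as an $A_\infty$-algebra with $m^l=0$ for $l\ge 3$.
   Context: **Forms.** Let $\Omega^k=\Omega^k(M)$ be the smooth real $k$-forms on $(M^{2n},\omega)$. Put $L\eta=\omega\wedge\eta$, let $\Lambda:\Omega^k\to\Omega^{k-2}$ be the interior product with the Poisson bivector field of $\omega$, and let $P^s=\{\beta\in\Omega^s:\Lambda\beta=0\}$ be the primitive $s$-forms. Every form is uniquely a sum of terms $L^j\beta_s$ with $\beta_s\in P^s$, $0\le s\le n$, $0\le j\le n-s$ (Lefschetz decomposition). Define linear operators termwise: $L^{-q}(L^j\beta_s)=L^{j-q}\beta_s$ if $j\ge q$ and $0$ otherwise ($q>0$); $*_r(L^j\beta_s)=L^{n-j-s}\beta_s$; $\Pi^p=1-L^{p+1}L^{-(p+1)}$ (keeps the terms with $j\le p$). For $\beta_s\in P^s$ write uniquely $d\beta_s=\beta'_{s+1}+\omega\wedge\beta''_{s-1}$ with $\beta',\beta''$ primitive, and set $\partial_+(L^j\beta_s)=L^j\beta'_{s+1}$, $\partial_-(L^j\beta_s)=L^j\beta''_{s-1}$. The $p$-filtered $k$-forms are $F^p\Omega^k=\Pi^p\Omega^k$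 (zero unless $0\le k\le n+p$). Set $d_+=\Pi^p\circ d$ and $d_-=*_r\,d\,*_r$. **$A_\infty$-algebras.** An $A_\infty$-algebra is a graded vector space $A$ with operations $m^l:A^{\otimes l}\to A[2-l]$, $l\ge1$, with $\sum_{r+s+t=N}(-1)^{r+st}m^{r+t+1}(\mathrm{id}^{\otimes r}\otimes m^s\otimes\mathrm{id}^{\otimes t})=0$ for all $N\ge 1$. An $A_\infty$-map $A\to B$ is a sequence $g^l:A^{\otimes l}\to B[1-l]$ with $\sum_{r+s+t=N}(-1)^{r+st}g^{r+1+t}(1^{\otimes r}\otimes m_A^s\otimes1^{\otimes t})=\sum_{i_1+\dots+i_q=N}(-1)^u m_B^q(g^{i_1}\otimes\dots\otimes g^{i_q})$ for all $N\ge1$, $u=(q-1)(i_1-1)+(q-2)(i_2-1)+\dots+(i_{q-1}-1)$ (Koszul sign rule). It is an equivalence if $g^1$ is a quasi-isomorphism. "Natural" means that the equivalence is given canonically by local operators on forms, hence is compatible with restriction to open subsets. **The $A_\infty$-algebra $\mathcal F_p$.** Let $\mathcal F_p^j=F^p\Omega^j$ for $0\le j\le n+p$, $\mathcal F_p^j=\overline{F^p\Omega^{2n+2p+1-j}}$ for $n+p+1\le j\le 2n+2p+1$, and $0$ otherwise, where $\overline{F^p\Omega^k}$ is a copy of $F^p\Omega^k$ (placed in degree $2n+2p+1-k$). The differential $m^1$ is $d_+$ on $F^p\Omega^k$, $k<n+p$; $-\partial_+\partial_-:F^p\Omega^{n+p}\to\overline{F^p\Omega^{n+p}}$; and $-d_-:\overline{F^p\Omega^k}\to\overline{F^p\Omega^{k-1}}$.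 The product $m^2$ is: - for $a_i\in F^p\Omega^{k_i}$, $k_1+k_2\le n+p$: $m^2(a_1,a_2)=\Pi^p(a_1\wedge a_2)$; - for $a_i\in F^p\Omega^{k_i}$, $k_1+k_2>n+p$: $m^2(a_1,a_2)=\Pi^p *_r\big(-dL^{-(p+1)}(a_1\wedge a_2)+(L^{-(p+1)}da_1)\wedge a_2+(-1)^{k_1}a_1\wedge L^{-(p+1)}da_2\big)$, viewed in the barred part; - for $a_1\in F^p\Omega^{k_1}$, $a_2\in\overline{F^p\Omega^{k_2}}$: $m^2(a_1,a_2)=(-1)^{k_1}*_r(a_1\wedge *_ra_2)$, barred; - for $a_1\in\overline{F^p\Omega^{k_1}}$, $a_2\in F^p\Omega^{k_2}$: $m^2(a_1,a_2)=*_r(( *_ra_1)\wedge a_2)$, barred; - $m^2=0$ on two barred elements. The operation $m^3(a_1,a_2,a_3)$, for $a_i\in F^p\Omega^{k_i}$ (unbarred) with $k_1+k_2+k_3\ge n+p+2$, is $\Pi^p*_r\big[a_1\wedge L^{-(p+1)}(a_2\wedge a_3)-L^{-(p+1)}(a_1\wedge a_2)\wedge a_3\big]$ (barred), and $m^3=0$ otherwise; $m^l=0$ for $l\ge4$. (It is known that this is an $A_\infty$-algebra.) **The cone.** $\mathrm{Cone}(\omega^{p+1})$ is the cdga obtained from $\Omega^\bullet(M)$ by freely adjoining a variable $\theta$ of degree $2p+1$ with $d\theta=\omega^{p+1}$: in degree $k$ it is $\Omega^k\oplus\theta\,\Omega^{k-2p-1}$, with $d(\eta+\theta\xi)=(d\eta+\omega^{p+1}\wedge\xi)-\theta\,d\xi$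 and product $(\alpha+\theta\alpha')(\beta+\theta\beta')=\alpha\wedge\beta+\theta(\alpha'\wedge\beta+(-1)^{|\alpha|}\alpha\wedge\beta')$. *)

theory Defs
  imports "HOL-Analysis.Analysis" "HOL-Library.Function_Algebras"
begin

section \<open>\<open>A\<^sub>\<infinity>\<close>-algebras\<close>

text \<open>
  A graded vector space is a family of subspaces, indexed by the degree, of a real vector space.
  Degrees are external: a homogeneous element is a pair of a degree and a vector, and
  \<open>mu A [(k\<^sub>1, a\<^sub>1), \<dots>, (k\<^sub>l, a\<^sub>l)]\<close> is \<open>m\<^sup>l(a\<^sub>1 \<otimes> \<dots> \<otimes> a\<^sub>l)\<close> for \<open>a\<^sub>i\<close> in degree \<open>k\<^sub>i\<close>.
  Linear maps on \<open>A\<^bsup>\<otimes>l\<^esup>\<close> are thus given as multilinear maps on homogeneous elements, and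
  equations between them are stated on homogeneous arguments, with the Koszul signs written out.
\<close>

record 'v graded_ops =
  piece :: "int \<Rightarrow> 'v set"
  mu :: "(int \<times> 'v) list \<Rightarrow> 'v"

definition homogeneous :: "(int \<Rightarrow> 'v set) \<Rightarrow> (int \<times> 'v) list \<Rightarrow> bool" where
  "homogeneous A xs \<longleftrightarrow> (\<forall>(k, a) \<in> set xs. a \<in> A k)"

definition total_degree :: "(int \<times> 'v) list \<Rightarrow> int" where
  "total_degree xs = sum_list (map fst xs)"

definition sgn_pow :: "int \<Rightarrow> real" where
  "sgn_pow e = (if even e then 1 else -1)"

text \<open>Linear maps \<open>A\<^bsup>\<otimes>l\<^esup> \<rightarrow> B[e]\<close>, where \<open>B[e]\<close> is \<open>B (k + e)\<close> in degree \<open>k\<close>.\<close>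

definition graded_multilinear ::
  "(int \<Rightarrow> 'v::real_vector set) \<Rightarrow> (int \<Rightarrow> 'w::real_vector set) \<Rightarrow> int \<Rightarrow> nat \<Rightarrow>
    ((int \<times> 'v) list \<Rightarrow> 'w) \<Rightarrow> bool" where
  "graded_multilinear A B e l f \<longleftrightarrow>
    (\<forall>xs. length xs = l \<and> homogeneous A xs \<longrightarrow> f xs \<in> B (total_degree xs + e)) \<and>
    (\<forall>xs ys k. length xs + 1 + length ys = l \<and> homogeneous A xs \<and> homogeneous A ys \<longrightarrow>
      (\<forall>a\<in>A k. \<forall>b\<in>A k. f (xs @ (k, a + b) # ys) = f (xs @ (k, a) # ys) + f (xs @ (k, b) # ys)) \<and>
      (\<forall>a\<in>A k. \<forall>r. f (xs @ (k, r *\<^sub>R a) # ys) = r *\<^sub>R f (xs @ (k, a) # ys)))"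

text \<open>
  The value on \<open>xs\<close> (of length \<open>N\<close>) of
  \<open>\<Sum>\<^bsub>r+s+t=N\<^esub> (-1)\<^bsup>r+st\<^esup> f (id\<^bsup>\<otimes>r\<^esup> \<otimes> m\<^sup>s \<otimes> id\<^bsup>\<otimes>t\<^esup>)\<close>; moving \<open>m\<^sup>s\<close>, which has degree \<open>2-s\<close>,
  past the first \<open>r\<close> arguments produces the second sign.
\<close>

definition insertion_sum ::
  "'v graded_ops \<Rightarrow> ((int \<times> 'v) list \<Rightarrow> 'w::real_vector) \<Rightarrow> (int \<times> 'v) list \<Rightarrow> 'w" where
  "insertion_sum A f xs =
    (\<Sum>s = 1..length xs. \<Sum>r = 0..length xs - s.
      let t = length xs - s - r; ys = take s (drop r xs)
      in (sgn_pow (int (r + s * t)) * sgn_pow ((2 - int s) * total_degree (take r xs))) *\<^sub>R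
           f (take r xs @ (total_degree ys + 2 - int s, mu A ys) # drop (r + s) xs))"

definition ainf_algebra :: "'v::real_vector graded_ops \<Rightarrow> bool" where
  "ainf_algebra A \<longleftrightarrow>
    (\<forall>k. subspace (piece A k)) \<and>
    (\<forall>l\<ge>1. graded_multilinear (piece A) (piece A) (2 - int l) l (mu A)) \<and>
    (\<forall>xs. xs \<noteq> [] \<and> homogeneous (piece A) xs \<longrightarrow> insertion_sum A (mu A) xs = 0)"

text \<open>
  The value on \<open>xs\<close> of \<open>\<Sum> (-1)\<^sup>u m\<^sup>q (g\<^bsup>i\<^sub>1\<^esup> \<otimes> \<dots> \<otimes> g\<^bsup>i\<^sub>q\<^esup>)\<close>. The summation runs over the ways of cutting
  \<open>xs\<close> into nonempty consecutive blocks, of lengths \<open>i\<^sub>1, \<dots>, i\<^sub>q\<close>; the map applied to block \<open>b\<close>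
  has degree \<open>1 - i\<^sub>b\<close> and moves past all the arguments in the earlier blocks.
\<close>

definition block_sum ::
  "'w::real_vector graded_ops \<Rightarrow> ((int \<times> 'v) list \<Rightarrow> 'w) \<Rightarrow> (int \<times> 'v) list \<Rightarrow> 'w" where
  "block_sum B g xs =
    (\<Sum>bs \<in> {bs. concat bs = xs \<and> [] \<notin> set bs}.
      let q = length bs;
          u = (\<Sum>b<q. (int q - 1 - int b) * (int (length (bs ! b)) - 1));
          koszul = (\<Sum>b<q. (1 - int (length (bs ! b))) * total_degree (concat (take b bs)))
      in (sgn_pow u * sgn_pow koszul) *\<^sub>R
           mu B (map (\<lambda>ys. (total_degree ys + 1 - int (length ys), g ys)) bs))"

definition ainf_map ::
  "'v::real_vector graded_ops \<Rightarrow> 'w::real_vector graded_ops \<Rightarrow> ((int \<times> 'v) list \<Rightarrow> 'w) \<Rightarrow> bool" where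
  "ainf_map A B g \<longleftrightarrow>
    (\<forall>l\<ge>1. graded_multilinear (piece A) (piece B) (1 - int l) l g) \<and>
    (\<forall>xs. xs \<noteq> [] \<and> homogeneous (piece A) xs \<longrightarrow> insertion_sum A g xs = block_sum B g xs)"

definition cocycles :: "'v::real_vector graded_ops \<Rightarrow> int \<Rightarrow> 'v set" where
  "cocycles A k = {a \<in> piece A k. mu A [(k, a)] = 0}"

definition cohomology_class :: "'v::real_vector graded_ops \<Rightarrow> int \<Rightarrow> 'v \<Rightarrow> 'v set" where
  "cohomology_class A k a = {a + mu A [(k - 1, b)] | b. b \<in> piece A (k - 1)}"

definition cohomology :: "'v::real_vector graded_ops \<Rightarrow> int \<Rightarrow> 'v set set" where
  "cohomology A k = cohomology_class A k ` cocycles A k"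

definition quasi_iso ::
  "'v::real_vector graded_ops \<Rightarrow> 'w::real_vector graded_ops \<Rightarrow> ((int \<times> 'v) list \<Rightarrow> 'w) \<Rightarrow> bool" where
  "quasi_iso A B g \<longleftrightarrow>
    (\<forall>k. \<exists>\<phi>. bij_betw \<phi> (cohomology A k) (cohomology B k) \<and>
      (\<forall>a\<in>cocycles A k. \<phi> (cohomology_class A k a) = cohomology_class B k (g [(k, a)])))"

definition ainf_equivalence ::
  "'v::real_vector graded_ops \<Rightarrow> 'w::real_vector graded_ops \<Rightarrow> ((int \<times> 'v) list \<Rightarrow> 'w) \<Rightarrow> bool" where
  "ainf_equivalence A B g \<longleftrightarrow>
    ainf_algebra A \<and> ainf_algebra B \<and> ainf_map A B g \<and> quasi_iso A B g"


section \<open>Smooth manifolds\<close>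

primrec Ck_on :: "nat \<Rightarrow> ('b::real_normed_vector \<Rightarrow> 'c::real_normed_vector) \<Rightarrow> 'b set \<Rightarrow> bool" where
  "Ck_on 0 f S = continuous_on S f"
| "Ck_on (Suc k) f S =
    ((\<forall>x\<in>S. f differentiable (at x)) \<and> (\<forall>v. Ck_on k (\<lambda>x. frechet_derivative f (at x) v) S))"

text \<open>Only used for open \<open>S\<close>.\<close>

definition smooth_on :: "('b::real_normed_vector \<Rightarrow> 'c::real_normed_vector) \<Rightarrow> 'b set \<Rightarrow> bool" where
  "smooth_on f S \<longleftrightarrow> (\<forall>k. Ck_on k f S)"

text \<open>A chart is a domain together with a coordinate map, whose values off the domain are irrelevant.\<close>

type_synonym ('a, 'b) chart = "'a set \<times> ('a \<Rightarrow> 'b)"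

definition chart_image :: "('a, 'b) chart \<Rightarrow> 'b set" where
  "chart_image c = snd c ` fst c"

definition overlap :: "('a, 'b) chart \<Rightarrow> ('a, 'b) chart \<Rightarrow> 'b set" where
  "overlap c c' = snd c ` (fst c \<inter> fst c')"

definition transition :: "('a, 'b) chart \<Rightarrow> ('a, 'b) chart \<Rightarrow> 'b \<Rightarrow> 'b" where
  "transition c c' = snd c' \<circ> inv_into (fst c) (snd c)"

definition topological_chart :: "'a topology \<Rightarrow> ('a, 'b::euclidean_space) chart \<Rightarrow> bool" where
  "topological_chart X c \<longleftrightarrow> openin X (fst c) \<and> open (chart_image c) \<and>
    homeomorphic_map (subtopology X (fst c)) (top_of_set (chart_image c)) (snd c)"

definition smoothly_compatible ::
  "('a, 'b::euclidean_space) chart \<Rightarrow> ('a, 'b) chart \<Rightarrow> bool" where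
  "smoothly_compatible c c' \<longleftrightarrow>
    smooth_on (transition c c') (overlap c c') \<and> smooth_on (transition c' c) (overlap c' c)"

locale smooth_manifold =
  fixes X :: "'a topology" and A :: "('a, 'b::euclidean_space) chart set"
  assumes Hausdorff: "Hausdorff_space X"
    and second_countable: "second_countable X"
    and charts: "\<And>c. c \<in> A \<Longrightarrow> topological_chart X c"
    and cover: "topspace X = (\<Union>c\<in>A. fst c)"
    and compatible: "\<And>c c'. c \<in> A \<Longrightarrow> c' \<in> A \<Longrightarrow> smoothly_compatible c c'"
    and maximal: "\<And>c. topological_chart X c \<Longrightarrow> (\<And>c'. c' \<in> A \<Longrightarrow> smoothly_compatible c c') \<Longrightarrow> c \<in> A"

text \<open>The maximal atlas of the open submanifold \<open>U\<close>.\<close>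

definition restrict_atlas :: "'a set \<Rightarrow> ('a, 'b) chart set \<Rightarrow> ('a, 'b) chart set" where
  "restrict_atlas U A = {c \<in> A. fst c \<subseteq> U}"

text \<open>The chart that \<open>c\<close> becomes under an injective map \<open>h\<close> of its domain.\<close>

definition push_chart :: "('a \<Rightarrow> 'a) \<Rightarrow> ('a, 'b) chart \<Rightarrow> ('a, 'b) chart" where
  "push_chart h c = (h ` fst c, snd c \<circ> inv_into (fst c) h)"

text \<open>
  As the atlases are maximal, a bijection is a diffeomorphism if and only if it takes charts to
  charts.
\<close>

definition diffeomorphism ::
  "'a topology \<Rightarrow> ('a, 'b) chart set \<Rightarrow> 'a topology \<Rightarrow> ('a, 'b) chart set \<Rightarrow> ('a \<Rightarrow> 'a) \<Rightarrow> bool" where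
  "diffeomorphism X A X' A' h \<longleftrightarrow>
    bij_betw h (topspace X) (topspace X') \<and> push_chart h ` A \<subseteq> A'"


section \<open>Differential forms\<close>

instantiation "fun" :: (type, real_vector) real_vector
begin

definition scaleR_fun :: "real \<Rightarrow> ('a \<Rightarrow> 'b) \<Rightarrow> 'a \<Rightarrow> 'b" where
  "scaleR_fun r f = (\<lambda>x. r *\<^sub>R f x)"

instance
  by standard (simp_all add: scaleR_fun_def fun_eq_iff scaleR_add_right scaleR_add_left)

end

text \<open>
  An alternating \<open>k\<close>-form on a vector space is a function on lists of vectors, extended by zero
  to the lists whose length is not \<open>k\<close>. It is zero if \<open>k < 0\<close>.
\<close>

definition alternating_form :: "int \<Rightarrow> ('b::real_vector list \<Rightarrow> real) \<Rightarrow> bool" where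
  "alternating_form k \<alpha> \<longleftrightarrow>
    (\<forall>v. int (length v) \<noteq> k \<longrightarrow> \<alpha> v = 0) \<and>
    (\<forall>v. \<forall>i<length v. linear (\<lambda>w. \<alpha> (v[i := w]))) \<and>
    (\<forall>v. \<not> distinct v \<longrightarrow> \<alpha> v = 0)"

text \<open>
  The summation runs over the \<open>(k,l)\<close>-shuffles, given by the set \<open>S\<close> of the positions of the
  vectors inserted into the first factor; the exponent counts the inversions of the shuffle.
\<close>

definition alt_wedge :: "('b list \<Rightarrow> real) \<Rightarrow> ('b list \<Rightarrow> real) \<Rightarrow> 'b list \<Rightarrow> real" where
  "alt_wedge \<alpha> \<beta> v =
    (\<Sum>S \<in> Pow {..<length v}.
      (-1) ^ card {(i, j). i \<in> {..<length v} - S \<and> j \<in> S \<and> i < j} *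
      \<alpha> (nths v S) * \<beta> (nths v (- S)))"

text \<open>
  A form on a manifold is given by its coordinate expression in every chart of the maximal atlas,
  as a function of the point in the image of the chart; these agree under pullback
  along the transition maps. To make forms a vector space, they are extended by zero off the
  atlas and off the images of the charts.
\<close>

type_synonym ('a, 'b) form = "('a, 'b) chart \<Rightarrow> 'b \<Rightarrow> 'b list \<Rightarrow> real"

definition (in smooth_manifold) forms :: "int \<Rightarrow> ('a, 'b) form set" where
  "forms k = {\<eta>.
    (\<forall>c x. c \<notin> A \<or> x \<notin> chart_image c \<longrightarrow> \<eta> c x = 0) \<and>
    (\<forall>c\<in>A. \<forall>x\<in>chart_image c. alternating_form k (\<eta> c x)) \<and>
    (\<forall>c\<in>A. \<forall>v. smooth_on (\<lambda>x. \<eta> c x v) (chart_image c)) \<and>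
    (\<forall>c\<in>A. \<forall>c'\<in>A. \<forall>x\<in>overlap c c'. \<forall>v.
      \<eta> c x v = \<eta> c' (transition c c' x) (map (frechet_derivative (transition c c') (at x)) v))}"

definition wedge :: "('a, 'b) form \<Rightarrow> ('a, 'b) form \<Rightarrow> ('a, 'b) form" (infixr \<open>\<and>\<^sub>f\<close> 70) where
  "\<eta> \<and>\<^sub>f \<xi> = (\<lambda>c x. alt_wedge (\<eta> c x) (\<xi> c x))"

text \<open>Here \<open>nths v (- {i})\<close> is \<open>v\<close> without its \<open>i\<close>-th entry.\<close>

definition ext_d :: "('a, 'b::real_normed_vector) form \<Rightarrow> ('a, 'b) form" where
  "ext_d \<eta> = (\<lambda>c x v.
    if x \<in> chart_image c
    then \<Sum>i<length v. (-1) ^ i * frechet_derivative (\<lambda>y. \<eta> c y (nths v (- {i}))) (at x) (v ! i)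
    else 0)"

definition restrict_form :: "'a set \<Rightarrow> ('a, 'b) form \<Rightarrow> ('a, 'b) form" where
  "restrict_form U \<eta> = (\<lambda>c. if fst c \<subseteq> U then \<eta> c else 0)"

text \<open>Pullback along a diffeomorphism from the manifold with atlas \<open>A\<close>.\<close>

definition pullback_form :: "('a, 'b) chart set \<Rightarrow> ('a \<Rightarrow> 'a) \<Rightarrow> ('a, 'b) form \<Rightarrow> ('a, 'b) form" where
  "pullback_form A h \<eta> = (\<lambda>c. if c \<in> A then \<eta> (push_chart h c) else 0)"


section \<open>Symplectic manifolds and filtered forms\<close>

locale symplectic_manifold = smooth_manifold X A
  for X :: "'a topology" and A :: "('a, 'b::euclidean_space) chart set" +
  fixes \<omega> :: "('a, 'b) form" and n :: nat
  assumes dimension: "DIM('b) = 2 * n"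
    and two_form: "\<omega> \<in> forms 2"
    and closed: "ext_d \<omega> = 0"
    and nondegenerate:
      "\<And>c x v. c \<in> A \<Longrightarrow> x \<in> chart_image c \<Longrightarrow> (\<And>w. \<omega> c x [v, w] = 0) \<Longrightarrow> v = 0"

text \<open>
  The matrix inverse to \<open>w [e\<^sub>i, e\<^sub>j]\<close>, that is, the components \<open>\<pi>\<^sup>i\<^sup>j\<close> of the Poisson bivector
  \<open>\<pi> = \<onehalf> \<Sum> \<pi>\<^sup>i\<^sup>j e\<^sub>i \<and> e\<^sub>j\<close>: row \<open>i\<close> is the vector whose contraction with \<open>w\<close> is the coordinate
  covector \<open>e\<^sup>i\<close>.
\<close>

definition poisson_bivector :: "('b::euclidean_space list \<Rightarrow> real) \<Rightarrow> 'b \<Rightarrow> 'b \<Rightarrow> real" where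
  "poisson_bivector w i j = (THE z. \<forall>v. w [z, v] = i \<bullet> v) \<bullet> j"

context symplectic_manifold
begin

definition Lef :: "('a, 'b) form \<Rightarrow> ('a, 'b) form" where
  "Lef \<eta> = \<omega> \<and>\<^sub>f \<eta>"

text \<open>\<open>\<Lambda> = \<onehalf> \<Sum> \<pi>\<^sup>i\<^sup>j \<iota>\<^sub>i \<iota>\<^sub>j\<close>, which is normalised so that \<open>\<Lambda> \<omega> = n\<close>.\<close>

definition Lam :: "('a, 'b) form \<Rightarrow> ('a, 'b) form" where
  "Lam \<eta> = (\<lambda>c x v.
    1/2 * (\<Sum>i\<in>Basis. \<Sum>j\<in>Basis. poisson_bivector (\<omega> c x) i j * \<eta> c x (j # i # v)))"

definition primitive :: "int \<Rightarrow> ('a, 'b) form set" where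
  "primitive s = {\<beta> \<in> forms s. Lam \<beta> = 0}"

text \<open>
  \<open>lefschetz \<eta> j s\<close> is the primitive \<open>s\<close>-form \<open>\<beta>\<^sub>s\<close> in the term \<open>L\<^sup>j \<beta>\<^sub>s\<close> of the Lefschetz
  decomposition of \<open>\<eta>\<close>.
\<close>

definition lefschetz :: "('a, 'b) form \<Rightarrow> nat \<Rightarrow> nat \<Rightarrow> ('a, 'b) form" where
  "lefschetz \<eta> = (THE \<beta>.
    (\<forall>j s. \<beta> j s \<in> (if s \<le> n \<and> j \<le> n - s then primitive (int s) else {0})) \<and>
    \<eta> = (\<Sum>s\<le>n. \<Sum>j\<le>n - s. (Lef ^^ j) (\<beta> j s)))"

definition Lef_inv :: "nat \<Rightarrow> ('a, 'b) form \<Rightarrow> ('a, 'b) form" where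
  "Lef_inv q \<eta> = (\<Sum>s\<le>n. \<Sum>j\<le>n - s. if j \<ge> q then (Lef ^^ (j - q)) (lefschetz \<eta> j s) else 0)"

definition star_r :: "('a, 'b) form \<Rightarrow> ('a, 'b) form" where
  "star_r \<eta> = (\<Sum>s\<le>n. \<Sum>j\<le>n - s. (Lef ^^ (n - j - s)) (lefschetz \<eta> j s))"

definition Proj :: "nat \<Rightarrow> ('a, 'b) form \<Rightarrow> ('a, 'b) form" where
  "Proj p \<eta> = \<eta> - (Lef ^^ (p + 1)) (Lef_inv (p + 1) \<eta>)"

definition d_primitive :: "nat \<Rightarrow> ('a, 'b) form \<Rightarrow> ('a, 'b) form \<times> ('a, 'b) form" where
  "d_primitive s \<beta> = (THE (\<beta>', \<beta>'').
    \<beta>' \<in> primitive (int s + 1) \<and> \<beta>'' \<in> primitive (int s - 1) \<and> ext_d \<beta> = \<beta>' + \<omega> \<and>\<^sub>f \<beta>'')"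

definition del_plus :: "('a, 'b) form \<Rightarrow> ('a, 'b) form" where
  "del_plus \<eta> = (\<Sum>s\<le>n. \<Sum>j\<le>n - s. (Lef ^^ j) (fst (d_primitive s (lefschetz \<eta> j s))))"

definition del_minus :: "('a, 'b) form \<Rightarrow> ('a, 'b) form" where
  "del_minus \<eta> = (\<Sum>s\<le>n. \<Sum>j\<le>n - s. (Lef ^^ j) (snd (d_primitive s (lefschetz \<eta> j s))))"

definition d_plus :: "nat \<Rightarrow> ('a, 'b) form \<Rightarrow> ('a, 'b) form" where
  "d_plus p \<eta> = Proj p (ext_d \<eta>)"

definition d_minus :: "('a, 'b) form \<Rightarrow> ('a, 'b) form" where
  "d_minus \<eta> = star_r (ext_d (star_r \<eta>))"

definition filtered_forms :: "nat \<Rightarrow> int \<Rightarrow> ('a, 'b) form set" where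
  "filtered_forms p k = Proj p ` forms k"

text \<open>
  A barred form is represented by the form itself: an element of \<open>\<F>\<^sub>p\<close> is barred if and only if
  its degree exceeds \<open>n + p\<close>. The degrees in the operations below are those in \<open>\<F>\<^sub>p\<close>, which
  for unbarred elements are their degrees as forms.
\<close>

definition filtered_piece :: "nat \<Rightarrow> int \<Rightarrow> ('a, 'b) form set" where
  "filtered_piece p j =
    (if 0 \<le> j \<and> j \<le> int (n + p) then filtered_forms p j
     else if int (n + p + 1) \<le> j \<and> j \<le> int (2*n + 2*p + 1)
       then filtered_forms p (int (2*n + 2*p + 1) - j)
     else {0})"

definition filtered_m1 :: "nat \<Rightarrow> int \<times> ('a, 'b) form \<Rightarrow> ('a, 'b) form" where
  "filtered_m1 p = (\<lambda>(k, a).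
    if k < int (n + p) then d_plus p a
    else if k = int (n + p) then - del_plus (del_minus a)
    else - d_minus a)"

definition filtered_m2 ::
  "nat \<Rightarrow> int \<times> ('a, 'b) form \<Rightarrow> int \<times> ('a, 'b) form \<Rightarrow> ('a, 'b) form" where
  "filtered_m2 p = (\<lambda>(k\<^sub>1, a\<^sub>1) (k\<^sub>2, a\<^sub>2).
    if k\<^sub>1 \<le> int (n + p) \<and> k\<^sub>2 \<le> int (n + p) then
      if k\<^sub>1 + k\<^sub>2 \<le> int (n + p) then Proj p (a\<^sub>1 \<and>\<^sub>f a\<^sub>2)
      else Proj p (star_r (- ext_d (Lef_inv (p + 1) (a\<^sub>1 \<and>\<^sub>f a\<^sub>2))
                           + (Lef_inv (p + 1) (ext_d a\<^sub>1)) \<and>\<^sub>f a\<^sub>2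
                           + sgn_pow k\<^sub>1 *\<^sub>R (a\<^sub>1 \<and>\<^sub>f Lef_inv (p + 1) (ext_d a\<^sub>2))))
    else if k\<^sub>1 \<le> int (n + p) then sgn_pow k\<^sub>1 *\<^sub>R star_r (a\<^sub>1 \<and>\<^sub>f star_r a\<^sub>2)
    else if k\<^sub>2 \<le> int (n + p) then star_r (star_r a\<^sub>1 \<and>\<^sub>f a\<^sub>2)
    else 0)"

definition filtered_m3 ::
  "nat \<Rightarrow> int \<times> ('a, 'b) form \<Rightarrow> int \<times> ('a, 'b) form \<Rightarrow> int \<times> ('a, 'b) form \<Rightarrow> ('a, 'b) form" where
  "filtered_m3 p = (\<lambda>(k\<^sub>1, a\<^sub>1) (k\<^sub>2, a\<^sub>2) (k\<^sub>3, a\<^sub>3).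
    if k\<^sub>1 \<le> int (n + p) \<and> k\<^sub>2 \<le> int (n + p) \<and> k\<^sub>3 \<le> int (n + p) \<and> k\<^sub>1 + k\<^sub>2 + k\<^sub>3 \<ge> int (n + p + 2)
    then Proj p (star_r (a\<^sub>1 \<and>\<^sub>f Lef_inv (p + 1) (a\<^sub>2 \<and>\<^sub>f a\<^sub>3) - Lef_inv (p + 1) (a\<^sub>1 \<and>\<^sub>f a\<^sub>2) \<and>\<^sub>f a\<^sub>3))
    else 0)"

definition filtered_algebra :: "nat \<Rightarrow> ('a, 'b) form graded_ops" where
  "filtered_algebra p = \<lparr>
    piece = filtered_piece p,
    mu = (\<lambda>xs. case xs of
        [x] \<Rightarrow> filtered_m1 p x
      | [x, y] \<Rightarrow> filtered_m2 p x y
      | [x, y, z] \<Rightarrow> filtered_m3 p x y z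
      | _ \<Rightarrow> 0)\<rparr>"

text \<open>The pair \<open>(\<eta>, \<xi>)\<close> stands for \<open>\<eta> + \<theta> \<xi>\<close>, and \<open>(Lef ^^ p) \<omega>\<close> is \<open>\<omega>\<^bsup>p+1\<^esup>\<close>.\<close>

definition cone_algebra :: "nat \<Rightarrow> (('a, 'b) form \<times> ('a, 'b) form) graded_ops" where
  "cone_algebra p = \<lparr>
    piece = (\<lambda>k. forms k \<times> forms (k - 2 * int p - 1)),
    mu = (\<lambda>xs. case xs of
        [(k, \<eta>, \<xi>)] \<Rightarrow> (ext_d \<eta> + (Lef ^^ p) \<omega> \<and>\<^sub>f \<xi>, - ext_d \<xi>)
      | [(k, \<alpha>, \<alpha>'), (l, \<beta>, \<beta>')] \<Rightarrow> (\<alpha> \<and>\<^sub>f \<beta>, \<alpha>' \<and>\<^sub>f \<beta> + sgn_pow k *\<^sub>R (\<alpha> \<and>\<^sub>f \<beta>'))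
      | _ \<Rightarrow> 0)\<rparr>"

end


section \<open>Natural equivalences\<close>

type_synonym ('a, 'b) ops_family =
  "('a, 'b) chart set \<Rightarrow> ('a, 'b) form \<Rightarrow>
    (int \<times> ('a, 'b) form) list \<Rightarrow> ('a, 'b) form \<times> ('a, 'b) form"

definition symplectomorphism ::
  "'a topology \<Rightarrow> ('a, 'b) chart set \<Rightarrow> ('a, 'b) form \<Rightarrow>
    'a topology \<Rightarrow> ('a, 'b) chart set \<Rightarrow> ('a, 'b) form \<Rightarrow> ('a \<Rightarrow> 'a) \<Rightarrow> bool" where
  "symplectomorphism X A \<omega> X' A' \<omega>' h \<longleftrightarrow>
    diffeomorphism X A X' A' h \<and> pullback_form A h \<omega>' = \<omega>"

text \<open>
  A family \<open>g\<close> assigns operations \<open>g A \<omega>\<close> on forms to the symplectic manifold with maximal atlas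
  \<open>A\<close> and symplectic form \<open>\<omega>\<close> (the maximal atlas determines the topology). That it is local means
  that it commutes with restriction to open subsets; in particular, the germ of the result at a
  point depends only on the germs of the arguments there. That it is canonical means that it
  commutes with the pullback along symplectomorphisms.
\<close>

definition commutes_with_restriction :: "nat \<Rightarrow> nat \<Rightarrow> ('a, 'b::euclidean_space) ops_family \<Rightarrow> bool" where
  "commutes_with_restriction n p g \<longleftrightarrow>
    (\<forall>X A \<omega> U xs.
      symplectic_manifold X A \<omega> n \<and> openin X U \<and> xs \<noteq> [] \<and>
      homogeneous (piece (symplectic_manifold.filtered_algebra A \<omega> n p)) xs \<longrightarrow>
      g (restrict_atlas U A) (restrict_form U \<omega>) (map (apsnd (restrict_form U)) xs) =
        map_prod (restrict_form U) (restrict_form U) (g A \<omega> xs))"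

definition commutes_with_symplectomorphisms ::
  "nat \<Rightarrow> nat \<Rightarrow> ('a, 'b::euclidean_space) ops_family \<Rightarrow> bool" where
  "commutes_with_symplectomorphisms n p g \<longleftrightarrow>
    (\<forall>X A \<omega> X' A' \<omega>' h xs.
      symplectic_manifold X A \<omega> n \<and> symplectic_manifold X' A' \<omega>' n \<and>
      symplectomorphism X A \<omega> X' A' \<omega>' h \<and> xs \<noteq> [] \<and>
      homogeneous (piece (symplectic_manifold.filtered_algebra A' \<omega>' n p)) xs \<longrightarrow>
      g A \<omega> (map (apsnd (pullback_form A h)) xs) =
        map_prod (pullback_form A h) (pullback_form A h) (g A' \<omega>' xs))"

definition natural_family :: "nat \<Rightarrow> nat \<Rightarrow> ('a, 'b::euclidean_space) ops_family \<Rightarrow> bool" where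
  "natural_family n p g \<longleftrightarrow> commutes_with_restriction n p g \<and> commutes_with_symplectomorphisms n p g"

end

theory Submission
  imports Defs
begin

text \<open>
  The filtered forms are a smaller copy of the cone, and their operations are obtained from the
  product of the cone by homotopy transfer. Write \<open>L\<^bsup>-(p+1)\<^esup>\<close> for the division by
  \<open>\<omega>\<^bsup>p+1\<^esup>\<close>, and let \<open>h(\<eta> + \<theta>\<xi>) = \<theta> L\<^bsup>-(p+1)\<^esup>\<eta>\<close>. This is a map of degree \<open>-1\<close> on the cone with
  \<open>h h = 0\<close> and \<open>h D h = h\<close>, where \<open>D\<close> is the differential. Hence \<open>P = 1 - D h - h D\<close> is a
  projection, homotopic to the identity, onto the subcomplex \<open>S\<close> of all \<open>z\<close> with \<open>h z = 0\<close> and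
  \<open>h D z = 0\<close>.

  The transferred structure on \<open>S\<close> is short. The forms \<open>\<theta>\<xi>\<close> make up an ideal of square zero that
  contains the image of \<open>h\<close> and is annihilated by \<open>h\<close>. In a planar binary tree with products at the
  vertices and \<open>h\<close> on the internal edges, two internal edges therefore give zero, and what remains is
  \<open>m\<^sup>1 = D\<close>, \<open>m\<^sup>2(x, y) = P(x y)\<close> and \<open>m\<^sup>3 = P W\<close> with
  \<open>W(x, y, z) = h(x y) z - (-1)\<^bsup>|x|\<^esup> x h(y z)\<close>. The map from \<open>S\<close> to the cone has the components
  \<open>g\<^sup>1(x) = x\<close> and \<open>g\<^sup>2(x, y) = - h(x y)\<close>. The relations with at most four arguments are
  \<open>transferred_leibniz\<close>, \<open>transferred_associativity\<close>, \<open>transferred_pentagon\<close> and \<open>P_W\<close>; in those with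
  more arguments every summand is zero (\<open>ainf_A\<close>, \<open>ainf_map_g\<close>). The map is a quasi-isomorphism as \<open>P\<close>
  is homotopic to the identity (\<open>quasi_iso_g\<close>).

  The link to filtered forms is the map \<open>to_cone\<close>. An unbarred form \<open>a\<close> goes to
  \<open>a - \<theta> L\<^bsup>-(p+1)\<^esup> d a\<close>, and a barred one to \<open>- \<theta> *\<^sub>r a\<close>. Its image is \<open>S\<close> (\<open>to_cone_image\<close>): in
  degrees up to \<open>n + p\<close>, the coefficient \<open>\<xi>\<close> has degree less than \<open>n - p\<close>, where
  \<open>\<omega>\<^bsup>p+1\<^esup>\<close> can be cancelled, so that the condition \<open>h D z = 0\<close> determines \<open>\<xi>\<close> from \<open>\<eta>\<close>, and \<open>h z = 0\<close>
  says that \<open>\<eta>\<close> is filtered; in higher degrees, \<open>\<omega>\<^bsup>p+1\<^esup> L\<^bsup>-(p+1)\<^esup>\<close> is the identity, hence \<open>\<eta> = 0\<close> and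
  \<open>\<omega>\<^bsup>p+1\<^esup> \<and> \<xi> = 0\<close>, and \<open>*\<^sub>r\<close> exchanges such \<open>\<xi>\<close> with filtered forms. Under this
  identification the operations on filtered forms are precisely the transferred ones
  (\<open>transferred_m1\<close>, \<open>transferred_m2\<close>, \<open>transferred_m3\<close>). The least obvious case is the second-order
  differential in the middle degree, which is computed in \<open>del_plus_del_minus\<close>.

  This rests on the Lefschetz decomposition. It is proved for abstract graded spaces with
  operators \<open>L\<close> and \<open>\<Lambda>\<close> such that \<open>[\<Lambda>, L] = n - k\<close> in degree \<open>k\<close>, and used twice: for the forms on
  a manifold, and for the alternating forms at one point. Comparing the two shows that
  \<open>L\<^bsup>-q\<^esup>\<close> and \<open>*\<^sub>r\<close> act point by point (\<open>local_eq\<close>), which is why the equivalence is natural. On the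
  way, the exterior algebra, smoothness of the Poisson bivector, and the rules for the exterior
  derivative are developed from the definitions. The products and derivatives of forms are handled
  through contractions: a form is determined by its contractions with vectors, and these obey
  \<open>\<iota>\<^sub>v(\<alpha> \<beta>) = \<iota>\<^sub>v\<alpha> \<beta> + (-1)\<^bsup>|\<alpha>|\<^esup> \<alpha> \<iota>\<^sub>v\<beta>\<close> and \<open>\<iota>\<^sub>v d + d \<iota>\<^sub>v = D\<^sub>v\<close> for constant \<open>v\<close>, so that identities follow by
  induction on the list of arguments.
\<close>

section \<open>Lefschetz decomposition\<close>

text \<open>
  The subspaces \<open>V k\<close> are independent but need not span the ambient space, so that this can be a space of
  functions, and no direct sum has to be formed.
\<close>

locale lefschetz_module =
  fixes V :: "int \<Rightarrow> 'v::real_vector set" and L \<Lambda> :: "'v \<Rightarrow> 'v" and n :: nat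
  assumes V_subspace: "subspace (V k)"
    and V_direct: "finite K \<Longrightarrow> (\<And>k. k \<in> K \<Longrightarrow> y k \<in> V k) \<Longrightarrow> (\<Sum>k\<in>K. y k) = 0 \<Longrightarrow> k \<in> K \<Longrightarrow> y k = 0"
    and V_bounded: "x \<in> V k \<Longrightarrow> k < 0 \<or> k > 2 * int n \<Longrightarrow> x = 0"
    and L_linear: "linear L" and \<Lambda>_linear: "linear \<Lambda>"
    and L_in: "x \<in> V k \<Longrightarrow> L x \<in> V (k + 2)" and \<Lambda>_in: "x \<in> V k \<Longrightarrow> \<Lambda> x \<in> V (k - 2)"
    and \<Lambda>_L: "x \<in> V k \<Longrightarrow> \<Lambda> (L x) - L (\<Lambda> x) = (real n - of_int k) *\<^sub>R x"
begin

definition prim :: "int \<Rightarrow> 'v set" where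
  "prim s = {\<beta> \<in> V s. \<Lambda> \<beta> = 0}"

text \<open>
  The components outside the range \<open>j \<le> n - s\<close> are required to be zero, since otherwise the
  decomposition would not be unique as a function of \<open>j\<close> and \<open>s\<close>.
\<close>

definition is_dec :: "(nat \<Rightarrow> nat \<Rightarrow> 'v) \<Rightarrow> 'v \<Rightarrow> bool" where
  "is_dec \<beta> x \<longleftrightarrow> (\<forall>j s. \<beta> j s \<in> (if s \<le> n \<and> j \<le> n - s then prim (int s) else {0})) \<and>
    x = (\<Sum>s\<le>n. \<Sum>j\<le>n - s. (L ^^ j) (\<beta> j s))"

definition dec :: "'v \<Rightarrow> nat \<Rightarrow> nat \<Rightarrow> 'v" where
  "dec x = (THE \<beta>. is_dec \<beta> x)"

text \<open>
  In contrast to the inverse image under \<open>L\<^sup>q\<close>, this is defined on all of \<open>V k\<close>: it discards the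
  terms of the decomposition that are not divisible by \<open>L\<^sup>q\<close>.
\<close>

definition Linv :: "nat \<Rightarrow> 'v \<Rightarrow> 'v" where
  "Linv q x = (\<Sum>s\<le>n. \<Sum>j\<le>n - s. if j \<ge> q then (L ^^ (j - q)) (dec x j s) else 0)"

definition star :: "'v \<Rightarrow> 'v" where
  "star x = (\<Sum>s\<le>n. \<Sum>j\<le>n - s. (L ^^ (n - j - s)) (dec x j s))"

lemma V_closed: "x \<in> V k \<Longrightarrow> y \<in> V k \<Longrightarrow> x + y \<in> V k" "x \<in> V k \<Longrightarrow> y \<in> V k \<Longrightarrow> x - y \<in> V k"
  "x \<in> V k \<Longrightarrow> - x \<in> V k" "x \<in> V k \<Longrightarrow> r *\<^sub>R x \<in> V k" "0 \<in> V k"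
  using V_subspace[of k] by (auto simp: subspace_add subspace_diff subspace_neg subspace_scale subspace_0)

lemma L_pow_linear: "linear (L ^^ j)"
proof (induction j)
  case 0
  have "linear (id :: 'v \<Rightarrow> 'v)" by (rule linear_id)
  then show ?case by (simp add: id_def)
next
  case (Suc j)
  then show ?case using linear_compose[OF _ L_linear] by (simp add: o_def)
qed

lemma \<Lambda>_pow_linear: "linear (\<Lambda> ^^ j)"
proof (induction j)
  case 0
  have "linear (id :: 'v \<Rightarrow> 'v)" by (rule linear_id)
  then show ?case by (simp add: id_def)
next
  case (Suc j)
  then show ?case using linear_compose[OF _ \<Lambda>_linear] by (simp add: o_def)
qed

lemmas L_pow_simps = linear_add[OF L_pow_linear] linear_diff[OF L_pow_linear] linear_scale[OF L_pow_linear]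
  linear_0[OF L_pow_linear] linear_sum[OF L_pow_linear] linear_neg[OF L_pow_linear]
lemmas L_simps = linear_add[OF L_linear] linear_diff[OF L_linear] linear_scale[OF L_linear]
  linear_0[OF L_linear] linear_sum[OF L_linear] linear_neg[OF L_linear]
lemmas \<Lambda>_simps = linear_add[OF \<Lambda>_linear] linear_diff[OF \<Lambda>_linear] linear_scale[OF \<Lambda>_linear]
  linear_0[OF \<Lambda>_linear] linear_sum[OF \<Lambda>_linear] linear_neg[OF \<Lambda>_linear]
lemmas \<Lambda>_pow_simps = linear_add[OF \<Lambda>_pow_linear] linear_diff[OF \<Lambda>_pow_linear] linear_scale[OF \<Lambda>_pow_linear]
  linear_0[OF \<Lambda>_pow_linear] linear_sum[OF \<Lambda>_pow_linear] linear_neg[OF \<Lambda>_pow_linear]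

lemma L_pow_in: "x \<in> V k \<Longrightarrow> i = k + 2 * int j \<Longrightarrow> (L ^^ j) x \<in> V i"
proof (induction j arbitrary: i)
  case (Suc j)
  then show ?case using L_in[of "(L ^^ j) x" "k + 2 * int j"] by (simp add: algebra_simps)
qed simp

lemma L_pow_L_pow: "(L ^^ i) ((L ^^ j) x) = (L ^^ (i + j)) x"
  by (simp add: funpow_add)

text \<open>
  The coefficient is the sum of the eigenvalues \<open>n - k, n - k - 2, \<dots>\<close> of \<open>[\<Lambda>, L]\<close> that are met
  when \<open>\<Lambda>\<close> is moved past \<open>j\<close> factors \<open>L\<close>. Whether it vanishes decides every question about the
  decomposition.
\<close>

lemma \<Lambda>_L_pow:
  assumes x: "x \<in> V k"
  shows "\<Lambda> ((L ^^ j) x) = (L ^^ j) (\<Lambda> x) + (real j * (real n - of_int k - real j + 1)) *\<^sub>R (L ^^ (j - 1)) x"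
proof (induction j)
  case (Suc j)
  have *: "\<Lambda> (L ((L ^^ j) x)) = L (\<Lambda> ((L ^^ j) x)) + (real n - of_int (k + 2 * int j)) *\<^sub>R (L ^^ j) x"
    using \<Lambda>_L[OF L_pow_in[OF x refl, of j]] by (simp add: algebra_simps)
  have "L ((L ^^ (j - 1)) x) = (L ^^ j) x" if "j > 0"
    using that by (cases j) auto
  then have "L (\<Lambda> ((L ^^ j) x)) = (L ^^ Suc j) (\<Lambda> x) + (real j * (real n - of_int k - real j + 1)) *\<^sub>R (L ^^ j) x"
    using Suc by (cases "j = 0") (simp_all add: L_simps)
  with * have "\<Lambda> ((L ^^ Suc j) x) = (L ^^ Suc j) (\<Lambda> x) +
      (real j * (real n - of_int k - real j + 1) + (real n - of_int (k + 2 * int j))) *\<^sub>R (L ^^ j) x"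
    by (simp add: scaleR_add_left)
  also have "real j * (real n - of_int k - real j + 1) + (real n - of_int (k + 2 * int j)) =
      real (Suc j) * (real n - of_int k - real (Suc j) + 1)"
    by (simp add: algebra_simps)
  finally show ?case by simp
qed simp

lemma L_pow_eventually_zero:
  assumes "x \<in> V k" obtains j where "(L ^^ j) x = 0" "j > 0"
proof
  let ?j = "Suc (nat (2 * int n - k))"
  show "(L ^^ ?j) x = 0"
    by (rule V_bounded[OF L_pow_in[OF assms refl]]) (cases "2 * int n - k \<ge> 0"; simp)
qed simp

text \<open>
  For degree reasons some power of \<open>L\<close> annihilates \<open>x\<close>, and the hypothesis lowers the exponent step
  by step. It is used with \<open>\<Lambda>\<close> applied to \<open>L\<^sup>i x = 0\<close>.
\<close>

lemma zero_if_\<Lambda>_lowers: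
  assumes x: "x \<in> V k" and c: "\<And>i. i > 0 \<Longrightarrow> (L ^^ i) x = 0 \<Longrightarrow> (L ^^ (i - 1)) x = 0"
  shows "x = 0"
proof -
  obtain j where j: "(L ^^ j) x = 0" using L_pow_eventually_zero[OF x] by blast
  have "(L ^^ (j - i)) x = 0" if "i \<le> j" for i
    using that
  proof (induction i)
    case (Suc i)
    then show ?case using c[of "j - i"] by simp
  qed (use j in simp)
  from this[of j] show ?thesis by simp
qed

lemma \<Lambda>_L_pow_prim: "\<beta> \<in> prim k \<Longrightarrow> \<Lambda> ((L ^^ j) \<beta>) = (real j * (real n - of_int k - real j + 1)) *\<^sub>R (L ^^ (j - 1)) \<beta>"
  using \<Lambda>_L_pow[of \<beta> k j] by (simp add: prim_def L_pow_simps)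

lemma prim_V: "\<beta> \<in> prim s \<Longrightarrow> \<beta> \<in> V s"
  by (simp add: prim_def)

lemma prim_above_middle:
  assumes "\<beta> \<in> prim k" "k > int n"
  shows "\<beta> = 0"
proof (rule zero_if_\<Lambda>_lowers[OF prim_V[OF assms(1)]])
  fix i :: nat assume i: "i > 0" "(L ^^ i) \<beta> = 0"
  have "real i * (real n - of_int k - real i + 1) \<noteq> 0"
    using i assms(2) by simp
  then show "(L ^^ (i - 1)) \<beta> = 0"
    using \<Lambda>_L_pow_prim[OF assms(1), of i] i by (simp add: \<Lambda>_simps)
qed

text \<open>
  The coefficient in \<open>\<Lambda> L\<^sup>j \<beta>\<close> vanishes for \<open>j = n - s + 1\<close>. Thus \<open>L\<^sup>j \<beta>\<close> is primitive of a degree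
  above the middle, and such elements are zero.
\<close>

lemma L_pow_prim_zero:
  assumes "\<beta> \<in> prim (int s)" "s \<le> n" "j > n - s"
  shows "(L ^^ j) \<beta> = 0"
proof -
  let ?j = "n - s + 1"
  have "\<Lambda> ((L ^^ ?j) \<beta>) = 0"
    using \<Lambda>_L_pow_prim[OF assms(1), of ?j] assms(2) by (simp add: of_nat_diff)
  then have "(L ^^ ?j) \<beta> \<in> prim (int s + 2 * int ?j)"
    using L_pow_in[OF prim_V[OF assms(1)] refl, of ?j] by (simp add: prim_def del: funpow.simps)
  then have "(L ^^ ?j) \<beta> = 0"
    by (rule prim_above_middle) (use assms(2) in simp)
  moreover have "(L ^^ j) \<beta> = (L ^^ (j - ?j)) ((L ^^ ?j) \<beta>)"
    using assms(3) by (simp only: L_pow_L_pow) simp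
  ultimately show ?thesis by (simp only: L_pow_simps)
qed

lemma prim_closed: "x \<in> prim k \<Longrightarrow> y \<in> prim k \<Longrightarrow> x + y \<in> prim k" "x \<in> prim k \<Longrightarrow> r *\<^sub>R x \<in> prim k" "0 \<in> prim k"
  by (auto simp: prim_def V_closed \<Lambda>_simps)

subsection \<open>Existence\<close>

text \<open>
  The homogeneous elements of degree \<open>k\<close> from which the decompositions are formed.
\<close>

definition gen :: "int \<Rightarrow> 'v set" where
  "gen k = {(L ^^ j) \<beta> | j s \<beta>. s \<le> n \<and> j \<le> n - s \<and> \<beta> \<in> prim (int s) \<and> int s + 2 * int j = k}"

lemma gen_V: "gen k \<subseteq> V k"
  by (auto simp: gen_def intro!: L_pow_in dest!: prim_V)

lemma \<Lambda>_pow_eventually_zero: assumes "x \<in> V k" shows "\<exists>j. (\<Lambda> ^^ j) x = 0"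
proof -
  have "(\<Lambda> ^^ j) x \<in> V (k - 2 * int j)" for j
  proof (induction j)
    case (Suc j)
    then show ?case using \<Lambda>_in[OF Suc] by (simp add: algebra_simps)
  qed (use assms in simp)
  from V_bounded[OF this[of "nat (k + 1)"]] show ?thesis by (intro exI[of _ "nat (k + 1)"]) linarith
qed

lemma span_gen_V: "span (gen k) \<subseteq> V k"
  using gen_V V_subspace by (simp add: span_minimal)

lemma prim_span_gen: assumes "\<beta> \<in> prim k" shows "\<beta> \<in> span (gen k)"
proof (cases "k < 0 \<or> k > int n")
  case True
  then have "\<beta> = 0" using prim_above_middle[OF assms] V_bounded[OF prim_V[OF assms]] by auto
  then show ?thesis by (simp add: span_zero)
next
  case False
  then have "(L ^^ 0) \<beta> \<in> gen k" 
    unfolding gen_def using assms by (intro CollectI exI[of _ 0] exI[of _ "nat k"] exI[of _ \<beta>]) auto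
  then show ?thesis by (simp add: span_base)
qed

text \<open>
  As \<open>\<Lambda>\<close> lowers the degree, it acts nilpotently, which allows an induction on its exponent. By the
  induction hypothesis, \<open>\<Lambda> x\<close> is a combination of generators. Up to a factor, each generator is \<open>\<Lambda>\<close> of
  another one, except for those at the end of their \<open>L\<close>-string, which are killed by \<open>L\<close>. So \<open>x\<close> can be
  corrected by generators until \<open>\<Lambda> x\<close> consists of the latter; then \<open>x\<close> is primitive or zero.
\<close>

lemma V_in_span_aux: "x \<in> V k \<Longrightarrow> (\<Lambda> ^^ m) x = 0 \<Longrightarrow> x \<in> span (gen k)"
proof (induction m arbitrary: x k)
  case 0
  then show ?case by (simp add: span_zero)
next
  case (Suc m)
  \<comment> \<open>\<open>Q y\<close> says that \<open>y\<close> lies in \<open>\<Lambda>\<close> of the span up to an error \<open>t\<close> made of ends of \<open>L\<close>-strings; these have degree at least \<open>n\<close>, hence do not occur for \<open>k \<le> n\<close>.\<close>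
  define Q where "Q y \<longleftrightarrow> (\<exists>z\<in>span (gen k). \<exists>t\<in>V (k - 2). L t = 0 \<and> (k \<le> int n \<longrightarrow> t = 0) \<and> y = \<Lambda> z + t)" for y
  have "\<Lambda> x \<in> span (gen (k - 2))"
    using Suc.prems by (intro Suc.IH \<Lambda>_in) (simp_all add: funpow_Suc_right del: funpow.simps)
  then have "Q (\<Lambda> x)"
  proof (induction rule: span_induct_alt)
    case base
    show ?case unfolding Q_def
      by (intro bexI[of _ 0] bexI[of _ 0]) (auto simp: L_simps \<Lambda>_simps span_zero V_closed)
  next
    case (step c g y)
    obtain j s \<beta> where g: "s \<le> n" "j \<le> n - s" "\<beta> \<in> prim (int s)" "int s + 2 * int j = k - 2" "g = (L ^^ j) \<beta>"
      using step(1) by (auto simp: gen_def)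
    obtain z t where zt: "z \<in> span (gen k)" "t \<in> V (k - 2)" "L t = 0" "k \<le> int n \<longrightarrow> t = 0" "y = \<Lambda> z + t"
      using step(2) unfolding Q_def by blast
    show ?case
    proof (cases "j = n - s")
      case True
      have "L g = 0" using L_pow_prim_zero[OF g(3,1), of "Suc j"] True g by simp
      moreover have "k > int n" using True g by linarith
      moreover have "g \<in> V (k - 2)" using step(1) gen_V by blast
      ultimately show ?thesis
        unfolding Q_def using zt
        by (intro bexI[of _ z] bexI[of _ "c *\<^sub>R g + t"]) (auto simp: L_simps V_closed)
    next
      case False
      define a where "a = real (Suc j) * (real n - real s - real (Suc j) + 1)"
      have a: "a \<noteq> 0" using False g by (simp add: a_def)
      have "(L ^^ Suc j) \<beta> \<in> gen k"
        unfolding gen_def using False g by (intro CollectI exI[of _ "Suc j"] exI[of _ s] exI[of _ \<beta>]) auto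
      then have "(c / a) *\<^sub>R (L ^^ Suc j) \<beta> + z \<in> span (gen k)"
        using zt(1) by (intro span_add span_scale) (auto intro: span_base)
      moreover have "\<Lambda> ((L ^^ Suc j) \<beta>) = a *\<^sub>R g"
        using \<Lambda>_L_pow_prim[OF g(3), of "Suc j"] g by (simp add: a_def)
      ultimately show ?thesis
        unfolding Q_def using zt a
        by (intro bexI[of _ "(c / a) *\<^sub>R (L ^^ Suc j) \<beta> + z"] bexI[of _ t]) (auto simp: \<Lambda>_simps simp del: funpow.simps)
    qed
  qed
  then obtain z t where zt: "z \<in> span (gen k)" "t \<in> V (k - 2)" "L t = 0" "k \<le> int n \<longrightarrow> t = 0" "\<Lambda> x = \<Lambda> z + t"
    unfolding Q_def by blast
  define y where "y = x - z"
  have y: "y \<in> V k" "\<Lambda> y = t"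
    using Suc.prems zt subsetD[OF span_gen_V zt(1)] by (simp_all add: y_def V_closed \<Lambda>_simps)
  have "y \<in> span (gen k)"
  proof (cases "k \<le> int n")
    case True
    then show ?thesis using y zt by (intro prim_span_gen) (simp add: prim_def)
  next
    case False
    \<comment> \<open>Above the middle the coefficient in \<open>\<Lambda> L\<^sup>i y\<close> is nonzero, and the term \<open>L\<^sup>i t\<close> vanishes.\<close>
    have "y = 0"
    proof (rule zero_if_\<Lambda>_lowers[OF y(1)])
      fix i :: nat assume i: "i > 0" "(L ^^ i) y = 0"
      have "(L ^^ i) t = 0" using i(1) zt(3) by (cases i) (simp_all add: funpow_Suc_right L_pow_simps del: funpow.simps)
      moreover have "real i * (real n - of_int k - real i + 1) \<noteq> 0" using i False by simp
      ultimately show "(L ^^ (i - 1)) y = 0"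
        using \<Lambda>_L_pow[OF y(1), of i] y(2) i by (simp add: \<Lambda>_simps)
    qed
    then show ?thesis by (simp add: span_zero)
  qed
  then have "y + z \<in> span (gen k)" using zt by (intro span_add)
  then show ?case by (simp add: y_def)
qed

lemma V_eq_span: "V k = span (gen k)"
proof
  show "V k \<subseteq> span (gen k)"
  proof
    fix x assume x: "x \<in> V k"
    then obtain m where "(\<Lambda> ^^ m) x = 0" using \<Lambda>_pow_eventually_zero[OF x] by blast
    then show "x \<in> span (gen k)" by (rule V_in_span_aux[OF x])
  qed
qed (rule span_gen_V)

text \<open>
  By linearity, an identity between operators on \<open>V k\<close> has to be checked only on the terms \<open>L\<^sup>j \<beta>\<close>.
  All the identities for division and reflection below are proved with this rule.
\<close>

lemma V_induct [consumes 1, case_names zero add gen]: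
  assumes "x \<in> V k" and "Q 0" and "\<And>x y. x \<in> V k \<Longrightarrow> y \<in> V k \<Longrightarrow> Q x \<Longrightarrow> Q y \<Longrightarrow> Q (x + y)"
    and "\<And>s j \<beta>. s \<le> n \<Longrightarrow> j \<le> n - s \<Longrightarrow> \<beta> \<in> prim (int s) \<Longrightarrow> k = int s + 2 * int j \<Longrightarrow> Q ((L ^^ j) \<beta>)"
  shows "Q x"
proof -
  have "x \<in> V k \<and> Q x"
    using subsetD[OF equalityD1[OF V_eq_span] assms(1)]
  proof (induction rule: span_induct_alt)
    case base
    show ?case using assms(2) V_closed(5) by simp
  next
    case (step c g y)
    from step(1) obtain j s \<beta> where g: "s \<le> n" "j \<le> n - s" "\<beta> \<in> prim (int s)" "k = int s + 2 * int j" "g = (L ^^ j) \<beta>"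
      by (auto simp: gen_def)
    then have "c *\<^sub>R g = (L ^^ j) (c *\<^sub>R \<beta>)" by (simp add: L_pow_simps)
    then have "Q (c *\<^sub>R g)" using assms(4)[OF g(1,2) prim_closed(2)[OF g(3)] g(4), of c] by simp
    moreover have "c *\<^sub>R g \<in> V k" using subsetD[OF gen_V step(1)] by (rule V_closed)
    ultimately show ?case
      using step(2) assms(3)[of "c *\<^sub>R g" y] V_closed(1)[of "c *\<^sub>R g" k y] by simp
  qed
  then show ?thesis ..
qed

subsection \<open>Uniqueness\<close>

lemma \<Lambda>_pow_L_pow_prim_zero:
  assumes "\<beta> \<in> prim k" "i > j" shows "(\<Lambda> ^^ i) ((L ^^ j) \<beta>) = 0"
  using assms(2)
proof (induction j arbitrary: i)
  case 0
  then show ?case using assms(1) by (cases i) (simp_all add: prim_def funpow_Suc_right \<Lambda>_pow_simps del: funpow.simps)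
next
  case (Suc j)
  then obtain i' where i: "i = Suc i'" "i' > j" by (cases i) auto
  have "(\<Lambda> ^^ i) ((L ^^ Suc j) \<beta>) = (\<Lambda> ^^ i') (\<Lambda> ((L ^^ Suc j) \<beta>))" by (simp add: i funpow_Suc_right del: funpow.simps)
  then show ?case using \<Lambda>_L_pow_prim[OF assms(1), of "Suc j"] Suc.IH[OF i(2)] by (simp add: \<Lambda>_pow_simps del: funpow.simps)
qed

text \<open>
  The power \<open>\<Lambda>\<^sup>j\<close> recovers \<open>\<beta>\<close> from \<open>L\<^sup>j \<beta>\<close> and annihilates \<open>L\<^sup>i \<beta>'\<close> for \<open>i < j\<close>. Hence the
  components of a decomposition can be read off one after the other, beginning with the largest
  exponent.
\<close>

lemma \<Lambda>_pow_L_pow_prim: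
  assumes "\<beta> \<in> prim (int s)" "s \<le> n" "j \<le> n - s"
  shows "\<exists>c. c \<noteq> 0 \<and> (\<Lambda> ^^ j) ((L ^^ j) \<beta>) = c *\<^sub>R \<beta>"
  using assms(3)
proof (induction j)
  case 0
  then show ?case by (intro exI[of _ 1]) simp
next
  case (Suc j)
  then obtain c where c: "c \<noteq> 0" "(\<Lambda> ^^ j) ((L ^^ j) \<beta>) = c *\<^sub>R \<beta>" by auto
  have "(\<Lambda> ^^ Suc j) ((L ^^ Suc j) \<beta>) = (real (Suc j) * (real n - real s - real (Suc j) + 1)) *\<^sub>R c *\<^sub>R \<beta>"
    using \<Lambda>_L_pow_prim[OF assms(1), of "Suc j"] c by (simp add: funpow_Suc_right \<Lambda>_pow_simps del: funpow.simps)
  moreover have "real (Suc j) * (real n - real s - real (Suc j) + 1) \<noteq> 0" using Suc.prems by simp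
  ultimately show ?case using c(1)
    by (intro exI[of _ "real (Suc j) * (real n - real s - real (Suc j) + 1) * c"]) (simp only: scaleR_scaleR, simp)
qed

definition idx :: "(nat \<times> nat) set" where
  "idx = {(s, j). s \<le> n \<and> j \<le> n - s}"

lemma idx_Sigma: "idx = Sigma {..n} (\<lambda>s. {..n - s})"
  by (auto simp: idx_def)

lemma finite_idx: "finite idx"
  by (simp add: idx_Sigma)

lemma sum_idx: "(\<Sum>s\<le>n. \<Sum>j\<le>n - s. f s j) = (\<Sum>(s, j)\<in>idx. f s j)"
  by (simp add: idx_Sigma sum.Sigma)

lemma is_dec_prim: "is_dec \<beta> x \<Longrightarrow> s \<le> n \<Longrightarrow> j \<le> n - s \<Longrightarrow> \<beta> j s \<in> prim (int s)"
  unfolding is_dec_def by meson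

lemma is_dec_outside: "is_dec \<beta> x \<Longrightarrow> \<not> (s \<le> n \<and> j \<le> n - s) \<Longrightarrow> \<beta> j s = 0"
  unfolding is_dec_def by (metis singletonD)

lemma is_dec_sum: "is_dec \<beta> x \<Longrightarrow> x = (\<Sum>s\<le>n. \<Sum>j\<le>n - s. (L ^^ j) (\<beta> j s))"
  unfolding is_dec_def by blast

lemma is_decI:
  assumes "\<And>s j. s \<le> n \<Longrightarrow> j \<le> n - s \<Longrightarrow> \<beta> j s \<in> prim (int s)"
    and "\<And>s j. \<not> (s \<le> n \<and> j \<le> n - s) \<Longrightarrow> \<beta> j s = 0"
    and "x = (\<Sum>s\<le>n. \<Sum>j\<le>n - s. (L ^^ j) (\<beta> j s))"
  shows "is_dec \<beta> x"
  unfolding is_dec_def using assms by simp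

lemma is_dec_zero:
  assumes "is_dec \<beta> 0" shows "\<beta> j s = 0"
proof -
  have mem: "\<beta> j s \<in> prim (int s)" if "(s, j) \<in> idx" for s j
    using is_dec_prim[OF assms] that by (simp add: idx_def)
  have out: "\<beta> j s = 0" if "(s, j) \<notin> idx" for s j
    using is_dec_outside[OF assms] that by (simp add: idx_def)
  define deg where "deg = (\<lambda>(s, j). int s + 2 * int j)"
  define f where "f = (\<lambda>(s, j). (L ^^ j) (\<beta> j s))"
  have f_V: "f x \<in> V (deg x)" if "x \<in> idx" for x
    using that mem by (cases x) (auto simp: f_def deg_def intro!: L_pow_in intro: prim_V)
  \<comment> \<open>The homogeneous parts vanish separately, so it suffices to compare terms of one degree, where \<open>j\<close> determines \<open>s\<close>.\<close>
  have homog: "(\<Sum>x\<in>{x \<in> idx. deg x = k}. f x) = 0" for k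
  proof (cases "k \<in> deg ` idx")
    case True
    have "(\<Sum>k\<in>deg ` idx. \<Sum>x\<in>{x \<in> idx. deg x = k}. f x) = (\<Sum>x\<in>idx. f x)"
      by (rule sum.group) (auto simp: finite_idx)
    also have "\<dots> = 0"
      using is_dec_sum[OF assms] by (simp add: sum_idx f_def case_prod_beta)
    finally have eq: "(\<Sum>k\<in>deg ` idx. \<Sum>x\<in>{x \<in> idx. deg x = k}. f x) = 0" .
    have fin: "finite (deg ` idx)" by (simp add: finite_idx)
    have "(\<Sum>x\<in>{x \<in> idx. deg x = k}. f x) \<in> V k" for k
      by (rule subspace_sum[OF V_subspace]) (use f_V in auto)
    from V_direct[OF fin this eq True] show ?thesis .
  next
    case False
    then have "{x \<in> idx. deg x = k} = {}" by auto
    then show ?thesis by (simp only: sum.empty)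
  qed
  \<comment> \<open>Downward induction on \<open>j\<close>: under \<open>\<Lambda>\<^sup>j\<close> the terms with a smaller exponent vanish, and those with a larger one are zero by induction hypothesis.\<close>
  have "\<beta> j s = 0" if "(s, j) \<in> idx" for s j
    using that
  proof (induction "n - j" arbitrary: s j rule: less_induct)
    case less
    let ?X = "{x \<in> idx. deg x = int s + 2 * int j}"
    have "(\<Lambda> ^^ j) (f x) = 0" if "x \<in> ?X - {(s, j)}" for x
    proof -
      obtain s' j' where x: "x = (s', j')" "(s', j') \<in> idx" "int s' + 2 * int j' = int s + 2 * int j" "(s', j') \<noteq> (s, j)"
        using \<open>x \<in> ?X - {(s, j)}\<close> by (cases x) (auto simp: deg_def)
      then consider "j' < j" | "j' > j" by fastforce
      then show ?thesis
      proof cases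
        case 1
        then show ?thesis using \<Lambda>_pow_L_pow_prim_zero[OF mem[OF x(2)]] by (simp add: f_def x)
      next
        case 2
        then have "n - j' < n - j" using x(2) by (auto simp: idx_def)
        then have "\<beta> j' s' = 0" using less(1) x(2) by blast
        then show ?thesis by (simp add: f_def x \<Lambda>_pow_simps L_pow_simps)
      qed
    qed
    then have "(\<Sum>x\<in>?X. (\<Lambda> ^^ j) (f x)) = (\<Lambda> ^^ j) (f (s, j))"
      using less.prems finite_idx by (subst sum.remove[of _ "(s, j)"]) (auto simp: deg_def intro!: sum.neutral)
    then have "(\<Lambda> ^^ j) ((L ^^ j) (\<beta> j s)) = 0"
      using homog[of "int s + 2 * int j"] by (simp add: f_def flip: \<Lambda>_pow_simps(5)) (simp add: \<Lambda>_pow_simps)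
    moreover have "s \<le> n" "j \<le> n - s" using less.prems by (simp_all add: idx_def)
    ultimately show ?case
      using \<Lambda>_pow_L_pow_prim[OF mem[OF less.prems], of j] by (metis scaleR_eq_0_iff)
  qed
  then show ?thesis using out by blast
qed

lemma is_dec_add: "is_dec \<beta> x \<Longrightarrow> is_dec \<gamma> y \<Longrightarrow> is_dec (\<lambda>j s. \<beta> j s + \<gamma> j s) (x + y)"
  by (intro is_decI) (auto simp: L_pow_simps sum.distrib is_dec_outside dest: is_dec_sum intro: prim_closed is_dec_prim)

lemma is_dec_scale: "is_dec \<beta> x \<Longrightarrow> is_dec (\<lambda>j s. r *\<^sub>R \<beta> j s) (r *\<^sub>R x)"
  by (intro is_decI) (auto simp: L_pow_simps scaleR_sum_right[symmetric] is_dec_outside dest: is_dec_sum intro: prim_closed is_dec_prim)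

lemma is_dec_unique: assumes "is_dec \<beta> x" "is_dec \<gamma> x" shows "\<beta> = \<gamma>"
proof (intro ext)
  fix j s
  have "is_dec (\<lambda>j s. \<beta> j s + (- 1) *\<^sub>R \<gamma> j s) (x + (- 1) *\<^sub>R x)"
    by (rule is_dec_add[OF assms(1) is_dec_scale[OF assms(2)]])
  then show "\<beta> j s = \<gamma> j s" using is_dec_zero[of "\<lambda>j s. \<beta> j s + (- 1) *\<^sub>R \<gamma> j s" j s] by simp
qed

lemma is_dec_gen:
  assumes "s \<le> n" "j \<le> n - s" "\<beta> \<in> prim (int s)"
  shows "is_dec (\<lambda>j' s'. if j' = j \<and> s' = s then \<beta> else 0) ((L ^^ j) \<beta>)"
proof (rule is_decI)
  have "(\<Sum>s'\<le>n. \<Sum>j'\<le>n - s'. (L ^^ j') (if j' = j \<and> s' = s then \<beta> else 0)) =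
    (\<Sum>x\<in>idx. if x = (s, j) then (L ^^ j) \<beta> else 0)"
    unfolding sum_idx by (rule sum.cong) (auto simp: L_pow_simps split: if_splits)
  also have "\<dots> = (L ^^ j) \<beta>" using assms finite_idx by (simp add: idx_def)
  finally show "(L ^^ j) \<beta> = (\<Sum>s'\<le>n. \<Sum>j'\<le>n - s'. (L ^^ j') (if j' = j \<and> s' = s then \<beta> else 0))" by simp
qed (use assms prim_closed in auto)

lemma is_dec_exists: "x \<in> V k \<Longrightarrow> \<exists>\<beta>. is_dec \<beta> x"
proof (induction rule: V_induct)
  case zero
  show ?case by (intro exI[of _ "\<lambda>j s. 0"] is_decI) (auto simp: prim_closed L_pow_simps)
next
  case (add x y)
  then obtain \<beta> \<gamma> where "is_dec \<beta> x" "is_dec \<gamma> y" by blast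
  then show ?case by (intro exI[where x = "\<lambda>j s. \<beta> j s + \<gamma> j s"] is_dec_add)
next
  case (gen s j \<beta>)
  show ?case
    by (rule exI[where x = "\<lambda>j' s'. if j' = j \<and> s' = s then \<beta> else 0"]) (rule is_dec_gen[OF gen(1-3)])
qed

lemma dec_eq: "is_dec \<beta> x \<Longrightarrow> dec x = \<beta>"
  unfolding dec_def using is_dec_unique by (intro the_equality) auto

lemma is_dec_dec: "x \<in> V k \<Longrightarrow> is_dec (dec x) x"
  using is_dec_exists[of x k] dec_eq[of _ x] by auto

lemma dec_gen: "s \<le> n \<Longrightarrow> j \<le> n - s \<Longrightarrow> \<beta> \<in> prim (int s) \<Longrightarrow>
  dec ((L ^^ j) \<beta>) = (\<lambda>j' s'. if j' = j \<and> s' = s then \<beta> else 0)"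
  by (rule dec_eq[OF is_dec_gen])

lemma dec_add: "x \<in> V k \<Longrightarrow> y \<in> V l \<Longrightarrow> dec (x + y) = (\<lambda>j s. dec x j s + dec y j s)"
  by (rule dec_eq[OF is_dec_add[OF is_dec_dec is_dec_dec]])

lemma dec_scale: "x \<in> V k \<Longrightarrow> dec (r *\<^sub>R x) = (\<lambda>j s. r *\<^sub>R dec x j s)"
  by (rule dec_eq[OF is_dec_scale[OF is_dec_dec]])

lemma dec_0: "dec 0 = (\<lambda>j s. 0)"
  using dec_scale[of 0 0 0] V_closed by simp

subsection \<open>Division by powers of \<open>L\<close>, and reflection\<close>

text \<open>
  Operators that are defined termwise on the decomposition can be evaluated on generators with this
  lemma.
\<close>

lemma sum_dec_gen:
  assumes "s \<le> n" "j \<le> n - s" "\<beta> \<in> prim (int s)" and "\<And>j' s'. f j' s' 0 = 0"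
  shows "(\<Sum>s'\<le>n. \<Sum>j'\<le>n - s'. f j' s' (dec ((L ^^ j) \<beta>) j' s')) = f j s \<beta>"
proof -
  have "(\<Sum>s'\<le>n. \<Sum>j'\<le>n - s'. f j' s' (dec ((L ^^ j) \<beta>) j' s')) =
    (\<Sum>x\<in>idx. if x = (s, j) then f j s \<beta> else 0)"
    unfolding sum_idx dec_gen[OF assms(1-3)] by (rule sum.cong) (auto simp: assms(4) split: if_splits)
  also have "\<dots> = f j s \<beta>" using assms finite_idx by (simp add: idx_def)
  finally show ?thesis .
qed

lemma Linv_gen:
  assumes "s \<le> n" "j \<le> n - s" "\<beta> \<in> prim (int s)"
  shows "Linv q ((L ^^ j) \<beta>) = (if j \<ge> q then (L ^^ (j - q)) \<beta> else 0)"
  unfolding Linv_def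
  using sum_dec_gen[OF assms, of "\<lambda>j' s' b. if q \<le> j' then (L ^^ (j' - q)) b else 0"] by (simp add: L_pow_simps)

lemma star_gen:
  assumes "s \<le> n" "j \<le> n - s" "\<beta> \<in> prim (int s)"
  shows "star ((L ^^ j) \<beta>) = (L ^^ (n - j - s)) \<beta>"
  unfolding star_def
  using sum_dec_gen[OF assms, of "\<lambda>j' s' b. (L ^^ (n - j' - s')) b"] by (simp add: L_pow_simps)

lemma Linv_add: "x \<in> V k \<Longrightarrow> y \<in> V l \<Longrightarrow> Linv q (x + y) = Linv q x + Linv q y"
  unfolding Linv_def sum.distrib[symmetric] by (intro sum.cong refl) (simp add: L_pow_simps dec_add)

lemma star_add: "x \<in> V k \<Longrightarrow> y \<in> V l \<Longrightarrow> star (x + y) = star x + star y"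
  unfolding star_def sum.distrib[symmetric] by (intro sum.cong refl) (simp add: L_pow_simps dec_add)

lemma Linv_scale: "x \<in> V k \<Longrightarrow> Linv q (r *\<^sub>R x) = r *\<^sub>R Linv q x"
  unfolding Linv_def scaleR_sum_right by (intro sum.cong refl) (simp add: L_pow_simps dec_scale)

lemma star_scale: "x \<in> V k \<Longrightarrow> star (r *\<^sub>R x) = r *\<^sub>R star x"
  unfolding star_def scaleR_sum_right by (intro sum.cong refl) (simp add: L_pow_simps dec_scale)

lemma Linv_0 [simp]: "Linv q 0 = 0" and star_0 [simp]: "star 0 = 0"
  by (simp_all add: Linv_def star_def dec_0 L_pow_simps if_distrib cong: if_cong)

lemma Linv_diff: "x \<in> V k \<Longrightarrow> y \<in> V l \<Longrightarrow> Linv q (x - y) = Linv q x - Linv q y"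
  using Linv_add[of x k "(-1) *\<^sub>R y" l q] Linv_scale[of y l q "-1"] V_closed(4)[of y l "-1"] by simp

lemma star_diff: "x \<in> V k \<Longrightarrow> y \<in> V l \<Longrightarrow> star (x - y) = star x - star y"
  using star_add[of x k "(-1) *\<^sub>R y" l] star_scale[of y l "-1"] V_closed(4)[of y l "-1"] by simp

lemma Linv_minus: "x \<in> V k \<Longrightarrow> Linv q (- x) = - Linv q x" and star_minus: "x \<in> V k \<Longrightarrow> star (- x) = - star x"
  using Linv_scale[of x k q "-1"] star_scale[of x k "-1"] by simp_all

lemma Linv_in: "x \<in> V k \<Longrightarrow> i = k - 2 * int q \<Longrightarrow> Linv q x \<in> V i"
proof (induction rule: V_induct)
  case (gen s j \<beta>)
  then show ?case by (auto simp: Linv_gen V_closed intro!: L_pow_in dest!: prim_V)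
qed (auto simp: V_closed Linv_add)

lemma star_in: "x \<in> V k \<Longrightarrow> i = 2 * int n - k \<Longrightarrow> star x \<in> V i"
proof (induction rule: V_induct)
  case (gen s j \<beta>)
  then show ?case by (auto simp: star_gen V_closed intro!: L_pow_in dest!: prim_V)
qed (auto simp: V_closed star_add)

lemma star_star: "x \<in> V k \<Longrightarrow> star (star x) = x"
proof (induction rule: V_induct)
  case (gen s j \<beta>)
  then show ?case by (simp add: star_gen)
qed (auto simp: star_add star_add[OF star_in[OF _ refl] star_in[OF _ refl]])

text \<open>
  The reflection turns the string \<open>\<beta>, L \<beta>, \<dots>, L\<^bsup>n-s\<^esup> \<beta>\<close> around, so it exchanges moving up along the
  string with moving down, including the convention that whatever leaves the string becomes zero.
\<close>

lemma L_pow_star: "x \<in> V k \<Longrightarrow> (L ^^ q) (star x) = star (Linv q x)"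
proof (induction rule: V_induct)
  case (gen s j \<beta>)
  then show ?case
  proof (cases "j \<ge> q")
    case True
    then have "n - (j - q) - s = q + (n - j - s)" using gen by linarith
    then show ?thesis using gen True by (simp add: star_gen Linv_gen L_pow_L_pow)
  next
    case False
    then have "q + (n - j - s) > n - s" using gen by linarith
    then show ?thesis using gen False L_pow_prim_zero[of \<beta> s "q + (n - j - s)"] by (simp add: star_gen Linv_gen L_pow_L_pow)
  qed
qed (auto simp: star_add Linv_add L_pow_simps star_add[OF Linv_in[OF _ refl] Linv_in[OF _ refl]])

lemma star_L_pow: assumes x: "x \<in> V k" shows "star ((L ^^ q) x) = Linv q (star x)"
proof -
  have "star ((L ^^ q) (star (star x))) = star (star (Linv q (star x)))"
    using L_pow_star[OF star_in[OF x refl]] by simp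
  then show ?thesis using star_star[OF x] star_star[OF Linv_in[OF star_in[OF x refl] refl]] by simp
qed

text \<open>
  In degree \<open>k \<le> n - q\<close>, each term \<open>L\<^sup>j \<beta>\<close> can be multiplied by \<open>L\<^sup>q\<close> without leaving its string.
\<close>

lemma Linv_L_pow: "x \<in> V k \<Longrightarrow> k + int q \<le> int n \<Longrightarrow> Linv q ((L ^^ q) x) = x"
proof (induction rule: V_induct)
  case (gen s j \<beta>)
  then have "q + j \<le> n - s" by linarith
  then show ?case using gen Linv_gen[of s "q + j" \<beta> q] by (simp add: L_pow_L_pow)
qed (auto simp: L_pow_simps Linv_add[OF L_pow_in[OF _ refl] L_pow_in[OF _ refl]])

text \<open>
  In degree \<open>k \<ge> n + q\<close>, each term \<open>L\<^sup>j \<beta>\<close> satisfies \<open>j \<ge> q\<close>, because \<open>s + 2 j = k\<close> and \<open>s + j \<le> n\<close>.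
\<close>

lemma L_pow_Linv: "x \<in> V k \<Longrightarrow> k \<ge> int n + int q \<Longrightarrow> (L ^^ q) (Linv q x) = x"
proof (induction rule: V_induct)
  case (gen s j \<beta>)
  then have "q \<le> j" by linarith
  then show ?case using gen by (simp add: Linv_gen L_pow_L_pow)
qed (auto simp: L_pow_simps Linv_add)

lemma Linv_L_pow_Linv: "x \<in> V k \<Longrightarrow> Linv q ((L ^^ q) (Linv q x)) = Linv q x"
proof (induction rule: V_induct)
  case (gen s j \<beta>)
  then show ?case by (simp add: Linv_gen L_pow_L_pow L_pow_simps)
qed (auto simp: L_pow_simps Linv_add Linv_add[OF L_pow_in[OF Linv_in[OF _ refl] refl] L_pow_in[OF Linv_in[OF _ refl] refl]])

subsection \<open>Short decompositions\<close>

lemma L_pow_prim_zero_int: assumes "\<beta> \<in> prim k" "int j > int n - k" shows "(L ^^ j) \<beta> = 0"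
proof (cases "0 \<le> k \<and> k \<le> int n")
  case True
  then have "nat k \<le> n" "j > n - nat k" "\<beta> \<in> prim (int (nat k))" using assms by auto
  then show ?thesis using L_pow_prim_zero by blast
next
  case False
  then have "\<beta> = 0" using V_bounded[OF prim_V[OF assms(1)]] prim_above_middle[OF assms(1)] by auto
  then show ?thesis by (simp add: L_pow_simps)
qed

lemma L_pow_injective: "x \<in> V k \<Longrightarrow> k + int q \<le> int n \<Longrightarrow> (L ^^ q) x = 0 \<Longrightarrow> x = 0"
  using Linv_L_pow by fastforce

lemma first_two_terms:
  "y \<in> V k \<Longrightarrow> \<exists>\<beta>'\<in>prim k. \<exists>\<beta>''\<in>prim (k - 2). y - (L ^^ 2) (Linv 2 y) = \<beta>' + L \<beta>''"
proof (induction rule: V_induct)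
  case zero
  show ?case by (intro bexI[of _ 0] prim_closed) (simp add: L_simps L_pow_simps)
next
  case (add x y)
  then obtain \<beta>' \<beta>'' \<gamma>' \<gamma>'' where "\<beta>' \<in> prim k" "\<beta>'' \<in> prim (k - 2)" "x - (L ^^ 2) (Linv 2 x) = \<beta>' + L \<beta>''"
    "\<gamma>' \<in> prim k" "\<gamma>'' \<in> prim (k - 2)" "y - (L ^^ 2) (Linv 2 y) = \<gamma>' + L \<gamma>''" by blast
  moreover have "(x + y) - (L ^^ 2) (Linv 2 (x + y)) = (x - (L ^^ 2) (Linv 2 x)) + (y - (L ^^ 2) (Linv 2 y))"
    by (simp add: Linv_add[OF add(1,2)] L_pow_simps)
  ultimately show ?case
    by (intro bexI[of _ "\<beta>' + \<gamma>'"] bexI[of _ "\<beta>'' + \<gamma>''"] prim_closed) (simp_all add: L_simps)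
next
  case (gen s j \<beta>)
  consider "j = 0" | "j = 1" | "j \<ge> 2" by linarith
  then show ?case
  proof cases
    case 1
    then show ?thesis using gen Linv_gen[OF gen(1-3), of 2]
      by (intro bexI[of _ \<beta>] bexI[of _ 0] prim_closed) (simp_all add: L_simps L_pow_simps)
  next
    case 2
    then show ?thesis using gen Linv_gen[OF gen(1-3), of 2]
      by (intro bexI[of _ 0] bexI[of _ \<beta>] prim_closed) (simp_all add: L_simps L_pow_simps)
  next
    case 3
    then have "(L ^^ 2) (Linv 2 ((L ^^ j) \<beta>)) = (L ^^ j) \<beta>"
      using Linv_gen[OF gen(1-3), of 2] L_pow_L_pow[of 2 "j - 2" \<beta>] by (simp only: if_True le_add_diff_inverse)
    then show ?thesis by (intro bexI[of _ 0] prim_closed) (simp add: L_simps)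
  qed
qed

text \<open>
  It applies to \<open>y = d \<beta>\<close> with \<open>\<beta>\<close> primitive of degree \<open>s\<close>, which is annihilated by the same power of
  \<open>L\<close> as \<open>\<beta>\<close> since \<open>d\<close> commutes with \<open>L\<close>. The terms after the first two make up \<open>L\<^sup>2 u\<close> with \<open>u\<close> of
  degree \<open>s - 3\<close>, where \<open>L\<^bsup>n-s+3\<^esup>\<close> is injective.
\<close>

lemma first_two_terms_suffice:
  assumes y: "y \<in> V (int s + 1)" and s: "s \<le> n" and zero: "(L ^^ (n - s + 1)) y = 0"
  obtains \<beta>' \<beta>'' where "\<beta>' \<in> prim (int s + 1)" "\<beta>'' \<in> prim (int s - 1)" "y = \<beta>' + L \<beta>''"
proof -
  obtain \<beta>' \<beta>'' where b: "\<beta>' \<in> prim (int s + 1)" "\<beta>'' \<in> prim (int s - 1)" "y - (L ^^ 2) (Linv 2 y) = \<beta>' + L \<beta>''"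
    using first_two_terms[OF y] by (auto simp: algebra_simps)
  let ?q = "n - s + 1"
  have u: "Linv 2 y \<in> V (int s - 3)" using y by (auto intro: Linv_in)
  have "(L ^^ ?q) \<beta>' = 0" by (rule L_pow_prim_zero_int[OF b(1)]) (use s in simp)
  moreover have "(L ^^ ?q) (L \<beta>'') = 0"
    using L_pow_prim_zero_int[OF b(2), of "Suc ?q"] s by (simp add: funpow_Suc_right del: funpow.simps)
  ultimately have "(L ^^ ?q) (y - (L ^^ 2) (Linv 2 y)) = 0" unfolding b(3) by (simp only: L_pow_simps) simp
  then have "(L ^^ ?q) ((L ^^ 2) (Linv 2 y)) = 0" using zero by (simp only: L_pow_simps) simp
  then have "(L ^^ (?q + 2)) (Linv 2 y) = 0" by (simp only: L_pow_L_pow)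
  then have "Linv 2 y = 0" by (rule L_pow_injective[OF u, rotated]) (use s in simp)
  then show ?thesis using b that by (simp add: L_pow_simps)
qed

text \<open>
  An element of degree \<open>n + p\<close> has only terms \<open>L\<^sup>j \<beta>\<^sub>s\<close> with \<open>j \<ge> p\<close>, so that a single term is left after
  those divisible by \<open>L\<^bsup>p+1\<^esup>\<close> have been removed.
\<close>

lemma lowest_term:
  assumes p: "p \<le> n"
  shows "x \<in> V (int (n + p)) \<Longrightarrow> \<exists>\<beta>\<in>prim (int (n - p)). x - (L ^^ (p + 1)) (Linv (p + 1) x) = (L ^^ p) \<beta>"
proof (induction rule: V_induct)
  case zero
  show ?case by (intro bexI[of _ 0] prim_closed) (simp add: L_simps L_pow_simps)
next
  case (add x y)
  then obtain \<beta> \<gamma> where "\<beta> \<in> prim (int (n - p))" "x - (L ^^ (p + 1)) (Linv (p + 1) x) = (L ^^ p) \<beta>"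
    "\<gamma> \<in> prim (int (n - p))" "y - (L ^^ (p + 1)) (Linv (p + 1) y) = (L ^^ p) \<gamma>" by blast
  moreover have "(x + y) - (L ^^ (p + 1)) (Linv (p + 1) (x + y)) =
      (x - (L ^^ (p + 1)) (Linv (p + 1) x)) + (y - (L ^^ (p + 1)) (Linv (p + 1) y))"
    by (simp only: Linv_add[OF add(1,2)] L_pow_simps) simp
  ultimately show ?case
    by (intro bexI[of _ "\<beta> + \<gamma>"] prim_closed) (simp_all add: L_pow_simps)
next
  case (gen s j \<beta>)
  then have "j \<ge> p" by linarith
  show ?case
  proof (cases "j = p")
    case True
    then have s: "s = n - p" using gen p by linarith
    have "Linv (p + 1) ((L ^^ j) \<beta>) = 0" unfolding Linv_gen[OF gen(1-3)] using True by simp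
    then have "(L ^^ (p + 1)) (Linv (p + 1) ((L ^^ j) \<beta>)) = 0" by (simp only: L_pow_simps)
    then show ?thesis using gen(3) True s by (intro bexI[of _ \<beta>]) (simp_all only: diff_zero)
  next
    case False
    then have "Linv (p + 1) ((L ^^ j) \<beta>) = (L ^^ (j - (p + 1))) \<beta>"
      unfolding Linv_gen[OF gen(1-3)] using \<open>j \<ge> p\<close> by simp
    then have "(L ^^ (p + 1)) (Linv (p + 1) ((L ^^ j) \<beta>)) = (L ^^ j) \<beta>"
      using False \<open>j \<ge> p\<close> by (simp only: L_pow_L_pow) simp
    then show ?thesis by (intro bexI[of _ 0] prim_closed) (simp only: L_pow_simps diff_self)
  qed
qed

end

section \<open>Exterior algebra\<close>

text \<open>
  The interior product with a vector, as an operation on functions of lists.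
\<close>

definition ins :: "'b \<Rightarrow> ('b list \<Rightarrow> real) \<Rightarrow> 'b list \<Rightarrow> real" where
  "ins v f = (\<lambda>ws. f (v # ws))"

text \<open>
  The grading involution, \<open>(-1)\<^sup>k\<close> on forms of degree \<open>k\<close>. With it, sign rules can be stated for
  functions that need not be homogeneous, as is required in inductions over lists.
\<close>

definition parity :: "('b list \<Rightarrow> real) \<Rightarrow> 'b list \<Rightarrow> real" where
  "parity f = (\<lambda>ws. (-1) ^ length ws * f ws)"

lemma alt_wedge_Nil: "alt_wedge \<alpha> \<beta> [] = \<alpha> [] * \<beta> []"
  by (simp add: alt_wedge_def)

text \<open>
  The interior product is an antiderivation. In the sum over shuffles, the first vector goes either
  into the first factor, without creating inversions, or into the second, and then it is inverted with
  every vector in the first factor, which produces the sign in \<open>parity\<close>.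
\<close>

lemma alt_wedge_Cons:
  "alt_wedge \<alpha> \<beta> (v # vs) = alt_wedge (ins v \<alpha>) \<beta> vs + alt_wedge (parity \<alpha>) (ins v \<beta>) vs"
proof -
  let ?n = "length vs"
  define inv where "inv n S = {(i, j). i \<in> {..<n} - S \<and> j \<in> S \<and> i < j}" for n :: nat and S
  define t where "t S = (-1) ^ card (inv (Suc ?n) S) * \<alpha> (nths (v # vs) S) * \<beta> (nths (v # vs) (- S))" for S
  have shift: "Pow {..<Suc ?n} = (\<lambda>T. insert 0 (Suc ` T)) ` Pow {..<?n} \<union> image Suc ` Pow {..<?n}"
  proof (intro equalityI subsetI)
    fix S assume S: "S \<in> Pow {..<Suc ?n}"
    define T where "T = {j. Suc j \<in> S}"
    have "S = (if 0 \<in> S then insert 0 (Suc ` T) else Suc ` T)"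
    proof (intro set_eqI)
      fix x show "x \<in> S \<longleftrightarrow> x \<in> (if 0 \<in> S then insert 0 (Suc ` T) else Suc ` T)"
        by (cases x) (auto simp: T_def)
    qed
    moreover have "T \<in> Pow {..<?n}" using S by (auto simp: T_def)
    ultimately show "S \<in> (\<lambda>T. insert 0 (Suc ` T)) ` Pow {..<?n} \<union> image Suc ` Pow {..<?n}"
      by (auto split: if_splits)
  qed auto
  have "alt_wedge \<alpha> \<beta> (v # vs) = (\<Sum>S\<in>Pow {..<Suc ?n}. t S)"
    by (simp add: alt_wedge_def t_def inv_def)
  also have "\<dots> = (\<Sum>S\<in>(\<lambda>T. insert 0 (Suc ` T)) ` Pow {..<?n}. t S) + (\<Sum>S\<in>image Suc ` Pow {..<?n}. t S)"
    unfolding shift by (rule sum.union_disjoint) auto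
  also have "(\<Sum>S\<in>(\<lambda>T. insert 0 (Suc ` T)) ` Pow {..<?n}. t S) = (\<Sum>T\<in>Pow {..<?n}. t (insert 0 (Suc ` T)))"
    by (rule sum.reindex_cong[OF _ refl refl]) (auto simp: inj_on_def)
  also have "\<dots> = alt_wedge (ins v \<alpha>) \<beta> vs"
    unfolding alt_wedge_def
  proof (rule sum.cong[OF refl])
    fix T assume "T \<in> Pow {..<?n}"
    have "inv (Suc ?n) (insert 0 (Suc ` T)) = map_prod Suc Suc ` inv ?n T"
    proof (intro set_eqI)
      fix x show "x \<in> inv (Suc ?n) (insert 0 (Suc ` T)) \<longleftrightarrow> x \<in> map_prod Suc Suc ` inv ?n T"
        by (cases x; cases "fst x"; cases "snd x") (auto simp: inv_def image_iff)
    qed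
    then have "card (inv (Suc ?n) (insert 0 (Suc ` T))) = card (inv ?n T)"
      using card_image[of "map_prod Suc Suc" "inv ?n T"] by (simp add: inj_on_def map_prod_def split: prod.splits)
    moreover have "{j. Suc j \<in> insert 0 (Suc ` T)} = T" "{j. Suc j \<in> - insert 0 (Suc ` T)} = - T" by auto
    ultimately show "t (insert 0 (Suc ` T)) =
      (-1) ^ card {(i, j). i \<in> {..<?n} - T \<and> j \<in> T \<and> i < j} * ins v \<alpha> (nths vs T) * \<beta> (nths vs (- T))"
      by (simp add: t_def nths_Cons ins_def inv_def)
  qed
  also have "(\<Sum>S\<in>image Suc ` Pow {..<?n}. t S) = (\<Sum>T\<in>Pow {..<?n}. t (Suc ` T))"
    by (rule sum.reindex_cong[OF _ refl refl]) (auto simp: inj_on_def)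
  also have "\<dots> = alt_wedge (parity \<alpha>) (ins v \<beta>) vs"
    unfolding alt_wedge_def
  proof (rule sum.cong[OF refl])
    fix T assume T: "T \<in> Pow {..<?n}"
    have fin: "finite T" using T finite_subset by auto
    \<comment> \<open>The pairs \<open>(0, j)\<close> are the inversions of the first vector with the first factor.\<close>
    have "inv (Suc ?n) (Suc ` T) = map_prod Suc Suc ` inv ?n T \<union> Pair 0 ` Suc ` T"
    proof (intro set_eqI)
      fix x show "x \<in> inv (Suc ?n) (Suc ` T) \<longleftrightarrow> x \<in> map_prod Suc Suc ` inv ?n T \<union> Pair 0 ` Suc ` T"
        by (cases x; cases "fst x"; cases "snd x") (auto simp: inv_def image_iff)
    qed
    moreover have "finite (inv ?n T)" by (rule finite_subset[of _ "{..<?n} \<times> T"]) (auto simp: inv_def fin)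
    ultimately have "card (inv (Suc ?n) (Suc ` T)) = card (map_prod Suc Suc ` inv ?n T) + card (Pair (0::nat) ` Suc ` T)"
      using fin by (simp only:) (rule card_Un_disjoint, auto)
    also have "\<dots> = card (inv ?n T) + card T"
      using card_image[of "map_prod Suc Suc" "inv ?n T"]
      by (simp add: card_image inj_on_def map_prod_def split: prod.splits)
    finally have "card (inv (Suc ?n) (Suc ` T)) = card (inv ?n T) + card T" .
    moreover have "{j. Suc j \<in> Suc ` T} = T" "{j. Suc j \<in> - Suc ` T} = - T" by auto
    moreover have "length (nths vs T) = card T"
    proof -
      have "{i. i < ?n \<and> i \<in> T} = T" using T by auto
      then show ?thesis by (simp add: length_nths)
    qed
    ultimately show "t (Suc ` T) = (-1) ^ card {(i, j). i \<in> {..<?n} - T \<and> j \<in> T \<and> i < j} *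
        parity \<alpha> (nths vs T) * ins v \<beta> (nths vs (- T))"
      by (simp add: t_def nths_Cons ins_def inv_def parity_def power_add)
  qed
  finally show ?thesis .
qed

lemma ins_alt_wedge: "ins v (alt_wedge \<alpha> \<beta>) = alt_wedge (ins v \<alpha>) \<beta> + alt_wedge (parity \<alpha>) (ins v \<beta>)"
  by (auto simp: ins_def alt_wedge_Cons[unfolded ins_def])

lemma ins_add: "ins v (f + g) = ins v f + ins v g" and ins_scale: "ins v (r *\<^sub>R f) = r *\<^sub>R ins v f"
  and ins_minus: "ins v (- f) = - ins v f" and ins_zero: "ins v 0 = 0"
  by (auto simp: ins_def fun_eq_iff scaleR_fun_def)

lemma parity_parity [simp]: "parity (parity f) = f"
  by (auto simp: parity_def fun_eq_iff power_mult_distrib[symmetric] simp flip: mult.assoc)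

lemma ins_parity: "ins v (parity f) = - parity (ins v f)"
  by (auto simp: ins_def parity_def)

lemma parity_ins: "parity (ins v f) = - ins v (parity f)"
  by (simp add: ins_parity)

lemma alt_wedge_add_left: "alt_wedge (f + f') g = alt_wedge f g + alt_wedge f' g"
  and alt_wedge_add_right: "alt_wedge f (g + g') = alt_wedge f g + alt_wedge f g'"
  and alt_wedge_scale_left: "alt_wedge (r *\<^sub>R f) g = r *\<^sub>R alt_wedge f g"
  and alt_wedge_scale_right: "alt_wedge f (r *\<^sub>R g) = r *\<^sub>R alt_wedge f g"
  by (auto simp: alt_wedge_def fun_eq_iff scaleR_fun_def algebra_simps sum.distrib sum_distrib_left)

lemma alt_wedge_zero [simp]: "alt_wedge 0 g = 0" "alt_wedge f 0 = 0"
  by (auto simp: alt_wedge_def fun_eq_iff)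

lemma alt_wedge_minus: "alt_wedge (- f) g = - alt_wedge f g" "alt_wedge f (- g) = - alt_wedge f g"
  by (auto simp: alt_wedge_def fun_eq_iff sum_negf)

lemma alt_wedge_linear: "linear (\<lambda>f. alt_wedge f g)" "linear (alt_wedge f)"
  by (auto intro!: linearI simp: alt_wedge_add_left alt_wedge_add_right alt_wedge_scale_left alt_wedge_scale_right)

text \<open>
  For arbitrary functions on lists; they need not vanish outside one length.
\<close>

lemma parity_alt_wedge: "parity (alt_wedge f g) = alt_wedge (parity f) (parity g)"
proof
  fix vs :: "'a list"
  show "parity (alt_wedge f g) vs = alt_wedge (parity f) (parity g) vs"
  proof (induction vs arbitrary: f g)
    case Nil
    then show ?case by (simp add: alt_wedge_Nil parity_def)
  next
    case (Cons v vs)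
    have "parity (alt_wedge f g) (v # vs) = - parity (alt_wedge (ins v f) g) vs - parity (alt_wedge (parity f) (ins v g)) vs"
      by (simp add: parity_def alt_wedge_Cons algebra_simps)
    then show ?case
      unfolding Cons.IH alt_wedge_Cons ins_parity by (simp add: alt_wedge_minus)
  qed
qed

text \<open>
  Both sides have the same contraction with \<open>v\<close>, by the antiderivation rule and the induction
  hypothesis; no shuffles of three lists need to be counted.
\<close>

lemma alt_wedge_assoc: "alt_wedge (alt_wedge f g) h = alt_wedge f (alt_wedge g h)"
proof
  fix vs :: "'a list"
  show "alt_wedge (alt_wedge f g) h vs = alt_wedge f (alt_wedge g h) vs"
  proof (induction vs arbitrary: f g h)
    case Nil
    then show ?case by (simp add: alt_wedge_Nil)
  next
    case (Cons v vs)
    then show ?case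
      by (simp add: alt_wedge_Cons ins_alt_wedge alt_wedge_add_left alt_wedge_add_right parity_alt_wedge)
  qed
qed

text \<open>
  The two cases of graded commutativity, for \<open>f\<close> even and odd, are proved by a simultaneous induction
  because a contraction changes the parity of \<open>f\<close>.
\<close>

lemma alt_wedge_commute:
  "parity f = f \<Longrightarrow> alt_wedge f g = alt_wedge g f" (is "?even \<Longrightarrow> _")
  "parity f = - f \<Longrightarrow> alt_wedge f g = alt_wedge (parity g) f"
proof -
  have "(parity f = f \<longrightarrow> alt_wedge f g vs = alt_wedge g f vs) \<and>
    (parity f = - f \<longrightarrow> alt_wedge f g vs = alt_wedge (parity g) f vs)" for vs
  proof (induction vs arbitrary: f g)
    case Nil
    then show ?case by (simp add: alt_wedge_Nil parity_def)
  next
    case (Cons v vs)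
    show ?case
    proof (intro conjI impI)
      assume f: "parity f = f"
      have "parity (ins v f) = - ins v f" unfolding parity_ins f ..
      then have "alt_wedge (ins v f) g vs = alt_wedge (parity g) (ins v f) vs" using Cons by blast
      moreover have "alt_wedge f (ins v g) vs = alt_wedge (ins v g) f vs" using Cons f by blast
      ultimately show "alt_wedge f g (v # vs) = alt_wedge g f (v # vs)"
        unfolding alt_wedge_Cons f by linarith
    next
      assume f: "parity f = - f"
      have "parity (ins v f) = ins v f" unfolding parity_ins f ins_minus by simp
      then have "alt_wedge (ins v f) g vs = alt_wedge g (ins v f) vs" using Cons by blast
      moreover have "alt_wedge f (ins v g) vs = alt_wedge (parity (ins v g)) f vs" using Cons f by blast
      ultimately show "alt_wedge f g (v # vs) = alt_wedge (parity g) f (v # vs)"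
        unfolding alt_wedge_Cons f alt_wedge_minus ins_parity parity_parity uminus_apply by linarith
    qed
  qed
  then show "parity f = f \<Longrightarrow> alt_wedge f g = alt_wedge g f"
    "parity f = - f \<Longrightarrow> alt_wedge f g = alt_wedge (parity g) f" by auto
qed

subsection \<open>Alternating forms\<close>

lemma alternating_form_length: "alternating_form k \<alpha> \<Longrightarrow> int (length v) \<noteq> k \<Longrightarrow> \<alpha> v = 0"
  by (simp add: alternating_form_def)

lemma alternating_form_distinct: "alternating_form k \<alpha> \<Longrightarrow> \<not> distinct v \<Longrightarrow> \<alpha> v = 0"
  by (simp add: alternating_form_def)

lemma alternating_form_linear: "alternating_form k \<alpha> \<Longrightarrow> i < length v \<Longrightarrow> linear (\<lambda>w. \<alpha> (v[i := w]))"
  by (simp add: alternating_form_def)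

lemma alternating_form_linear_Cons: fixes \<alpha> :: "'b::real_vector list \<Rightarrow> real" shows "alternating_form k \<alpha> \<Longrightarrow> linear (\<lambda>v. \<alpha> (v # ws))"
  using alternating_form_linear[of k \<alpha> 0 "undefined # ws"] by simp

lemma alternating_form_ins: fixes \<alpha> :: "'b::real_vector list \<Rightarrow> real" assumes "alternating_form k \<alpha>" shows "alternating_form (k - 1) (ins v \<alpha>)"
  unfolding alternating_form_def ins_def
proof (intro conjI allI impI)
  fix ws :: "'b list" assume "int (length ws) \<noteq> k - 1"
  then show "\<alpha> (v # ws) = 0" using assms by (intro alternating_form_length) auto
next
  fix ws :: "'b list" and i assume "i < length ws"
  then show "linear (\<lambda>w. \<alpha> (v # ws[i := w]))"
    using alternating_form_linear[OF assms, of "Suc i" "v # ws"] by simp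
next
  fix ws :: "'b list" assume "\<not> distinct ws"
  then show "\<alpha> (v # ws) = 0" using assms by (intro alternating_form_distinct) auto
qed

lemma alternating_form_swap:
  fixes \<alpha> :: "'b::real_vector list \<Rightarrow> real"
  assumes "alternating_form k \<alpha>" shows "\<alpha> (v # w # ws) = - \<alpha> (w # v # ws)"
proof -
  have lin: "linear (\<lambda>v. \<alpha> (v # u # ws))" "linear (\<lambda>u. \<alpha> (v # u # ws))" for u v
    using alternating_form_linear_Cons[OF assms] alternating_form_linear_Cons[OF alternating_form_ins[OF assms], of v ws]
    by (auto simp: ins_def)
  have eq: "\<alpha> (u # u # ws) = 0" for u using alternating_form_distinct[OF assms] by simp
  have "0 = \<alpha> ((v + w) # (v + w) # ws)" using eq by simp
  also have "\<dots> = \<alpha> (v # w # ws) + \<alpha> (w # v # ws)"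
    using eq[of v] eq[of w] by (simp add: linear_add[OF lin(1)] linear_add[OF lin(2)])
  finally show ?thesis by simp
qed

text \<open>
  An inductive criterion: together with the behaviour of the first one or two arguments, it is enough
  to know that all contractions are alternating. Equal arguments that are further apart are brought
  together by the antisymmetry in the first two.
\<close>

lemma alternating_formI:
  fixes \<alpha> :: "'b::real_vector list \<Rightarrow> real"
  assumes ins: "\<And>v. alternating_form (k - 1) (ins v \<alpha>)" and Nil: "k \<noteq> 0 \<Longrightarrow> \<alpha> [] = 0"
    and lin: "\<And>ws. linear (\<lambda>v. \<alpha> (v # ws))" and alt: "\<And>v ws. \<alpha> (v # v # ws) = 0"
  shows "alternating_form k \<alpha>"
proof -
  have swap: "\<alpha> (v # w # ws) = - \<alpha> (w # v # ws)" for v w ws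
  proof -
    have lin2: "linear (\<lambda>u. \<alpha> (v # u # ws))" for v
      using alternating_form_linear_Cons[OF ins[of v], of ws] by (simp add: ins_def)
    have "0 = \<alpha> ((v + w) # (v + w) # ws)" using alt by simp
    also have "\<dots> = \<alpha> (v # w # ws) + \<alpha> (w # v # ws)"
      using alt[of v] alt[of w] by (simp add: linear_add[OF lin] linear_add[OF lin2])
    finally show ?thesis by simp
  qed
  show ?thesis
    unfolding alternating_form_def
  proof (intro conjI allI impI)
    fix v :: "'b list" assume "int (length v) \<noteq> k"
    then show "\<alpha> v = 0"
      using Nil alternating_form_length[OF ins] by (cases v) (auto simp: ins_def)
  next
    fix v :: "'b list" and i assume "i < length v"
    then show "linear (\<lambda>w. \<alpha> (v[i := w]))"
      using lin alternating_form_linear[OF ins] by (cases v; cases i) (auto simp: ins_def)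
  next
    fix v :: "'b list" assume nd: "\<not> distinct v"
    then obtain u us where v: "v = u # us" by (cases v) auto
    show "\<alpha> v = 0"
    proof (cases "distinct us")
      case False
      then show ?thesis using alternating_form_distinct[OF ins] by (simp add: v ins_def)
    next
      case True
      then have u: "u \<in> set us" using nd v by simp
      then obtain w ws where us: "us = w # ws" by (cases us) auto
      show ?thesis
      proof (cases "u = w")
        case True
        then show ?thesis using alt by (simp add: v us)
      next
        case False
        then have "\<alpha> (w # u # ws) = 0"
          using alternating_form_distinct[OF ins[of w], of "u # ws"] u us by (simp add: ins_def)
        then show ?thesis using swap[of u w ws] by (simp add: v us)
      qed
    qed
  qed
qed

lemma alternating_form_subspace: "subspace {\<alpha>. alternating_form k \<alpha>}"
  by (auto simp: subspace_def alternating_form_def scaleR_fun_def zero_fun_def plus_fun_def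
      intro!: linear_zero linear_compose_add linear_compose_scale_right[where 'b = real, unfolded real_scaleR_def])

lemma alternating_form_closed: "alternating_form k 0"
  "alternating_form k \<alpha> \<Longrightarrow> alternating_form k \<beta> \<Longrightarrow> alternating_form k (\<alpha> + \<beta>)"
  "alternating_form k \<alpha> \<Longrightarrow> alternating_form k (r *\<^sub>R \<alpha>)"
  "alternating_form k \<alpha> \<Longrightarrow> alternating_form k (- \<alpha>)"
  using alternating_form_subspace[of k] subspace_neg[OF alternating_form_subspace, of \<alpha> k]
  by (auto simp: subspace_def)

lemma alternating_form_negative: "alternating_form k \<alpha> \<Longrightarrow> k < 0 \<Longrightarrow> \<alpha> = 0"
  using alternating_form_length by (fastforce simp: fun_eq_iff)

lemma alternating_form_parity: "alternating_form k \<alpha> \<Longrightarrow> parity \<alpha> = sgn_pow k *\<^sub>R \<alpha>"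
proof
  fix v assume "alternating_form k \<alpha>"
  then show "parity \<alpha> v = (sgn_pow k *\<^sub>R \<alpha>) v"
    by (cases "int (length v) = k") (auto simp: parity_def scaleR_fun_def sgn_pow_def alternating_form_length)
qed

lemma alternating_form_ins_ins: "alternating_form k \<alpha> \<Longrightarrow> ins v (ins v \<alpha>) = 0"
  using alternating_form_distinct[of k \<alpha>] by (auto simp: ins_def)

lemma ins_linear: "alternating_form k \<alpha> \<Longrightarrow> linear (\<lambda>v. ins v \<alpha>)"
  using alternating_form_linear_Cons[of k \<alpha>]
  by (auto simp: ins_def linear_iff fun_eq_iff scaleR_fun_def)

lemma linear_apply: "linear (\<lambda>f :: 'a \<Rightarrow> real. f x)"
  by (auto intro!: linearI simp: scaleR_fun_def)

text \<open>
  Induction on the total degree by the criterion above. The vanishing on \<open>(v, v, \<dots>)\<close> is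
  \<open>\<iota>\<^sub>v \<iota>\<^sub>v (\<alpha> \<beta>) = 0\<close>, where the two mixed terms cancel.
\<close>

lemma alternating_form_alt_wedge:
  "alternating_form k \<alpha> \<Longrightarrow> alternating_form l \<beta> \<Longrightarrow> alternating_form (k + l) (alt_wedge \<alpha> \<beta>)"
proof (induction "nat (k + l + 1)" arbitrary: k l \<alpha> \<beta> rule: less_induct)
  case less
  show ?case
  proof (cases "k + l < 0")
    case True
    then have "\<alpha> = 0 \<or> \<beta> = 0" using less.prems alternating_form_negative by (cases "k < 0") auto
    then show ?thesis using alternating_form_closed(1) by auto
  next
    case False
    note \<alpha> = less.prems(1) and \<beta> = less.prems(2)
    have p: "alternating_form k (parity \<alpha>)" using \<alpha> alternating_form_parity alternating_form_closed(3) by metis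
    show ?thesis
    proof (rule alternating_formI)
      fix v
      have "alternating_form (k - 1 + l) (alt_wedge (ins v \<alpha>) \<beta>)"
        using False by (intro less.hyps alternating_form_ins \<alpha> \<beta>) auto
      moreover have "alternating_form (k + (l - 1)) (alt_wedge (parity \<alpha>) (ins v \<beta>))"
        using False by (intro less.hyps alternating_form_ins p \<beta>) auto
      ultimately show "alternating_form (k + l - 1) (ins v (alt_wedge \<alpha> \<beta>))"
        unfolding ins_alt_wedge by (intro alternating_form_closed) (simp_all add: algebra_simps)
    next
      assume "k + l \<noteq> 0"
      then show "alt_wedge \<alpha> \<beta> [] = 0"
        using alternating_form_length[OF \<alpha>, of "[]"] alternating_form_length[OF \<beta>, of "[]"]
        by (cases "k = 0") (auto simp: alt_wedge_Nil)
    next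
      fix ws
      have "linear (\<lambda>v. alt_wedge (ins v \<alpha>) \<beta> ws)"
        using linear_compose[OF linear_compose[OF ins_linear[OF \<alpha>] alt_wedge_linear(1)] linear_apply] by (simp add: o_def)
      moreover have "linear (\<lambda>v. alt_wedge (parity \<alpha>) (ins v \<beta>) ws)"
        using linear_compose[OF linear_compose[OF ins_linear[OF \<beta>] alt_wedge_linear(2)] linear_apply] by (simp add: o_def)
      ultimately show "linear (\<lambda>v. alt_wedge \<alpha> \<beta> (v # ws))"
        unfolding alt_wedge_Cons by (rule linear_compose_add)
    next
      fix v ws
      have "ins v (ins v (alt_wedge \<alpha> \<beta>)) = 0"
        by (simp add: ins_alt_wedge ins_add alternating_form_ins_ins[OF \<alpha>] alternating_form_ins_ins[OF \<beta>] parity_ins alt_wedge_minus)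
      then show "alt_wedge \<alpha> \<beta> (v # v # ws) = 0" by (simp add: ins_def fun_eq_iff)
    qed
  qed
qed

lemma alt_wedge_map: "alt_wedge \<alpha> \<beta> (map F v) = alt_wedge (\<lambda>u. \<alpha> (map F u)) (\<lambda>u. \<beta> (map F u)) v"
  by (simp add: alt_wedge_def nths_map)

lemma linear_expand:
  fixes v :: "'b::euclidean_space" and f :: "'b \<Rightarrow> 'c::real_vector"
  assumes "linear f" shows "f v = (\<Sum>b\<in>Basis. (v \<bullet> b) *\<^sub>R f b)"
  using linear_sum[OF assms, of "\<lambda>b. (v \<bullet> b) *\<^sub>R b" Basis] linear_scale[OF assms] by (simp add: euclidean_representation)

lemma alternating_form_eq_zero:
  fixes \<alpha> :: "'b::euclidean_space list \<Rightarrow> real"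
  assumes "alternating_form k \<alpha>" "\<And>bs. set bs \<subseteq> Basis \<Longrightarrow> \<alpha> bs = 0" shows "\<alpha> = 0"
proof
  fix vs show "\<alpha> vs = 0 vs"
    using assms
  proof (induction vs arbitrary: \<alpha> k)
    case Nil
    then show ?case by simp
  next
    case (Cons v vs)
    have "ins b \<alpha> vs = 0" if "b \<in> Basis" for b
      using Cons.IH[OF alternating_form_ins[OF Cons.prems(1), of b]] Cons.prems(2)[of "b # _"] that by (simp add: ins_def)
    then show ?case
      using linear_expand[OF alternating_form_linear_Cons[OF Cons.prems(1), of vs], of v] by (simp add: ins_def)
  qed
qed

lemma alternating_form_above_dimension:
  fixes \<alpha> :: "'b::euclidean_space list \<Rightarrow> real"
  assumes "alternating_form k \<alpha>" "k > int DIM('b)" shows "\<alpha> = 0"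
proof (rule alternating_form_eq_zero[OF assms(1)])
  fix bs :: "'b list" assume bs: "set bs \<subseteq> Basis"
  show "\<alpha> bs = 0"
  proof (cases "distinct bs")
    case True
    then have "length bs \<le> DIM('b)" using bs card_mono[OF finite_Basis bs] by (simp add: distinct_card)
    then show ?thesis using assms by (intro alternating_form_length) auto
  qed (rule alternating_form_distinct[OF assms(1)])
qed

subsection \<open>The Lefschetz operators of a symplectic vector space\<close>

lemma sum_fun_apply: "(\<Sum>i\<in>I. f i) x = (\<Sum>i\<in>I. (f i :: 'a \<Rightarrow> 'b::comm_monoid_add) x)"
  by (induction I rule: infinite_finite_induct) auto

lemma scaleR_apply [simp]: "(r *\<^sub>R f) x = r *\<^sub>R f x"
  by (simp add: scaleR_fun_def)

definition covector :: "'b::real_inner \<Rightarrow> 'b list \<Rightarrow> real" where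
  "covector u = (\<lambda>v. case v of [x] \<Rightarrow> u \<bullet> x | _ \<Rightarrow> 0)"

lemma covector_simps [simp]: "covector u [] = 0" "covector u [x] = u \<bullet> x" "covector u (x # y # ws) = 0"
  by (simp_all add: covector_def)

definition scalar_form :: "real \<Rightarrow> 'b list \<Rightarrow> real" where
  "scalar_form r = (\<lambda>v. if v = [] then r else 0)"

lemma ins_scalar_form: "ins v (scalar_form r) = 0"
  by (auto simp: ins_def scalar_form_def fun_eq_iff)

lemma parity_scalar_form: "parity (scalar_form r) = scalar_form r"
  by (auto simp: parity_def scalar_form_def fun_eq_iff)

lemma alt_wedge_scalar_form: "alt_wedge (scalar_form r) \<eta> = r *\<^sub>R \<eta>"
proof
  fix vs show "alt_wedge (scalar_form r) \<eta> vs = (r *\<^sub>R \<eta>) vs"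
  proof (induction vs arbitrary: \<eta>)
    case Nil
    then show ?case by (simp add: alt_wedge_Nil scalar_form_def)
  next
    case (Cons v vs)
    then show ?case by (simp add: alt_wedge_Cons ins_scalar_form parity_scalar_form) (simp add: ins_def)
  qed
qed

lemma ins_covector: "ins v (covector u) = scalar_form (u \<bullet> v)"
  by (auto simp: ins_def scalar_form_def fun_eq_iff covector_def split: list.split)

lemma parity_covector: "parity (covector u) = - covector u"
  by (auto simp: parity_def fun_eq_iff covector_def split: list.split)

lemma ins_commute: "alternating_form k \<eta> \<Longrightarrow> ins v (ins u \<eta>) = - ins u (ins v \<eta>)"
  using alternating_form_swap[of k \<eta> u v] by (auto simp: ins_def fun_eq_iff)

text \<open>
  Euler's identity: a form of degree \<open>k\<close> is an eigenvector of \<open>\<Sum> e\<^sup>b \<and> \<iota>\<^sub>b\<close>, with eigenvalue \<open>k\<close>. This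
  produces the degree in \<open>[\<Lambda>, L] = n - k\<close>.
\<close>

lemma sum_covector_wedge_ins:
  fixes \<eta> :: "'b::euclidean_space list \<Rightarrow> real"
  assumes "alternating_form k \<eta>"
  shows "(\<Sum>b\<in>Basis. alt_wedge (covector b) (ins b \<eta>)) = of_int k *\<^sub>R \<eta>"
proof
  fix vs
  have "(\<Sum>b\<in>Basis. alt_wedge (covector b) (ins b \<eta>) vs) = of_int k * \<eta> vs"
    using assms
  proof (induction vs arbitrary: \<eta> k)
    case Nil
    then show ?case using alternating_form_length[OF Nil, of "[]"] by (cases "k = 0") (auto simp: alt_wedge_Nil)
  next
    case (Cons v vs)
    have "alt_wedge (covector b) (ins b \<eta>) (v # vs) = (v \<bullet> b) * ins b \<eta> vs + alt_wedge (covector b) (ins b (ins v \<eta>)) vs" for b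
      by (simp add: alt_wedge_Cons ins_covector alt_wedge_scalar_form parity_covector alt_wedge_minus
          ins_commute[OF Cons.prems, of v b] inner_commute)
    then have "(\<Sum>b\<in>Basis. alt_wedge (covector b) (ins b \<eta>) (v # vs)) =
      (\<Sum>b\<in>Basis. (v \<bullet> b) * ins b \<eta> vs) + (\<Sum>b\<in>Basis. alt_wedge (covector b) (ins b (ins v \<eta>)) vs)"
      by (simp add: sum.distrib)
    also have "(\<Sum>b\<in>Basis. (v \<bullet> b) * ins b \<eta> vs) = ins v \<eta> vs"
      using linear_expand[OF alternating_form_linear_Cons[OF Cons.prems, of vs], of v] by (simp add: ins_def)
    also have "(\<Sum>b\<in>Basis. alt_wedge (covector b) (ins b (ins v \<eta>)) vs) = of_int (k - 1) * ins v \<eta> vs"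
      by (rule Cons.IH[OF alternating_form_ins[OF Cons.prems]])
    finally show ?case by (simp add: ins_def algebra_simps)
  qed
  then show "(\<Sum>b\<in>Basis. alt_wedge (covector b) (ins b \<eta>)) vs = (of_int k *\<^sub>R \<eta>) vs"
    by (simp add: sum_fun_apply)
qed

definition contract_poisson :: "('b::euclidean_space list \<Rightarrow> real) \<Rightarrow> ('b list \<Rightarrow> real) \<Rightarrow> 'b list \<Rightarrow> real" where
  "contract_poisson w \<eta> = (\<lambda>v. 1/2 * (\<Sum>i\<in>Basis. \<Sum>j\<in>Basis. poisson_bivector w i j * \<eta> (j # i # v)))"

lemma contract_poisson_eq:
  "contract_poisson w \<eta> = (1/2) *\<^sub>R (\<Sum>i\<in>Basis. \<Sum>j\<in>Basis. poisson_bivector w i j *\<^sub>R ins i (ins j \<eta>))"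
  by (auto simp: contract_poisson_def fun_eq_iff sum_fun_apply ins_def)

lemma contract_poisson_linear: "linear (contract_poisson w)"
  by (rule linearI) (auto simp: contract_poisson_def fun_eq_iff algebra_simps sum.distrib sum_distrib_left)

text \<open>
  A symplectic form on a vector space, with \<open>w\<close> in the role of \<open>\<omega>\<close> at one point.
\<close>

locale symplectic_vector =
  fixes w :: "'b::euclidean_space list \<Rightarrow> real" and n :: nat
  assumes dim: "DIM('b) = 2 * n" and w2: "alternating_form 2 w"
    and nondeg: "\<And>v. (\<And>u. w [v, u] = 0) \<Longrightarrow> v = 0"
begin

definition sharp :: "'b \<Rightarrow> 'b" where
  "sharp u = (THE z. \<forall>v. w [z, v] = u \<bullet> v)"

lemma w_linear: "linear (\<lambda>z. w [z, v])" "linear (\<lambda>v. w [z, v])"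
  using alternating_form_linear_Cons[OF w2, of "[v]"] alternating_form_linear_Cons[OF alternating_form_ins[OF w2, of z], of "[]"]
  by (simp_all add: ins_def)

lemma w_swap: "w [u, v] = - w [v, u]"
  using alternating_form_swap[OF w2, of u v "[]"] .

text \<open>
  Nondegeneracy makes the map from vectors to covectors injective, and injective linear maps between
  spaces of equal dimension are bijective.
\<close>

lemma sharp_ex1: "\<exists>!z. \<forall>v. w [z, v] = u \<bullet> v"
proof -
  define M where "M z = (\<Sum>j\<in>Basis. w [z, j] *\<^sub>R j)" for z
  have inner: "M z \<bullet> v = w [z, v]" for z v
    unfolding M_def inner_sum_left linear_expand[OF w_linear(2), of z v] by (simp add: inner_commute mult.commute)
  have lin: "linear M"
    unfolding M_def using w_linear(1) by (intro linear_compose_sum ballI) (auto simp: linear_iff scaleR_add_left)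
  have "inj M"
    unfolding linear_injective_0[OF lin] using inner nondeg by (metis inner_zero_left)
  then have "surj M" using linear_injective_imp_surjective[OF lin] by blast
  then obtain z where "M z = u" by (metis surjD)
  then have "\<forall>v. w [z, v] = u \<bullet> v" using inner by metis
  moreover have "z = z'" if "\<forall>v. w [z, v] = u \<bullet> v" "\<forall>v. w [z', v] = u \<bullet> v" for z z'
  proof -
    have "z - z' = 0" by (rule nondeg) (simp add: linear_diff[OF w_linear(1)] that)
    then show ?thesis by simp
  qed
  ultimately show ?thesis by blast
qed

lemma w_sharp: "w [sharp u, v] = u \<bullet> v"
  using theI'[OF sharp_ex1[of u]] unfolding sharp_def by blast

lemma poisson_sharp: "poisson_bivector w i j = sharp i \<bullet> j"
  by (simp add: poisson_bivector_def sharp_def)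

lemma poisson_w: "poisson_bivector w i j = w [sharp j, sharp i]"
  by (simp add: poisson_sharp w_sharp inner_commute)

lemma poisson_skew: "poisson_bivector w i j = - poisson_bivector w j i"
  unfolding poisson_w by (rule w_swap)

text \<open>
  A sum against a row of the Poisson bivector is the evaluation at the vector dual to a covector; in
  this way all double sums below are reduced to single ones.
\<close>

lemma sum_poisson: 
  fixes f :: "'b \<Rightarrow> 'c::real_vector"
  shows "linear f \<Longrightarrow> (\<Sum>j\<in>Basis. poisson_bivector w i j *\<^sub>R f j) = f (sharp i)"
  by (simp add: poisson_sharp linear_expand[of f "sharp i"])

lemma contract_poisson_sharp:
  assumes "alternating_form k \<eta>"
  shows "contract_poisson w \<eta> v = 1/2 * (\<Sum>i\<in>Basis. \<eta> (sharp i # i # v))"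
  using sum_poisson[OF alternating_form_linear_Cons[OF assms]] by (simp add: contract_poisson_def)

lemma parity_w: "parity w = w"
  using alternating_form_parity[OF w2] by (simp add: sgn_pow_def)

lemma alternating_form_contract_poisson:
  "alternating_form k \<eta> \<Longrightarrow> alternating_form (k - 2) (contract_poisson w \<eta>)"
proof -
  assume "alternating_form k \<eta>"
  then have "alternating_form (k - 2) (ins i (ins j \<eta>))" for i j
    using alternating_form_ins[OF alternating_form_ins] by fastforce
  then show ?thesis
    unfolding contract_poisson_eq
    using subspace_sum[OF alternating_form_subspace[of "k - 2"], of Basis "\<lambda>i. \<Sum>j\<in>Basis. poisson_bivector w i j *\<^sub>R ins i (ins j \<eta>)"]
      subspace_sum[OF alternating_form_subspace[of "k - 2"], of Basis "\<lambda>j. poisson_bivector w i j *\<^sub>R ins i (ins j \<eta>)" for i]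
    by (simp add: alternating_form_closed)
qed

lemma sum_poisson_w: "(\<Sum>i\<in>Basis. \<Sum>j\<in>Basis. poisson_bivector w i j * w [j, i]) = 2 * real n"
proof -
  have "(\<Sum>j\<in>Basis. poisson_bivector w i j * w [j, i]) = 1" if "i \<in> Basis" for i
    using sum_poisson[OF w_linear(1)[of i], of i] w_sharp[of i i] that by simp
  then show ?thesis using dim by simp
qed

text \<open>
  In \<open>\<Lambda>(w \<and> \<eta>) = \<onehalf> \<Sum> \<pi>\<^sup>i\<^sup>j \<iota>\<^sub>i \<iota>\<^sub>j (w \<and> \<eta>)\<close>, both contractions can fall on \<open>w\<close>, which gives \<open>n \<eta>\<close>; or one
  on each factor, and the two possibilities give \<open>- k \<eta>\<close> by Euler's identity; or both on \<open>\<eta>\<close>, which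
  gives \<open>w \<and> \<Lambda>\<eta>\<close>.
\<close>

lemma contract_poisson_wedge:
  assumes \<eta>: "alternating_form k \<eta>"
  shows "contract_poisson w (alt_wedge w \<eta>) = alt_wedge w (contract_poisson w \<eta>) + (real n - of_int k) *\<^sub>R \<eta>"
proof -
  let ?p = "poisson_bivector w"
  have w1: "parity (ins j w) = - ins j w" for j by (simp add: parity_ins parity_w)
  have w0: "ins i (ins j w) = scalar_form (w [j, i])" for i j
    using alternating_form_length[OF w2] by (auto simp: ins_def scalar_form_def fun_eq_iff)
  have ii: "ins i (ins j (alt_wedge w \<eta>)) = w [j, i] *\<^sub>R \<eta> + (alt_wedge (ins i w) (ins j \<eta>) - alt_wedge (ins j w) (ins i \<eta>))
      + alt_wedge w (ins i (ins j \<eta>))" for i j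
    by (simp add: ins_alt_wedge ins_add w1 w0 parity_w alt_wedge_scalar_form alt_wedge_minus algebra_simps)
  have A: "(\<Sum>i\<in>Basis. \<Sum>j\<in>Basis. ?p i j *\<^sub>R w [j, i] *\<^sub>R \<eta>) = (2 * real n) *\<^sub>R \<eta>"
    unfolding sum_poisson_w[symmetric] by (simp add: scaleR_sum_left)
  have "(\<Sum>j\<in>Basis. ?p i j *\<^sub>R alt_wedge (ins j w) (ins i \<eta>)) = alt_wedge (covector i) (ins i \<eta>)" for i
  proof -
    have "linear (\<lambda>j. alt_wedge (ins j w) (ins i \<eta>))"
      using linear_compose[OF ins_linear[OF w2] alt_wedge_linear(1)] by (simp add: o_def)
    then have "(\<Sum>j\<in>Basis. ?p i j *\<^sub>R alt_wedge (ins j w) (ins i \<eta>)) = alt_wedge (ins (sharp i) w) (ins i \<eta>)"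
      by (rule sum_poisson)
    moreover have "ins (sharp i) w = covector i"
      using alternating_form_length[OF w2]
      by (auto simp: ins_def covector_def fun_eq_iff w_sharp split: list.split)
    ultimately show ?thesis by simp
  qed
  then have B: "(\<Sum>i\<in>Basis. \<Sum>j\<in>Basis. ?p i j *\<^sub>R alt_wedge (ins j w) (ins i \<eta>)) = of_int k *\<^sub>R \<eta>"
    using sum_covector_wedge_ins[OF \<eta>] by simp
  have "(\<Sum>i\<in>Basis. \<Sum>j\<in>Basis. ?p i j *\<^sub>R alt_wedge (ins i w) (ins j \<eta>)) =
      (\<Sum>j\<in>Basis. \<Sum>i\<in>Basis. ?p i j *\<^sub>R alt_wedge (ins i w) (ins j \<eta>))" by (rule sum.swap)
  also have "\<dots> = - (\<Sum>j\<in>Basis. \<Sum>i\<in>Basis. ?p j i *\<^sub>R alt_wedge (ins i w) (ins j \<eta>))"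
    unfolding sum_negf[symmetric] scaleR_minus_left[symmetric] poisson_skew[symmetric] ..
  finally have C: "(\<Sum>i\<in>Basis. \<Sum>j\<in>Basis. ?p i j *\<^sub>R alt_wedge (ins i w) (ins j \<eta>)) = - (of_int k *\<^sub>R \<eta>)"
    unfolding B .
  have E: "(\<Sum>i\<in>Basis. \<Sum>j\<in>Basis. ?p i j *\<^sub>R alt_wedge w (ins i (ins j \<eta>))) =
      alt_wedge w (\<Sum>i\<in>Basis. \<Sum>j\<in>Basis. ?p i j *\<^sub>R ins i (ins j \<eta>))"
    by (simp add: linear_sum[OF alt_wedge_linear(2)] linear_scale[OF alt_wedge_linear(2)])
  have "(\<Sum>i\<in>Basis. \<Sum>j\<in>Basis. ?p i j *\<^sub>R ins i (ins j (alt_wedge w \<eta>))) =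
    (2 * real n) *\<^sub>R \<eta> + (- (of_int k *\<^sub>R \<eta>) - of_int k *\<^sub>R \<eta>)
     + alt_wedge w (\<Sum>i\<in>Basis. \<Sum>j\<in>Basis. ?p i j *\<^sub>R ins i (ins j \<eta>))"
    unfolding ii scaleR_add_right scaleR_diff_right sum.distrib sum_subtractf A B C E ..
  also have "(2 * real n) *\<^sub>R \<eta> + (- (of_int k *\<^sub>R \<eta>) - of_int k *\<^sub>R \<eta>) = 2 *\<^sub>R (real n - of_int k) *\<^sub>R \<eta>"
    by (rule ext) (simp add: algebra_simps)
  finally show ?thesis
    unfolding contract_poisson_eq alt_wedge_scale_right by (simp only: scaleR_add_right) simp
qed

lemma lefschetz_module_pointwise:
  "lefschetz_module (\<lambda>k. {\<alpha>. alternating_form k \<alpha>}) (alt_wedge w) (contract_poisson w) n"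
proof
  fix K and y :: "int \<Rightarrow> 'b list \<Rightarrow> real" and k
  assume K: "finite K" "\<And>k. k \<in> K \<Longrightarrow> y k \<in> {\<alpha>. alternating_form k \<alpha>}" "(\<Sum>k\<in>K. y k) = 0" "k \<in> K"
  show "y k = 0"
  proof
    fix v
    show "y k v = 0 v"
    proof (cases "int (length v) = k")
      case True
      have "(\<Sum>i\<in>K. y i v) = y k v + (\<Sum>i\<in>K - {k}. y i v)"
        using K by (simp add: sum.remove)
      also have "(\<Sum>i\<in>K - {k}. y i v) = 0"
      proof (intro sum.neutral ballI)
        fix i assume "i \<in> K - {k}"
        then show "y i v = 0" using K(2)[of i] True by (intro alternating_form_length[of i]) auto
      qed
      finally show ?thesis using K(3) by (simp add: sum_fun_apply[symmetric])
    qed (use K alternating_form_length in auto)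
  qed
next
  fix x :: "'b list \<Rightarrow> real" and k :: int
  assume "x \<in> {\<alpha>. alternating_form k \<alpha>}"
  then show "contract_poisson w (alt_wedge w x) - alt_wedge w (contract_poisson w x) = (real n - of_int k) *\<^sub>R x"
    by (simp add: contract_poisson_wedge)
next
  fix x :: "'b list \<Rightarrow> real" and k :: int
  assume "x \<in> {\<alpha>. alternating_form k \<alpha>}" "k < 0 \<or> k > 2 * int n"
  then show "x = 0"
    using alternating_form_negative alternating_form_above_dimension[of k x] dim by auto
next
  fix x :: "'b list \<Rightarrow> real" and k :: int
  assume "x \<in> {\<alpha>. alternating_form k \<alpha>}"
  then show "alt_wedge w x \<in> {\<alpha>. alternating_form (k + 2) \<alpha>}"
    using alternating_form_alt_wedge[OF w2, of k x] by (simp add: add.commute)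
qed (simp_all add: alternating_form_subspace alternating_form_contract_poisson alt_wedge_linear contract_poisson_linear
    linear_add[OF contract_poisson_linear] linear_scale[OF contract_poisson_linear] alt_wedge_add_right alt_wedge_scale_right)

end

text \<open>
  A linear map that preserves the symplectic forms is injective, hence invertible, and carries the
  dual of one covector to the dual of the transformed one. After expansion of both in the basis, the
  matrix of the map and that of its inverse cancel.
\<close>

lemma contract_poisson_pullback:
  fixes w w' :: "'b::euclidean_space list \<Rightarrow> real"
  assumes w: "symplectic_vector w n" and w': "symplectic_vector w' n" and F: "linear F"
    and pull: "\<And>v. w v = w' (map F v)" and \<eta>': "alternating_form k \<eta>'"
    and \<eta>: "alternating_form k \<eta>" "\<And>v. \<eta> v = \<eta>' (map F v)"
  shows "contract_poisson w \<eta> v = contract_poisson w' \<eta>' (map F v)"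
proof -
  interpret w: symplectic_vector w n by fact
  interpret w': symplectic_vector w' n by fact
  have "inj F"
    unfolding linear_injective_0[OF F]
  proof (intro allI impI)
    fix v assume "F v = 0"
    then show "v = 0" using linear_0[OF w'.w_linear(1)] by (intro w.nondeg) (simp add: pull)
  qed
  then obtain G where G: "linear G" "\<And>x. F (G x) = x"
    using linear_injective_isomorphism[OF F] by blast
  have F_sharp: "F (w.sharp i) = (\<Sum>j\<in>Basis. (i \<bullet> G j) *\<^sub>R w'.sharp j)" if "i \<in> Basis" for i
  proof -
    have "w' [F (w.sharp i) - (\<Sum>j\<in>Basis. (i \<bullet> G j) *\<^sub>R w'.sharp j), u] = 0" for u
    proof -
      have "w' [F (w.sharp i), u] = w [w.sharp i, G u]" by (simp add: pull G)
      also have "\<dots> = i \<bullet> G u" by (simp add: w.w_sharp)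
      also have "\<dots> = (\<Sum>j\<in>Basis. (u \<bullet> j) * (i \<bullet> G j))"
        by (subst linear_expand[OF G(1)]) (simp add: inner_sum_right)
      finally show ?thesis
        by (simp add: linear_diff[OF w'.w_linear(1)] linear_sum[OF w'.w_linear(1)] linear_scale[OF w'.w_linear(1)]
            w'.w_sharp inner_commute mult.commute)
    qed
    then show ?thesis using w'.nondeg by fastforce
  qed
  have lin2: "linear (\<lambda>u. \<eta>' (x # u # ws))" for x ws
    using alternating_form_linear_Cons[OF alternating_form_ins[OF \<eta>', of x], of ws] by (simp add: ins_def)
  note lin1 = alternating_form_linear_Cons[OF \<eta>']
  have "(\<Sum>i\<in>Basis. \<eta> (w.sharp i # i # v)) = (\<Sum>i\<in>Basis. \<Sum>j\<in>Basis. (i \<bullet> G j) * \<eta>' (w'.sharp j # F i # map F v))"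
    by (simp add: \<eta>(2) F_sharp linear_sum[OF lin1] linear_scale[OF lin1])
  also have "\<dots> = (\<Sum>j\<in>Basis. \<Sum>i\<in>Basis. (i \<bullet> G j) * \<eta>' (w'.sharp j # F i # map F v))"
    by (rule sum.swap)
  also have "\<dots> = (\<Sum>j\<in>Basis. \<eta>' (w'.sharp j # j # map F v))"
  proof (rule sum.cong[OF refl])
    fix j :: 'b
    have "linear (\<lambda>x. \<eta>' (w'.sharp j # F x # map F v))"
      using linear_compose[OF F lin2[of "w'.sharp j" "map F v"]] by (simp add: o_def)
    from linear_expand[OF this, of "G j"]
    show "(\<Sum>i\<in>Basis. (i \<bullet> G j) * \<eta>' (w'.sharp j # F i # map F v)) = \<eta>' (w'.sharp j # j # map F v)"
      by (simp add: G inner_commute)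
  qed
  finally show ?thesis
    unfolding w.contract_poisson_sharp[OF \<eta>(1)] w'.contract_poisson_sharp[OF \<eta>'] by simp
qed

section \<open>Smooth functions\<close>

abbreviation dirderiv :: "('b::real_normed_vector \<Rightarrow> 'c::real_normed_vector) \<Rightarrow> 'b \<Rightarrow> 'b \<Rightarrow> 'c" where
  "dirderiv f x v \<equiv> frechet_derivative f (at x) v"

lemma dirderiv_eqI: "(f has_derivative f') (at x) \<Longrightarrow> dirderiv f x v = f' v"
  using frechet_derivative_at by metis

lemma has_derivative_cong_open:
  assumes "open S" "x \<in> S" "\<And>y. y \<in> S \<Longrightarrow> f y = g y" "(f has_derivative f') (at x)"
  shows "(g has_derivative f') (at x)"
  using has_derivative_transform_within_open[OF assms(4,1,2)] assms(3) by blast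

lemma dirderiv_cong_open:
  assumes "open S" "x \<in> S" "\<And>y. y \<in> S \<Longrightarrow> f y = g y"
  shows "frechet_derivative f (at x) = frechet_derivative g (at x)"
proof -
  have "(f has_derivative f') (at x) = (g has_derivative f') (at x)" for f'
    using has_derivative_cong_open[OF assms(1,2), of f g f'] has_derivative_cong_open[OF assms(1,2), of g f f'] assms(3) by auto
  then show ?thesis by (simp add: frechet_derivative_def)
qed

lemma differentiable_cong_open:
  assumes "open S" "x \<in> S" "\<And>y. y \<in> S \<Longrightarrow> f y = g y" "f differentiable (at x)"
  shows "g differentiable (at x)"
  using assms(3,4) has_derivative_cong_open[OF assms(1,2), of f g] by (auto simp: differentiable_def)

lemma Ck_on_cong:
  assumes "open S" shows "(\<And>x. x \<in> S \<Longrightarrow> f x = g x) \<Longrightarrow> Ck_on k f S \<Longrightarrow> Ck_on k g S"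
proof (induction k arbitrary: f g)
  case 0
  then show ?case using continuous_on_cong[of S S f g] by simp
next
  case (Suc k)
  have "Ck_on k (\<lambda>x. dirderiv g x v) S" for v
    by (rule Suc.IH[of "\<lambda>x. dirderiv f x v"])
      (use Suc.prems dirderiv_cong_open[OF assms, of _ f g] in \<open>auto simp: fun_eq_iff\<close>)
  moreover have "g differentiable (at x)" if "x \<in> S" for x
    using differentiable_cong_open[OF assms that, of f g] Suc.prems that by simp
  ultimately show ?case by simp
qed

lemma Ck_on_Suc_imp: "Ck_on (Suc k) f S \<Longrightarrow> Ck_on k f S"
proof (induction k arbitrary: f)
  case 0
  then have "continuous (at x) f" if "x \<in> S" for x
    using that differentiable_imp_continuous_within[of f x UNIV] by simp
  then show ?case by (simp add: continuous_at_imp_continuous_on)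
next
  case (Suc k)
  then show ?case by (metis Ck_on.simps(2))
qed

lemma Ck_on_const: "Ck_on k (\<lambda>x. c) S"
  by (induction k arbitrary: c) auto

lemma Ck_on_add:
  assumes "open S" shows "Ck_on k f S \<Longrightarrow> Ck_on k g S \<Longrightarrow> Ck_on k (\<lambda>x. f x + g x) S"
proof (induction k arbitrary: f g)
  case 0
  then show ?case by (auto intro: continuous_on_add)
next
  case (Suc k)
  have d: "((\<lambda>x. f x + g x) has_derivative (\<lambda>v. dirderiv f x v + dirderiv g x v)) (at x)" if "x \<in> S" for x
    using Suc.prems that by (auto intro!: has_derivative_add simp flip: frechet_derivative_works)
  have "Ck_on k (\<lambda>x. dirderiv (\<lambda>x. f x + g x) x v) S" for v
    by (rule Ck_on_cong[OF assms _ Suc.IH[of "\<lambda>x. dirderiv f x v" "\<lambda>x. dirderiv g x v"]])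
      (use Suc.prems dirderiv_eqI[OF d] in auto)
  then show ?case using d by (auto simp: differentiable_def)
qed

text \<open>
  The product rule expresses the derivative by products of functions of class at least \<open>k\<close>, for which
  the induction hypothesis holds; \<open>Ck_on_Suc_imp\<close> is needed for the factors that are not
  differentiated.
\<close>

lemma Ck_on_mult:
  fixes f g :: "'b::real_normed_vector \<Rightarrow> real"
  assumes "open S" shows "Ck_on k f S \<Longrightarrow> Ck_on k g S \<Longrightarrow> Ck_on k (\<lambda>x. f x * g x) S"
proof (induction k arbitrary: f g)
  case 0
  then show ?case by (auto intro: continuous_on_mult)
next
  case (Suc k)
  have d: "((\<lambda>x. f x * g x) has_derivative (\<lambda>v. f x * dirderiv g x v + dirderiv f x v * g x)) (at x)" if "x \<in> S" for x
    using Suc.prems that by (auto intro!: has_derivative_mult simp flip: frechet_derivative_works)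
  have "Ck_on k (\<lambda>x. dirderiv (\<lambda>x. f x * g x) x v) S" for v
  proof (rule Ck_on_cong[OF assms])
    show "Ck_on k (\<lambda>x. f x * dirderiv g x v + dirderiv f x v * g x) S"
      using Suc.prems Ck_on_Suc_imp[OF Suc.prems(1)] Ck_on_Suc_imp[OF Suc.prems(2)]
      by (intro Ck_on_add[OF assms] Suc.IH) auto
  qed (use dirderiv_eqI[OF d] in auto)
  then show ?case using d by (auto simp: differentiable_def)
qed

lemma Ck_on_sum:
  assumes "open S" "\<And>i. i \<in> I \<Longrightarrow> Ck_on k (f i) S"
  shows "Ck_on k (\<lambda>x. \<Sum>i\<in>I. f i x) S"
  using assms(2) by (induction I rule: infinite_finite_induct) (auto simp: Ck_on_const Ck_on_add[OF assms(1)])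

lemma smooth_on_const: "smooth_on (\<lambda>x. c) S"
  by (simp add: smooth_on_def Ck_on_const)

lemma smooth_on_add: "open S \<Longrightarrow> smooth_on f S \<Longrightarrow> smooth_on g S \<Longrightarrow> smooth_on (\<lambda>x. f x + g x) S"
  by (simp add: smooth_on_def Ck_on_add)

lemma smooth_on_mult:
  fixes f g :: "'b::real_normed_vector \<Rightarrow> real"
  shows "open S \<Longrightarrow> smooth_on f S \<Longrightarrow> smooth_on g S \<Longrightarrow> smooth_on (\<lambda>x. f x * g x) S"
  by (simp add: smooth_on_def Ck_on_mult)

lemma smooth_on_sum: "open S \<Longrightarrow> (\<And>i. i \<in> I \<Longrightarrow> smooth_on (f i) S) \<Longrightarrow> smooth_on (\<lambda>x. \<Sum>i\<in>I. f i x) S"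
  by (simp add: smooth_on_def Ck_on_sum)

lemma smooth_on_differentiable: "smooth_on f S \<Longrightarrow> x \<in> S \<Longrightarrow> f differentiable (at x)"
  using Ck_on.simps(2)[of 0 f S] by (simp add: smooth_on_def)

lemma smooth_on_dirderiv: "smooth_on f S \<Longrightarrow> smooth_on (\<lambda>x. dirderiv f x v) S"
  unfolding smooth_on_def using Ck_on.simps(2) by blast

lemma smooth_on_cong: "open S \<Longrightarrow> (\<And>x. x \<in> S \<Longrightarrow> f x = g x) \<Longrightarrow> smooth_on f S \<Longrightarrow> smooth_on g S"
  using Ck_on_cong[of S f g] by (auto simp: smooth_on_def)

subsection \<open>Symmetry of second derivatives\<close>

lemma has_derivative_line:
  fixes f :: "'b::real_normed_vector \<Rightarrow> real"
  assumes "f differentiable (at (a + s *\<^sub>R v))"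
  shows "((\<lambda>s. f (a + s *\<^sub>R v)) has_real_derivative dirderiv f (a + s *\<^sub>R v) v) (at s)"
proof -
  have f: "(f has_derivative frechet_derivative f (at (a + s *\<^sub>R v))) (at (a + s *\<^sub>R v))"
    using assms by (simp add: frechet_derivative_works)
  have "((\<lambda>s. a + s *\<^sub>R v) has_derivative (\<lambda>h. h *\<^sub>R v)) (at s)"
    by (auto intro!: derivative_eq_intros)
  from has_derivative_compose[OF this f]
  have "((\<lambda>s. f (a + s *\<^sub>R v)) has_derivative (\<lambda>h. h * dirderiv f (a + s *\<^sub>R v) v)) (at s)"
    by (simp add: linear_scale[OF linear_frechet_derivative[OF assms]])
  moreover have "(\<lambda>h. h * dirderiv f (a + s *\<^sub>R v) v) = (*) (dirderiv f (a + s *\<^sub>R v) v)"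
    by (simp add: fun_eq_iff)
  ultimately show ?thesis by (simp add: has_field_derivative_def)
qed

text \<open>
  The mean value theorem is applied to the difference \<open>f(\<cdot> + h w) - f\<close> along \<open>v\<close>, and then to the
  derivative in direction \<open>v\<close> along \<open>w\<close>.
\<close>

lemma second_difference:
  fixes f :: "'b::real_normed_vector \<Rightarrow> real"
  assumes h: "h > 0" and ball: "cball x (h * (norm v + norm w)) \<subseteq> S"
    and f: "\<And>y. y \<in> S \<Longrightarrow> f differentiable (at y)" "\<And>y. y \<in> S \<Longrightarrow> (\<lambda>y. dirderiv f y v) differentiable (at y)"
  shows "\<exists>y\<in>cball x (h * (norm v + norm w)).
    f (x + h *\<^sub>R v + h *\<^sub>R w) - f (x + h *\<^sub>R v) - f (x + h *\<^sub>R w) + f x = h * h * dirderiv (\<lambda>y. dirderiv f y v) y w"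
proof -
  have in_ball: "x + s *\<^sub>R v + t *\<^sub>R w \<in> cball x (h * (norm v + norm w))" if "0 \<le> s" "s \<le> h" "0 \<le> t" "t \<le> h" for s t
  proof -
    have "norm (s *\<^sub>R v + t *\<^sub>R w) \<le> h * norm v + h * norm w"
      using that by (intro norm_triangle_le add_mono) (auto intro: mult_right_mono)
    moreover have "dist x (x + (s *\<^sub>R v + t *\<^sub>R w)) = norm (s *\<^sub>R v + t *\<^sub>R w)"
      by (metis add_diff_cancel_left' dist_commute dist_norm)
    ultimately show ?thesis by (simp add: add.assoc distrib_left)
  qed
  have "\<exists>s>0. s < h \<and> (f (x + h *\<^sub>R w + h *\<^sub>R v) - f (x + h *\<^sub>R v)) - (f (x + h *\<^sub>R w + 0 *\<^sub>R v) - f (x + 0 *\<^sub>R v)) =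
    (h - 0) * (dirderiv f (x + h *\<^sub>R w + s *\<^sub>R v) v - dirderiv f (x + s *\<^sub>R v) v)"
  proof (rule MVT2[OF h])
    fix s assume s: "0 \<le> s" "s \<le> h"
    have "x + h *\<^sub>R w + s *\<^sub>R v \<in> S" "x + s *\<^sub>R v \<in> S"
      using in_ball[OF s, of h] in_ball[OF s, of 0] h ball by (auto simp: algebra_simps)
    then show "((\<lambda>s. f (x + h *\<^sub>R w + s *\<^sub>R v) - f (x + s *\<^sub>R v)) has_real_derivative
        dirderiv f (x + h *\<^sub>R w + s *\<^sub>R v) v - dirderiv f (x + s *\<^sub>R v) v) (at s)"
      by (intro DERIV_diff has_derivative_line f)
  qed
  then obtain s where s: "0 < s" "s < h" "f (x + h *\<^sub>R v + h *\<^sub>R w) - f (x + h *\<^sub>R v) - f (x + h *\<^sub>R w) + f x =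
    h * (dirderiv f (x + s *\<^sub>R v + h *\<^sub>R w) v - dirderiv f (x + s *\<^sub>R v + 0 *\<^sub>R w) v)"
    by (auto simp: algebra_simps)
  have "\<exists>t>0. t < h \<and> dirderiv f (x + s *\<^sub>R v + h *\<^sub>R w) v - dirderiv f (x + s *\<^sub>R v + 0 *\<^sub>R w) v =
    (h - 0) * dirderiv (\<lambda>y. dirderiv f y v) (x + s *\<^sub>R v + t *\<^sub>R w) w"
  proof (rule MVT2[OF h])
    fix t assume t: "0 \<le> t" "t \<le> h"
    have "x + s *\<^sub>R v + t *\<^sub>R w \<in> S"
      using in_ball[OF _ _ t, of s] s ball by auto
    then show "((\<lambda>t. dirderiv f (x + s *\<^sub>R v + t *\<^sub>R w) v) has_real_derivative
        dirderiv (\<lambda>y. dirderiv f y v) (x + s *\<^sub>R v + t *\<^sub>R w) w) (at t)"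
      by (intro has_derivative_line f)
  qed
  then obtain t where t: "0 < t" "t < h" "dirderiv f (x + s *\<^sub>R v + h *\<^sub>R w) v - dirderiv f (x + s *\<^sub>R v + 0 *\<^sub>R w) v =
    h * dirderiv (\<lambda>y. dirderiv f y v) (x + s *\<^sub>R v + t *\<^sub>R w) w" by auto
  then show ?thesis
    using s in_ball[of s t] by (intro bexI[of _ "x + s *\<^sub>R v + t *\<^sub>R w"]) (simp_all add: mult.assoc)
qed

lemma Ck_on_2D:
  assumes "Ck_on 2 f S"
  shows "\<And>x. x \<in> S \<Longrightarrow> f differentiable (at x)" "\<And>x v. x \<in> S \<Longrightarrow> (\<lambda>y. dirderiv f y v) differentiable (at x)"
    "\<And>v w. continuous_on S (\<lambda>y. dirderiv (\<lambda>y. dirderiv f y v) y w)"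
  using assms by (auto simp: numeral_2_eq_2)

text \<open>
  The second difference does not depend on the order of \<open>v\<close> and \<open>w\<close>. By the mean value theorem it is
  \<open>h\<^sup>2\<close> times either mixed derivative at nearby points, and these converge to the values at \<open>x\<close>.
\<close>

lemma second_derivative_symmetric:
  fixes f :: "'b::real_normed_vector \<Rightarrow> real"
  assumes S: "open S" "x \<in> S" and f: "Ck_on 2 f S"
  shows "dirderiv (\<lambda>y. dirderiv f y v) x w = dirderiv (\<lambda>y. dirderiv f y w) x v" (is "?a x = ?b x")
proof (rule ccontr)
  assume ne: "?a x \<noteq> ?b x"
  define e where "e = \<bar>?a x - ?b x\<bar> / 2"
  have e: "e > 0" using ne by (simp add: e_def)
  have ca: "continuous_on S ?a" and cb: "continuous_on S ?b"
    by (rule Ck_on_2D(3)[OF f])+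
  have "isCont ?a x" and "isCont ?b x"
    using continuous_on_interior[OF ca] continuous_on_interior[OF cb] S by (simp_all add: interior_open)
  then obtain d1 d2 where d: "d1 > 0" "\<And>y. dist y x < d1 \<Longrightarrow> dist (?a y) (?a x) < e"
    "d2 > 0" "\<And>y. dist y x < d2 \<Longrightarrow> dist (?b y) (?b x) < e"
    using continuous_at_eps_delta[of x ?a] continuous_at_eps_delta[of x ?b] e by metis
  obtain r where r: "r > 0" "cball x r \<subseteq> S" using S open_contains_cball by blast
  define N where "N = norm v + norm w + 1"
  have N: "N > 0" by (simp add: N_def add_nonneg_pos)
  define \<delta> where "\<delta> = min r (min d1 d2)"
  have \<delta>: "\<delta> > 0" using r d by (simp add: \<delta>_def)
  define h where "h = \<delta> / (2 * N)"
  have h: "h > 0" using \<delta> N by (simp add: h_def)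
  have "h * (norm v + norm w) \<le> h * N" using h by (simp add: N_def)
  also have "h * N < \<delta>" using N \<delta> by (simp add: h_def)
  finally have small: "h * (norm v + norm w) < min r (min d1 d2)" by (simp add: \<delta>_def)
  then have ball: "cball x (h * (norm v + norm w)) \<subseteq> S" "cball x (h * (norm w + norm v)) \<subseteq> S"
    using r(2) by (auto simp: add.commute)
  obtain y where y: "y \<in> cball x (h * (norm v + norm w))"
    "f (x + h *\<^sub>R v + h *\<^sub>R w) - f (x + h *\<^sub>R v) - f (x + h *\<^sub>R w) + f x = h * h * ?a y"
    using second_difference[OF h ball(1) Ck_on_2D(1,2)[OF f]] by blast
  obtain z where z: "z \<in> cball x (h * (norm w + norm v))"
    "f (x + h *\<^sub>R w + h *\<^sub>R v) - f (x + h *\<^sub>R w) - f (x + h *\<^sub>R v) + f x = h * h * ?b z"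
    using second_difference[OF h ball(2) Ck_on_2D(1,2)[OF f]] by blast
  have "h * h * ?a y = h * h * ?b z"
    unfolding y(2)[symmetric] z(2)[symmetric] by (simp add: algebra_simps)
  then have "?a y = ?b z" using h by simp
  moreover have "dist (?a y) (?a x) < e" "dist (?b z) (?b x) < e"
    using d(2)[of y] d(4)[of z] y(1) z(1) small by (auto simp: dist_commute add.commute)
  ultimately show False by (simp add: e_def dist_real_def field_simps abs_if split: if_splits)
qed

subsection \<open>Smoothness of the Poisson bivector\<close>

text \<open>
  A product is differentiable at a zero of a differentiable factor even if the other factor is only
  continuous. This is what makes the inverse matrix differentiable: its increments contain the inverse
  matrix, known to be continuous, times the increments of the matrix.
\<close>

lemma has_derivative_mult_vanishing:
  fixes F G :: "'b::real_normed_vector \<Rightarrow> real"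
  assumes F: "isCont F x" and G: "(G has_derivative G') (at x)" "G x = 0"
  shows "((\<lambda>y. F y * G y) has_derivative (\<lambda>v. F x * G' v)) (at x)"
proof -
  have bl: "bounded_linear G'" using G(1) by (rule has_derivative_bounded_linear)
  then obtain K where K: "K > 0" "\<And>v. norm (G' v) \<le> norm v * K" using bounded_linear.pos_bounded by blast
  obtain d0 where d0: "d0 > 0" "\<And>y. norm (y - x) < d0 \<Longrightarrow> norm (G y - G x - G' (y - x)) \<le> 1 * norm (y - x)"
    using G(1) unfolding has_derivative_at_alt by (metis zero_less_one)
  have G_bound: "\<bar>G y\<bar> \<le> (K + 1) * norm (y - x)" if "norm (y - x) < d0" for y
    using d0(2)[OF that] K(2)[of "y - x"] G(2) by (simp add: algebra_simps abs_le_iff)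
  have "((\<lambda>y. (F y - F x) * G y) has_derivative (\<lambda>v. 0)) (at x)"
    unfolding has_derivative_at_alt
  proof (intro conjI allI impI)
    fix e :: real assume e: "e > 0"
    have "e / (K + 1) > 0" using e K by simp
    then obtain d where d: "d > 0" "\<And>y. dist y x < d \<Longrightarrow> dist (F y) (F x) < e / (K + 1)"
      using F continuous_at_eps_delta[of x F] by metis
    show "\<exists>d>0. \<forall>y. norm (y - x) < d \<longrightarrow> norm ((F y - F x) * G y - (F x - F x) * G x - 0) \<le> e * norm (y - x)"
    proof (intro exI[of _ "min d d0"] conjI allI impI)
      fix y assume y: "norm (y - x) < min d d0"
      have "\<bar>F y - F x\<bar> * \<bar>G y\<bar> \<le> (e / (K + 1)) * ((K + 1) * norm (y - x))"
        using d(2)[of y] G_bound[of y] y K e by (intro mult_mono) (auto simp: dist_norm)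
      then show "norm ((F y - F x) * G y - (F x - F x) * G x - 0) \<le> e * norm (y - x)"
        using K by (simp add: abs_mult)
    qed (use d d0 in auto)
  qed simp
  from has_derivative_add[OF this has_derivative_mult_right[OF G(1), of "F x"]]
  show ?thesis by (simp add: algebra_simps)
qed

text \<open>
  Symplectic forms that depend smoothly on a point of an open set.
\<close>

locale symplectic_field =
  fixes W :: "'b::euclidean_space \<Rightarrow> 'b list \<Rightarrow> real" and S :: "'b set" and n :: nat
  assumes open_S: "open S" and symplectic: "\<And>x. x \<in> S \<Longrightarrow> symplectic_vector (W x) n"
    and smooth_W: "\<And>v. smooth_on (\<lambda>x. W x v) S"
begin

text \<open>
  The resolvent identity \<open>Y\<^bsup>-1\<^esup> - X\<^bsup>-1\<^esup> = X\<^bsup>-1\<^esup> (X - Y) Y\<^bsup>-1\<^esup>\<close> for the matrices of the two forms. It yields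
  continuity, differentiability and a formula for the derivative without recourse to determinants.
\<close>

lemma poisson_difference:
  assumes x: "x \<in> S" and y: "y \<in> S"
  shows "poisson_bivector (W y) i j = poisson_bivector (W x) i j +
    (\<Sum>a\<in>Basis. \<Sum>b\<in>Basis. poisson_bivector (W x) j a * (poisson_bivector (W y) i b * (W x [a, b] - W y [a, b])))"
proof -
  interpret x: symplectic_vector "W x" n using symplectic[OF x] .
  interpret y: symplectic_vector "W y" n using symplectic[OF y] .
  have expand: "(\<Sum>a\<in>Basis. \<Sum>b\<in>Basis. (u \<bullet> a) * ((v \<bullet> b) * w [a, b])) = w [u, v]"
    if "linear (\<lambda>z. w [z, v])" "\<And>z. linear (\<lambda>v. w [z, v])" for w :: "'b list \<Rightarrow> real" and u v
    using linear_expand[OF that(1), of u] linear_expand[OF that(2), of _ v]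
    by (simp add: sum_distrib_left mult.assoc)
  have "(\<Sum>a\<in>Basis. \<Sum>b\<in>Basis. (x.sharp j \<bullet> a) * ((y.sharp i \<bullet> b) * (W x [a, b] - W y [a, b]))) =
      W x [x.sharp j, y.sharp i] - W y [x.sharp j, y.sharp i]"
    unfolding right_diff_distrib sum_subtractf
    by (simp add: expand x.w_linear y.w_linear)
  also have "\<dots> = y.sharp i \<bullet> j + i \<bullet> x.sharp j"
    using y.w_swap[of "x.sharp j" "y.sharp i"] by (simp add: x.w_sharp y.w_sharp inner_commute)
  also have "i \<bullet> x.sharp j = - (x.sharp i \<bullet> j)"
    using x.poisson_skew[of i j] by (simp add: x.poisson_sharp inner_commute)
  finally show ?thesis by (simp add: x.poisson_sharp y.poisson_sharp)
qed

text \<open>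
  With \<open>M y\<close> the sum of the absolute values of the entries of the inverse matrix at \<open>y\<close>, and \<open>E y\<close> that
  of the increments of the matrix, the identity bounds the increment of each entry by \<open>M x M y E y\<close>. As
  \<open>E\<close> tends to zero, \<open>M y \<le> 2 M x\<close> near \<open>x\<close>, and then the increments tend to zero.
\<close>

lemma poisson_continuous:
  assumes x: "x \<in> S" and ij: "i \<in> Basis" "j \<in> Basis"
  shows "isCont (\<lambda>y. poisson_bivector (W y) i j) x"
proof -
  define p where "p y = poisson_bivector (W y)" for y
  define M where "M y = (\<Sum>i\<in>Basis. \<Sum>j\<in>Basis. \<bar>p y i j\<bar>)" for y
  define E where "E y = (\<Sum>a\<in>Basis. \<Sum>b\<in>Basis. \<bar>W x [a, b] - W y [a, b]\<bar>)" for y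
  have p_M: "\<bar>p y i j\<bar> \<le> M y" if "i \<in> Basis" "j \<in> Basis" for y and i j :: 'b
  proof -
    have "\<bar>p y i j\<bar> \<le> (\<Sum>j\<in>Basis. \<bar>p y i j\<bar>)" using that by (intro member_le_sum) auto
    also have "\<dots> \<le> M y" unfolding M_def using that by (intro member_le_sum[of i]) (auto intro: sum_nonneg)
    finally show ?thesis .
  qed
  have M0: "M y \<ge> 0" for y by (auto simp: M_def intro!: sum_nonneg)
  have E0: "E y \<ge> 0" for y by (auto simp: E_def intro!: sum_nonneg)
  have diff: "\<bar>p y i j - p x i j\<bar> \<le> M x * M y * E y" if y: "y \<in> S" and ij: "i \<in> Basis" "j \<in> Basis" for y i j
  proof -
    have "\<bar>p y i j - p x i j\<bar> = \<bar>\<Sum>a\<in>Basis. \<Sum>b\<in>Basis. p x j a * (p y i b * (W x [a, b] - W y [a, b]))\<bar>"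
      using poisson_difference[OF x y, of i j] by (simp add: p_def)
    also have "\<dots> \<le> (\<Sum>a\<in>Basis. \<Sum>b\<in>Basis. M x * (M y * \<bar>W x [a, b] - W y [a, b]\<bar>))"
      by (intro order_trans[OF sum_abs] sum_mono)
        (auto simp: abs_mult intro!: mult_mono p_M ij M0 mult_nonneg_nonneg)
    also have "\<dots> = M x * M y * E y"
      by (simp add: E_def sum_distrib_left mult.assoc)
    finally show ?thesis .
  qed
  have "isCont E x"
    unfolding E_def using smooth_on_differentiable[OF smooth_W x]
    by (intro continuous_intros) (auto dest: differentiable_imp_continuous_within)
  then have E_lim: "(E \<longlongrightarrow> 0) (at x)" by (simp add: isCont_def E_def)
  define K where "K = real DIM('b) * real DIM('b) * M x"
  have K0: "K \<ge> 0" using M0 by (simp add: K_def)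
  have "((\<lambda>y. K * E y) \<longlongrightarrow> 0) (at x)" using tendsto_mult_right_zero[OF E_lim, of K] by simp
  then have ev1: "\<forall>\<^sub>F y in at x. K * E y < 1/2" by (rule order_tendstoD(2)) simp
  have ev2: "\<forall>\<^sub>F y in at x. y \<in> S" using open_S x eventually_at_topological by blast
  have bound: "\<forall>\<^sub>F y in at x. norm (p y i j - p x i j) \<le> 2 * M x * M x * E y"
    using ev1 ev2
  proof eventually_elim
    case (elim y)
    have "M y - M x = (\<Sum>i\<in>Basis. \<Sum>j\<in>Basis. \<bar>p y i j\<bar> - \<bar>p x i j\<bar>)"
      by (simp add: M_def sum_subtractf)
    also have "\<dots> \<le> (\<Sum>i\<in>(Basis::'b set). \<Sum>j\<in>(Basis::'b set). M x * M y * E y)"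
    proof (intro sum_mono)
      fix i j :: 'b assume "i \<in> Basis" "j \<in> Basis"
      from diff[OF elim(2) this] show "\<bar>p y i j\<bar> - \<bar>p x i j\<bar> \<le> M x * M y * E y" by linarith
    qed
    also have "\<dots> = M y * (K * E y)" by (simp add: K_def algebra_simps)
    also have "\<dots> \<le> M y * (1/2)" using elim(1) M0 by (intro mult_left_mono) auto
    finally have "M y \<le> 2 * M x" by simp
    then have "M x * M y * E y \<le> M x * (2 * M x) * E y"
      using M0 E0 by (intro mult_right_mono mult_left_mono) auto
    then show ?case using diff[OF elim(2) ij] by (simp add: mult.commute mult.left_commute)
  qed
  have "((\<lambda>y. p y i j - p x i j) \<longlongrightarrow> 0) (at x)"
    using bound tendsto_mult_right_zero[OF E_lim, of "2 * M x * M x"] by (rule Lim_null_comparison)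
  then show ?thesis unfolding isCont_def p_def by (rule LIM_zero_cancel)
qed

lemma poisson_has_derivative:
  assumes x: "x \<in> S" and ij: "i \<in> Basis" "j \<in> Basis"
  shows "((\<lambda>y. poisson_bivector (W y) i j) has_derivative (\<lambda>v. \<Sum>a\<in>Basis. \<Sum>b\<in>Basis.
    poisson_bivector (W x) j a * (poisson_bivector (W x) i b * (- dirderiv (\<lambda>y. W y [a, b]) x v)))) (at x)"
proof (rule has_derivative_cong_open[OF open_S x])
  show "((\<lambda>y. poisson_bivector (W x) i j + (\<Sum>a\<in>Basis. \<Sum>b\<in>Basis.
      poisson_bivector (W x) j a * (poisson_bivector (W y) i b * (W x [a, b] - W y [a, b]))))
    has_derivative (\<lambda>v. \<Sum>a\<in>Basis. \<Sum>b\<in>Basis.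
    poisson_bivector (W x) j a * (poisson_bivector (W x) i b * (- dirderiv (\<lambda>y. W y [a, b]) x v)))) (at x)"
  proof (rule has_derivative_eq_rhs[OF has_derivative_add[OF has_derivative_const has_derivative_sum[OF has_derivative_sum[OF
          has_derivative_mult_right[OF has_derivative_mult_vanishing]]]]])
    fix a b :: 'b assume "b \<in> Basis"
    then show "isCont (\<lambda>y. poisson_bivector (W y) i b) x" by (intro poisson_continuous x ij)
    have "((\<lambda>y. W y [a, b]) has_derivative dirderiv (\<lambda>y. W y [a, b]) x) (at x)"
      using smooth_on_differentiable[OF smooth_W x] by (simp add: frechet_derivative_works)
    from has_derivative_diff[OF has_derivative_const this]
    show "((\<lambda>y. W x [a, b] - W y [a, b]) has_derivative (\<lambda>v. - dirderiv (\<lambda>y. W y [a, b]) x v)) (at x)" by simp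
  qed auto
qed (rule poisson_difference[symmetric, OF x])

text \<open>
  The derivative of the inverse matrix is a polynomial in the inverse matrix and the derivatives of the
  matrix, which allows an induction on the order of differentiability.
\<close>

lemma smooth_poisson:
  assumes "i \<in> Basis" "j \<in> Basis" shows "smooth_on (\<lambda>x. poisson_bivector (W x) i j) S"
proof -
  have "Ck_on k (\<lambda>x. poisson_bivector (W x) i j) S" if "i \<in> Basis" "j \<in> Basis" for k i j
    using that
  proof (induction k arbitrary: i j)
    case 0
    then show ?case using poisson_continuous by (simp add: continuous_at_imp_continuous_on)
  next
    case (Suc k)
    have "Ck_on k (\<lambda>x. dirderiv (\<lambda>x. poisson_bivector (W x) i j) x v) S" for v
    proof (rule Ck_on_cong[OF open_S])
      have "Ck_on k (\<lambda>x. - 1 * dirderiv (\<lambda>y. W y [a, b]) x v) S" for a b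
        using smooth_on_dirderiv[OF smooth_W, of "[a, b]" v]
        by (intro Ck_on_mult open_S Ck_on_const) (simp add: smooth_on_def)
      then show "Ck_on k (\<lambda>x. \<Sum>a\<in>Basis. \<Sum>b\<in>Basis.
        poisson_bivector (W x) j a * (poisson_bivector (W x) i b * (- dirderiv (\<lambda>y. W y [a, b]) x v))) S"
        using Suc by (intro Ck_on_sum Ck_on_mult open_S) auto
    qed (use dirderiv_eqI[OF poisson_has_derivative] Suc.prems in simp)
    then show ?case using Derivative.differentiableI[OF poisson_has_derivative[OF _ Suc.prems]] by simp
  qed
  then show ?thesis using assms by (simp add: smooth_on_def)
qed

end

section \<open>The exterior derivative in a chart\<close>

type_synonym 'b local_form = "'b \<Rightarrow> 'b list \<Rightarrow> real"

definition local_d :: "'b::euclidean_space local_form \<Rightarrow> 'b local_form" where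
  "local_d F x v = (\<Sum>i<length v. (-1) ^ i * dirderiv (\<lambda>y. F y (nths v (- {i}))) x (v ! i))"

definition form_deriv :: "'b::euclidean_space \<Rightarrow> 'b local_form \<Rightarrow> 'b local_form" where
  "form_deriv v F x = (\<lambda>ws. dirderiv (\<lambda>y. F y ws) x v)"

text \<open>
  An alternating form is smooth if its coefficients are, and then so are its values on all fixed lists
  of vectors.
\<close>

definition smooth_field :: "'b::euclidean_space set \<Rightarrow> 'b local_form \<Rightarrow> bool" where
  "smooth_field U F \<longleftrightarrow> open U \<and> (\<forall>v. smooth_on (\<lambda>x. F x v) U)"

lemma nths_delete_Cons: "nths (v # vs) (- {0}) = vs" "nths (v # vs) (- {Suc i}) = v # nths vs (- {i})"
proof -
  have "{j. Suc j \<in> - {0}} = UNIV" "{j. Suc j \<in> - {Suc i}} = - {i}" by auto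
  then show "nths (v # vs) (- {0}) = vs" "nths (v # vs) (- {Suc i}) = v # nths vs (- {i})"
    by (simp_all add: nths_Cons nths_all)
qed

lemma local_d_Nil: "local_d F x [] = 0"
  by (simp add: local_d_def)

text \<open>
  Cartan's formula \<open>\<iota>\<^sub>v d = D\<^sub>v - d \<iota>\<^sub>v\<close> for the constant vector field \<open>v\<close>. The inductions
  below use it in place of the defining sum.
\<close>

lemma ins_local_d: "ins v (local_d F x) = form_deriv v F x - local_d (\<lambda>y. ins v (F y)) x"
proof
  fix vs
  show "ins v (local_d F x) vs = (form_deriv v F x - local_d (\<lambda>y. ins v (F y)) x) vs"
    by (simp add: ins_def local_d_def form_deriv_def sum.lessThan_Suc_shift nths_delete_Cons sum_negf del: sum.lessThan_Suc)
qed

lemma local_d_Cons: "local_d F x (v # vs) = form_deriv v F x vs - local_d (\<lambda>y. ins v (F y)) x vs"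
  using fun_cong[OF ins_local_d, of v F x vs] by (simp add: ins_def)

lemma local_d_cong:
  assumes "open U" "x \<in> U" "\<And>y. y \<in> U \<Longrightarrow> F y = G y" shows "local_d F x = local_d G x"
  unfolding local_d_def by (intro ext) (simp add: dirderiv_cong_open[OF assms(1,2), of "\<lambda>y. F y ws" "\<lambda>y. G y ws" for ws] assms(3))

lemma local_d_zero: "local_d (\<lambda>y. 0) x = 0"
  by (rule ext) (simp add: local_d_def)

subsection \<open>Smooth fields\<close>

lemma form_deriv_eqI: "((\<lambda>y. F y v) has_derivative f') (at x) \<Longrightarrow> form_deriv u F x v = f' u"
  unfolding form_deriv_def by (rule dirderiv_eqI)

lemma local_d_form_deriv: "local_d F x v = (\<Sum>i<length v. (-1) ^ i * form_deriv (v ! i) F x (nths v (- {i})))"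
  by (simp add: local_d_def form_deriv_def)

context
  fixes U :: "'b::euclidean_space set" and x :: 'b
  assumes x: "x \<in> U"
begin

lemma smooth_field_has_derivative:
  assumes "smooth_field U F"
  shows "((\<lambda>y. F y v) has_derivative (\<lambda>u. form_deriv u F x v)) (at x)"
  using smooth_on_differentiable[of "\<lambda>y. F y v" U x] assms x
  by (simp add: smooth_field_def form_deriv_def frechet_derivative_works)

lemma form_deriv_linear: "smooth_field U F \<Longrightarrow> linear (\<lambda>u. form_deriv u F x v)"
  using smooth_field_has_derivative has_derivative_linear by blast

lemma form_deriv_add: "smooth_field U F \<Longrightarrow> smooth_field U G \<Longrightarrow>
  form_deriv u (\<lambda>y. F y + G y) x = form_deriv u F x + form_deriv u G x"
  using form_deriv_eqI[of "\<lambda>y. F y + G y" v "\<lambda>u. form_deriv u F x v + form_deriv u G x v" x u for v]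
    has_derivative_add[OF smooth_field_has_derivative smooth_field_has_derivative, of F G v v for v]
  by (intro ext) auto

lemma form_deriv_scale: "smooth_field U F \<Longrightarrow> form_deriv u (\<lambda>y. r *\<^sub>R F y) x = r *\<^sub>R form_deriv u F x"
proof
  fix v assume "smooth_field U F"
  then have "((\<lambda>y. (r *\<^sub>R F y) v) has_derivative (\<lambda>u. r * form_deriv u F x v)) (at x)"
    unfolding scaleR_fun_def real_scaleR_def by (intro has_derivative_mult_right smooth_field_has_derivative)
  from form_deriv_eqI[of "\<lambda>y. r *\<^sub>R F y", OF this]
  show "form_deriv u (\<lambda>y. r *\<^sub>R F y) x v = (r *\<^sub>R form_deriv u F x) v" by (simp add: scaleR_fun_def)
qed

lemma local_d_add: "smooth_field U F \<Longrightarrow> smooth_field U G \<Longrightarrow>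
  local_d (\<lambda>y. F y + G y) x = local_d F x + local_d G x"
  by (rule ext) (simp add: local_d_form_deriv form_deriv_add algebra_simps sum.distrib)

lemma local_d_scale: "smooth_field U F \<Longrightarrow> local_d (\<lambda>y. r *\<^sub>R F y) x = r *\<^sub>R local_d F x"
  by (rule ext) (simp add: local_d_form_deriv form_deriv_scale algebra_simps sum_distrib_left)

lemma form_deriv_wedge:
  assumes "smooth_field U F" "smooth_field U G"
  shows "form_deriv u (\<lambda>y. alt_wedge (F y) (G y)) x = alt_wedge (form_deriv u F x) (G x) + alt_wedge (F x) (form_deriv u G x)"
proof
  fix v
  have "((\<lambda>y. alt_wedge (F y) (G y) v) has_derivative (\<lambda>u. alt_wedge (form_deriv u F x) (G x) v + alt_wedge (F x) (form_deriv u G x) v)) (at x)"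
    unfolding alt_wedge_def sum.distrib[symmetric]
    by (rule derivative_eq_intros smooth_field_has_derivative assms refl | simp add: algebra_simps)+
  from form_deriv_eqI[of "\<lambda>y. alt_wedge (F y) (G y)", OF this]
  show "form_deriv u (\<lambda>y. alt_wedge (F y) (G y)) x v =
    (alt_wedge (form_deriv u F x) (G x) + alt_wedge (F x) (form_deriv u G x)) v" by simp
qed

lemma form_deriv_parity: "smooth_field U F \<Longrightarrow> form_deriv u (\<lambda>y. parity (F y)) x = parity (form_deriv u F x)"
proof
  fix v assume "smooth_field U F"
  then have "((\<lambda>y. parity (F y) v) has_derivative (\<lambda>u. (-1) ^ length v * form_deriv u F x v)) (at x)"
    unfolding parity_def by (intro has_derivative_mult_right smooth_field_has_derivative)
  from form_deriv_eqI[of "\<lambda>y. parity (F y)", OF this]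
  show "form_deriv u (\<lambda>y. parity (F y)) x v = parity (form_deriv u F x) v" by (simp add: parity_def)
qed

lemma local_d_parity: assumes "smooth_field U F" shows "local_d (\<lambda>y. parity (F y)) x = (-1) *\<^sub>R parity (local_d F x)"
proof
  fix v :: "'b list"
  have "length (nths v (- {i})) = length v - 1" if "i < length v" for i
  proof -
    have "{j. j < length v \<and> j \<in> - {i}} = {..<length v} - {i}" by auto
    then show ?thesis using that by (simp add: length_nths)
  qed
  moreover have "(-1) ^ (length v - 1) = - ((-1) ^ length v :: real)" if "i < length v" for i
    using that by (cases "length v") auto
  ultimately have "(-1) ^ i * parity (form_deriv (v ! i) F x) (nths v (- {i})) =
      - ((-1) ^ length v * ((-1) ^ i * form_deriv (v ! i) F x (nths v (- {i}))))" if "i < length v" for i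
    using that by (simp add: parity_def)
  then have "(\<Sum>i<length v. (-1) ^ i * parity (form_deriv (v ! i) F x) (nths v (- {i}))) =
      - (\<Sum>i<length v. (-1) ^ length v * ((-1) ^ i * form_deriv (v ! i) F x (nths v (- {i}))))"
    unfolding sum_negf[symmetric] by (intro sum.cong) auto
  then show "local_d (\<lambda>y. parity (F y)) x v = ((-1) *\<^sub>R parity (local_d F x)) v"
    unfolding local_d_form_deriv form_deriv_parity[OF assms]
    by (simp add: scaleR_fun_def parity_def local_d_form_deriv sum_distrib_left sum_negf)
qed

end

lemma smooth_field_open: "smooth_field U F \<Longrightarrow> open U"
  by (simp add: smooth_field_def)

lemma smooth_field_ins: "smooth_field U F \<Longrightarrow> smooth_field U (\<lambda>y. ins v (F y))"
  by (simp add: smooth_field_def ins_def)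

lemma smooth_field_form_deriv: "smooth_field U F \<Longrightarrow> smooth_field U (form_deriv v F)"
  by (simp add: smooth_field_def form_deriv_def smooth_on_dirderiv)

lemma smooth_field_add: "smooth_field U F \<Longrightarrow> smooth_field U G \<Longrightarrow> smooth_field U (\<lambda>y. F y + G y)"
  by (simp add: smooth_field_def smooth_on_add)

lemma smooth_field_scale: "smooth_field U F \<Longrightarrow> smooth_field U (\<lambda>y. r *\<^sub>R F y)"
  by (simp add: smooth_field_def scaleR_fun_def smooth_on_mult smooth_on_const)

lemma smooth_field_parity: "smooth_field U F \<Longrightarrow> smooth_field U (\<lambda>y. parity (F y))"
  by (simp add: smooth_field_def parity_def smooth_on_mult smooth_on_const)

lemma smooth_field_wedge: "smooth_field U F \<Longrightarrow> smooth_field U G \<Longrightarrow> smooth_field U (\<lambda>y. alt_wedge (F y) (G y))"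
  by (auto simp: smooth_field_def alt_wedge_def intro!: smooth_on_sum smooth_on_mult smooth_on_const)

lemma smooth_field_local_d: "smooth_field U F \<Longrightarrow> smooth_field U (local_d F)"
  by (auto simp: smooth_field_def local_d_def intro!: smooth_on_sum smooth_on_mult smooth_on_const smooth_on_dirderiv)

lemma smooth_field_cong: "smooth_field U F \<Longrightarrow> (\<And>y. y \<in> U \<Longrightarrow> F y = G y) \<Longrightarrow> smooth_field U G"
  using smooth_on_cong[of U "\<lambda>y. F y v" "\<lambda>y. G y v" for v] by (auto simp: smooth_field_def)

lemma alt_wedge_diff: "alt_wedge (f - f') g = alt_wedge f g - alt_wedge f' g" "alt_wedge f (g - g') = alt_wedge f g - alt_wedge f g'"
  by (rule linear_diff[OF alt_wedge_linear(1)], rule linear_diff[OF alt_wedge_linear(2)])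

text \<open>
  Both sides vanish on the empty list, and their contractions with \<open>v\<close> agree by Cartan's formula and
  the antiderivation rule, with the induction hypothesis applied to \<open>(\<iota>\<^sub>v F, G)\<close> and \<open>(\<plusminus>F, \<iota>\<^sub>v G)\<close>.
\<close>

lemma local_d_wedge:
  assumes "smooth_field U F" "smooth_field U G" and x: "x \<in> U"
  shows "local_d (\<lambda>y. alt_wedge (F y) (G y)) x = alt_wedge (local_d F x) (G x) + alt_wedge (parity (F x)) (local_d G x)"
proof
  fix vs show "local_d (\<lambda>y. alt_wedge (F y) (G y)) x vs = (alt_wedge (local_d F x) (G x) + alt_wedge (parity (F x)) (local_d G x)) vs"
    using assms(1,2)
  proof (induction vs arbitrary: F G)
    case Nil
    then show ?case by (simp add: local_d_Nil alt_wedge_Nil)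
  next
    case (Cons v vs)
    note F = Cons.prems(1) and G = Cons.prems(2)
    have "local_d (\<lambda>y. alt_wedge (F y) (G y)) x (v # vs) = form_deriv v (\<lambda>y. alt_wedge (F y) (G y)) x vs
      - (local_d (\<lambda>y. alt_wedge (ins v (F y)) (G y)) x vs + local_d (\<lambda>y. alt_wedge (parity (F y)) (ins v (G y))) x vs)"
      unfolding local_d_Cons ins_alt_wedge
      by (subst local_d_add[OF x]) (auto intro!: smooth_field_wedge smooth_field_ins smooth_field_parity F G)
    also have "\<dots> = (alt_wedge (local_d F x) (G x) + alt_wedge (parity (F x)) (local_d G x)) (v # vs)"
      using Cons.IH[OF smooth_field_ins[OF F, of v] G] Cons.IH[OF smooth_field_parity[OF F] smooth_field_ins[OF G, of v]]
      by (simp add: form_deriv_wedge[OF x F G] local_d_parity[OF x F] alt_wedge_Cons ins_local_d alt_wedge_minus ins_parity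
          alt_wedge_add_left alt_wedge_add_right alt_wedge_scale_left alt_wedge_diff
          alt_wedge_minus[unfolded fun_Compl_def])
    finally show ?case .
  qed
qed

lemma form_deriv_commute:
  assumes F: "smooth_field U F" and x: "x \<in> U"
  shows "form_deriv u (form_deriv v F) x = form_deriv v (form_deriv u F) x"
  using second_derivative_symmetric[of U x "\<lambda>y. F y w" for w] F x
  by (simp add: form_deriv_def smooth_field_def smooth_on_def fun_eq_iff)

lemma form_deriv_local_d:
  assumes F: "smooth_field U F" and x: "x \<in> U"
  shows "form_deriv u (local_d F) x = local_d (form_deriv u F) x"
proof
  fix v
  have "((\<lambda>y. \<Sum>i<length v. (-1) ^ i * form_deriv (v ! i) F y (nths v (- {i}))) has_derivative
    (\<lambda>u. \<Sum>i<length v. (-1) ^ i * form_deriv u (form_deriv (v ! i) F) x (nths v (- {i})))) (at x)"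
    by (intro has_derivative_sum has_derivative_mult_right smooth_field_has_derivative[OF x] smooth_field_form_deriv F)
  then have "((\<lambda>y. local_d F y v) has_derivative
    (\<lambda>u. \<Sum>i<length v. (-1) ^ i * form_deriv u (form_deriv (v ! i) F) x (nths v (- {i})))) (at x)"
    unfolding local_d_form_deriv .
  then have "form_deriv u (local_d F) x v = (\<Sum>i<length v. (-1) ^ i * form_deriv u (form_deriv (v ! i) F) x (nths v (- {i})))"
    by (rule form_deriv_eqI)
  then show "form_deriv u (local_d F) x v = local_d (form_deriv u F) x v"
    by (simp add: local_d_form_deriv form_deriv_commute[OF F x, of u])
qed

text \<open>
  By Cartan's formula \<open>\<iota>\<^sub>v d d F = D\<^sub>v d F - d D\<^sub>v F + d d \<iota>\<^sub>v F\<close>. The last term vanishes by induction, and \<open>d\<close>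
  commutes with \<open>D\<^sub>v\<close> as second derivatives are symmetric.
\<close>

lemma local_d_local_d:
  assumes F: "smooth_field U F" and x: "x \<in> U" shows "local_d (local_d F) x = 0"
proof
  fix vs show "local_d (local_d F) x vs = 0 vs"
    using F
  proof (induction vs arbitrary: F)
    case Nil
    then show ?case by (simp add: local_d_Nil)
  next
    case (Cons v vs)
    note F = Cons.prems
    have "local_d (\<lambda>y. ins v (local_d F y)) x = local_d (\<lambda>y. form_deriv v F y + (-1) *\<^sub>R local_d (\<lambda>y. ins v (F y)) y) x"
      by (simp add: ins_local_d)
    also have "\<dots> = local_d (form_deriv v F) x + (-1) *\<^sub>R local_d (local_d (\<lambda>y. ins v (F y))) x"
      by (simp only: local_d_add[OF x smooth_field_form_deriv[OF F] smooth_field_scale[OF smooth_field_local_d[OF smooth_field_ins[OF F]]]]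
          local_d_scale[OF x smooth_field_local_d[OF smooth_field_ins[OF F]]])
    finally show ?case
      using Cons.IH[OF smooth_field_ins[OF F, of v]] by (simp add: local_d_Cons form_deriv_local_d[OF F x])
  qed
qed

subsection \<open>Alternation\<close>

lemma form_deriv_alternating:
  assumes F: "smooth_field U F" and x: "x \<in> U" and alt: "\<And>y. y \<in> U \<Longrightarrow> alternating_form k (F y)"
  shows "alternating_form k (form_deriv u F x)"
proof -
  have U: "open U" using F by (rule smooth_field_open)
  have zero: "form_deriv u F x v = 0" if "\<And>y. y \<in> U \<Longrightarrow> F y v = 0" for v
    unfolding form_deriv_def using dirderiv_cong_open[OF U x, of "\<lambda>y. F y v" "\<lambda>y. 0"] that by simp
  show ?thesis
    unfolding alternating_form_def
  proof (intro conjI allI impI)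
    fix v :: "'a list" and i assume i: "i < length v"
    have add: "F y (v[i := a + b]) = F y (v[i := a]) + F y (v[i := b])" and scale: "F y (v[i := r *\<^sub>R a]) = r * F y (v[i := a])" 
      if "y \<in> U" for y a b r
      using alternating_form_linear[OF alt[OF that] i] by (simp_all add: linear_iff)
    show "linear (\<lambda>w. form_deriv u F x (v[i := w]))"
    proof (rule linearI)
      fix a b
      have "((\<lambda>y. F y (v[i := a + b])) has_derivative (\<lambda>u. form_deriv u F x (v[i := a]) + form_deriv u F x (v[i := b]))) (at x)"
        by (rule has_derivative_cong_open[OF U x _ has_derivative_add[OF smooth_field_has_derivative[OF x F, of "v[i := a]"]
                smooth_field_has_derivative[OF x F, of "v[i := b]"]]]) (simp add: add)
      from form_deriv_eqI[of F "v[i := a + b]", OF this]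
      show "form_deriv u F x (v[i := a + b]) = form_deriv u F x (v[i := a]) + form_deriv u F x (v[i := b])" .
    next
      fix r a
      have "((\<lambda>y. F y (v[i := r *\<^sub>R a])) has_derivative (\<lambda>u. r * form_deriv u F x (v[i := a]))) (at x)"
        by (rule has_derivative_cong_open[OF U x _ has_derivative_mult_right[OF smooth_field_has_derivative[OF x F, of "v[i := a]"]]])
          (simp add: scale)
      from form_deriv_eqI[of F "v[i := r *\<^sub>R a]", OF this]
      show "form_deriv u F x (v[i := r *\<^sub>R a]) = r *\<^sub>R form_deriv u F x (v[i := a])" by simp
    qed
  qed (use zero alt alternating_form_length alternating_form_distinct in blast)+
qed

text \<open>
  Induction on the degree with the criterion for alternating forms; the contractions are given by
  Cartan's formula.
\<close>

lemma local_d_alternating: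
  assumes "smooth_field U F" and x: "x \<in> U" and "\<And>y. y \<in> U \<Longrightarrow> alternating_form k (F y)"
  shows "alternating_form (k + 1) (local_d F x)"
  using assms(1,3)
proof (induction "nat (k + 1)" arbitrary: k F rule: less_induct)
  case less
  note F = less.prems(1) and alt = less.prems(2)
  have U: "open U" using F by (rule smooth_field_open)
  show ?case
  proof (cases "k < 0")
    case True
    then have "local_d F x = local_d (\<lambda>y. 0) x"
      using alternating_form_negative alt by (intro local_d_cong[OF U x]) blast
    then show ?thesis by (simp add: local_d_zero alternating_form_closed)
  next
    case False
    have ins_lin: "ins (a + b) (F y) = ins a (F y) + ins b (F y)" "ins (r *\<^sub>R a) (F y) = r *\<^sub>R ins a (F y)" if "y \<in> U" for a b r y
      using linear_add[OF ins_linear[OF alt[OF that]], of a b] linear_scale[OF ins_linear[OF alt[OF that]], of r a] by simp_all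
    have insF: "smooth_field U (\<lambda>y. ins a (F y))" for a by (rule smooth_field_ins[OF F])
    show ?thesis
    proof (rule alternating_formI)
      fix v
      have "alternating_form (k - 1 + 1) (local_d (\<lambda>y. ins v (F y)) x)"
        using False by (intro less.hyps insF alternating_form_ins alt) auto
      then have "alternating_form k (local_d (\<lambda>y. ins v (F y)) x)" by simp
      from alternating_form_closed(2)[OF form_deriv_alternating[OF F x alt] alternating_form_closed(3)[OF this, of "-1"]]
      show "alternating_form (k + 1 - 1) (ins v (local_d F x))" by (simp add: ins_local_d)
    next
      show "local_d F x [] = 0" by (rule local_d_Nil)
    next
      fix ws
      have "linear (\<lambda>v. local_d (\<lambda>y. ins v (F y)) x ws)"
      proof (rule linearI)
        fix a b
        have "local_d (\<lambda>y. ins (a + b) (F y)) x = local_d (\<lambda>y. ins a (F y) + ins b (F y)) x"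
          by (rule local_d_cong[OF U x]) (rule ins_lin)
        then show "local_d (\<lambda>y. ins (a + b) (F y)) x ws = local_d (\<lambda>y. ins a (F y)) x ws + local_d (\<lambda>y. ins b (F y)) x ws"
          by (simp add: local_d_add[OF x insF insF])
      next
        fix r a
        have "local_d (\<lambda>y. ins (r *\<^sub>R a) (F y)) x = local_d (\<lambda>y. r *\<^sub>R ins a (F y)) x"
          by (rule local_d_cong[OF U x]) (rule ins_lin)
        then show "local_d (\<lambda>y. ins (r *\<^sub>R a) (F y)) x ws = r *\<^sub>R local_d (\<lambda>y. ins a (F y)) x ws"
          by (simp add: local_d_scale[OF x insF])
      qed
      then show "linear (\<lambda>v. local_d F x (v # ws))"
        unfolding local_d_Cons by (intro linear_compose_sub form_deriv_linear[OF x F])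
    next
      fix v ws
      have "local_d (\<lambda>y. ins v (ins v (F y))) x = local_d (\<lambda>y. 0) x"
        by (rule local_d_cong[OF U x]) (rule alternating_form_ins_ins[OF alt])
      then show "local_d F x (v # v # ws) = 0"
        by (simp add: local_d_Cons local_d_zero) (simp add: form_deriv_def ins_def)
    qed
  qed
qed

subsection \<open>Naturality\<close>

text \<open>
  The expression \<open>\<Sum>\<^sub>i g(T w\<^sub>1, \<dots>, B w\<^sub>i, \<dots>, T w\<^sub>k)\<close>, that is, the derivative of the pullback of \<open>g\<close> along
  \<open>T\<close> when \<open>T\<close> varies in the direction \<open>B\<close>.
\<close>

primrec second_order :: "('b \<Rightarrow> 'b) \<Rightarrow> ('b \<Rightarrow> 'b) \<Rightarrow> ('b list \<Rightarrow> real) \<Rightarrow> 'b list \<Rightarrow> real" where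
  "second_order T B g [] = 0"
| "second_order T B g (w # ws) = g (B w # map T ws) + second_order T B (ins (T w) g) ws"

lemma second_order_linear: "linear (\<lambda>g. second_order T B g ws)"
proof (rule linearI)
  show "second_order T B (f + g) ws = second_order T B f ws + second_order T B g ws" for f g
    by (induction ws arbitrary: f g) (auto simp: ins_add)
  show "second_order T B (r *\<^sub>R g) ws = r *\<^sub>R second_order T B g ws" for r g
    by (induction ws arbitrary: g) (auto simp: ins_scale algebra_simps)
qed

lemma second_order_expand:
  assumes "alternating_form k g"
  shows "second_order T B g ws = (\<Sum>i<length ws. (-1) ^ i * g (B (ws ! i) # map T (nths ws (- {i}))))"
  using assms
proof (induction ws arbitrary: g k)
  case (Cons w ws)
  have swap: "ins (T w) g (B (ws ! i) # map T (nths ws (- {i}))) = - g (B (ws ! i) # T w # map T (nths ws (- {i})))" for i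
    unfolding ins_def by (rule alternating_form_swap[OF Cons.prems])
  show ?case
    unfolding second_order.simps Cons.IH[OF alternating_form_ins[OF Cons.prems]] swap
    by (simp add: sum.lessThan_Suc_shift nths_delete_Cons sum_negf del: sum.lessThan_Suc)
qed simp

text \<open>
  In the alternating sum each pair of arguments \<open>v\<^sub>i\<close>, \<open>v\<^sub>j\<close> contributes \<open>B v\<^sub>i v\<^sub>j\<close> and \<open>B v\<^sub>j v\<^sub>i\<close> with opposite
  signs.
\<close>

lemma sum_second_order_zero:
  assumes B: "\<And>v w. B v w = B w v" and "alternating_form k g"
  shows "(\<Sum>i<length vs. (-1) ^ i * second_order T (B (vs ! i)) g (nths vs (- {i}))) = 0"
  using assms(2)
proof (induction vs arbitrary: g k)
  case (Cons v vs)
  have "(\<Sum>i<length vs. (-1) ^ i * g (B (vs ! i) v # map T (nths vs (- {i})))) = second_order T (B v) g vs"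
    unfolding second_order_expand[OF Cons.prems] by (simp add: B[of _ v])
  then show ?case
    using Cons.IH[OF alternating_form_ins[OF Cons.prems, of "T v"]]
    by (simp add: sum.lessThan_Suc_shift nths_delete_Cons sum_negf sum_subtractf sum.distrib distrib_left del: sum.lessThan_Suc)
qed simp

lemma Ck_on_inner:
  fixes \<tau> :: "'b::euclidean_space \<Rightarrow> 'b"
  assumes "open U" shows "Ck_on k \<tau> U \<Longrightarrow> Ck_on k (\<lambda>x. \<tau> x \<bullet> b) U"
proof (induction k arbitrary: \<tau>)
  case 0
  then show ?case by (auto intro: continuous_on_inner continuous_on_const)
next
  case (Suc k)
  have d: "((\<lambda>x. \<tau> x \<bullet> b) has_derivative (\<lambda>v. dirderiv \<tau> x v \<bullet> b)) (at x)" if "x \<in> U" for x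
    using Suc.prems that by (intro has_derivative_inner_left) (simp add: frechet_derivative_works)
  have "Ck_on k (\<lambda>x. dirderiv (\<lambda>x. \<tau> x \<bullet> b) x v) U" for v
    by (rule Ck_on_cong[OF assms _ Suc.IH[of "\<lambda>x. dirderiv \<tau> x v"]]) (use Suc.prems dirderiv_eqI[OF d] in auto)
  then show ?case using d by (auto simp: differentiable_def)
qed

context
  fixes U W :: "'b::euclidean_space set" and \<tau> :: "'b \<Rightarrow> 'b" and x :: 'b
  assumes U: "open U" and \<tau>: "smooth_on \<tau> U" and \<tau>_W: "\<And>y. y \<in> U \<Longrightarrow> \<tau> y \<in> W" and x: "x \<in> U"
begin

private definition "T y = dirderiv \<tau> y"
private definition "B v w = dirderiv (\<lambda>y. T y w) x v"

private lemma \<tau>_derivative: "y \<in> U \<Longrightarrow> (\<tau> has_derivative T y) (at y)"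
  using smooth_on_differentiable[OF \<tau>] by (simp add: T_def frechet_derivative_works)

private lemma T_derivative: "((\<lambda>y. T y w) has_derivative (\<lambda>v. B v w)) (at x)"
  using smooth_on_differentiable[OF smooth_on_dirderiv[OF \<tau>, of w] x] by (simp add: B_def T_def frechet_derivative_works)

private lemma B_symmetric: "B v w = B w v"
proof (rule euclidean_eqI)
  fix b :: 'b
  have "B v w \<bullet> b = dirderiv (\<lambda>y. dirderiv (\<lambda>z. \<tau> z \<bullet> b) y w) x v" for v w
  proof -
    have 1: "((\<lambda>y. T y w \<bullet> b) has_derivative (\<lambda>v. B v w \<bullet> b)) (at x)"
      by (rule has_derivative_inner_left[OF T_derivative])
    have 2: "T y w \<bullet> b = dirderiv (\<lambda>z. \<tau> z \<bullet> b) y w" if "y \<in> U" for y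
      using dirderiv_eqI[OF has_derivative_inner_left[OF \<tau>_derivative[OF that], of b]] by simp
    have "((\<lambda>y. dirderiv (\<lambda>z. \<tau> z \<bullet> b) y w) has_derivative (\<lambda>v. B v w \<bullet> b)) (at x)"
      by (rule has_derivative_cong_open[OF U x 2 1])
    from dirderiv_eqI[OF this] show ?thesis by simp
  qed
  moreover have "Ck_on 2 (\<lambda>z. \<tau> z \<bullet> b) U" using Ck_on_inner[OF U] \<tau> by (simp add: smooth_on_def)
  ultimately show "B v w \<bullet> b = B w v \<bullet> b" using second_derivative_symmetric[OF U x] by simp
qed

text \<open>
  The chain rule for \<open>y \<mapsto> G(\<tau> y)(T y w\<^sub>1, \<dots>, T y w\<^sub>k)\<close>. Only the values of \<open>G\<close> on fixed vectors are known to
  be smooth, so the argument \<open>T y w\<^sub>1\<close>, which moves with \<open>y\<close>, is expanded in the basis before the induction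
  hypothesis is applied to the contractions.
\<close>

private lemma pullback_has_derivative:
  assumes "smooth_field W G" "\<And>y. y \<in> W \<Longrightarrow> alternating_form k (G y)"
  shows "((\<lambda>y. G (\<tau> y) (map (T y) ws)) has_derivative
    (\<lambda>v. form_deriv (T x v) G (\<tau> x) (map (T x) ws) + second_order (T x) (B v) (G (\<tau> x)) ws)) (at x)"
  using assms
proof (induction ws arbitrary: G k)
  case Nil
  show ?case
    using has_derivative_compose[OF \<tau>_derivative[OF x] smooth_field_has_derivative[OF \<tau>_W[OF x] Nil(1), of "[]"]] by simp
next
  case (Cons w ws)
  note G = Cons.prems(1) and alt = Cons.prems(2)
  let ?t = "\<tau> x" and ?ws = "map (T x) ws"
  have insG: "smooth_field W (\<lambda>y. ins b (G y))" for b by (rule smooth_field_ins[OF G])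
  have IH: "((\<lambda>y. ins b (G (\<tau> y)) (map (T y) ws)) has_derivative
    (\<lambda>v. form_deriv (T x v) (\<lambda>y. ins b (G y)) ?t ?ws + second_order (T x) (B v) (ins b (G ?t)) ws)) (at x)" for b
    by (rule Cons.IH[OF insG]) (rule alternating_form_ins[OF alt])
  have 1: "((\<lambda>y. \<Sum>b\<in>Basis. (T y w \<bullet> b) * ins b (G (\<tau> y)) (map (T y) ws)) has_derivative
    (\<lambda>v. \<Sum>b\<in>Basis. (T x w \<bullet> b) * (form_deriv (T x v) (\<lambda>y. ins b (G y)) ?t ?ws + second_order (T x) (B v) (ins b (G ?t)) ws)
      + (B v w \<bullet> b) * ins b (G ?t) ?ws)) (at x)"
    by (intro has_derivative_sum has_derivative_mult IH has_derivative_inner_left T_derivative)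
  have 2: "(\<Sum>b\<in>Basis. (T y w \<bullet> b) * ins b (G (\<tau> y)) (map (T y) ws)) = G (\<tau> y) (map (T y) (w # ws))" if "y \<in> U" for y
    using linear_expand[OF alternating_form_linear_Cons[OF alt[OF \<tau>_W[OF that]], of "map (T y) ws"], of "T y w"]
    by (simp add: ins_def)
  have d: "((\<lambda>y. G (\<tau> y) (map (T y) (w # ws))) has_derivative
    (\<lambda>v. \<Sum>b\<in>Basis. (T x w \<bullet> b) * (form_deriv (T x v) (\<lambda>y. ins b (G y)) ?t ?ws + second_order (T x) (B v) (ins b (G ?t)) ws)
      + (B v w \<bullet> b) * ins b (G ?t) ?ws)) (at x)"
    by (rule has_derivative_cong_open[OF U x 2 1])
  have "(\<Sum>b\<in>Basis. (T x w \<bullet> b) * (form_deriv (T x v) (\<lambda>y. ins b (G y)) ?t ?ws + second_order (T x) (B v) (ins b (G ?t)) ws)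
      + (B v w \<bullet> b) * ins b (G ?t) ?ws) =
    form_deriv (T x v) G ?t (map (T x) (w # ws)) + second_order (T x) (B v) (G ?t) (w # ws)" for v
  proof -
    have "(\<Sum>b\<in>Basis. (T x w \<bullet> b) * form_deriv (T x v) (\<lambda>y. ins b (G y)) ?t ?ws) = form_deriv (T x v) G ?t (map (T x) (w # ws))"
      using linear_expand[OF alternating_form_linear_Cons[OF form_deriv_alternating[OF G \<tau>_W[OF x] alt], of "T x v" ?ws], of "T x w"]
      by (simp add: form_deriv_def ins_def)
    moreover have "(\<Sum>b\<in>Basis. (T x w \<bullet> b) * second_order (T x) (B v) (ins b (G ?t)) ws) = second_order (T x) (B v) (ins (T x w) (G ?t)) ws"
      using linear_expand[OF linear_compose[OF ins_linear[OF alt[OF \<tau>_W[OF x]]] second_order_linear[of "T x" "B v" ws]], of "T x w"]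
      by (simp add: o_def)
    moreover have "(\<Sum>b\<in>Basis. (B v w \<bullet> b) * ins b (G ?t) ?ws) = G ?t (B v w # ?ws)"
      using linear_expand[OF alternating_form_linear_Cons[OF alt[OF \<tau>_W[OF x]], of ?ws], of "B v w"] by (simp add: ins_def)
    ultimately show ?thesis by (simp add: sum.distrib distrib_left)
  qed
  then show ?case using d by simp
qed

text \<open>
  Differentiating the pullback, one gets the pullback of the derivative and the terms with the second
  derivative of \<open>\<tau>\<close>. The latter cancel in the alternating sum since the second derivative is symmetric.
\<close>

lemma local_d_pullback:
  assumes G: "smooth_field W G" "\<And>y. y \<in> W \<Longrightarrow> alternating_form k (G y)"
    and F: "\<And>y v. y \<in> U \<Longrightarrow> F y v = G (\<tau> y) (map (dirderiv \<tau> y) v)"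
  shows "local_d F x vs = local_d G (\<tau> x) (map (dirderiv \<tau> x) vs)"
proof -
  have "form_deriv u F x ws = form_deriv (T x u) G (\<tau> x) (map (T x) ws) + second_order (T x) (B u) (G (\<tau> x)) ws" for u ws
    using form_deriv_eqI[of F ws, OF has_derivative_cong_open[OF U x _ pullback_has_derivative[OF G, of ws], of "\<lambda>y. F y ws"]]
    by (simp add: F T_def)
  then have "local_d F x vs = local_d G (\<tau> x) (map (T x) vs) +
      (\<Sum>i<length vs. (-1) ^ i * second_order (T x) (B (vs ! i)) (G (\<tau> x)) (nths vs (- {i})))"
    by (simp add: local_d_form_deriv nths_map distrib_left sum.distrib)
  then show ?thesis
    using sum_second_order_zero[OF B_symmetric G(2)[OF \<tau>_W[OF x]]] by (simp add: T_def)
qed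

end

section \<open>Forms on manifolds\<close>

context smooth_manifold
begin

lemma chart_open: "c \<in> A \<Longrightarrow> open (chart_image c)"
  using charts by (auto simp: topological_chart_def)

lemma chart_domain: "c \<in> A \<Longrightarrow> fst c \<subseteq> topspace X"
  using charts[of c] openin_subset[of X "fst c"] by (simp add: topological_chart_def)

lemma chart_inj: assumes "c \<in> A" shows "inj_on (snd c) (fst c)"
proof -
  have "topspace (subtopology X (fst c)) = fst c" using chart_domain[OF assms] by auto
  then show ?thesis
    using charts[OF assms] homeomorphic_imp_injective_map[of "subtopology X (fst c)" _ "snd c"]
    by (auto simp: topological_chart_def)
qed

lemma overlap_open:
  assumes "c \<in> A" "c' \<in> A" shows "open (overlap c c')"
proof -
  have "open_map (subtopology X (fst c)) (top_of_set (chart_image c)) (snd c)"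
    using charts[OF assms(1)] homeomorphic_imp_open_map by (auto simp: topological_chart_def)
  moreover have "openin (subtopology X (fst c)) (fst c \<inter> fst c')"
    using charts[OF assms(2)] by (auto simp: topological_chart_def openin_subtopology)
  ultimately have "openin (top_of_set (chart_image c)) (overlap c c')"
    unfolding overlap_def open_map_def by blast
  then show ?thesis using chart_open[OF assms(1)] openin_open_trans by blast
qed

lemma overlap_subset: "overlap c c' \<subseteq> chart_image c"
  by (auto simp: overlap_def chart_image_def)

lemma transition_in:
  assumes "c \<in> A" "x \<in> overlap c c'" shows "transition c c' x \<in> chart_image c'"
  using assms(2) chart_inj[OF assms(1)] by (auto simp: overlap_def transition_def chart_image_def inv_into_f_f)

lemma transition_smooth: "c \<in> A \<Longrightarrow> c' \<in> A \<Longrightarrow> smooth_on (transition c c') (overlap c c')"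
  using compatible by (auto simp: smoothly_compatible_def)

lemma forms_outside: "\<eta> \<in> forms k \<Longrightarrow> c \<notin> A \<or> x \<notin> chart_image c \<Longrightarrow> \<eta> c x = 0"
  unfolding forms_def by blast

lemma forms_alternating: assumes "\<eta> \<in> forms k" shows "alternating_form k (\<eta> c x)"
proof (cases "c \<in> A \<and> x \<in> chart_image c")
  case True
  then show ?thesis using assms by (auto simp: forms_def)
next
  case False
  then have "\<eta> c x = 0" using forms_outside[OF assms] by blast
  then show ?thesis by (simp add: alternating_form_closed)
qed

lemma forms_smooth_field: "\<eta> \<in> forms k \<Longrightarrow> c \<in> A \<Longrightarrow> smooth_field (chart_image c) (\<eta> c)"
  using chart_open by (auto simp: forms_def smooth_field_def)

lemma forms_compatible:
  "\<eta> \<in> forms k \<Longrightarrow> c \<in> A \<Longrightarrow> c' \<in> A \<Longrightarrow> x \<in> overlap c c' \<Longrightarrow>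
    \<eta> c x v = \<eta> c' (transition c c' x) (map (dirderiv (transition c c') x) v)"
  unfolding forms_def by blast

lemma formsI:
  assumes "\<And>c x. c \<notin> A \<or> x \<notin> chart_image c \<Longrightarrow> \<eta> c x = 0"
    and "\<And>c x. c \<in> A \<Longrightarrow> x \<in> chart_image c \<Longrightarrow> alternating_form k (\<eta> c x)"
    and "\<And>c. c \<in> A \<Longrightarrow> smooth_field (chart_image c) (\<eta> c)"
    and "\<And>c c' x v. c \<in> A \<Longrightarrow> c' \<in> A \<Longrightarrow> x \<in> overlap c c' \<Longrightarrow>
      \<eta> c x v = \<eta> c' (transition c c' x) (map (dirderiv (transition c c') x) v)"
  shows "\<eta> \<in> forms k"
  using assms unfolding forms_def smooth_field_def by blast

lemma forms_subspace: "subspace (forms k)"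
proof (rule subspaceI)
  show "0 \<in> forms k"
    by (rule formsI) (auto simp: alternating_form_closed smooth_field_def smooth_on_const chart_open)
next
  fix \<eta> \<xi> assume f: "\<eta> \<in> forms k" "\<xi> \<in> forms k"
  have "smooth_field (chart_image c) (\<lambda>x. \<eta> c x + \<xi> c x)" if "c \<in> A" for c
    using smooth_field_add[OF forms_smooth_field[OF f(1) that] forms_smooth_field[OF f(2) that]] .
  then have smooth: "smooth_field (chart_image c) ((\<eta> + \<xi>) c)" if "c \<in> A" for c
    using that by (simp add: plus_fun_def)
  show "\<eta> + \<xi> \<in> forms k"
  proof (rule formsI)
    fix c x assume "c \<in> A" "x \<in> chart_image c"
    show "alternating_form k ((\<eta> + \<xi>) c x)"
      using alternating_form_closed(2)[OF forms_alternating[OF f(1)] forms_alternating[OF f(2)]] by simp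
  qed (use smooth in \<open>simp_all add: forms_outside[OF f(1)] forms_outside[OF f(2)] forms_compatible[OF f(1)] forms_compatible[OF f(2)]\<close>)
next
  fix r \<eta> assume f: "\<eta> \<in> forms k"
  have "smooth_field (chart_image c) (\<lambda>x. r *\<^sub>R \<eta> c x)" if "c \<in> A" for c
    using smooth_field_scale[OF forms_smooth_field[OF f that]] .
  then have smooth: "smooth_field (chart_image c) ((r *\<^sub>R \<eta>) c)" if "c \<in> A" for c
    using that by (simp add: scaleR_fun_def)
  show "r *\<^sub>R \<eta> \<in> forms k"
  proof (rule formsI)
    fix c x assume "c \<in> A" "x \<in> chart_image c"
    show "alternating_form k ((r *\<^sub>R \<eta>) c x)"
      using alternating_form_closed(3)[OF forms_alternating[OF f]] by simp
  qed (use smooth in \<open>simp_all add: forms_outside[OF f] forms_compatible[OF f]\<close>)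
qed

lemma forms_eqI:
  assumes "\<eta> \<in> forms k" "\<xi> \<in> forms l" "\<And>c x. c \<in> A \<Longrightarrow> x \<in> chart_image c \<Longrightarrow> \<eta> c x = \<xi> c x"
  shows "\<eta> = \<xi>"
  using assms(3) forms_outside[OF assms(1)] forms_outside[OF assms(2)] by (intro ext) metis

lemma forms_direct:
  assumes "finite K" "\<And>k. k \<in> K \<Longrightarrow> y k \<in> forms k" "(\<Sum>k\<in>K. y k) = 0" "k \<in> K"
  shows "y k = 0"
proof (intro ext)
  fix c x v
  show "y k c x v = 0 c x v"
  proof (cases "int (length v) = k")
    case True
    have "0 = (\<Sum>i\<in>K. y i) c x v" using assms(3) by simp
    also have "\<dots> = (\<Sum>i\<in>K. y i c x v)" by (simp add: sum_fun_apply)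
    also have "\<dots> = y k c x v + (\<Sum>i\<in>K - {k}. y i c x v)"
      using assms by (simp add: sum.remove)
    also have "(\<Sum>i\<in>K - {k}. y i c x v) = 0"
    proof (intro sum.neutral ballI)
      fix i assume "i \<in> K - {k}"
      then show "y i c x v = 0" using forms_alternating[OF assms(2)] True by (intro alternating_form_length[of i]) auto
    qed
    finally show ?thesis by simp
  next
    case False
    then show ?thesis using alternating_form_length[OF forms_alternating[OF assms(2)[OF assms(4)]]] by simp
  qed
qed

lemma forms_bounded: 
  assumes "\<eta> \<in> forms k" "k < 0 \<or> k > int DIM('b)" shows "\<eta> = 0"
  using assms alternating_form_negative[OF forms_alternating] alternating_form_above_dimension[OF forms_alternating]
  by (intro ext) (metis zero_fun_apply)

lemma forms_wedge:
  assumes f: "\<eta> \<in> forms k" "\<xi> \<in> forms l" shows "\<eta> \<and>\<^sub>f \<xi> \<in> forms (k + l)"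
proof (rule formsI)
  fix c c' x v assume c: "c \<in> A" "c' \<in> A" "x \<in> overlap c c'"
  have "\<eta> c x = (\<lambda>v. \<eta> c' (transition c c' x) (map (dirderiv (transition c c') x) v))"
    "\<xi> c x = (\<lambda>v. \<xi> c' (transition c c' x) (map (dirderiv (transition c c') x) v))"
    using forms_compatible[OF f(1) c] forms_compatible[OF f(2) c] by blast+
  then show "(\<eta> \<and>\<^sub>f \<xi>) c x v = (\<eta> \<and>\<^sub>f \<xi>) c' (transition c c' x) (map (dirderiv (transition c c') x) v)"
    by (simp add: wedge_def alt_wedge_map)
next
  fix c assume "c \<in> A"
  from smooth_field_wedge[OF forms_smooth_field[OF f(1) this] forms_smooth_field[OF f(2) this]]
  show "smooth_field (chart_image c) ((\<eta> \<and>\<^sub>f \<xi>) c)" by (simp add: wedge_def)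
qed (simp_all add: wedge_def forms_outside[OF f(1)] alternating_form_alt_wedge[OF forms_alternating[OF f(1)] forms_alternating[OF f(2)]])

lemma ext_d_local: "ext_d \<eta> c x = (if x \<in> chart_image c then local_d (\<eta> c) x else 0)" for \<eta> :: "('a, 'b) form"
  by (auto simp: ext_d_def local_d_def fun_eq_iff)

lemma forms_ext_d:
  assumes f: "\<eta> \<in> forms k" shows "ext_d \<eta> \<in> forms (k + 1)"
proof (rule formsI)
  fix c x assume "c \<notin> A \<or> x \<notin> chart_image c"
  moreover have "\<eta> c = (\<lambda>y. 0)" if "c \<notin> A" using forms_outside[OF f] that by blast
  ultimately show "ext_d \<eta> c x = 0" by (auto simp: ext_d_local local_d_zero)
next
  fix c x assume c: "c \<in> A" "x \<in> chart_image c"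
  then show "alternating_form (k + 1) (ext_d \<eta> c x)"
    using local_d_alternating[OF forms_smooth_field[OF f c(1)] c(2) forms_alternating[OF f]] by (simp add: ext_d_local)
next
  fix c assume c: "c \<in> A"
  show "smooth_field (chart_image c) (ext_d \<eta> c)"
    by (rule smooth_field_cong[OF smooth_field_local_d[OF forms_smooth_field[OF f c]]]) (simp add: ext_d_local)
next
  fix c c' x v assume c: "c \<in> A" "c' \<in> A" "x \<in> overlap c c'"
  have "local_d (\<eta> c) x v = local_d (\<eta> c') (transition c c' x) (map (dirderiv (transition c c') x) v)"
    by (rule local_d_pullback[OF overlap_open[OF c(1,2)] transition_smooth[OF c(1,2)] transition_in[OF c(1)] c(3)
          forms_smooth_field[OF f c(2)] forms_alternating[OF f] forms_compatible[OF f c(1,2)]])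
  then show "ext_d \<eta> c x v = ext_d \<eta> c' (transition c c' x) (map (dirderiv (transition c c') x) v)"
    using subsetD[OF overlap_subset c(3)] transition_in[OF c(1,3)] by (simp add: ext_d_local)
qed

lemma ext_d_outside: "\<eta> \<in> forms k \<Longrightarrow> c \<notin> A \<or> x \<notin> chart_image c \<Longrightarrow> ext_d \<eta> c x = 0"
  using forms_outside forms_ext_d by blast

lemma ext_d_add: assumes f: "\<eta> \<in> forms k" "\<xi> \<in> forms l" shows "ext_d (\<eta> + \<xi>) = ext_d \<eta> + ext_d \<xi>"
proof (intro ext)
  fix c x v
  show "ext_d (\<eta> + \<xi>) c x v = (ext_d \<eta> + ext_d \<xi>) c x v"
  proof (cases "c \<in> A \<and> x \<in> chart_image c")
    case True
    then show ?thesis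
      using local_d_add[of x "chart_image c" "\<eta> c" "\<xi> c"] forms_smooth_field[OF f(1)] forms_smooth_field[OF f(2)]
      by (simp add: ext_d_local plus_fun_def[of "\<eta> c" "\<xi> c"])
  next
    case False
    then have "(\<eta> + \<xi>) c = (\<lambda>y. 0)" if "x \<in> chart_image c"
      using that forms_outside[OF f(1), of c] forms_outside[OF f(2), of c] by auto
    then have "ext_d (\<eta> + \<xi>) c x = 0" by (simp add: ext_d_local local_d_zero)
    then show ?thesis using ext_d_outside[OF f(1)] ext_d_outside[OF f(2)] False by auto
  qed
qed

lemma ext_d_scale: assumes f: "\<eta> \<in> forms k" shows "ext_d (r *\<^sub>R \<eta>) = r *\<^sub>R ext_d \<eta>"
proof (intro ext)
  fix c x v
  show "ext_d (r *\<^sub>R \<eta>) c x v = (r *\<^sub>R ext_d \<eta>) c x v"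
  proof (cases "c \<in> A \<and> x \<in> chart_image c")
    case True
    then show ?thesis
      using local_d_scale[of x "chart_image c" "\<eta> c" r] forms_smooth_field[OF f]
      by (simp add: ext_d_local scaleR_fun_def[of r "\<eta> c"])
  next
    case False
    then have "(r *\<^sub>R \<eta>) c = (\<lambda>y. 0)" if "x \<in> chart_image c"
      using that forms_outside[OF f, of c] by auto
    then have "ext_d (r *\<^sub>R \<eta>) c x = 0" by (simp add: ext_d_local local_d_zero)
    then show ?thesis using ext_d_outside[OF f] False by auto
  qed
qed

lemma ext_d_ext_d: assumes f: "\<eta> \<in> forms k" shows "ext_d (ext_d \<eta>) = 0"
proof (rule forms_eqI[OF forms_ext_d[OF forms_ext_d[OF f]] subspace_0[OF forms_subspace]])
  fix c x assume c: "c \<in> A" "x \<in> chart_image c"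
  have "local_d (ext_d \<eta> c) x = local_d (local_d (\<eta> c)) x"
    by (rule local_d_cong[OF chart_open[OF c(1)] c(2)]) (simp add: ext_d_local)
  then show "ext_d (ext_d \<eta>) c x = 0 c x"
    using local_d_local_d[OF forms_smooth_field[OF f c(1)] c(2)] c by (simp add: ext_d_local[of "ext_d \<eta>"])
qed

lemma ext_d_wedge:
  assumes f: "\<eta> \<in> forms k" "\<xi> \<in> forms l"
  shows "ext_d (\<eta> \<and>\<^sub>f \<xi>) = ext_d \<eta> \<and>\<^sub>f \<xi> + sgn_pow k *\<^sub>R (\<eta> \<and>\<^sub>f ext_d \<xi>)"
proof -
  have 1: "ext_d (\<eta> \<and>\<^sub>f \<xi>) \<in> forms (k + l + 1)"
    by (intro forms_ext_d forms_wedge f)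
  have "ext_d \<eta> \<and>\<^sub>f \<xi> \<in> forms (k + l + 1)" "\<eta> \<and>\<^sub>f ext_d \<xi> \<in> forms (k + l + 1)"
    using forms_wedge[OF forms_ext_d[OF f(1)] f(2)] forms_wedge[OF f(1) forms_ext_d[OF f(2)]] by (simp_all add: algebra_simps)
  then have 2: "ext_d \<eta> \<and>\<^sub>f \<xi> + sgn_pow k *\<^sub>R (\<eta> \<and>\<^sub>f ext_d \<xi>) \<in> forms (k + l + 1)"
    using forms_subspace by (simp add: subspace_add subspace_scale)
  show ?thesis
  proof (rule forms_eqI[OF 1 2])
    fix c x assume c: "c \<in> A" "x \<in> chart_image c"
    show "ext_d (\<eta> \<and>\<^sub>f \<xi>) c x = (ext_d \<eta> \<and>\<^sub>f \<xi> + sgn_pow k *\<^sub>R (\<eta> \<and>\<^sub>f ext_d \<xi>)) c x"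
      using c local_d_wedge[OF forms_smooth_field[OF f(1) c(1)] forms_smooth_field[OF f(2) c(1)] c(2)]
      by (simp add: ext_d_local wedge_def alternating_form_parity[OF forms_alternating[OF f(1)]] alt_wedge_scale_left)
  qed
qed

end

lemma wedge_linear:
  fixes \<eta> \<xi> \<zeta> :: "('a, 'b) form"
  shows "(\<eta> + \<eta>') \<and>\<^sub>f \<xi> = \<eta> \<and>\<^sub>f \<xi> + \<eta>' \<and>\<^sub>f \<xi>" "\<eta> \<and>\<^sub>f (\<xi> + \<xi>') = \<eta> \<and>\<^sub>f \<xi> + \<eta> \<and>\<^sub>f \<xi>'"
    "(r *\<^sub>R \<eta>) \<and>\<^sub>f \<xi> = r *\<^sub>R (\<eta> \<and>\<^sub>f \<xi>)" "\<eta> \<and>\<^sub>f (r *\<^sub>R \<xi>) = r *\<^sub>R (\<eta> \<and>\<^sub>f \<xi>)"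
  by (auto simp: wedge_def fun_eq_iff alt_wedge_add_left alt_wedge_add_right alt_wedge_scale_left alt_wedge_scale_right)

lemma wedge_assoc: "(\<eta> \<and>\<^sub>f \<xi>) \<and>\<^sub>f \<zeta> = \<eta> \<and>\<^sub>f (\<xi> \<and>\<^sub>f \<zeta>)"
  by (simp add: wedge_def alt_wedge_assoc)

subsection \<open>Symplectic manifolds\<close>

context symplectic_manifold
begin

lemma symplectic_vector_\<omega>: "c \<in> A \<Longrightarrow> x \<in> chart_image c \<Longrightarrow> symplectic_vector (\<omega> c x) n"
  by unfold_locales (use dimension forms_alternating[OF two_form] nondegenerate in auto)

lemma symplectic_field_\<omega>: "c \<in> A \<Longrightarrow> symplectic_field (\<omega> c) (chart_image c) n"
  using symplectic_vector_\<omega>[of c] chart_open[of c] forms_smooth_field[OF two_form, of c]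
  by (intro symplectic_field.intro) (simp_all add: smooth_field_def)

lemma Lam_local: "Lam \<eta> c x = contract_poisson (\<omega> c x) (\<eta> c x)"
  by (simp add: Lam_def contract_poisson_def)

lemma Lef_local: "Lef \<eta> c x = alt_wedge (\<omega> c x) (\<eta> c x)"
  by (simp add: Lef_def wedge_def)

text \<open>
  Smoothness is that of the Poisson bivector; the compatibility of different charts holds as the
  transition maps preserve the symplectic form, with which the contraction is natural.
\<close>

lemma forms_Lam:
  assumes f: "\<eta> \<in> forms k" shows "Lam \<eta> \<in> forms (k - 2)"
proof (rule formsI)
  fix c x assume "c \<notin> A \<or> x \<notin> chart_image c"
  then show "Lam \<eta> c x = 0" 
    using forms_outside[OF f] linear_0[OF contract_poisson_linear] by (simp add: Lam_local)
next
  fix c x assume c: "c \<in> A" "x \<in> chart_image c"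
  then show "alternating_form (k - 2) (Lam \<eta> c x)"
    using symplectic_vector.alternating_form_contract_poisson[OF symplectic_vector_\<omega> forms_alternating[OF f]]
    by (simp add: Lam_local)
next
  fix c assume c: "c \<in> A"
  interpret symplectic_field "\<omega> c" "chart_image c" n by (rule symplectic_field_\<omega>[OF c])
  show "smooth_field (chart_image c) (Lam \<eta> c)"
    using forms_smooth_field[OF f c] smooth_poisson unfolding smooth_field_def Lam_def
    by (intro conjI allI smooth_on_mult smooth_on_sum smooth_on_const) auto
next
  fix c c' x v assume c: "c \<in> A" "c' \<in> A" "x \<in> overlap c c'"
  have "linear (dirderiv (transition c c') x)"
    by (rule linear_frechet_derivative[OF smooth_on_differentiable[OF transition_smooth[OF c(1,2)] c(3)]])
  then show "Lam \<eta> c x v = Lam \<eta> c' (transition c c' x) (map (dirderiv (transition c c') x) v)"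
    unfolding Lam_local
    by (rule contract_poisson_pullback[OF symplectic_vector_\<omega>[OF c(1) subsetD[OF overlap_subset c(3)]]
          symplectic_vector_\<omega>[OF c(2) transition_in[OF c(1,3)]] _ forms_compatible[OF two_form c]
          forms_alternating[OF f] forms_alternating[OF f] forms_compatible[OF f c]])
qed

lemma Lef_linear: "linear Lef"
  by (rule linearI) (simp_all add: Lef_def wedge_linear)

lemma Lam_linear: "linear Lam"
  by (rule linearI)
    (auto simp: Lam_local fun_eq_iff linear_add[OF contract_poisson_linear] linear_scale[OF contract_poisson_linear])

lemma forms_Lef: "\<eta> \<in> forms k \<Longrightarrow> Lef \<eta> \<in> forms (k + 2)"
  using forms_wedge[OF two_form] by (simp add: Lef_def add.commute)

lemma Lam_Lef: assumes x: "\<eta> \<in> forms k" shows "Lam (Lef \<eta>) - Lef (Lam \<eta>) = (real n - of_int k) *\<^sub>R \<eta>"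
proof (intro ext)
  fix c y v
  show "(Lam (Lef \<eta>) - Lef (Lam \<eta>)) c y v = ((real n - of_int k) *\<^sub>R \<eta>) c y v"
  proof (cases "c \<in> A \<and> y \<in> chart_image c")
    case True
    then show ?thesis
      using symplectic_vector.contract_poisson_wedge[OF symplectic_vector_\<omega> forms_alternating[OF x], of c y c y]
      by (simp add: Lam_local Lef_local)
  next
    case False
    then have "\<eta> c y = 0" using forms_outside[OF x] by blast
    then show ?thesis by (simp add: Lam_local Lef_local linear_0[OF contract_poisson_linear])
  qed
qed

lemma lefschetz_module_forms: "lefschetz_module forms Lef Lam n"
  by (intro lefschetz_module.intro forms_subspace Lef_linear Lam_linear)
    (auto simp: forms_Lef forms_Lam Lam_Lef dest: forms_bounded forms_direct simp: dimension)

interpretation lef: lefschetz_module forms Lef Lam n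
  by (rule lefschetz_module_forms)

lemma lefschetz_eq: "lefschetz = lef.dec"
  unfolding lefschetz_def lef.dec_def lef.is_dec_def lef.prim_def primitive_def ..

lemma Lef_inv_eq: "Lef_inv = lef.Linv"
  by (rule ext, rule ext) (simp only: Lef_inv_def lef.Linv_def lefschetz_eq)

lemma star_r_eq: "star_r = lef.star"
  by (rule ext) (simp only: star_r_def lef.star_def lefschetz_eq)

end

subsection \<open>Locality of the operators\<close>

text \<open>
  Division by \<open>w\<^sup>q\<close> on the alternating forms at one point. The value at zero is fixed separately: where
  the form of a chart is set to zero, the two-form \<open>w\<close> is degenerate, the Lefschetz operators are not
  defined, and the result still has to be zero.
\<close>

definition pointwise_Linv :: "nat \<Rightarrow> nat \<Rightarrow> ('b::euclidean_space list \<Rightarrow> real) \<Rightarrow> ('b list \<Rightarrow> real) \<Rightarrow> 'b list \<Rightarrow> real" where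
  "pointwise_Linv n q w \<alpha> = (if \<alpha> = 0 then 0
    else lefschetz_module.Linv (\<lambda>k. {\<alpha>. alternating_form k \<alpha>}) (alt_wedge w) (contract_poisson w) n q \<alpha>)"

definition pointwise_star :: "nat \<Rightarrow> ('b::euclidean_space list \<Rightarrow> real) \<Rightarrow> ('b list \<Rightarrow> real) \<Rightarrow> 'b list \<Rightarrow> real" where
  "pointwise_star n w \<alpha> = (if \<alpha> = 0 then 0
    else lefschetz_module.star (\<lambda>k. {\<alpha>. alternating_form k \<alpha>}) (alt_wedge w) (contract_poisson w) n \<alpha>)"

definition local_Linv :: "nat \<Rightarrow> nat \<Rightarrow> ('a, 'b::euclidean_space) form \<Rightarrow> ('a, 'b) form \<Rightarrow> ('a, 'b) form" where
  "local_Linv n q \<omega> \<eta> = (\<lambda>c x. pointwise_Linv n q (\<omega> c x) (\<eta> c x))"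

definition local_star :: "nat \<Rightarrow> ('a, 'b::euclidean_space) form \<Rightarrow> ('a, 'b) form \<Rightarrow> ('a, 'b) form" where
  "local_star n \<omega> \<eta> = (\<lambda>c x. pointwise_star n (\<omega> c x) (\<eta> c x))"

context symplectic_manifold
begin

interpretation lef: lefschetz_module forms Lef Lam n
  by (rule lefschetz_module_forms)

lemma Lef_pow_local: "(Lef ^^ j) \<eta> c x = (alt_wedge (\<omega> c x) ^^ j) (\<eta> c x)"
  by (induction j) (simp_all add: Lef_local)

text \<open>
  Since \<open>L\<close> and \<open>\<Lambda>\<close> act point by point, the decomposition of a form restricts at each point to a
  decomposition of its value, which is unique.
\<close>

lemma local_eq:
  assumes f: "\<eta> \<in> forms k"
  shows "local_Linv n q \<omega> \<eta> = lef.Linv q \<eta>" "local_star n \<omega> \<eta> = lef.star \<eta>"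
proof -
  have outside: "local_Linv n q \<omega> \<eta> c x = lef.Linv q \<eta> c x \<and> local_star n \<omega> \<eta> c x = lef.star \<eta> c x"
    if "\<not> (c \<in> A \<and> x \<in> chart_image c)" for c x
    using forms_outside[OF f] forms_outside[OF lef.Linv_in[OF f refl]] forms_outside[OF lef.star_in[OF f refl]] that
    by (auto simp: local_Linv_def local_star_def pointwise_Linv_def pointwise_star_def)
  have inside: "local_Linv n q \<omega> \<eta> c x = lef.Linv q \<eta> c x \<and> local_star n \<omega> \<eta> c x = lef.star \<eta> c x"
    if c: "c \<in> A" "x \<in> chart_image c" for c x
  proof -
    interpret sv: symplectic_vector "\<omega> c x" n by (rule symplectic_vector_\<omega>[OF c])
    interpret pt: lefschetz_module "\<lambda>k. {\<alpha>. alternating_form k \<alpha>}" "alt_wedge (\<omega> c x)" "contract_poisson (\<omega> c x)" n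
      by (rule sv.lefschetz_module_pointwise)
    have dec: "lef.is_dec (lef.dec \<eta>) \<eta>" by (rule lef.is_dec_dec[OF f])
    have "pt.is_dec (\<lambda>j s. lef.dec \<eta> j s c x) (\<eta> c x)"
    proof (rule pt.is_decI)
      fix s j assume "s \<le> n" "j \<le> n - s"
      then have "lef.dec \<eta> j s \<in> lef.prim (int s)" by (rule lef.is_dec_prim[OF dec])
      then show "lef.dec \<eta> j s c x \<in> pt.prim (int s)"
        using forms_alternating by (auto simp: lef.prim_def pt.prim_def Lam_local[symmetric])
    next
      fix s j assume "\<not> (s \<le> n \<and> j \<le> n - s)"
      then show "lef.dec \<eta> j s c x = 0" using lef.is_dec_outside[OF dec] by simp
    next
      show "\<eta> c x = (\<Sum>s\<le>n. \<Sum>j\<le>n - s. (alt_wedge (\<omega> c x) ^^ j) (lef.dec \<eta> j s c x))"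
        by (subst lef.is_dec_sum[OF dec]) (simp add: sum_fun_apply Lef_pow_local)
    qed
    then have "pt.dec (\<eta> c x) = (\<lambda>j s. lef.dec \<eta> j s c x)" by (rule pt.dec_eq)
    then have 1: "pt.Linv q (\<eta> c x) = lef.Linv q \<eta> c x" "pt.star (\<eta> c x) = lef.star \<eta> c x"
      by (simp_all add: pt.Linv_def pt.star_def lef.Linv_def lef.star_def sum_fun_apply Lef_pow_local if_distribR cong: if_cong)
    then show ?thesis
      using pt.Linv_0 pt.star_0 
      by (auto simp: local_Linv_def local_star_def pointwise_Linv_def pointwise_star_def simp flip: 1)
  qed
  show "local_Linv n q \<omega> \<eta> = lef.Linv q \<eta>" "local_star n \<omega> \<eta> = lef.star \<eta>"
    using inside outside by blast+
qed

end

section \<open>Transfer of the product along a contraction\<close>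

lemma sgn_pow_simps [simp]:
  "sgn_pow 0 = 1" "sgn_pow (k + 1) = - sgn_pow k" "sgn_pow (1 + k) = - sgn_pow k"
  "sgn_pow (k - 1) = - sgn_pow k" "sgn_pow 1 = -1" "sgn_pow 2 = 1" "sgn_pow 3 = -1" "sgn_pow 4 = 1" "sgn_pow (- k) = sgn_pow k"
  "sgn_pow k * sgn_pow k = 1" "sgn_pow k * (sgn_pow k * r) = r"
  by (auto simp: sgn_pow_def)

lemma sgn_pow_add: "sgn_pow (k + l) = sgn_pow k * sgn_pow l"
  by (auto simp: sgn_pow_def)

text \<open>
  In the cone, \<open>I\<close> consists of the multiples of \<open>\<theta>\<close>, and \<open>h\<close> is \<open>\<theta>\<close> times the division by \<open>\<omega>\<^bsup>p+1\<^esup>\<close>. The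
  degree \<open>k\<close> of the first factor is an argument of the product \<open>m k x y\<close> because the sign in the product
  of the cone depends on it. That \<open>h h = 0\<close> follows from \<open>h\<close> taking values in \<open>I\<close> and vanishing there.
\<close>

locale dga_contraction =
  fixes C I :: "int \<Rightarrow> 'c::real_vector set" and D h :: "'c \<Rightarrow> 'c" and m :: "int \<Rightarrow> 'c \<Rightarrow> 'c \<Rightarrow> 'c"
  assumes C_subspace: "subspace (C k)" and I_subspace: "subspace (I k)" and I_sub_C: "I k \<subseteq> C k"
    and D_in: "x \<in> C k \<Longrightarrow> j = k + 1 \<Longrightarrow> D x \<in> C j"
    and D_add: "x \<in> C k \<Longrightarrow> y \<in> C k \<Longrightarrow> D (x + y) = D x + D y"
    and D_scale: "x \<in> C k \<Longrightarrow> D (r *\<^sub>R x) = r *\<^sub>R D x"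
    and D_D: "x \<in> C k \<Longrightarrow> D (D x) = 0"
    and m_in: "x \<in> C k \<Longrightarrow> y \<in> C l \<Longrightarrow> j = k + l \<Longrightarrow> m k x y \<in> C j"
    and m_add_left: "m k (x + x') y = m k x y + m k x' y"
    and m_add_right: "m k x (y + y') = m k x y + m k x y'"
    and m_scale_left: "m k (r *\<^sub>R x) y = r *\<^sub>R m k x y"
    and m_scale_right: "m k x (r *\<^sub>R y) = r *\<^sub>R m k x y"
    and m_assoc: "x \<in> C k \<Longrightarrow> y \<in> C l \<Longrightarrow> z \<in> C i \<Longrightarrow> kl = k + l \<Longrightarrow> m kl (m k x y) z = m k x (m l y z)"
    and D_m: "x \<in> C k \<Longrightarrow> y \<in> C l \<Longrightarrow> D (m k x y) = m (k + 1) (D x) y + sgn_pow k *\<^sub>R m k x (D y)"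
    and m_I_left: "x \<in> I k \<Longrightarrow> y \<in> C l \<Longrightarrow> j = k + l \<Longrightarrow> m k x y \<in> I j"
    and m_I_right: "x \<in> C k \<Longrightarrow> y \<in> I l \<Longrightarrow> j = k + l \<Longrightarrow> m k x y \<in> I j"
    and m_I_I: "x \<in> I k \<Longrightarrow> y \<in> I l \<Longrightarrow> m k x y = 0"
    and h_in: "x \<in> C k \<Longrightarrow> j = k - 1 \<Longrightarrow> h x \<in> I j"
    and h_add: "x \<in> C k \<Longrightarrow> y \<in> C k \<Longrightarrow> h (x + y) = h x + h y"
    and h_scale: "x \<in> C k \<Longrightarrow> h (r *\<^sub>R x) = r *\<^sub>R h x"
    and h_I: "x \<in> I k \<Longrightarrow> h x = 0"
    and h_D_h: "x \<in> C k \<Longrightarrow> h (D (h x)) = h x"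
begin

definition P :: "'c \<Rightarrow> 'c" where
  "P x = x - D (h x) - h (D x)"

text \<open>
  The two planar binary trees with three leaves, with \<open>h\<close> on the internal edge. The defect of
  associativity of \<open>(x, y) \<mapsto> P(x y)\<close> is the boundary of \<open>P W\<close>.
\<close>

definition W :: "int \<Rightarrow> int \<Rightarrow> 'c \<Rightarrow> 'c \<Rightarrow> 'c \<Rightarrow> 'c" where
  "W k l x y z = m (k + l - 1) (h (m k x y)) z - sgn_pow k *\<^sub>R m k x (h (m l y z))"

text \<open>
  The image of \<open>P\<close>, on which the structure is transferred.
\<close>

definition S :: "int \<Rightarrow> 'c set" where
  "S k = {x \<in> C k. h x = 0 \<and> h (D x) = 0}"

lemma I_C: "x \<in> I k \<Longrightarrow> x \<in> C k"
  using I_sub_C by blast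

lemma h_C: "x \<in> C k \<Longrightarrow> j = k - 1 \<Longrightarrow> h x \<in> C j"
  using h_in I_C by blast

lemma C_closed: "x \<in> C k \<Longrightarrow> y \<in> C k \<Longrightarrow> x + y \<in> C k" "x \<in> C k \<Longrightarrow> y \<in> C k \<Longrightarrow> x - y \<in> C k"
  "x \<in> C k \<Longrightarrow> - x \<in> C k" "x \<in> C k \<Longrightarrow> r *\<^sub>R x \<in> C k" "0 \<in> C k"
  using C_subspace[of k] by (auto simp: subspace_add subspace_diff subspace_neg subspace_scale subspace_0)

lemma I_closed: "x \<in> I k \<Longrightarrow> y \<in> I k \<Longrightarrow> x + y \<in> I k" "x \<in> I k \<Longrightarrow> y \<in> I k \<Longrightarrow> x - y \<in> I k"
  "x \<in> I k \<Longrightarrow> - x \<in> I k" "x \<in> I k \<Longrightarrow> r *\<^sub>R x \<in> I k" "0 \<in> I k"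
  using I_subspace[of k] by (auto simp: subspace_add subspace_diff subspace_neg subspace_scale subspace_0)

lemmas mem = m_in D_in h_C C_closed

lemma h_minus: "x \<in> C k \<Longrightarrow> h (- x) = - h x"
  using h_scale[of x k "-1"] by simp

lemma D_minus: "x \<in> C k \<Longrightarrow> D (- x) = - D x"
  using D_scale[of x k "-1"] by simp

lemma h_diff: "x \<in> C k \<Longrightarrow> y \<in> C k \<Longrightarrow> h (x - y) = h x - h y"
  using h_add[of x k "- y"] h_minus[of y k] C_closed(3)[of y k] by simp

lemma D_diff: "x \<in> C k \<Longrightarrow> y \<in> C k \<Longrightarrow> D (x - y) = D x - D y"
  using D_add[of x k "- y"] D_minus[of y k] C_closed(3)[of y k] by simp

lemma h_0 [simp]: "h 0 = 0"
  using h_scale[of 0 0 0] C_closed(5) by simp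

lemma D_0 [simp]: "D 0 = 0"
  using D_scale[of 0 0 0] C_closed(5) by simp

lemma m_0 [simp]: "m k 0 y = 0" "m k x 0 = 0"
  using m_scale_left[of k 0 0 y] m_scale_right[of k x 0 0] by simp_all

lemma m_minus: "m k (- x) y = - m k x y" "m k x (- y) = - m k x y"
  using m_scale_left[of k "-1" x y] m_scale_right[of k x "-1" y] by simp_all

lemma m_diff: "m k (x - x') y = m k x y - m k x' y" "m k x (y - y') = m k x y - m k x y'"
  using m_add_left[of k x "- x'" y] m_add_right[of k x y "- y'"] by (simp_all add: m_minus)

lemmas m_linear = m_add_left m_add_right m_scale_left m_scale_right m_minus m_diff

lemma P_in: "x \<in> C k \<Longrightarrow> P x \<in> C k"
  unfolding P_def by (auto intro!: mem)

lemma P_add: "x \<in> C k \<Longrightarrow> y \<in> C k \<Longrightarrow> P (x + y) = P x + P y"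
  unfolding P_def
  by (simp add: h_add D_add h_add[OF D_in[OF _ refl] D_in[OF _ refl]] D_add[OF h_C[OF _ refl] h_C[OF _ refl]])

lemma P_scale: "x \<in> C k \<Longrightarrow> P (r *\<^sub>R x) = r *\<^sub>R P x"
  unfolding P_def
  by (simp add: h_scale D_scale h_scale[OF D_in[OF _ refl]] D_scale[OF h_C[OF _ refl]] scaleR_diff_right)

lemma P_minus: "x \<in> C k \<Longrightarrow> P (- x) = - P x"
  using P_scale[of x k "-1"] by simp

lemma P_diff: "x \<in> C k \<Longrightarrow> y \<in> C k \<Longrightarrow> P (x - y) = P x - P y"
  using P_add[of x k "- y"] P_minus[of y k] C_closed(3)[of y k] by simp

lemma P_0 [simp]: "P 0 = 0"
  by (simp add: P_def)

lemma D_P: assumes x: "x \<in> C k" shows "D (P x) = P (D x)"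
proof -
  have a: "D (h x) \<in> C k" "h (D x) \<in> C k" "D x \<in> C (k + 1)" "D (h (D x)) \<in> C (k + 1)" "x - D (h x) \<in> C k"
    "h x \<in> C (k - 1)"
    using x by (auto intro!: mem)
  then show ?thesis
    using x by (simp add: P_def D_diff[of _ k] D_D[of _ k] D_D[of "h x" "k-1"])
qed

lemma h_P: assumes x: "x \<in> C k" shows "h (P x) = 0"
proof -
  have "D (h x) \<in> C k" "h (D x) \<in> I k" "h x \<in> I (k - 1)" "x - D (h x) \<in> C k"
    using x by (auto intro!: mem h_in)
  then show ?thesis
    using x I_C by (simp add: P_def h_diff[of _ k] h_I[of _ k] h_D_h[of _ k])
qed

lemma P_in_S: "x \<in> C k \<Longrightarrow> P x \<in> S k"
  unfolding S_def by (auto simp: D_P h_P h_P[OF D_in[OF _ refl]] intro: P_in)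

lemma P_on_I: "x \<in> I k \<Longrightarrow> P x = x - h (D x)"
  by (simp add: P_def h_I)

lemma P_I: "x \<in> I k \<Longrightarrow> P x \<in> I k"
  by (auto simp: P_on_I intro!: I_closed h_in D_in dest: I_C)

lemma h_of_I_left: "x \<in> I k \<Longrightarrow> y \<in> C l \<Longrightarrow> h (m k x y) = 0"
  using h_I m_I_left by blast

lemma h_of_I_right: "x \<in> C k \<Longrightarrow> y \<in> I l \<Longrightarrow> h (m k x y) = 0"
  using h_I m_I_right by blast

lemma W_I: "x \<in> C k \<Longrightarrow> y \<in> C l \<Longrightarrow> z \<in> C i \<Longrightarrow> j = k + l + i - 1 \<Longrightarrow> W k l x y z \<in> I j"
  unfolding W_def by (intro I_closed m_I_left m_I_right h_in m_in; simp)

lemma W_C: "x \<in> C k \<Longrightarrow> y \<in> C l \<Longrightarrow> z \<in> C i \<Longrightarrow> j = k + l + i - 1 \<Longrightarrow> W k l x y z \<in> C j"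
  using W_I I_C by blast

text \<open>
  Since \<open>h\<close> annihilates the ideal, and the ideal has square zero, trees with another \<open>h\<close> at a leaf
  vanish. This is the reason why there are no operations with more than three arguments.
\<close>

lemma W_zero:
  assumes x: "x \<in> C k" and y: "y \<in> C l" and z: "z \<in> C i"
    and "x \<in> I k \<or> y \<in> I l \<or> z \<in> I i"
  shows "W k l x y z = 0"
proof -
  have I: "h (m k x y) \<in> I (k + l - 1)" "h (m l y z) \<in> I (l + i - 1)"
    using x y z by (auto intro!: h_in m_in)
  show ?thesis
    using assms(4)
  proof (elim disjE)
    assume "x \<in> I k"
    then show ?thesis
      using y m_I_I[OF _ I(2)] h_of_I_left by (simp add: W_def)
  next
    assume "y \<in> I l"
    then show ?thesis
      using x z h_of_I_left h_of_I_right by (simp add: W_def)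
  next
    assume "z \<in> I i"
    then show ?thesis
      using y m_I_I[OF I(1)] h_of_I_right by (simp add: W_def)
  qed
qed

lemma transferred_leibniz:
  assumes x: "x \<in> C k" and y: "y \<in> C l"
  shows "D (P (m k x y)) = P (m (k + 1) (D x) y) + sgn_pow k *\<^sub>R P (m k x (D y))"
proof -
  have "m k x y \<in> C (k + l)" "m (k + 1) (D x) y \<in> C (k + l + 1)" "m k x (D y) \<in> C (k + l + 1)"
    using x y by (auto intro!: mem)
  then show ?thesis
    by (simp add: D_P D_m[OF x y] P_add[of _ "k + l + 1"] P_scale[of _ "k + l + 1"] C_closed)
qed

text \<open>
  In \<open>h((P u) z) = h(u z) - h((D h u) z) - h((h D u) z)\<close> with \<open>u = x y\<close>, the last term vanishes as it is \<open>h\<close>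
  of an element of the ideal, and by the Leibniz rule the middle one is \<open>h(D((h u) z))\<close> up to such a term.
\<close>

lemma h_m_P_left:
  assumes x: "x \<in> C k" and y: "y \<in> C l" and z: "z \<in> C i"
  shows "h (m (k + l) (P (m k x y)) z) = h (m (k + l) (m k x y) z) - h (D (m (k + l - 1) (h (m k x y)) z))"
proof -
  define xy where "xy = m k x y"
  have xy: "xy \<in> C (k + l)" unfolding xy_def using x y by (auto intro: mem)
  have hxy: "h xy \<in> I (k + l - 1)" using xy by (auto intro: h_in)
  have c: "D xy \<in> C (k + l + 1)" "D (h xy) \<in> C (k + l)" "D z \<in> C (i + 1)" using xy z by (auto intro!: mem)
  have hD: "h (D xy) \<in> I (k + l)" using c by (auto intro: h_in)
  have d: "m (k + l) xy z \<in> C (k + l + i)" "m (k + l) (D (h xy)) z \<in> C (k + l + i)"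
    "m (k + l) (h (D xy)) z \<in> C (k + l + i)" "m (k + l - 1) (h xy) (D z) \<in> C (k + l + i)"
    using xy c z by (auto intro!: mem)
  have 1: "h (m (k + l) (P xy) z) = h (m (k + l) xy z) - h (m (k + l) (D (h xy)) z)"
    using d h_of_I_left[OF hD z] by (simp add: P_def m_linear h_diff[of _ "k + l + i"] C_closed)
  have 2: "h (D (m (k + l - 1) (h xy) z)) = h (m (k + l) (D (h xy)) z)"
    using d h_of_I_left[OF hxy c(3)] D_m[OF I_C[OF hxy] z]
    by (simp add: h_diff[of _ "k + l + i"] h_add[of _ "k + l + i"] h_scale[of _ "k + l + i"] h_minus[of _ "k + l + i"] C_closed)
  show ?thesis
    using 1 2 by (simp add: xy_def)
qed

lemma h_m_P_right:
  assumes x: "x \<in> C k" and y: "y \<in> C l" and z: "z \<in> C i"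
  shows "h (m k x (P (m l y z))) = h (m k x (m l y z)) - sgn_pow k *\<^sub>R h (D (m k x (h (m l y z))))"
proof -
  define yz where "yz = m l y z"
  have yz: "yz \<in> C (l + i)" unfolding yz_def using y z by (auto intro: mem)
  have hyz: "h yz \<in> I (l + i - 1)" using yz by (auto intro: h_in)
  have c: "D yz \<in> C (l + i + 1)" "D (h yz) \<in> C (l + i)" "D x \<in> C (k + 1)" using yz x by (auto intro!: mem)
  have hD: "h (D yz) \<in> I (l + i)" using c by (auto intro: h_in)
  have d: "m k x yz \<in> C (k + l + i)" "m k x (D (h yz)) \<in> C (k + l + i)"
    "m k x (h (D yz)) \<in> C (k + l + i)" "m (k + 1) (D x) (h yz) \<in> C (k + l + i)"
    using yz c x by (auto intro!: mem)
  have 1: "h (m k x (P yz)) = h (m k x yz) - h (m k x (D (h yz)))"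
    using d h_of_I_right[OF x hD] by (simp add: P_def m_linear h_diff[of _ "k + l + i"] C_closed)
  have 2: "h (D (m k x (h yz))) = sgn_pow k *\<^sub>R h (m k x (D (h yz)))"
    using d h_of_I_right[OF c(3) hyz] D_m[OF x I_C[OF hyz]]
    by (simp add: h_add[of _ "k + l + i"] h_scale[of _ "k + l + i"] C_closed)
  show ?thesis
    using 1 2 by (simp add: yz_def)
qed

text \<open>
  On the ideal, \<open>P\<close> is \<open>1 - h D\<close>; the preceding two lemmas evaluate \<open>h D W\<close>, and the terms \<open>h(x y z)\<close> cancel
  by associativity. This is also the relation with three arguments for the map with the components
  \<open>x\<close> and \<open>- h(x y)\<close>.
\<close>

lemma P_W:
  assumes x: "x \<in> C k" and y: "y \<in> C l" and z: "z \<in> C i"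
  shows "P (W k l x y z) = h (m (k + l) (P (m k x y)) z) - h (m k x (P (m l y z)))
    - sgn_pow k *\<^sub>R m k x (h (m l y z)) + m (k + l - 1) (h (m k x y)) z"
proof -
  have c: "m (k + l - 1) (h (m k x y)) z \<in> C (k + l + i - 1)" "m k x (h (m l y z)) \<in> C (k + l + i - 1)"
    using x y z by (auto intro!: mem)
  have c': "D (m (k + l - 1) (h (m k x y)) z) \<in> C (k + l + i)" "D (m k x (h (m l y z))) \<in> C (k + l + i)"
    using x y z by (auto intro!: mem)
  have "h (D (W k l x y z)) = h (D (m (k + l - 1) (h (m k x y)) z)) - sgn_pow k *\<^sub>R h (D (m k x (h (m l y z))))"
    using c c' by (simp add: W_def D_diff[of _ "k + l + i - 1"] D_scale[of _ "k + l + i - 1"]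
        h_diff[of _ "k + l + i"] h_scale[of _ "k + l + i"] C_closed)
  then show ?thesis
    unfolding P_on_I[OF W_I[OF x y z refl]]
    by (simp add: h_m_P_left[OF x y z] h_m_P_right[OF x y z] m_assoc[OF x y z] W_def)
qed

text \<open>
  The relation holds before the outer \<open>P\<close> is applied to the sum: expanding
  \<open>P = 1 - D h - h D\<close> inside the products, one finds that the terms are cancelled by those from \<open>D W\<close> and
  from \<open>W\<close> with a differential on one argument. Then \<open>P\<close> is applied, which commutes with \<open>D\<close>.
\<close>

lemma transferred_associativity:
  assumes x: "x \<in> C k" and y: "y \<in> C l" and z: "z \<in> C i"
  shows "P (m (k + l) (P (m k x y)) z) - P (m k x (P (m l y z))) + D (P (W k l x y z))
    + P (W (k + 1) l (D x) y z) + sgn_pow k *\<^sub>R P (W k (l + 1) x (D y) z)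
    + sgn_pow (k + l) *\<^sub>R P (W k l x y (D z)) = 0"
proof -
  define j where "j = k + l + i"
  have dx: "D x \<in> C (k + 1)" and dy: "D y \<in> C (l + 1)" and dz: "D z \<in> C (i + 1)"
    using x y z by (auto intro!: mem)
  have xy: "m k x y \<in> C (k + l)" and yz: "m l y z \<in> C (l + i)"
    using x y z by (auto intro!: mem)
  have dxy: "m (k + 1) (D x) y \<in> C (k + l + 1)" "m k x (D y) \<in> C (k + l + 1)"
    "m (l + 1) (D y) z \<in> C (l + i + 1)" "m l y (D z) \<in> C (l + i + 1)"
    using dx dy dz x y z by (auto intro!: mem)
  have c: "m (k + l) (m k x y) z \<in> C j" "m k x (m l y z) \<in> C j"
    "m (k + l) (P (m k x y)) z \<in> C j" "m k x (P (m l y z)) \<in> C j"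
    "D (W k l x y z) \<in> C j" "W (k + 1) l (D x) y z \<in> C j" "W k (l + 1) x (D y) z \<in> C j" "W k l x y (D z) \<in> C j"
    using x y z dx dy dz by (auto intro!: mem P_in W_C simp: j_def)
  have w: "m (k + l - 1) (h (m k x y)) z \<in> C (j - 1)" "m k x (h (m l y z)) \<in> C (j - 1)"
    using x y z by (auto intro!: mem simp: j_def)
  have 1: "D (m (k + l - 1) (h (m k x y)) z) =
      m (k + l) (D (h (m k x y))) z - sgn_pow (k + l) *\<^sub>R m (k + l - 1) (h (m k x y)) (D z)"
    using D_m[OF h_C[OF xy refl] z] by simp
  have 2: "D (m k x (h (m l y z))) =
      m (k + 1) (D x) (h (m l y z)) + sgn_pow k *\<^sub>R m k x (D (h (m l y z)))"
    using D_m[OF x h_C[OF yz refl]] by simp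
  have 3: "h (D (m k x y)) = h (m (k + 1) (D x) y) + sgn_pow k *\<^sub>R h (m k x (D y))"
    using dxy D_m[OF x y] by (simp add: h_add[of _ "k + l + 1"] h_scale[of _ "k + l + 1"] C_closed)
  have 4: "h (D (m l y z)) = h (m (l + 1) (D y) z) + sgn_pow l *\<^sub>R h (m l y (D z))"
    using dxy D_m[OF y z] by (simp add: h_add[of _ "l + i + 1"] h_scale[of _ "l + i + 1"] C_closed)
  have "m (k + l) (P (m k x y)) z - m k x (P (m l y z)) + D (W k l x y z)
    + W (k + 1) l (D x) y z + sgn_pow k *\<^sub>R W k (l + 1) x (D y) z + sgn_pow (k + l) *\<^sub>R W k l x y (D z) = 0"
    using w by (simp add: P_def[of "m k x y"] P_def[of "m l y z"] W_def m_linear m_assoc[OF x y z]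
        D_diff[of _ "j - 1"] D_scale[of _ "j - 1"] C_closed 1 2 3 4 sgn_pow_add algebra_simps)
  then have "P (m (k + l) (P (m k x y)) z - m k x (P (m l y z)) + D (W k l x y z)
    + W (k + 1) l (D x) y z + sgn_pow k *\<^sub>R W k (l + 1) x (D y) z + sgn_pow (k + l) *\<^sub>R W k l x y (D z)) = 0"
    by simp
  then show ?thesis
    using c W_C[OF x y z refl] by (simp add: P_add[of _ j] P_diff[of _ j] P_scale[of _ j] C_closed D_P[of "W k l x y z" "j - 1"] j_def)
qed

text \<open>
  Again the relation holds before the outer \<open>P\<close> is applied: \<open>P W\<close> is replaced by its value from \<open>P_W\<close>, and
  all that remains are products such as \<open>h(x y) D(h(z w))\<close>, which cancel because \<open>h(x y) h(z w) = 0\<close> has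
  derivative zero.
\<close>

lemma transferred_pentagon:
  assumes x: "x \<in> C k" and y: "y \<in> C l" and z: "z \<in> C i" and w: "w \<in> C e"
  shows "P (W (k + l) i (P (m k x y)) z w) - P (W k (l + i) x (P (m l y z)) w) + P (W k l x y (P (m i z w)))
    - P (m (k + l + i - 1) (P (W k l x y z)) w) - sgn_pow k *\<^sub>R P (m k x (P (W l i y z w))) = 0"
proof -
  define j where "j = k + l + i + e - 1"
  have xy: "m k x y \<in> C (k + l)" and yz: "m l y z \<in> C (l + i)" and zw: "m i z w \<in> C (i + e)"
    using x y z w by (auto intro!: mem)
  have Hxy: "h (m k x y) \<in> I (k + l - 1)" and Hyz: "h (m l y z) \<in> I (l + i - 1)" and Hzw: "h (m i z w) \<in> I (i + e - 1)"
    using xy yz zw by (auto intro!: h_in)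
  have hxy: "h (m k x y) \<in> C (k + l - 1)" and hyz: "h (m l y z) \<in> C (l + i - 1)" and hzw: "h (m i z w) \<in> C (i + e - 1)"
    using x y z w by (auto intro!: mem)
  have c: "W (k + l) i (P (m k x y)) z w \<in> C j" "W k (l + i) x (P (m l y z)) w \<in> C j" "W k l x y (P (m i z w)) \<in> C j"
    "m (k + l + i - 1) (P (W k l x y z)) w \<in> C j" "m k x (P (W l i y z w)) \<in> C j"
    using x y z w by (auto intro!: mem P_in W_C simp: j_def)
  have a1: "m (k + l + i - 1) (P (W k l x y z)) w =
     m (k + l + i - 1) (h (m (k + l) (P (m k x y)) z)) w - m (k + l + i - 1) (h (m k x (P (m l y z)))) w
     - sgn_pow k *\<^sub>R m k x (m (l + i - 1) (h (m l y z)) w) + m (k + l - 1) (h (m k x y)) (m i z w)"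
    using m_assoc[OF x hyz w, of "k + l + i - 1"] m_assoc[OF hxy z w, of "k + l + i - 1"]
    by (simp add: P_W[OF x y z] m_linear)
  have a2: "m k x (P (W l i y z w)) =
     m k x (h (m (l + i) (P (m l y z)) w)) - m k x (h (m l y (P (m i z w))))
     - sgn_pow l *\<^sub>R m (k + l) (m k x y) (h (m i z w)) + m k x (m (l + i - 1) (h (m l y z)) w)"
    using m_assoc[OF x y hzw, of "k + l"]
    by (simp add: P_W[OF y z w] m_linear)
  have b1: "m (k + l) (P (m k x y)) (h (m i z w)) = m (k + l) (m k x y) (h (m i z w)) - m (k + l) (D (h (m k x y))) (h (m i z w))"
    using m_I_I[OF h_in[OF D_in[OF xy refl] refl] Hzw] by (simp add: P_def m_linear)
  have b2: "m (k + l - 1) (h (m k x y)) (P (m i z w)) = m (k + l - 1) (h (m k x y)) (m i z w) - m (k + l - 1) (h (m k x y)) (D (h (m i z w)))"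
    using m_I_I[OF Hxy h_in[OF D_in[OF zw refl] refl]] by (simp add: P_def m_linear)
  have b3: "m (k + l) (D (h (m k x y))) (h (m i z w)) = sgn_pow (k + l) *\<^sub>R m (k + l - 1) (h (m k x y)) (D (h (m i z w)))"
    using D_m[OF hxy hzw] m_I_I[OF Hxy Hzw] by simp
  have "W (k + l) i (P (m k x y)) z w - W k (l + i) x (P (m l y z)) w + W k l x y (P (m i z w))
    - m (k + l + i - 1) (P (W k l x y z)) w - sgn_pow k *\<^sub>R m k x (P (W l i y z w)) = 0"
    unfolding W_def[of "k + l"] W_def[of k "l + i"] W_def[of k l x y "P (m i z w)"] a1 a2 b1 b2 b3
    by (simp add: sgn_pow_add algebra_simps)
  then have "P (W (k + l) i (P (m k x y)) z w - W k (l + i) x (P (m l y z)) w + W k l x y (P (m i z w))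
    - m (k + l + i - 1) (P (W k l x y z)) w - sgn_pow k *\<^sub>R m k x (P (W l i y z w))) = 0" by simp
  then show ?thesis
    using c by (simp add: P_add[of _ j] P_diff[of _ j] P_scale[of _ j] C_closed)
qed

end

subsection \<open>Sums over insertions and over blocks\<close>

lemma insertion_sum_1: "insertion_sum A f [x] = f [(fst x + 1, mu A [x])]"
  by (simp add: insertion_sum_def total_degree_def Let_def algebra_simps)

lemma insertion_sum_2:
  "insertion_sum A f [(k, x), (l, y)] = f [(k + l, mu A [(k, x), (l, y)])]
    - f [(k + 1, mu A [(k, x)]), (l, y)] - sgn_pow k *\<^sub>R f [(k, x), (l + 1, mu A [(l, y)])]"
  by (simp add: insertion_sum_def total_degree_def Let_def numeral_eq_Suc sum.atLeast_Suc_atMost algebra_simps)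

lemma insertion_sum_3:
  "insertion_sum A f [(k, x), (l, y), (i, z)] = f [(k + l + i - 1, mu A [(k, x), (l, y), (i, z)])]
    + f [(k + l, mu A [(k, x), (l, y)]), (i, z)] - f [(k, x), (l + i, mu A [(l, y), (i, z)])]
    + f [(k + 1, mu A [(k, x)]), (l, y), (i, z)] + sgn_pow k *\<^sub>R f [(k, x), (l + 1, mu A [(l, y)]), (i, z)]
    + sgn_pow (k + l) *\<^sub>R f [(k, x), (l, y), (i + 1, mu A [(i, z)])]"
  by (simp add: insertion_sum_def total_degree_def Let_def numeral_eq_Suc sum.atLeast_Suc_atMost algebra_simps)

lemma insertion_sum_4:
  "insertion_sum A f [(k, x), (l, y), (i, z), (e, w)] = 
   f [(k + l + i + e - 2, mu A [(k, x), (l, y), (i, z), (e, w)])]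
    - f [(k + l + i - 1, mu A [(k, x), (l, y), (i, z)]), (e, w)]
    - sgn_pow k *\<^sub>R f [(k, x), (l + i + e - 1, mu A [(l, y), (i, z), (e, w)])]
    + f [(k + l, mu A [(k, x), (l, y)]), (i, z), (e, w)] - f [(k, x), (l + i, mu A [(l, y), (i, z)]), (e, w)]
    + f [(k, x), (l, y), (i + e, mu A [(i, z), (e, w)])]
    - (f [(k + 1, mu A [(k, x)]), (l, y), (i, z), (e, w)]
      + sgn_pow k *\<^sub>R f [(k, x), (l + 1, mu A [(l, y)]), (i, z), (e, w)]
      + sgn_pow (k + l) *\<^sub>R f [(k, x), (l, y), (i + 1, mu A [(i, z)]), (e, w)]
      + sgn_pow (k + l + i) *\<^sub>R f [(k, x), (l, y), (i, z), (e + 1, mu A [(e, w)])])"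
  by (simp add: insertion_sum_def total_degree_def Let_def numeral_eq_Suc sum.atLeast_Suc_atMost algebra_simps)

lemma insertion_sum_zero:
  assumes "\<And>us ys vs. xs = us @ ys @ vs \<Longrightarrow> ys \<noteq> [] \<Longrightarrow>
      f (us @ (total_degree ys + 2 - int (length ys), mu A ys) # vs) = 0"
  shows "insertion_sum A f xs = 0"
proof -
  have "f (take r xs @ (total_degree (take s (drop r xs)) + 2 - int s, mu A (take s (drop r xs))) # drop (r + s) xs) = 0"
    if "s \<in> {1..length xs}" "r \<in> {0..length xs - s}" for s r
  proof -
    have "xs = take r xs @ take s (drop r xs) @ drop (r + s) xs"
      by (metis append_take_drop_id drop_drop add.commute)
    moreover have "length (take s (drop r xs)) = s" "take s (drop r xs) \<noteq> []" using that by auto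
    ultimately show ?thesis using assms[of "take r xs" "take s (drop r xs)" "drop (r + s) xs"] by simp
  qed
  then show ?thesis
    by (simp add: insertion_sum_def Let_def)
qed

lemma cuts_singleton: "{bs. concat bs = [x] \<and> [] \<notin> set bs} = {[[x]]}" 
proof -
  have "bs = [[x]]" if "concat bs = [x]" "[] \<notin> set bs" for bs
  proof (cases bs)
    case (Cons b cs)
    moreover have "cs = []" if "concat cs = []" using that \<open>[] \<notin> set bs\<close> Cons by (cases cs) auto
    ultimately show ?thesis using that by (cases b) auto
  qed (use that in simp)
  then show ?thesis by auto
qed

text \<open>
  The first entry either is a block of its own or is joined to the first block of the rest. By
  repeated use, the index set of a block sum over a short list is enumerated.
\<close>

lemma cuts_Cons:
  assumes "xs \<noteq> []"
  shows "{bs. concat bs = x # xs \<and> [] \<notin> set bs} =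
    Cons [x] ` {bs. concat bs = xs \<and> [] \<notin> set bs} \<union>
    (\<lambda>bs. (x # hd bs) # tl bs) ` {bs. concat bs = xs \<and> [] \<notin> set bs}"
proof (intro equalityI subsetI)
  fix bs assume "bs \<in> {bs. concat bs = x # xs \<and> [] \<notin> set bs}"
  then have bs: "concat bs = x # xs" "[] \<notin> set bs" by auto
  then obtain b cs where b: "bs = b # cs" "b \<noteq> []" by (cases bs) auto
  then obtain b' where b': "b = x # b'" using bs by (cases b) auto
  show "bs \<in> Cons [x] ` {bs. concat bs = xs \<and> [] \<notin> set bs} \<union>
    (\<lambda>bs. (x # hd bs) # tl bs) ` {bs. concat bs = xs \<and> [] \<notin> set bs}"
  proof (cases "b' = []")
    case True
    then show ?thesis using b b' bs by auto
  next
    case False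
    then have "bs = (x # hd (b' # cs)) # tl (b' # cs)" "concat (b' # cs) = xs" "[] \<notin> set (b' # cs)"
      using b b' bs by auto
    then show ?thesis by blast
  qed
next
  fix bs assume "bs \<in> Cons [x] ` {bs. concat bs = xs \<and> [] \<notin> set bs} \<union>
    (\<lambda>bs. (x # hd bs) # tl bs) ` {bs. concat bs = xs \<and> [] \<notin> set bs}"
  then consider cs where "bs = [x] # cs" "concat cs = xs" "[] \<notin> set cs"
    | cs where "bs = (x # hd cs) # tl cs" "concat cs = xs" "[] \<notin> set cs" by auto
  then show "bs \<in> {bs. concat bs = x # xs \<and> [] \<notin> set bs}"
  proof cases
    case 2
    then show ?thesis using assms by (cases cs) auto
  qed auto
qed

lemma block_sum_1: "block_sum B g [x] = mu B [(fst x, g [x])]"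
  by (simp add: block_sum_def cuts_singleton total_degree_def)

lemma block_sum_2:
  "block_sum B g [(k, x), (l, y)] = mu B [(k, g [(k, x)]), (l, g [(l, y)])] + mu B [(k + l - 1, g [(k, x), (l, y)])]"
  by (simp add: block_sum_def cuts_singleton cuts_Cons total_degree_def numeral_eq_Suc)

lemma block_sum_3:
  "block_sum B g [(k, x), (l, y), (i, z)] =
     mu B [(k, g [(k, x)]), (l, g [(l, y)]), (i, g [(i, z)])]
     + sgn_pow k *\<^sub>R mu B [(k, g [(k, x)]), (l + i - 1, g [(l, y), (i, z)])]
     - mu B [(k + l - 1, g [(k, x), (l, y)]), (i, g [(i, z)])]
     + mu B [(k + l + i - 2, g [(k, x), (l, y), (i, z)])]"
  by (simp add: block_sum_def cuts_singleton cuts_Cons image_image total_degree_def numeral_eq_Suc add.assoc)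

lemma block_sum_zero:
  assumes "\<And>bs. concat bs = xs \<Longrightarrow> [] \<notin> set bs \<Longrightarrow>
    mu B (map (\<lambda>ys. (total_degree ys + 1 - int (length ys), g ys)) bs) = 0"
  shows "block_sum B g xs = 0"
  using assms by (auto simp: block_sum_def Let_def intro!: sum.neutral)

subsection \<open>Multilinear maps of few arguments\<close>

lemma homogeneous_simps [simp]: "homogeneous A []" 
  "homogeneous A ((k, x) # xs) \<longleftrightarrow> x \<in> A k \<and> homogeneous A xs"
  "homogeneous A (xs @ ys) \<longleftrightarrow> homogeneous A xs \<and> homogeneous A ys"
  by (auto simp: homogeneous_def)

lemma graded_multilinear_1:
  assumes "\<And>k x. x \<in> A k \<Longrightarrow> f [(k, x)] \<in> B (k + e)"
    and "\<And>k x y. x \<in> A k \<Longrightarrow> y \<in> A k \<Longrightarrow> f [(k, x + y)] = f [(k, x)] + f [(k, y)]"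
    and "\<And>k x r. x \<in> A k \<Longrightarrow> f [(k, r *\<^sub>R x)] = r *\<^sub>R f [(k, x)]"
  shows "graded_multilinear A B e 1 f"
  unfolding graded_multilinear_def
proof (intro conjI allI impI ballI)
  fix xs :: "(int \<times> 'a) list" assume "length xs = 1 \<and> homogeneous A xs"
  then show "f xs \<in> B (total_degree xs + e)"
    using assms(1) by (auto simp: length_Suc_conv total_degree_def)
qed (use assms in auto)

lemma graded_multilinear_2:
  assumes "\<And>k x l y. x \<in> A k \<Longrightarrow> y \<in> A l \<Longrightarrow> f [(k, x), (l, y)] \<in> B (k + l + e)"
    and "\<And>k x x' l y. x \<in> A k \<Longrightarrow> x' \<in> A k \<Longrightarrow> y \<in> A l \<Longrightarrow>
      f [(k, x + x'), (l, y)] = f [(k, x), (l, y)] + f [(k, x'), (l, y)]"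
    and "\<And>k x l y y'. x \<in> A k \<Longrightarrow> y \<in> A l \<Longrightarrow> y' \<in> A l \<Longrightarrow>
      f [(k, x), (l, y + y')] = f [(k, x), (l, y)] + f [(k, x), (l, y')]"
    and "\<And>k x l y r. x \<in> A k \<Longrightarrow> y \<in> A l \<Longrightarrow> f [(k, r *\<^sub>R x), (l, y)] = r *\<^sub>R f [(k, x), (l, y)]"
    and "\<And>k x l y r. x \<in> A k \<Longrightarrow> y \<in> A l \<Longrightarrow> f [(k, x), (l, r *\<^sub>R y)] = r *\<^sub>R f [(k, x), (l, y)]"
  shows "graded_multilinear A B e 2 f"
  unfolding graded_multilinear_def
proof (intro conjI allI impI ballI)
  fix xs :: "(int \<times> 'a) list" assume "length xs = 2 \<and> homogeneous A xs"
  then show "f xs \<in> B (total_degree xs + e)"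
    using assms(1) by (auto simp: length_Suc_conv numeral_2_eq_2 total_degree_def)
next
  fix xs ys :: "(int \<times> 'a) list" and k x y
  assume *: "length xs + 1 + length ys = 2 \<and> homogeneous A xs \<and> homogeneous A ys" and xy: "x \<in> A k" "y \<in> A k"
  have "(\<exists>z. xs = [] \<and> ys = [z]) \<or> (\<exists>z. xs = [z] \<and> ys = [])"
    using * by (cases xs; cases ys) auto
  then show "f (xs @ (k, x + y) # ys) = f (xs @ (k, x) # ys) + f (xs @ (k, y) # ys)"
    using xy * assms(2,3) by auto
next
  fix xs ys :: "(int \<times> 'a) list" and k x r
  assume *: "length xs + 1 + length ys = 2 \<and> homogeneous A xs \<and> homogeneous A ys" and xy: "x \<in> A k"
  have "(\<exists>z. xs = [] \<and> ys = [z]) \<or> (\<exists>z. xs = [z] \<and> ys = [])"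
    using * by (cases xs; cases ys) auto
  then show "f (xs @ (k, r *\<^sub>R x) # ys) = r *\<^sub>R f (xs @ (k, x) # ys)"
    using xy * assms(4,5) by auto
qed

lemma graded_multilinear_3:
  assumes "\<And>k x l y i z. x \<in> A k \<Longrightarrow> y \<in> A l \<Longrightarrow> z \<in> A i \<Longrightarrow> f [(k, x), (l, y), (i, z)] \<in> B (k + l + i + e)"
    and "\<And>k x x' l y i z. x \<in> A k \<Longrightarrow> x' \<in> A k \<Longrightarrow> y \<in> A l \<Longrightarrow> z \<in> A i \<Longrightarrow>
      f [(k, x + x'), (l, y), (i, z)] = f [(k, x), (l, y), (i, z)] + f [(k, x'), (l, y), (i, z)]"
    and "\<And>k x l y y' i z. x \<in> A k \<Longrightarrow> y \<in> A l \<Longrightarrow> y' \<in> A l \<Longrightarrow> z \<in> A i \<Longrightarrow>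
      f [(k, x), (l, y + y'), (i, z)] = f [(k, x), (l, y), (i, z)] + f [(k, x), (l, y'), (i, z)]"
    and "\<And>k x l y i z z'. x \<in> A k \<Longrightarrow> y \<in> A l \<Longrightarrow> z \<in> A i \<Longrightarrow> z' \<in> A i \<Longrightarrow>
      f [(k, x), (l, y), (i, z + z')] = f [(k, x), (l, y), (i, z)] + f [(k, x), (l, y), (i, z')]"
    and "\<And>k x l y i z r. x \<in> A k \<Longrightarrow> y \<in> A l \<Longrightarrow> z \<in> A i \<Longrightarrow>
      f [(k, r *\<^sub>R x), (l, y), (i, z)] = r *\<^sub>R f [(k, x), (l, y), (i, z)]"
    and "\<And>k x l y i z r. x \<in> A k \<Longrightarrow> y \<in> A l \<Longrightarrow> z \<in> A i \<Longrightarrow>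
      f [(k, x), (l, r *\<^sub>R y), (i, z)] = r *\<^sub>R f [(k, x), (l, y), (i, z)]"
    and "\<And>k x l y i z r. x \<in> A k \<Longrightarrow> y \<in> A l \<Longrightarrow> z \<in> A i \<Longrightarrow>
      f [(k, x), (l, y), (i, r *\<^sub>R z)] = r *\<^sub>R f [(k, x), (l, y), (i, z)]"
  shows "graded_multilinear A B e 3 f"
proof -
  have split: "(\<exists>u v. xs = [] \<and> ys = [u, v]) \<or> (\<exists>u v. xs = [u] \<and> ys = [v]) \<or> (\<exists>u v. xs = [u, v] \<and> ys = [])"
    if "length xs + 1 + length ys = 3" for xs ys :: "(int \<times> 'a) list"
  proof -
    have "length xs = 0 \<and> length ys = 2 \<or> length xs = 1 \<and> length ys = 1 \<or> length xs = 2 \<and> length ys = 0"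
      using that by linarith
    then show ?thesis by (auto simp: length_Suc_conv numeral_2_eq_2)
  qed
  show ?thesis
    unfolding graded_multilinear_def
  proof (intro conjI allI impI ballI)
    fix xs :: "(int \<times> 'a) list" assume "length xs = 3 \<and> homogeneous A xs"
    then show "f xs \<in> B (total_degree xs + e)"
      using assms(1) by (auto simp: length_Suc_conv numeral_3_eq_3 total_degree_def add.assoc)
  next
    fix xs ys :: "(int \<times> 'a) list" and k x y
    assume *: "length xs + 1 + length ys = 3 \<and> homogeneous A xs \<and> homogeneous A ys" and xy: "x \<in> A k" "y \<in> A k"
    show "f (xs @ (k, x + y) # ys) = f (xs @ (k, x) # ys) + f (xs @ (k, y) # ys)"
      using xy * assms(2-4) split[of xs ys] by auto
  next
    fix xs ys :: "(int \<times> 'a) list" and k x r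
    assume *: "length xs + 1 + length ys = 3 \<and> homogeneous A xs \<and> homogeneous A ys" and xy: "x \<in> A k"
    show "f (xs @ (k, r *\<^sub>R x) # ys) = r *\<^sub>R f (xs @ (k, x) # ys)"
      using xy * assms(5-7) split[of xs ys] by auto
  qed
qed

lemma graded_multilinear_zero:
  assumes "\<And>k. subspace (B k)" "\<And>xs. length xs = l \<Longrightarrow> f xs = 0"
  shows "graded_multilinear A B e l f"
  using assms by (auto simp: graded_multilinear_def subspace_0)

subsection \<open>The equivalence\<close>

lemma list_length_cases:
  assumes "xs \<noteq> []"
  obtains u where "xs = [u]" | u v where "xs = [u, v]" | u v w where "xs = [u, v, w]"
    | u v w t where "xs = [u, v, w, t]" | "length xs \<ge> 5"
proof -
  have "length xs = 1 \<or> length xs = 2 \<or> length xs = 3 \<or> length xs = 4 \<or> length xs \<ge> 5"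
    using assms length_greater_0_conv[of xs] by linarith
  then show ?thesis
    using that by (auto simp: length_Suc_conv numeral_eq_Suc)
qed

text \<open>
  The operations of \<open>A\<close> correspond to the transferred ones on \<open>S\<close> under injections \<open>\<phi>\<close>. As only the images
  under \<open>\<phi>\<close> are prescribed, every identity in \<open>A\<close> is derived from one in \<open>C\<close>.
\<close>

locale transferred_ainf = dga_contraction C I D h m
  for C I :: "int \<Rightarrow> 'c::real_vector set" and D h :: "'c \<Rightarrow> 'c" and m :: "int \<Rightarrow> 'c \<Rightarrow> 'c \<Rightarrow> 'c" +
  fixes A :: "'v::real_vector graded_ops" and B :: "'c graded_ops" and \<phi> :: "int \<Rightarrow> 'v \<Rightarrow> 'c"
  assumes piece_subspace: "subspace (piece A k)"
    and \<phi>_add: "x \<in> piece A k \<Longrightarrow> y \<in> piece A k \<Longrightarrow> \<phi> k (x + y) = \<phi> k x + \<phi> k y"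
    and \<phi>_scale: "x \<in> piece A k \<Longrightarrow> \<phi> k (r *\<^sub>R x) = r *\<^sub>R \<phi> k x"
    and \<phi>_inj: "x \<in> piece A k \<Longrightarrow> \<phi> k x = 0 \<Longrightarrow> x = 0"
    and \<phi>_image: "\<phi> k ` piece A k = S k"
    and mu1_in: "x \<in> piece A k \<Longrightarrow> mu A [(k, x)] \<in> piece A (k + 1)"
    and mu1: "x \<in> piece A k \<Longrightarrow> \<phi> (k + 1) (mu A [(k, x)]) = D (\<phi> k x)"
    and mu2_in: "x \<in> piece A k \<Longrightarrow> y \<in> piece A l \<Longrightarrow> mu A [(k, x), (l, y)] \<in> piece A (k + l)"
    and mu2: "x \<in> piece A k \<Longrightarrow> y \<in> piece A l \<Longrightarrow>
      \<phi> (k + l) (mu A [(k, x), (l, y)]) = P (m k (\<phi> k x) (\<phi> l y))"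
    and mu3_in: "x \<in> piece A k \<Longrightarrow> y \<in> piece A l \<Longrightarrow> z \<in> piece A i \<Longrightarrow>
      mu A [(k, x), (l, y), (i, z)] \<in> piece A (k + l + i - 1)"
    and mu3: "x \<in> piece A k \<Longrightarrow> y \<in> piece A l \<Longrightarrow> z \<in> piece A i \<Longrightarrow>
      \<phi> (k + l + i - 1) (mu A [(k, x), (l, y), (i, z)]) = P (W k l (\<phi> k x) (\<phi> l y) (\<phi> i z))"
    and mu_higher: "length xs > 3 \<Longrightarrow> mu A xs = 0"
    and piece_B: "piece B = C"
    and mu_B1: "mu B [(k, u)] = D u"
    and mu_B2: "mu B [(k, u), (l, v)] = m k u v"
    and mu_B_higher: "length us > 2 \<Longrightarrow> mu B us = 0"
begin

definition g :: "(int \<times> 'v) list \<Rightarrow> 'c" where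
  "g xs = (case xs of [(k, x)] \<Rightarrow> \<phi> k x | [(k, x), (l, y)] \<Rightarrow> - h (m k (\<phi> k x) (\<phi> l y)) | _ \<Rightarrow> 0)"

lemma g_simps [simp]: "g [] = 0" "g [(k, x)] = \<phi> k x" "g [(k, x), (l, y)] = - h (m k (\<phi> k x) (\<phi> l y))"
  "length xs > 2 \<Longrightarrow> g xs = 0"
  by (auto simp: g_def split: list.split)

lemma piece_closed: "x \<in> piece A k \<Longrightarrow> y \<in> piece A k \<Longrightarrow> x + y \<in> piece A k"
  "x \<in> piece A k \<Longrightarrow> y \<in> piece A k \<Longrightarrow> x - y \<in> piece A k"
  "x \<in> piece A k \<Longrightarrow> - x \<in> piece A k" "x \<in> piece A k \<Longrightarrow> r *\<^sub>R x \<in> piece A k" "0 \<in> piece A k"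
  using piece_subspace[of k] by (auto simp: subspace_add subspace_diff subspace_neg subspace_scale subspace_0)

lemma \<phi>_0 [simp]: "\<phi> k 0 = 0"
  using \<phi>_scale[of 0 k 0] piece_closed by simp

lemma \<phi>_minus: "x \<in> piece A k \<Longrightarrow> \<phi> k (- x) = - \<phi> k x"
  using \<phi>_scale[of x k "-1"] by simp

lemma \<phi>_diff: "x \<in> piece A k \<Longrightarrow> y \<in> piece A k \<Longrightarrow> \<phi> k (x - y) = \<phi> k x - \<phi> k y"
  using \<phi>_add[of x k "- y"] \<phi>_minus[of y k] piece_closed(3)[of y k] by simp

lemma \<phi>_eq: "x \<in> piece A k \<Longrightarrow> y \<in> piece A k \<Longrightarrow> \<phi> k x = \<phi> k y \<Longrightarrow> x = y"
  using \<phi>_inj[of "x - y" k] \<phi>_diff piece_closed by auto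

lemma \<phi>_S: "x \<in> piece A k \<Longrightarrow> \<phi> k x \<in> S k"
  using \<phi>_image by blast

lemma \<phi>_C: "x \<in> piece A k \<Longrightarrow> \<phi> k x \<in> C k"
  using \<phi>_S by (auto simp: S_def)

lemma \<phi>_m_C: "x \<in> piece A k \<Longrightarrow> y \<in> piece A l \<Longrightarrow> m k (\<phi> k x) (\<phi> l y) \<in> C (k + l)"
  by (auto intro: m_in \<phi>_C)

lemma \<phi>_W_I: "x \<in> piece A k \<Longrightarrow> y \<in> piece A l \<Longrightarrow> z \<in> piece A i \<Longrightarrow>
  W k l (\<phi> k x) (\<phi> l y) (\<phi> i z) \<in> I (k + l + i - 1)"
  by (auto intro: W_I \<phi>_C)

lemma \<phi>_mu3_I: "x \<in> piece A k \<Longrightarrow> y \<in> piece A l \<Longrightarrow> z \<in> piece A i \<Longrightarrow>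
  \<phi> (k + l + i - 1) (mu A [(k, x), (l, y), (i, z)]) \<in> I (k + l + i - 1)"
  by (auto simp: mu3 intro: P_I \<phi>_W_I)

lemma mu1_linear: "x \<in> piece A k \<Longrightarrow> y \<in> piece A k \<Longrightarrow> mu A [(k, x + y)] = mu A [(k, x)] + mu A [(k, y)]"
  "x \<in> piece A k \<Longrightarrow> mu A [(k, r *\<^sub>R x)] = r *\<^sub>R mu A [(k, x)]"
  by (rule \<phi>_eq[of _ "k + 1"]; auto intro!: piece_closed mu1_in
      simp: mu1 \<phi>_add \<phi>_scale mu1_in D_add[OF \<phi>_C \<phi>_C] D_scale[OF \<phi>_C] piece_closed)+

lemma mu2_linear: 
  "x \<in> piece A k \<Longrightarrow> x' \<in> piece A k \<Longrightarrow> y \<in> piece A l \<Longrightarrow>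
    mu A [(k, x + x'), (l, y)] = mu A [(k, x), (l, y)] + mu A [(k, x'), (l, y)]"
  "x \<in> piece A k \<Longrightarrow> y \<in> piece A l \<Longrightarrow> y' \<in> piece A l \<Longrightarrow>
    mu A [(k, x), (l, y + y')] = mu A [(k, x), (l, y)] + mu A [(k, x), (l, y')]"
  "x \<in> piece A k \<Longrightarrow> y \<in> piece A l \<Longrightarrow> mu A [(k, r *\<^sub>R x), (l, y)] = r *\<^sub>R mu A [(k, x), (l, y)]"
  "x \<in> piece A k \<Longrightarrow> y \<in> piece A l \<Longrightarrow> mu A [(k, x), (l, r *\<^sub>R y)] = r *\<^sub>R mu A [(k, x), (l, y)]"
  by (rule \<phi>_eq[of _ "k + l"]; auto intro!: piece_closed mu2_in
      simp: mu2 \<phi>_add \<phi>_scale mu2_in m_linear P_add[OF \<phi>_m_C \<phi>_m_C] P_scale[OF \<phi>_m_C] piece_closed)+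

lemma W_linear:
  assumes "x \<in> C k" "x' \<in> C k" "y \<in> C l" "y' \<in> C l" "z \<in> C i" "z' \<in> C i"
  shows "W k l (x + x') y z = W k l x y z + W k l x' y z"
    "W k l x (y + y') z = W k l x y z + W k l x y' z"
    "W k l x y (z + z') = W k l x y z + W k l x y z'"
    "W k l (r *\<^sub>R x) y z = r *\<^sub>R W k l x y z"
    "W k l x (r *\<^sub>R y) z = r *\<^sub>R W k l x y z"
    "W k l x y (r *\<^sub>R z) = r *\<^sub>R W k l x y z"
  using assms m_in[OF _ _ refl]
  by (simp_all add: W_def m_linear h_add[of _ "k + l"] h_add[of _ "l + i"] h_scale[of _ "k + l"] h_scale[of _ "l + i"]
      scaleR_add_right scaleR_diff_right add_diff_add scaleR_left_commute del: scaleR_scaleR)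

lemma mu3_linear: 
  assumes "x \<in> piece A k" "x' \<in> piece A k" "y \<in> piece A l" "y' \<in> piece A l" "z \<in> piece A i" "z' \<in> piece A i"
  shows
  "mu A [(k, x + x'), (l, y), (i, z)] = mu A [(k, x), (l, y), (i, z)] + mu A [(k, x'), (l, y), (i, z)]"
  "mu A [(k, x), (l, y + y'), (i, z)] = mu A [(k, x), (l, y), (i, z)] + mu A [(k, x), (l, y'), (i, z)]"
  "mu A [(k, x), (l, y), (i, z + z')] = mu A [(k, x), (l, y), (i, z)] + mu A [(k, x), (l, y), (i, z')]"
  "mu A [(k, r *\<^sub>R x), (l, y), (i, z)] = r *\<^sub>R mu A [(k, x), (l, y), (i, z)]"
  "mu A [(k, x), (l, r *\<^sub>R y), (i, z)] = r *\<^sub>R mu A [(k, x), (l, y), (i, z)]"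
  "mu A [(k, x), (l, y), (i, r *\<^sub>R z)] = r *\<^sub>R mu A [(k, x), (l, y), (i, z)]"
  by (rule \<phi>_eq[of _ "k + l + i - 1"]; use assms in \<open>auto intro!: piece_closed mu3_in
      simp: mu3 \<phi>_add \<phi>_scale mu3_in piece_closed
        W_linear[OF \<phi>_C \<phi>_C \<phi>_C \<phi>_C \<phi>_C \<phi>_C, of x k x' y l y' z i z']
        P_add[OF W_C[OF \<phi>_C \<phi>_C \<phi>_C refl] W_C[OF \<phi>_C \<phi>_C \<phi>_C refl]] P_scale[OF W_C[OF \<phi>_C \<phi>_C \<phi>_C refl]]\<close>)+

lemma mu1_0 [simp]: "mu A [(k, 0)] = 0"
  using mu1_linear(2)[of 0 k 0] piece_closed by simp

lemma mu2_0 [simp]: "y \<in> piece A l \<Longrightarrow> mu A [(k, 0), (l, y)] = 0" "x \<in> piece A k \<Longrightarrow> mu A [(k, x), (l, 0)] = 0"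
  using mu2_linear(3)[of 0 k y l 0] mu2_linear(4)[of x k 0 l 0] piece_closed by simp_all

text \<open>
  Since the values of \<open>m\<^sup>3\<close> lie in the ideal, this lemma makes iterated triple products vanish.
\<close>

lemma mu3_ideal:
  assumes "x \<in> piece A k" "y \<in> piece A l" "z \<in> piece A i"
    and "\<phi> k x \<in> I k \<or> \<phi> l y \<in> I l \<or> \<phi> i z \<in> I i"
  shows "mu A [(k, x), (l, y), (i, z)] = 0"
  using assms W_zero[OF \<phi>_C \<phi>_C \<phi>_C, of x k y l z i] mu3[of x k y l z i]
  by (intro \<phi>_inj[OF mu3_in[of x k y l z i]]) auto

lemma insertion_sum_4':
  "insertion_sum A (mu A) [(k, x), (l, y), (i, z), (e, w)] =
    mu A [(k + l, mu A [(k, x), (l, y)]), (i, z), (e, w)] - mu A [(k, x), (l + i, mu A [(l, y), (i, z)]), (e, w)]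
    + mu A [(k, x), (l, y), (i + e, mu A [(i, z), (e, w)])]
    - mu A [(k + l + i - 1, mu A [(k, x), (l, y), (i, z)]), (e, w)]
    - sgn_pow k *\<^sub>R mu A [(k, x), (l + i + e - 1, mu A [(l, y), (i, z), (e, w)])]"
  by (simp add: insertion_sum_4 mu_higher)

text \<open>
  With at most four arguments, the relations are the transferred identities, pulled back along \<open>\<phi>\<close>. With
  five or more, each summand involves an operation of more than three arguments, or it is \<open>m\<^sup>3\<close> with an
  inner \<open>m\<^sup>3\<close>, which vanishes.
\<close>

lemma ainf_A: "ainf_algebra A"
  unfolding ainf_algebra_def
proof (intro conjI allI impI)
  show "subspace (piece A k)" for k by (rule piece_subspace)
next
  fix l :: nat assume "l \<ge> 1"
  then consider "l = 1" | "l = 2" | "l = 3" | "l > 3" by linarith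
  then show "graded_multilinear (piece A) (piece A) (2 - int l) l (mu A)"
  proof cases
    case 1
    then show ?thesis using graded_multilinear_1[of "piece A" "mu A" "piece A" 1] mu1_in mu1_linear by simp
  next
    case 2
    then show ?thesis using graded_multilinear_2[of "piece A" "mu A" "piece A" 0] mu2_in mu2_linear by simp
  next
    case 3
    have "graded_multilinear (piece A) (piece A) (-1) 3 (mu A)"
      by (rule graded_multilinear_3) (auto intro: mu3_in[simplified] mu3_linear simp: mu3_in[simplified])
    then show ?thesis using 3 by simp
  next
    case 4
    then show ?thesis by (intro graded_multilinear_zero piece_subspace mu_higher) simp
  qed
next
  fix xs assume *: "xs \<noteq> [] \<and> homogeneous (piece A) xs"
  then have "xs \<noteq> []" by simp
  then show "insertion_sum A (mu A) xs = 0"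
  proof (cases rule: list_length_cases)
    case (1 u)
    obtain k x where u: "u = (k, x)" by force
    then have x: "x \<in> piece A k" using * 1 by simp
    have "\<phi> (k + 1 + 1) (mu A [(k + 1, mu A [(k, x)])]) = 0"
      unfolding mu1[OF mu1_in[OF x]] mu1[OF x] using D_D[OF \<phi>_C[OF x]] .
    then show ?thesis
      using \<phi>_inj[OF mu1_in[OF mu1_in[OF x]]] by (simp add: insertion_sum_1 1 u)
  next
    case (2 u v)
    obtain k x l y where u: "u = (k, x)" "v = (l, y)" by (cases u; cases v) force
    then have x: "x \<in> piece A k" and y: "y \<in> piece A l" using * 2 by simp_all
    note mem = x y mu1_in[OF x] mu1_in[OF y] mu2_in[OF x y]
    have mem2: "mu A [(k + 1, mu A [(k, x)]), (l, y)] \<in> piece A (k + l + 1)"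
      "mu A [(k, x), (l + 1, mu A [(l, y)])] \<in> piece A (k + l + 1)"
      "mu A [(k + l, mu A [(k, x), (l, y)])] \<in> piece A (k + l + 1)"
      using mu2_in[OF mem(3) y] mu2_in[OF x mem(4)] mu1_in[OF mem(5)] by (simp_all add: algebra_simps)
    have eq: "\<phi> (k + l + 1) (mu A [(k + 1, mu A [(k, x)]), (l, y)]) = P (m (k + 1) (D (\<phi> k x)) (\<phi> l y))"
      "\<phi> (k + l + 1) (mu A [(k, x), (l + 1, mu A [(l, y)])]) = P (m k (\<phi> k x) (D (\<phi> l y)))"
      "\<phi> (k + l + 1) (mu A [(k + l, mu A [(k, x), (l, y)])]) = D (P (m k (\<phi> k x) (\<phi> l y)))"
      using mu2[OF mem(3) y] mu2[OF x mem(4)] mu1[OF mem(5)] mu1[OF x] mu1[OF y] mu2[OF x y]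
      by (simp_all add: algebra_simps)
    have "\<phi> (k + l + 1) (insertion_sum A (mu A) xs) = 0"
      unfolding 2 u insertion_sum_2 using mem2 transferred_leibniz[OF \<phi>_C[OF x] \<phi>_C[OF y]]
      by (simp only: \<phi>_diff \<phi>_scale piece_closed eq) simp
    moreover have "insertion_sum A (mu A) xs \<in> piece A (k + l + 1)"
      unfolding 2 u insertion_sum_2 using mem2 by (intro piece_closed)
    ultimately show ?thesis using \<phi>_inj by blast
  next
    case (3 u v w)
    obtain k x l y i z where u: "u = (k, x)" "v = (l, y)" "w = (i, z)" by (cases u; cases v; cases w) force
    then have x: "x \<in> piece A k" and y: "y \<in> piece A l" and z: "z \<in> piece A i" using * 3 by simp_all
    define j where "j = k + l + i"
    note dx = mu1_in[OF x] and dy = mu1_in[OF y] and dz = mu1_in[OF z]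
    note xy = mu2_in[OF x y] and yz = mu2_in[OF y z] and xyz = mu3_in[OF x y z]
    have mem: "mu A [(k + l + i - 1, mu A [(k, x), (l, y), (i, z)])] \<in> piece A j"
      "mu A [(k + l, mu A [(k, x), (l, y)]), (i, z)] \<in> piece A j"
      "mu A [(k, x), (l + i, mu A [(l, y), (i, z)])] \<in> piece A j"
      "mu A [(k + 1, mu A [(k, x)]), (l, y), (i, z)] \<in> piece A j"
      "mu A [(k, x), (l + 1, mu A [(l, y)]), (i, z)] \<in> piece A j"
      "mu A [(k, x), (l, y), (i + 1, mu A [(i, z)])] \<in> piece A j"
      using mu1_in[OF xyz] mu2_in[OF xy z] mu2_in[OF x yz] mu3_in[OF dx y z] mu3_in[OF x dy z] mu3_in[OF x y dz]
      by (simp_all add: j_def algebra_simps)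
    have eq: "\<phi> j (mu A [(k + l + i - 1, mu A [(k, x), (l, y), (i, z)])]) = D (P (W k l (\<phi> k x) (\<phi> l y) (\<phi> i z)))"
      "\<phi> j (mu A [(k + l, mu A [(k, x), (l, y)]), (i, z)]) = P (m (k + l) (P (m k (\<phi> k x) (\<phi> l y))) (\<phi> i z))"
      "\<phi> j (mu A [(k, x), (l + i, mu A [(l, y), (i, z)])]) = P (m k (\<phi> k x) (P (m l (\<phi> l y) (\<phi> i z))))"
      "\<phi> j (mu A [(k + 1, mu A [(k, x)]), (l, y), (i, z)]) = P (W (k + 1) l (D (\<phi> k x)) (\<phi> l y) (\<phi> i z))"
      "\<phi> j (mu A [(k, x), (l + 1, mu A [(l, y)]), (i, z)]) = P (W k (l + 1) (\<phi> k x) (D (\<phi> l y)) (\<phi> i z))"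
      "\<phi> j (mu A [(k, x), (l, y), (i + 1, mu A [(i, z)])]) = P (W k l (\<phi> k x) (\<phi> l y) (D (\<phi> i z)))"
      using mu1[OF xyz] mu2[OF xy z] mu2[OF x yz] mu3[OF dx y z] mu3[OF x dy z] mu3[OF x y dz]
        mu1[OF x] mu1[OF y] mu1[OF z] mu2[OF x y] mu2[OF y z] mu3[OF x y z]
      by (simp_all add: j_def algebra_simps)
    have "\<phi> j (insertion_sum A (mu A) xs) = 0"
      unfolding 3 u insertion_sum_3 using mem transferred_associativity[OF \<phi>_C[OF x] \<phi>_C[OF y] \<phi>_C[OF z]]
      by (simp only: \<phi>_diff \<phi>_add \<phi>_scale piece_closed eq) (simp only: algebra_simps)
    moreover have "insertion_sum A (mu A) xs \<in> piece A j"
      unfolding 3 u insertion_sum_3 using mem by (intro piece_closed)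
    ultimately show ?thesis using \<phi>_inj by blast
  next
    case (4 u v w t)
    obtain k x l y i z e r where u: "u = (k, x)" "v = (l, y)" "w = (i, z)" "t = (e, r)"
      by (cases u; cases v; cases w; cases t) force
    then have x: "x \<in> piece A k" and y: "y \<in> piece A l" and z: "z \<in> piece A i" and r: "r \<in> piece A e"
      using * 4 by simp_all
    define j where "j = k + l + i + e - 1"
    note xy = mu2_in[OF x y] and yz = mu2_in[OF y z] and zr = mu2_in[OF z r]
      and xyz = mu3_in[OF x y z] and yzr = mu3_in[OF y z r]
    have mem: "mu A [(k + l, mu A [(k, x), (l, y)]), (i, z), (e, r)] \<in> piece A j"
      "mu A [(k, x), (l + i, mu A [(l, y), (i, z)]), (e, r)] \<in> piece A j"
      "mu A [(k, x), (l, y), (i + e, mu A [(i, z), (e, r)])] \<in> piece A j"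
      "mu A [(k + l + i - 1, mu A [(k, x), (l, y), (i, z)]), (e, r)] \<in> piece A j"
      "mu A [(k, x), (l + i + e - 1, mu A [(l, y), (i, z), (e, r)])] \<in> piece A j"
      using mu3_in[OF xy z r] mu3_in[OF x yz r] mu3_in[OF x y zr] mu2_in[OF xyz r] mu2_in[OF x yzr]
      by (simp_all add: j_def algebra_simps)
    have eq: "\<phi> j (mu A [(k + l, mu A [(k, x), (l, y)]), (i, z), (e, r)]) =
        P (W (k + l) i (P (m k (\<phi> k x) (\<phi> l y))) (\<phi> i z) (\<phi> e r))"
      "\<phi> j (mu A [(k, x), (l + i, mu A [(l, y), (i, z)]), (e, r)]) =
        P (W k (l + i) (\<phi> k x) (P (m l (\<phi> l y) (\<phi> i z))) (\<phi> e r))"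
      "\<phi> j (mu A [(k, x), (l, y), (i + e, mu A [(i, z), (e, r)])]) =
        P (W k l (\<phi> k x) (\<phi> l y) (P (m i (\<phi> i z) (\<phi> e r))))"
      "\<phi> j (mu A [(k + l + i - 1, mu A [(k, x), (l, y), (i, z)]), (e, r)]) =
        P (m (k + l + i - 1) (P (W k l (\<phi> k x) (\<phi> l y) (\<phi> i z))) (\<phi> e r))"
      "\<phi> j (mu A [(k, x), (l + i + e - 1, mu A [(l, y), (i, z), (e, r)])]) =
        P (m k (\<phi> k x) (P (W l i (\<phi> l y) (\<phi> i z) (\<phi> e r))))"
      using mu3[OF xy z r] mu3[OF x yz r] mu3[OF x y zr] mu2[OF xyz r] mu2[OF x yzr]
        mu2[OF x y] mu2[OF y z] mu2[OF z r] mu3[OF x y z] mu3[OF y z r]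
      by (simp_all add: j_def algebra_simps)
    have "\<phi> j (insertion_sum A (mu A) xs) = 0"
      unfolding 4 u insertion_sum_4' using mem transferred_pentagon[OF \<phi>_C[OF x] \<phi>_C[OF y] \<phi>_C[OF z] \<phi>_C[OF r]]
      by (simp only: \<phi>_diff \<phi>_add \<phi>_scale piece_closed eq)
    moreover have "insertion_sum A (mu A) xs \<in> piece A j"
      using mem by (simp add: insertion_sum_4 4 u mu_higher piece_closed)
    ultimately show ?thesis using \<phi>_inj by blast
  next
    case 5
    show ?thesis
    proof (rule insertion_sum_zero)
      fix us ys vs assume s: "xs = us @ ys @ vs" "ys \<noteq> []"
      define w where "w = us @ (total_degree ys + 2 - int (length ys), mu A ys) # vs"
      have hom: "homogeneous (piece A) us" "homogeneous (piece A) ys" "homogeneous (piece A) vs"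
        using s(1) * by auto
      have len: "length us + length ys + length vs \<ge> 5" using 5 s by simp
      show "mu A (us @ (total_degree ys + 2 - int (length ys), mu A ys) # vs) = 0"
      proof (cases "length us + length vs + 1 > 3")
        case True
        then show ?thesis by (intro mu_higher) simp
      next
        case False
        then have "length us + length vs \<le> 2" by simp
        then have cases: "us = [] \<and> vs = [] \<or> (\<exists>a. us = [] \<and> vs = [a]) \<or> (\<exists>a. us = [a] \<and> vs = [])
          \<or> (\<exists>a b. us = [] \<and> vs = [a, b]) \<or> (\<exists>a b. us = [a] \<and> vs = [b]) \<or> (\<exists>a b. us = [a, b] \<and> vs = [])"
          by (cases us; cases vs; cases "tl us"; cases "tl vs") auto
        show ?thesis
        proof (cases "length ys = 3")
          case True
          then obtain k x l y i z where ys: "ys = [(k, x), (l, y), (i, z)]"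
            by (auto simp: length_Suc_conv numeral_3_eq_3)
          have "length us + length vs = 2" using True False len by simp
          then show ?thesis
            using cases hom \<phi>_mu3_I[of x k y l z i] mu3_in[of x k y l z i]
            by (auto simp: ys mu3_ideal total_degree_def algebra_simps)
        next
          case False
          then have "mu A ys = 0" using len \<open>length us + length vs \<le> 2\<close> by (intro mu_higher) simp
          then show ?thesis
            using cases hom mu3_ideal[OF piece_closed(5)] mu3_ideal[OF _ piece_closed(5)] mu3_ideal[OF _ _ piece_closed(5)]
            by (auto simp: I_closed)
        qed
      qed
    qed
  qed
qed

lemma g_zero_I:
  assumes "x \<in> piece A k" "y \<in> piece A l" and "\<phi> k x \<in> I k \<or> \<phi> l y \<in> I l"
  shows "g [(k, x), (l, y)] = 0"
  using assms(3) h_of_I_left[OF _ \<phi>_C[OF assms(2)]] h_of_I_right[OF \<phi>_C[OF assms(1)]] by auto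

text \<open>
  A nonzero summand has at most two blocks, of at most two entries each. This leaves the blocks of four
  arguments into two pairs, and there the product of two values of \<open>h\<close> is zero.
\<close>

lemma block_sum_g_zero:
  assumes hom: "homogeneous (piece A) xs" and len: "length xs \<ge> 4"
  shows "block_sum B g xs = 0"
proof (rule block_sum_zero)
  fix bs assume bs: "concat bs = xs" "[] \<notin> set bs"
  let ?f = "\<lambda>ys. (total_degree ys + 1 - int (length ys), g ys)"
  have "bs \<noteq> []" using bs len by auto
  then consider "length bs > 2" | b where "bs = [b]" | b c where "bs = [b, c]"
    by (cases bs; cases "tl bs"; cases "tl (tl bs)") auto
  then show "mu B (map ?f bs) = 0"
  proof cases
    case 1
    then show ?thesis by (intro mu_B_higher) simp
  next
    case 2
    then show ?thesis using bs len by (simp add: mu_B1)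
  next
    case 3
    then have bc: "xs = b @ c" using bs by simp
    show ?thesis
    proof (cases "length b = 2 \<and> length c = 2")
      case True
      then obtain k x l y i z e r where b: "b = [(k, x), (l, y)]" "c = [(i, z), (e, r)]"
        by (auto simp: length_Suc_conv numeral_2_eq_2)
      then have "x \<in> piece A k" "y \<in> piece A l" "z \<in> piece A i" "r \<in> piece A e"
        using hom bc by auto
      then have "h (m k (\<phi> k x) (\<phi> l y)) \<in> I (k + l - 1)" "h (m i (\<phi> i z) (\<phi> e r)) \<in> I (i + e - 1)"
        by (auto intro: h_in \<phi>_m_C)
      then show ?thesis using m_I_I 3 b by (simp add: mu_B2 total_degree_def m_minus)
    next
      case False
      then have "g b = 0 \<or> g c = 0" using bc len by (cases "length b > 2") auto
      then show ?thesis using 3 by (auto simp: mu_B2)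
    qed
  qed
qed

lemma ainf_map_g: "ainf_map A B g"
  unfolding ainf_map_def
proof (intro conjI allI impI)
  fix l :: nat assume "l \<ge> 1"
  then consider "l = 1" | "l = 2" | "l > 2" by linarith
  then show "graded_multilinear (piece A) (piece B) (1 - int l) l g"
  proof cases
    case 1
    then show ?thesis using graded_multilinear_1[of "piece A" g "piece B" 0]
      by (auto simp: piece_B \<phi>_C \<phi>_add \<phi>_scale)
  next
    case 2
    have "graded_multilinear (piece A) (piece B) (-1) 2 g"
      by (rule graded_multilinear_2)
        (auto simp: piece_B \<phi>_add \<phi>_scale m_linear h_add[OF \<phi>_m_C \<phi>_m_C] h_scale[OF \<phi>_m_C]
          intro!: C_closed h_C \<phi>_m_C)
    then show ?thesis using 2 by simp
  next
    case 3
    then show ?thesis by (intro graded_multilinear_zero) (auto simp: piece_B C_subspace)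
  qed
next
  fix xs assume *: "xs \<noteq> [] \<and> homogeneous (piece A) xs"
  then have "xs \<noteq> []" by simp
  then show "insertion_sum A g xs = block_sum B g xs"
  proof (cases rule: list_length_cases)
    case (1 u)
    then show ?thesis using * mu1 by (cases u) (auto simp: insertion_sum_1 block_sum_1 mu_B1)
  next
    case (2 u v)
    obtain k x l y where u: "u = (k, x)" "v = (l, y)" by (cases u; cases v) force
    then have x: "x \<in> piece A k" and y: "y \<in> piece A l" using * 2 by simp_all
    have xC: "\<phi> k x \<in> C k" and yC: "\<phi> l y \<in> C l" using x y by (auto intro: \<phi>_C)
    have c: "m (k + 1) (D (\<phi> k x)) (\<phi> l y) \<in> C (k + l + 1)" "m k (\<phi> k x) (D (\<phi> l y)) \<in> C (k + l + 1)"
      "h (m k (\<phi> k x) (\<phi> l y)) \<in> C (k + l - 1)"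
      using xC yC by (auto intro!: mem)
    show ?thesis
      using c
      by (simp add: 2 u insertion_sum_2 block_sum_2 mu_B1 mu_B2 mu1 mu2 x y P_def D_m[OF xC yC] D_minus[of _ "k + l - 1"]
          h_add[of _ "k + l + 1"] h_scale[of _ "k + l + 1"] C_closed)
  next
    case (3 u v w)
    obtain k x l y i z where u: "u = (k, x)" "v = (l, y)" "w = (i, z)" by (cases u; cases v; cases w) force
    then have x: "x \<in> piece A k" and y: "y \<in> piece A l" and z: "z \<in> piece A i" using * 3 by simp_all
    have "insertion_sum A g xs = block_sum B g xs \<longleftrightarrow>
      P (W k l (\<phi> k x) (\<phi> l y) (\<phi> i z)) - h (m (k + l) (P (m k (\<phi> k x) (\<phi> l y))) (\<phi> i z))
        + h (m k (\<phi> k x) (P (m l (\<phi> l y) (\<phi> i z))))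
      = m (k + l - 1) (h (m k (\<phi> k x) (\<phi> l y))) (\<phi> i z) - sgn_pow k *\<^sub>R m k (\<phi> k x) (h (m l (\<phi> l y) (\<phi> i z)))"
      by (simp add: 3 u insertion_sum_3 block_sum_3 mu_B1 mu_B2 mu_B_higher m_minus mu2 mu3 x y z)
    then show ?thesis
      by (simp add: P_W[OF \<phi>_C[OF x] \<phi>_C[OF y] \<phi>_C[OF z]])
  next
    case (4 u v w t)
    obtain k x l y i z e r where u: "u = (k, x)" "v = (l, y)" "w = (i, z)" "t = (e, r)"
      by (cases u; cases v; cases w; cases t) force
    then have x: "x \<in> piece A k" and y: "y \<in> piece A l" and z: "z \<in> piece A i" and r: "r \<in> piece A e"
      using * 4 by simp_all
    have "g [(k + l + i - 1, mu A [(k, x), (l, y), (i, z)]), (e, r)] = 0"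
      "g [(k, x), (l + i + e - 1, mu A [(l, y), (i, z), (e, r)])] = 0"
      using \<phi>_mu3_I[OF x y z] \<phi>_mu3_I[OF y z r] mu3_in[OF x y z] mu3_in[OF y z r] x r
      by (auto intro!: g_zero_I simp del: g_simps)
    then have "insertion_sum A g xs = 0"
      by (simp add: 4 u insertion_sum_4 mu_higher del: g_simps(3))
    then show ?thesis using block_sum_g_zero * 4 by simp
  next
    case 5
    have "insertion_sum A g xs = 0"
    proof (rule insertion_sum_zero)
      fix us ys vs assume s: "xs = us @ ys @ vs" "ys \<noteq> []"
      have len: "length us + length ys + length vs \<ge> 5" using 5 s by simp
      show "g (us @ (total_degree ys + 2 - int (length ys), mu A ys) # vs) = 0"
      proof (cases "length us + length vs + 1 > 2")
        case False
        then have "mu A ys = 0" using len by (intro mu_higher) simp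
        moreover have "us = [] \<and> vs = [] \<or> (\<exists>a. us = [] \<and> vs = [a]) \<or> (\<exists>a. us = [a] \<and> vs = [])"
          using False by (cases us; cases vs) auto
        ultimately show ?thesis by auto
      qed auto
    qed
    then show ?thesis using block_sum_g_zero * 5 by simp
  qed
qed

lemma cohomology_class_eq_iff_A:
  assumes "x \<in> piece A k" "y \<in> piece A k"
  shows "cohomology_class A k x = cohomology_class A k y \<longleftrightarrow> (\<exists>b\<in>piece A (k - 1). x = y + mu A [(k - 1, b)])"
proof
  assume eq: "cohomology_class A k x = cohomology_class A k y"
  have "x \<in> cohomology_class A k x"
    using piece_closed(5)[of "k - 1"] by (auto simp: cohomology_class_def intro!: exI[of _ 0])
  then show "\<exists>b\<in>piece A (k - 1). x = y + mu A [(k - 1, b)]"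
    unfolding eq by (auto simp: cohomology_class_def)
next
  assume "\<exists>b\<in>piece A (k - 1). x = y + mu A [(k - 1, b)]"
  then obtain b where b: "b \<in> piece A (k - 1)" "x = y + mu A [(k - 1, b)]" by blast
  have "x + mu A [(k - 1, c)] = y + mu A [(k - 1, b + c)]" "y + mu A [(k - 1, c)] = x + mu A [(k - 1, c + (- 1) *\<^sub>R b)]"
    if "c \<in> piece A (k - 1)" for c
    using b that mu1_linear(1)[of c "k - 1" "(- 1) *\<^sub>R b"] mu1_linear(2)[of b "k - 1" "-1"]
    by (simp_all add: mu1_linear piece_closed del: scaleR_minus1_left)
  moreover have "b + c \<in> piece A (k - 1)" "c + (- 1) *\<^sub>R b \<in> piece A (k - 1)" if "c \<in> piece A (k - 1)" for c
    using b that by (auto intro!: piece_closed)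
  ultimately show "cohomology_class A k x = cohomology_class A k y"
    unfolding cohomology_class_def by fast
qed

lemma cohomology_class_eq_iff_B:
  "cohomology_class B k x = cohomology_class B k y \<longleftrightarrow> (\<exists>b\<in>C (k - 1). x = y + D b)"
proof
  assume eq: "cohomology_class B k x = cohomology_class B k y"
  have "x \<in> cohomology_class B k x"
    using C_closed(5)[of "k - 1"] by (auto simp: cohomology_class_def piece_B mu_B1 intro!: exI[of _ 0])
  then show "\<exists>b\<in>C (k - 1). x = y + D b"
    unfolding eq by (auto simp: cohomology_class_def piece_B mu_B1)
next
  assume "\<exists>b\<in>C (k - 1). x = y + D b"
  then obtain b where b: "b \<in> C (k - 1)" "x = y + D b" by blast
  have "x + D c = y + D (b + c)" "y + D c = x + D (c - b)" "b + c \<in> C (k - 1)" "c - b \<in> C (k - 1)"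
    if "c \<in> C (k - 1)" for c
    using b that by (simp_all add: D_add D_diff C_closed)
  then show "cohomology_class B k x = cohomology_class B k y"
    unfolding cohomology_class_def piece_B mu_B1 by fast
qed

text \<open>
  On cohomology, \<open>P\<close> is inverse to the inclusion of \<open>S\<close>: a cocycle \<open>z\<close> differs from \<open>P z\<close> by \<open>D h z\<close>, and if
  an element of \<open>S\<close> is \<open>D z\<close>, then it is also \<open>D(P z)\<close>.
\<close>

lemma quasi_iso_g: "quasi_iso A B g"
  unfolding quasi_iso_def
proof (intro allI exI conjI ballI)
  fix k
  \<comment> \<open>The map induced on classes is defined by a choice of representatives.\<close>
  define \<psi> where "\<psi> X = cohomology_class B k (\<phi> k (SOME a. a \<in> piece A k \<and> X = cohomology_class A k a))" for X
  have \<psi>: "\<psi> (cohomology_class A k a) = cohomology_class B k (\<phi> k a)" if a: "a \<in> piece A k" for a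
  proof -
    define a' where "a' = (SOME a'. a' \<in> piece A k \<and> cohomology_class A k a = cohomology_class A k a')"
    have "a' \<in> piece A k \<and> cohomology_class A k a = cohomology_class A k a'"
      unfolding a'_def using a by (intro someI_ex[of "\<lambda>a'. a' \<in> piece A k \<and> cohomology_class A k a = cohomology_class A k a'"]) blast
    then obtain b where b: "b \<in> piece A (k - 1)" "a = a' + mu A [(k - 1, b)]" "a' \<in> piece A k"
      using cohomology_class_eq_iff_A a by blast
    then have "\<phi> k a = \<phi> k a' + D (\<phi> (k - 1) b)"
      using \<phi>_add[OF b(3), of "mu A [(k - 1, b)]"] mu1[OF b(1)] mu1_in[OF b(1)] by simp
    then have "cohomology_class B k (\<phi> k a) = cohomology_class B k (\<phi> k a')"
      using cohomology_class_eq_iff_B \<phi>_C[OF b(1)] by blast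
    then show ?thesis by (simp add: \<psi>_def a'_def)
  qed
  show "\<psi> (cohomology_class A k a) = cohomology_class B k (g [(k, a)])" if "a \<in> cocycles A k" for a
    using \<psi> that by (auto simp: cocycles_def)
  have boundary: "\<exists>b\<in>piece A (k - 1). a = mu A [(k - 1, b)]" if a: "a \<in> piece A k" and z: "z \<in> C (k - 1)" "\<phi> k a = D z" for a z
  proof -
    have hz: "D (h z) \<in> C (k - 1)" "h z \<in> C (k - 1 - 1)" using z by (auto intro!: mem)
    have Pz: "P z = z - D (h z) - h (D z)" by (simp add: P_def)
    have "h (D z) = 0" using \<phi>_S[OF a] z by (simp add: S_def)
    then have "D (P z) = D z" using z hz D_D[OF hz(2)] by (simp add: Pz D_diff)
    moreover obtain b where b: "b \<in> piece A (k - 1)" "\<phi> (k - 1) b = P z"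
      using P_in_S[OF z(1)] \<phi>_image by (metis imageE)
    ultimately have "\<phi> k (mu A [(k - 1, b)]) = \<phi> k a"
      using mu1[OF b(1)] z by simp
    then have "a = mu A [(k - 1, b)]" using \<phi>_eq[OF a, of "mu A [(k - 1, b)]"] mu1_in[OF b(1)] by simp
    then show ?thesis using b(1) by blast
  qed
  have inj: "cohomology_class A k a = cohomology_class A k a'"
    if a: "a \<in> piece A k" "a' \<in> piece A k" and eq: "cohomology_class B k (\<phi> k a) = cohomology_class B k (\<phi> k a')" for a a'
  proof -
    obtain z where z: "z \<in> C (k - 1)" "\<phi> k a = \<phi> k a' + D z"
      using eq cohomology_class_eq_iff_B by blast
    then have "\<phi> k (a - a') = D z" using a by (simp add: \<phi>_diff)
    then obtain b where "b \<in> piece A (k - 1)" "a - a' = mu A [(k - 1, b)]"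
      using boundary[OF piece_closed(2)[OF a] z(1)] by blast
    then show ?thesis using a by (auto simp: cohomology_class_eq_iff_A algebra_simps intro!: bexI[of _ b])
  qed
  have surj: "\<exists>a\<in>cocycles A k. cohomology_class B k z = cohomology_class B k (\<phi> k a)" if z: "z \<in> cocycles B k" for z
  proof -
    have z': "z \<in> C k" "D z = 0" using z by (auto simp: cocycles_def piece_B mu_B1)
    have hz: "h z \<in> C (k - 1)" using z' by (auto intro: mem)
    obtain a where a: "a \<in> piece A k" "\<phi> k a = P z"
      using P_in_S[OF z'(1)] \<phi>_image by (metis imageE)
    have "D (P z) = 0" using D_P[OF z'(1)] z' by simp
    then have "mu A [(k, a)] = 0" using \<phi>_inj[OF mu1_in[OF a(1)]] mu1[OF a(1)] a by simp
    moreover have "z = \<phi> k a + D (h z)" using z' a by (simp add: P_def)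
    ultimately show ?thesis
      using a hz by (intro bexI[of _ a]) (auto simp: cocycles_def cohomology_class_eq_iff_B)
  qed
  show "bij_betw \<psi> (cohomology A k) (cohomology B k)"
    unfolding bij_betw_def
  proof
    show "inj_on \<psi> (cohomology A k)"
    proof (rule inj_onI)
      fix X Y assume "X \<in> cohomology A k" "Y \<in> cohomology A k" and eq: "\<psi> X = \<psi> Y"
      then obtain a a' where "a \<in> piece A k" "a' \<in> piece A k" "X = cohomology_class A k a" "Y = cohomology_class A k a'"
        by (auto simp: cohomology_def cocycles_def)
      then show "X = Y" using inj[of a a'] eq \<psi>[of a] \<psi>[of a'] by metis
    qed
    have "\<phi> k a \<in> cocycles B k" if "a \<in> cocycles A k" for a
      using that mu1[of a k] by (auto simp: cocycles_def piece_B mu_B1 intro: \<phi>_C)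
    moreover have "\<psi> (cohomology_class A k a) = cohomology_class B k (\<phi> k a)" if "a \<in> cocycles A k" for a
      using that \<psi> by (simp add: cocycles_def)
    ultimately show "\<psi> ` cohomology A k = cohomology B k"
      using surj by (fastforce simp: cohomology_def image_image)
  qed
qed

lemma ainf_B: "ainf_algebra B"
  unfolding ainf_algebra_def
proof (intro conjI allI impI)
  show "subspace (piece B k)" for k by (simp add: piece_B C_subspace)
next
  fix l :: nat assume "l \<ge> 1"
  then consider "l = 1" | "l = 2" | "l > 2" by linarith
  then show "graded_multilinear (piece B) (piece B) (2 - int l) l (mu B)"
  proof cases
    case 1
    then show ?thesis using graded_multilinear_1[of "piece B" "mu B" "piece B" 1]
      by (simp add: piece_B mu_B1 D_in D_add D_scale)
  next
    case 2
    then show ?thesis using graded_multilinear_2[of "piece B" "mu B" "piece B" 0]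
      by (simp add: piece_B mu_B2 m_in m_linear)
  next
    case 3
    then show ?thesis by (intro graded_multilinear_zero mu_B_higher) (auto simp: piece_B C_subspace)
  qed
next
  fix xs assume *: "xs \<noteq> [] \<and> homogeneous (piece B) xs"
  then have "xs \<noteq> []" by simp
  then show "insertion_sum B (mu B) xs = 0"
  proof (cases rule: list_length_cases)
    case (1 u)
    then show ?thesis using * D_D by (cases u) (auto simp: insertion_sum_1 mu_B1 piece_B)
  next
    case (2 u v)
    then show ?thesis using * by (cases u; cases v) (auto simp: insertion_sum_2 mu_B1 mu_B2 piece_B D_m)
  next
    case (3 u v w)
    then show ?thesis using * by (cases u; cases v; cases w) (auto simp: insertion_sum_3 mu_B_higher mu_B1 mu_B2 piece_B m_assoc)
  next
    case (4 u v w t)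
    then show ?thesis by (cases u; cases v; cases w; cases t) (auto simp: insertion_sum_4 mu_B_higher mu_B1 mu_B2)
  next
    case 5
    show ?thesis
    proof (rule insertion_sum_zero)
      fix us ys vs assume s: "xs = us @ ys @ vs" "ys \<noteq> []"
      have len: "length us + length ys + length vs \<ge> 5" using 5 s by simp
      show "mu B (us @ (total_degree ys + 2 - int (length ys), mu B ys) # vs) = 0"
      proof (cases "length us + length vs + 1 > 2")
        case False
        then have "mu B ys = 0" using len by (intro mu_B_higher) simp
        moreover have "us = [] \<and> vs = [] \<or> (\<exists>a. us = [] \<and> vs = [a]) \<or> (\<exists>a. us = [a] \<and> vs = [])"
          using False by (cases us; cases vs) auto
        ultimately show ?thesis by (auto simp: mu_B1 mu_B2)
      qed (auto intro: mu_B_higher)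
    qed
  qed
qed

lemma ainf_equivalence_g: "ainf_equivalence A B g"
  by (simp add: ainf_equivalence_def ainf_A ainf_B ainf_map_g quasi_iso_g)

end

section \<open>The cone and the filtered forms\<close>

definition cone_wedge :: "int \<Rightarrow> ('a, 'b) form \<times> ('a, 'b) form \<Rightarrow> ('a, 'b) form \<times> ('a, 'b) form \<Rightarrow>
    ('a, 'b) form \<times> ('a, 'b) form" where
  "cone_wedge k z w = (fst z \<and>\<^sub>f fst w, snd z \<and>\<^sub>f fst w + sgn_pow k *\<^sub>R (fst z \<and>\<^sub>f snd w))"

definition cone_homotopy :: "nat \<Rightarrow> nat \<Rightarrow> ('a, 'b::euclidean_space) form \<Rightarrow>
    ('a, 'b) form \<times> ('a, 'b) form \<Rightarrow> ('a, 'b) form \<times> ('a, 'b) form" where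
  "cone_homotopy n p \<omega> z = (0, local_Linv n (p + 1) \<omega> (fst z))"

text \<open>
  The correspondence with the transferred structure. It is written with the pointwise operators, which
  depend on the symplectic form alone, and not on the atlas; so the same formula serves for all
  manifolds.
\<close>

definition to_cone :: "nat \<Rightarrow> nat \<Rightarrow> ('a, 'b::euclidean_space) form \<Rightarrow> int \<Rightarrow> ('a, 'b) form \<Rightarrow>
    ('a, 'b) form \<times> ('a, 'b) form" where
  "to_cone n p \<omega> k a = (if k \<le> int (n + p) then (a, - local_Linv n (p + 1) \<omega> (ext_d a)) else (0, - local_star n \<omega> a))"

text \<open>
  The components \<open>x\<close> and \<open>- h(x y)\<close> of the map for the transferred structure.
\<close>

definition natural_map :: "nat \<Rightarrow> nat \<Rightarrow> ('a, 'b::euclidean_space) form \<Rightarrow> (int \<times> ('a, 'b) form) list \<Rightarrow>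
    ('a, 'b) form \<times> ('a, 'b) form" where
  "natural_map n p \<omega> xs = (case xs of [(k, a)] \<Rightarrow> to_cone n p \<omega> k a
    | [(k, a), (l, b)] \<Rightarrow> - cone_homotopy n p \<omega> (cone_wedge k (to_cone n p \<omega> k a) (to_cone n p \<omega> l b))
    | _ \<Rightarrow> 0)"

lemma wedge_zero [simp]: "0 \<and>\<^sub>f \<xi> = 0" "\<eta> \<and>\<^sub>f 0 = 0"
  by (simp_all add: wedge_def fun_eq_iff)

lemma wedge_minus: "(- \<eta>) \<and>\<^sub>f \<xi> = - (\<eta> \<and>\<^sub>f \<xi>)" "\<eta> \<and>\<^sub>f (- \<xi>) = - (\<eta> \<and>\<^sub>f \<xi>)"
  for \<eta> \<xi> :: "('a, 'b) form"
  using wedge_linear(3)[of "-1" \<eta> \<xi>] wedge_linear(4)[of \<eta> "-1" \<xi>] by simp_all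

context symplectic_manifold
begin

interpretation lef: lefschetz_module forms Lef Lam n
  by (rule lefschetz_module_forms)

lemma forms_closed: "x \<in> forms k \<Longrightarrow> y \<in> forms k \<Longrightarrow> x + y \<in> forms k" "x \<in> forms k \<Longrightarrow> y \<in> forms k \<Longrightarrow> x - y \<in> forms k"
  "x \<in> forms k \<Longrightarrow> - x \<in> forms k" "x \<in> forms k \<Longrightarrow> r *\<^sub>R x \<in> forms k" "0 \<in> forms k"
  by (simp_all add: lef.V_closed)

lemma d_in: "x \<in> forms k \<Longrightarrow> j = k + 1 \<Longrightarrow> ext_d x \<in> forms j"
  using forms_ext_d by blast

lemma wedge_in: "x \<in> forms k \<Longrightarrow> y \<in> forms l \<Longrightarrow> j = k + l \<Longrightarrow> x \<and>\<^sub>f y \<in> forms j"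
  using forms_wedge by blast

lemma ext_d_minus: "x \<in> forms k \<Longrightarrow> ext_d (- x) = - ext_d x"
  using ext_d_scale[of x k "-1"] by simp

lemma ext_d_0 [simp]: "ext_d 0 = (0 :: ('a, 'b) form)"
  using ext_d_scale[of 0 0 0] forms_closed(5) by simp

lemma ext_d_Lef: "x \<in> forms k \<Longrightarrow> ext_d (Lef x) = Lef (ext_d x)"
  unfolding Lef_def using ext_d_wedge[OF two_form, of x k] closed by simp

lemma ext_d_Lef_pow: "x \<in> forms k \<Longrightarrow> ext_d ((Lef ^^ j) x) = (Lef ^^ j) (ext_d x)"
proof (induction j)
  case (Suc j)
  then show ?case using ext_d_Lef[OF lef.L_pow_in[OF Suc.prems refl]] by simp
qed simp

lemma Lef_pow_wedge_left: "(Lef ^^ j) (x \<and>\<^sub>f y) = (Lef ^^ j) x \<and>\<^sub>f y"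
  by (induction j) (simp_all add: Lef_def wedge_assoc)

lemma Lef_wedge_right: "Lef (x \<and>\<^sub>f y) = x \<and>\<^sub>f Lef y"
proof -
  have "parity (\<omega> c z) = \<omega> c z" for c z
    using alternating_form_parity[OF forms_alternating[OF two_form]] by simp
  then have "alt_wedge (\<omega> c z) (x c z) = alt_wedge (x c z) (\<omega> c z)" for c z
    by (rule alt_wedge_commute)
  then have "\<omega> \<and>\<^sub>f x = x \<and>\<^sub>f \<omega>" by (simp add: wedge_def)
  then show ?thesis unfolding Lef_def wedge_assoc[symmetric] by simp
qed

lemma Lef_pow_wedge_right: "(Lef ^^ j) (x \<and>\<^sub>f y) = x \<and>\<^sub>f (Lef ^^ j) y"
  by (induction j) (simp_all add: Lef_wedge_right)

lemma omega_pow_wedge: "(Lef ^^ p) \<omega> \<and>\<^sub>f x = (Lef ^^ (p + 1)) x"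
  using Lef_pow_wedge_left[of p \<omega> x] by (simp add: Lef_def[of x, symmetric] funpow_swap1)

subsection \<open>The components of the exterior derivative of a primitive form\<close>

text \<open>
  If \<open>u + L u' = 0\<close> with \<open>u\<close> and \<open>u'\<close> primitive, then applying \<open>\<Lambda>\<close> gives a nonzero multiple of \<open>u'\<close>, so that
  \<open>u' = 0\<close> and \<open>u = 0\<close>.
\<close>

lemma d_primitive_eqI:
  assumes "s \<le> n" "\<beta>' \<in> primitive (int s + 1)" "\<beta>'' \<in> primitive (int s - 1)" "ext_d \<beta> = \<beta>' + Lef \<beta>''"
  shows "d_primitive s \<beta> = (\<beta>', \<beta>'')"
proof -
  have prim: "primitive = lef.prim" by (intro ext) (simp add: primitive_def lef.prim_def)
  have unique: "x = y \<and> x' = y'"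
    if x: "x \<in> primitive (int s + 1)" "x' \<in> primitive (int s - 1)" and y: "y \<in> primitive (int s + 1)" "y' \<in> primitive (int s - 1)"
      and eq: "x + Lef x' = y + Lef y'" for x x' y y'
  proof -
    define u where "u = x - y"
    define u' where "u' = x' - y'"
    have u: "u \<in> lef.prim (int s + 1)" "u' \<in> lef.prim (int s - 1)"
      using x y lef.prim_closed(1)[of x "int s + 1" "(-1) *\<^sub>R y"] lef.prim_closed(1)[of x' "int s - 1" "(-1) *\<^sub>R y'"]
        lef.prim_closed(2)[of y "int s + 1" "-1"] lef.prim_closed(2)[of y' "int s - 1" "-1"]
      by (simp_all add: prim u_def u'_def)
    have "u + Lef u' = 0" using eq by (simp add: u_def u'_def lef.L_simps algebra_simps)
    then have L: "Lam (Lef u') = 0" using u(1) lef.\<Lambda>_simps(1)[of u "Lef u'"] by (simp add: lef.prim_def lef.\<Lambda>_simps)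
    have "real n - real s + 1 \<noteq> 0" using assms(1) by simp
    then have "u' = 0" using lef.\<Lambda>_L_pow_prim[OF u(2), of 1] L by auto
    then have "u = 0" using \<open>u + Lef u' = 0\<close> by (simp add: lef.L_simps)
    then show ?thesis using \<open>u' = 0\<close> by (simp add: u_def u'_def)
  qed
  show ?thesis
    unfolding d_primitive_def
  proof (rule the_equality)
    show "case (\<beta>', \<beta>'') of (\<beta>', \<beta>'') \<Rightarrow> \<beta>' \<in> primitive (int s + 1) \<and> \<beta>'' \<in> primitive (int s - 1) \<and> ext_d \<beta> = \<beta>' + \<omega> \<and>\<^sub>f \<beta>''"
      using assms(2-4) unfolding Lef_def prod.case by blast
  next
    fix z assume z: "case z of (\<beta>', \<beta>'') \<Rightarrow> \<beta>' \<in> primitive (int s + 1) \<and> \<beta>'' \<in> primitive (int s - 1) \<and> ext_d \<beta> = \<beta>' + \<omega> \<and>\<^sub>f \<beta>''"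
    obtain y y' where y: "z = (y, y')" by (cases z)
    have "y = \<beta>' \<and> y' = \<beta>''"
      using z unfolding y prod.case Lef_def[symmetric] assms(4) by (intro unique assms) auto
    then show "z = (\<beta>', \<beta>'')" by (simp add: y)
  qed
qed

lemma d_primitive_exists:
  assumes s: "s \<le> n" and \<beta>: "\<beta> \<in> primitive (int s)"
  obtains \<beta>' \<beta>'' where "d_primitive s \<beta> = (\<beta>', \<beta>'')" "\<beta>' \<in> primitive (int s + 1)" "\<beta>'' \<in> primitive (int s - 1)"
    "ext_d \<beta> = \<beta>' + Lef \<beta>''"
proof -
  have prim: "primitive = lef.prim" by (intro ext) (simp add: primitive_def lef.prim_def)
  have \<beta>_form: "\<beta> \<in> forms (int s)" using \<beta> by (simp add: primitive_def)
  have "(Lef ^^ (n - s + 1)) (ext_d \<beta>) = 0"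
    unfolding ext_d_Lef_pow[OF \<beta>_form, symmetric] using lef.L_pow_prim_zero[of \<beta> s "n - s + 1"] \<beta> s by (simp add: prim)
  then obtain \<beta>' \<beta>'' where b: "\<beta>' \<in> lef.prim (int s + 1)" "\<beta>'' \<in> lef.prim (int s - 1)" "ext_d \<beta> = \<beta>' + Lef \<beta>''"
    using lef.first_two_terms_suffice[OF forms_ext_d[OF \<beta>_form] s] by blast
  show ?thesis
    using that[of \<beta>' \<beta>''] d_primitive_eqI[OF s, of \<beta>' \<beta>'' \<beta>] b by (simp add: prim)
qed

text \<open>
  A filtered form of degree \<open>n + p\<close> is \<open>L\<^sup>p \<beta>\<close> with \<open>\<beta>\<close> primitive. With \<open>d \<beta> = b\<^sub>1 + L b\<^sub>2\<close>, the first term is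
  annihilated by \<open>L\<^sup>p\<close>, so \<open>d a = L\<^bsup>p+1\<^esup> b\<^sub>2\<close>, and \<open>b\<^sub>2\<close> is recovered by division. As \<open>d d a = 0\<close>, the form \<open>d b\<^sub>2\<close>
  is primitive, and the second-order operator takes \<open>L\<^sup>p \<beta>\<close> to \<open>L\<^sup>p d b\<^sub>2\<close>, whose reflection is \<open>d b\<^sub>2\<close>.
\<close>

lemma del_plus_del_minus:
  assumes p: "p \<le> n" and a: "a \<in> forms (int (n + p))" "Lef_inv (p + 1) a = 0"
  shows "del_plus (del_minus a) \<in> forms (int (n + p))" "Lef_inv (p + 1) (del_plus (del_minus a)) = 0"
    "star_r (del_plus (del_minus a)) = ext_d (Lef_inv (p + 1) (ext_d a))"
proof -
  have prim: "primitive = lef.prim" by (intro ext) (simp add: primitive_def lef.prim_def)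
  let ?s = "n - p"
  have "lef.Linv (p + 1) a = 0" using a(2) by (simp only: Lef_inv_eq)
  then have "a - (Lef ^^ (p + 1)) (lef.Linv (p + 1) a) = a" by (simp only: lef.L_pow_simps diff_zero)
  then obtain \<beta> where \<beta>: "\<beta> \<in> lef.prim (int ?s)" "a = (Lef ^^ p) \<beta>"
    using lef.lowest_term[OF p a(1)] by metis
  have d0: "d_primitive s 0 = (0, 0)" if "s \<le> n" for s
    using that by (intro d_primitive_eqI) (simp_all add: prim lef.prim_closed lef.L_simps)
  have Lef_pow_d0: "(Lef ^^ j) (fst (d_primitive s 0)) = 0 \<and> (Lef ^^ j) (snd (d_primitive s 0)) = 0" if "s \<le> n" for j s
    unfolding d0[OF that] fst_conv snd_conv by (simp only: lef.L_pow_simps)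
  obtain b1 b2 where b: "d_primitive ?s \<beta> = (b1, b2)" "b1 \<in> primitive (int ?s + 1)" "b2 \<in> primitive (int ?s - 1)" "ext_d \<beta> = b1 + Lef b2"
    using d_primitive_exists[of ?s \<beta>] \<beta> by (auto simp: prim)
  \<comment> \<open>The guard is there since the components of the derivative are unique only for \<open>s \<le> n\<close>.\<close>
  have dm: "del_minus a = (Lef ^^ p) b2"
  proof -
    have "del_minus a = (\<Sum>s\<le>n. \<Sum>j\<le>n - s. (\<lambda>j s x. if s \<le> n then (Lef ^^ j) (snd (d_primitive s x)) else 0) j s (lef.dec ((Lef ^^ p) \<beta>) j s))"
      unfolding del_minus_def lefschetz_eq \<beta>(2) by (intro sum.cong refl) simp
    also have "\<dots> = (if ?s \<le> n then (Lef ^^ p) (snd (d_primitive ?s \<beta>)) else 0)"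
      by (rule lef.sum_dec_gen[OF _ _ \<beta>(1)]) (use p in simp, use p in simp, use Lef_pow_d0 in metis)
    finally show ?thesis unfolding b(1) by simp
  qed
  have \<beta>_form: "\<beta> \<in> forms (int ?s)" and b2_form: "b2 \<in> forms (int ?s - 1)"
    using \<beta> b by (simp_all add: lef.prim_def primitive_def)
  have "(Lef ^^ p) b1 = 0" by (rule lef.L_pow_prim_zero_int[of b1 "int ?s + 1"]) (use b p in \<open>simp_all add: prim\<close>)
  moreover have "(Lef ^^ p) (Lef b2) = (Lef ^^ (p + 1)) b2" by (simp add: funpow_swap1)
  ultimately have da: "ext_d a = (Lef ^^ (p + 1)) b2"
    unfolding \<beta>(2) ext_d_Lef_pow[OF \<beta>_form] b(4) by (simp only: lef.L_pow_simps) simp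
  have Linv_da: "Lef_inv (p + 1) (ext_d a) = b2"
    unfolding da Lef_inv_eq using p by (intro lef.Linv_L_pow[OF b2_form]) simp
  have "\<exists>c\<in>lef.prim (int ?s). del_plus (del_minus a) = (Lef ^^ p) c \<and> ext_d b2 = c"
  \<comment> \<open>For \<open>p = n\<close> the form \<open>b\<^sub>2\<close> would have degree \<open>-1\<close>, outside the range of the decomposition.\<close>
  proof (cases "p = n")
    case True
    then have "b2 = 0" using forms_bounded[OF b2_form] by simp
    moreover have "del_plus 0 = 0"
      unfolding del_plus_def lefschetz_eq lef.dec_0 by (intro sum.neutral ballI) (simp add: d0 lef.L_pow_simps)
    ultimately show ?thesis unfolding dm by (intro bexI[of _ 0] lef.prim_closed) (simp add: lef.L_pow_simps)
  next
    case False
    let ?t = "n - p - 1"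
    have t: "int ?s - 1 = int ?t" "?t \<le> n" "p \<le> n - ?t" using False p by auto
    have b2: "b2 \<in> lef.prim (int ?t)" using b(3) unfolding t(1) prim .
    obtain c1 c2 where c: "d_primitive ?t b2 = (c1, c2)" "c1 \<in> primitive (int ?t + 1)" "c2 \<in> primitive (int ?t - 1)" "ext_d b2 = c1 + Lef c2"
      using d_primitive_exists[of ?t b2] b2 by (auto simp: prim)
    have "del_plus ((Lef ^^ p) b2) = (\<Sum>s\<le>n. \<Sum>j\<le>n - s. (\<lambda>j s x. if s \<le> n then (Lef ^^ j) (fst (d_primitive s x)) else 0) j s (lef.dec ((Lef ^^ p) b2) j s))"
      unfolding del_plus_def lefschetz_eq by (intro sum.cong refl) simp
    also have "\<dots> = (if ?t \<le> n then (Lef ^^ p) (fst (d_primitive ?t b2)) else 0)"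
      by (rule lef.sum_dec_gen[OF t(2,3) b2]) (use Lef_pow_d0 in metis)
    finally have dp: "del_plus (del_minus a) = (Lef ^^ p) c1" unfolding dm c(1) using t(2) by simp
    have c1: "c1 \<in> lef.prim (int ?s)" using c(2) t(1) by (simp add: prim)
    have c2: "c2 \<in> forms (int ?t - 1)" using c(3) by (simp add: primitive_def)
    have "0 = ext_d (ext_d a)" using ext_d_ext_d[OF a(1)] by simp
    also have "\<dots> = (Lef ^^ (p + 1)) (c1 + Lef c2)"
      unfolding da ext_d_Lef_pow[OF b2_form] c(4) ..
    also have "\<dots> = (Lef ^^ (p + 1)) c1 + (Lef ^^ (p + 2)) c2"
      unfolding lef.L_pow_simps by (simp add: funpow_swap1)
    also have "(Lef ^^ (p + 1)) c1 = 0"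
      by (rule lef.L_pow_prim_zero_int[OF c1]) (use p in simp)
    finally have "(Lef ^^ (p + 2)) c2 = 0" by (simp only: add_0_left)
    then have "c2 = 0" by (rule lef.L_pow_injective[OF c2, rotated]) (use False p in simp)
    then show ?thesis using c1 dp c(4) by (intro bexI[of _ c1]) (simp_all add: lef.L_simps)
  qed
  then obtain c where c: "c \<in> lef.prim (int ?s)" "del_plus (del_minus a) = (Lef ^^ p) c" "ext_d b2 = c" by blast
  show "del_plus (del_minus a) \<in> forms (int (n + p))"
    unfolding c(2) by (rule lef.L_pow_in[OF lef.prim_V[OF c(1)]]) (use p in simp)
  show "Lef_inv (p + 1) (del_plus (del_minus a)) = 0"
    unfolding c(2) Lef_inv_eq using lef.Linv_gen[OF _ _ c(1), of p "p + 1"] p by simp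
  show "star_r (del_plus (del_minus a)) = ext_d (Lef_inv (p + 1) (ext_d a))"
    unfolding c(2) Linv_da c(3) star_r_eq using lef.star_gen[OF _ _ c(1), of p] p by simp
qed

end

context symplectic_manifold
begin

interpretation lef: lefschetz_module forms Lef Lam n
  by (rule lefschetz_module_forms)

definition cone_diff :: "nat \<Rightarrow> ('a, 'b) form \<times> ('a, 'b) form \<Rightarrow> ('a, 'b) form \<times> ('a, 'b) form" where
  "cone_diff p z = (ext_d (fst z) + (Lef ^^ (p + 1)) (snd z), - ext_d (snd z))"

definition cone_ideal :: "nat \<Rightarrow> int \<Rightarrow> (('a, 'b) form \<times> ('a, 'b) form) set" where
  "cone_ideal p k = {0} \<times> forms (k - 2 * int p - 1)"

abbreviation cone_piece :: "nat \<Rightarrow> int \<Rightarrow> (('a, 'b) form \<times> ('a, 'b) form) set" where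
  "cone_piece p k \<equiv> forms k \<times> forms (k - 2 * int p - 1)"

lemma local_Linv_forms: "\<eta> \<in> forms k \<Longrightarrow> local_Linv n q \<omega> \<eta> = lef.Linv q \<eta>"
  by (rule local_eq)

lemma dga_contraction_cone:
  "dga_contraction (cone_piece p) (cone_ideal p) (cone_diff p) (cone_homotopy n p \<omega>) cone_wedge"
proof
  fix k
  show "subspace (cone_piece p k)" by (intro subspace_Times forms_subspace)
  show "subspace (cone_ideal p k)" unfolding cone_ideal_def by (intro subspace_Times forms_subspace subspace_single_0)
  show "cone_ideal p k \<subseteq> cone_piece p k" using forms_closed(5) by (auto simp: cone_ideal_def)
next
  fix x k and j :: int assume x: "x \<in> cone_piece p k" and j: "j = k + 1"
  show "cone_diff p x \<in> cone_piece p j"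
    using x unfolding j cone_diff_def
    by (auto intro!: forms_closed(1,3) d_in lef.L_pow_in[of _ "k - 2 * int p - 1"] simp del: funpow.simps)
next
  fix x y k assume "x \<in> cone_piece p k" "y \<in> cone_piece p k"
  then show "cone_diff p (x + y) = cone_diff p x + cone_diff p y"
    "cone_homotopy n p \<omega> (x + y) = cone_homotopy n p \<omega> x + cone_homotopy n p \<omega> y"
    by (auto simp: cone_diff_def cone_homotopy_def ext_d_add[of _ k _ k] ext_d_add[of _ "k - 2 * int p - 1" _ "k - 2 * int p - 1"] lef.L_pow_simps
        local_Linv_forms[of _ k] forms_closed lef.Linv_add[of _ k _ k] simp del: funpow.simps)
next
  fix x k and r :: real assume "x \<in> cone_piece p k"
  then show "cone_diff p (r *\<^sub>R x) = r *\<^sub>R cone_diff p x"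
    "cone_homotopy n p \<omega> (r *\<^sub>R x) = r *\<^sub>R cone_homotopy n p \<omega> x"
    by (auto simp: cone_diff_def cone_homotopy_def ext_d_scale[of _ k] ext_d_scale[of _ "k - 2 * int p - 1"] lef.L_pow_simps
        local_Linv_forms[of _ k] forms_closed lef.Linv_scale[of _ k] scaleR_add_right simp del: funpow.simps)
next
  fix x k assume "x \<in> cone_piece p k"
  then obtain a b where x: "x = (a, b)" "a \<in> forms k" "b \<in> forms (k - 2 * int p - 1)" by auto
  have "(Lef ^^ (p + 1)) b \<in> forms (k + 1)" by (rule lef.L_pow_in[OF x(3)]) simp
  then show "cone_diff p (cone_diff p x) = 0"
    unfolding cone_diff_def x(1) using ext_d_add[OF forms_ext_d[OF x(2)], of "(Lef ^^ (p + 1)) b" "k + 1"] x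
    by (simp add: ext_d_ext_d[of _ k] ext_d_ext_d[of _ "k - 2 * int p - 1"] ext_d_minus[OF forms_ext_d[OF x(3)]]
        ext_d_Lef_pow[OF x(3)] lef.L_pow_simps zero_prod_def del: funpow.simps)
next
  fix x y k l and j :: int assume "x \<in> cone_piece p k" "y \<in> cone_piece p l" and j: "j = k + l"
  then have "fst x \<and>\<^sub>f fst y \<in> forms (k + l)" "snd x \<and>\<^sub>f fst y \<in> forms (k + l - 2 * int p - 1)"
    "fst x \<and>\<^sub>f snd y \<in> forms (k + l - 2 * int p - 1)"
    by (auto intro: wedge_in)
  then show "cone_wedge k x y \<in> cone_piece p j"
    unfolding cone_wedge_def j by (auto intro!: forms_closed(1,4))
next
  fix k x x' y y' and r :: real
  show "cone_wedge k (x + x') y = cone_wedge k x y + cone_wedge k x' y" "cone_wedge k x (y + y') = cone_wedge k x y + cone_wedge k x y'"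
    "cone_wedge k (r *\<^sub>R x) y = r *\<^sub>R cone_wedge k x y" "cone_wedge k x (r *\<^sub>R y) = r *\<^sub>R cone_wedge k x y"
    by (auto simp: cone_wedge_def wedge_linear scaleR_add_right)
next
  fix x y z k l i and kl :: int assume "x \<in> cone_piece p k" "y \<in> cone_piece p l" "z \<in> cone_piece p i" "kl = k + l"
  then show "cone_wedge kl (cone_wedge k x y) z = cone_wedge k x (cone_wedge l y z)"
    by (auto simp: cone_wedge_def wedge_linear wedge_assoc sgn_pow_add scaleR_add_right)
next
  fix x y k l assume "x \<in> cone_piece p k" "y \<in> cone_piece p l"
  then obtain a b a' b' where x: "x = (a, b)" "a \<in> forms k" "b \<in> forms (k - 2 * int p - 1)"
    and y: "y = (a', b')" "a' \<in> forms l" "b' \<in> forms (l - 2 * int p - 1)" by auto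
  have s: "sgn_pow (k - 2 * int p) = sgn_pow k" by (simp add: sgn_pow_def)
  have c: "b \<and>\<^sub>f a' \<in> forms (k + l - 2 * int p - 1)" "a \<and>\<^sub>f b' \<in> forms (k + l - 2 * int p - 1)"
    using x y by (auto intro: wedge_in)
  have d: "ext_d (b \<and>\<^sub>f a' + sgn_pow k *\<^sub>R (a \<and>\<^sub>f b')) =
      (ext_d b \<and>\<^sub>f a' - sgn_pow k *\<^sub>R (b \<and>\<^sub>f ext_d a')) + sgn_pow k *\<^sub>R (ext_d a \<and>\<^sub>f b' + sgn_pow k *\<^sub>R (a \<and>\<^sub>f ext_d b'))"
    using ext_d_add[OF c(1) forms_closed(4)[OF c(2)]] ext_d_scale[OF c(2)] ext_d_wedge[OF x(3) y(2)] ext_d_wedge[OF x(2) y(3)]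
    by (simp add: s)
  have L: "(Lef ^^ (p + 1)) (b \<and>\<^sub>f a' + sgn_pow k *\<^sub>R (a \<and>\<^sub>f b')) =
      (Lef ^^ (p + 1)) b \<and>\<^sub>f a' + sgn_pow k *\<^sub>R (a \<and>\<^sub>f (Lef ^^ (p + 1)) b')"
    by (simp only: lef.L_pow_simps Lef_pow_wedge_left[symmetric] Lef_pow_wedge_right[symmetric])
  show "cone_diff p (cone_wedge k x y) = cone_wedge (k + 1) (cone_diff p x) y + sgn_pow k *\<^sub>R cone_wedge k x (cone_diff p y)"
    unfolding cone_diff_def cone_wedge_def x(1) y(1) fst_conv snd_conv d L ext_d_wedge[OF x(2) y(2)]
    using Lef_pow_wedge_left[of "p + 1" b b'] Lef_pow_wedge_right[of "p + 1" b b']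
    by (simp add: wedge_linear wedge_minus scaleR_add_right scaleR_diff_right del: funpow.simps)
next
  fix x y k l and j :: int assume "x \<in> cone_ideal p k" "y \<in> cone_piece p l" "j = k + l"
  then show "cone_wedge k x y \<in> cone_ideal p j"
    by (auto simp: cone_wedge_def cone_ideal_def intro!: wedge_in[of _ "k - 2 * int p - 1" _ l])
next
  fix x y k l and j :: int assume "x \<in> cone_piece p k" "y \<in> cone_ideal p l" "j = k + l"
  then show "cone_wedge k x y \<in> cone_ideal p j"
    by (auto simp: cone_wedge_def cone_ideal_def intro!: forms_closed(4) wedge_in[of _ k])
next
  fix x y k l assume "x \<in> cone_ideal p k" "y \<in> cone_ideal p l"
  then show "cone_wedge k x y = 0"
    by (auto simp: cone_wedge_def cone_ideal_def zero_prod_def)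
next
  fix x k and j :: int assume "x \<in> cone_piece p k" "j = k - 1"
  then show "cone_homotopy n p \<omega> x \<in> cone_ideal p j"
    by (auto simp: cone_homotopy_def cone_ideal_def local_Linv_forms[of _ k] intro!: lef.Linv_in[of _ k])
next
  fix x k assume "x \<in> cone_ideal p k"
  then show "cone_homotopy n p \<omega> x = 0"
    using local_Linv_forms[OF forms_closed(5)] by (auto simp: cone_homotopy_def cone_ideal_def zero_prod_def)
next
  fix x k assume "x \<in> cone_piece p k"
  then have a: "fst x \<in> forms k" by auto
  have "(Lef ^^ (p + 1)) (lef.Linv (p + 1) (fst x)) \<in> forms k"
    by (rule lef.L_pow_in[OF lef.Linv_in[OF a refl]]) simp
  then show "cone_homotopy n p \<omega> (cone_diff p (cone_homotopy n p \<omega> x)) = cone_homotopy n p \<omega> x"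
    by (simp add: cone_homotopy_def cone_diff_def local_Linv_forms[of _ k] a lef.Linv_L_pow_Linv[OF a] del: funpow.simps)
qed

subsection \<open>Multiplication and division by the power of the symplectic form\<close>

definition Lp :: "nat \<Rightarrow> ('a, 'b) form \<Rightarrow> ('a, 'b) form" where
  "Lp p = Lef ^^ (p + 1)"

definition Li :: "nat \<Rightarrow> ('a, 'b) form \<Rightarrow> ('a, 'b) form" where
  "Li p = lef.Linv (p + 1)"

lemma Lef_inv_Li: "Lef_inv (p + 1) = Li p" "Lef_inv (Suc p) = Li p"
  by (simp_all add: Li_def Lef_inv_eq)

lemma Lp_simps: "Lp p (x + y) = Lp p x + Lp p y" "Lp p (x - y) = Lp p x - Lp p y" "Lp p (- x) = - Lp p x"
  "Lp p 0 = 0" "Lp p (r *\<^sub>R x) = r *\<^sub>R Lp p x"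
  unfolding Lp_def by (rule lef.L_pow_simps)+

lemma Lp_in: "x \<in> forms k \<Longrightarrow> j = k + 2 * int p + 2 \<Longrightarrow> Lp p x \<in> forms j"
  unfolding Lp_def by (rule lef.L_pow_in) simp_all

lemma Li_in: "x \<in> forms k \<Longrightarrow> j = k - 2 * int p - 2 \<Longrightarrow> Li p x \<in> forms j"
  unfolding Li_def by (rule lef.Linv_in) simp_all

lemma Li_linear: "x \<in> forms k \<Longrightarrow> y \<in> forms l \<Longrightarrow> Li p (x + y) = Li p x + Li p y"
  "x \<in> forms k \<Longrightarrow> y \<in> forms l \<Longrightarrow> Li p (x - y) = Li p x - Li p y" "x \<in> forms k \<Longrightarrow> Li p (- x) = - Li p x"
  "Li p 0 = 0"
  unfolding Li_def by (rule lef.Linv_add lef.Linv_diff lef.Linv_minus lef.Linv_0; assumption)+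

lemma Li_Lp_Li: "x \<in> forms k \<Longrightarrow> Li p (Lp p (Li p x)) = Li p x"
  unfolding Li_def Lp_def by (rule lef.Linv_L_pow_Linv)

lemma Lp_Li_high: "x \<in> forms k \<Longrightarrow> k > int (n + p) \<Longrightarrow> Lp p (Li p x) = x"
  unfolding Li_def Lp_def by (rule lef.L_pow_Linv) auto

lemma Li_Lp_low: "x \<in> forms k \<Longrightarrow> k \<le> int n - int p - 1 \<Longrightarrow> Li p (Lp p x) = x"
  unfolding Li_def Lp_def by (rule lef.Linv_L_pow) auto

lemma star_Lp: "x \<in> forms k \<Longrightarrow> lef.star (Lp p x) = Li p (lef.star x)"
  unfolding Li_def Lp_def by (rule lef.star_L_pow)

lemma Lp_star_Li: "x \<in> forms k \<Longrightarrow> Lp p (lef.star x) = lef.star (Li p x)"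
  unfolding Li_def Lp_def by (rule lef.L_pow_star)

lemma star_high_in: "a \<in> forms (2 * int n + 2 * int p + 1 - k) \<Longrightarrow> lef.star a \<in> forms (k - 2 * int p - 1)"
  by (rule lef.star_in) auto

lemma ext_d_Lp: "x \<in> forms k \<Longrightarrow> ext_d (Lp p x) = Lp p (ext_d x)"
  unfolding Lp_def by (rule ext_d_Lef_pow)

lemma Lp_wedge_left: "Lp p (x \<and>\<^sub>f y) = Lp p x \<and>\<^sub>f y" and Lp_wedge_right: "Lp p (x \<and>\<^sub>f y) = x \<and>\<^sub>f Lp p y"
  unfolding Lp_def by (rule Lef_pow_wedge_left, rule Lef_pow_wedge_right)

subsection \<open>The filtered forms as a subcomplex of the cone\<close>

lemma Proj_eq: "Proj p \<eta> = \<eta> - Lp p (Li p \<eta>)"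
  by (simp only: Proj_def Lef_inv_Li Lp_def)

lemma Proj_in: assumes "\<eta> \<in> forms k" shows "Proj p \<eta> \<in> forms k"
  unfolding Proj_eq by (rule forms_closed(2)[OF assms Lp_in[OF Li_in[OF assms refl]]]) simp

lemma Li_Proj: assumes "\<eta> \<in> forms k" shows "Li p (Proj p \<eta>) = 0"
  unfolding Proj_eq using Li_linear(2)[OF assms Lp_in[OF Li_in[OF assms refl] refl]] Li_Lp_Li[OF assms] by simp

text \<open>
  As \<open>L\<^bsup>-q\<^esup> L\<^sup>q L\<^bsup>-q\<^esup> = L\<^bsup>-q\<^esup>\<close>, the operator \<open>\<Pi>\<^sup>p = 1 - L\<^bsup>p+1\<^esup> L\<^bsup>-(p+1)\<^esup>\<close> is the projection onto the kernel of
  \<open>L\<^bsup>-(p+1)\<^esup>\<close>.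
\<close>

lemma filtered_forms_eq: "filtered_forms p k = {a \<in> forms k. Li p a = 0}"
proof
  show "filtered_forms p k \<subseteq> {a \<in> forms k. Li p a = 0}"
    using Proj_in Li_Proj by (auto simp: filtered_forms_def)
  have "a = Proj p a" if "Li p a = 0" for a
    unfolding Proj_eq that Lp_simps by simp
  then show "{a \<in> forms k. Li p a = 0} \<subseteq> filtered_forms p k"
    unfolding filtered_forms_def by blast
qed

lemma filtered_forms_zero: "0 \<in> filtered_forms p k"
  by (simp add: filtered_forms_eq forms_closed Li_linear)

lemma filtered_forms_below: "k < 0 \<Longrightarrow> filtered_forms p k = {0}"
  using forms_bounded[of _ k] filtered_forms_zero by (auto simp: filtered_forms_eq)

text \<open>
  The degrees outside \<open>0 \<le> j \<le> 2n + 2p + 1\<close> are covered too, for forms of negative degree are zero.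
\<close>

lemma filtered_piece_eq: "filtered_piece p j = filtered_forms p (if j \<le> int (n + p) then j else int (2*n + 2*p + 1) - j)"
  using filtered_forms_below[of j p] filtered_forms_below[of "int (2*n + 2*p + 1) - j" p] by (auto simp: filtered_piece_def)

lemma filtered_piece_low: "j \<le> int (n + p) \<Longrightarrow> a \<in> filtered_piece p j \<longleftrightarrow> a \<in> forms j \<and> Li p a = 0"
  by (simp add: filtered_piece_eq filtered_forms_eq)

lemma filtered_piece_high: "j > int (n + p) \<Longrightarrow>
  a \<in> filtered_piece p j \<longleftrightarrow> a \<in> forms (2 * int n + 2 * int p + 1 - j) \<and> Li p a = 0"
  by (simp add: filtered_piece_eq filtered_forms_eq algebra_simps)

lemma filtered_piece_below: "a \<in> filtered_piece p j \<Longrightarrow> j < 0 \<Longrightarrow> a = 0"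
  by (simp add: filtered_piece_def)

lemma Linv_zero_high: "\<eta> \<in> forms k \<Longrightarrow> k > int (n + p) \<Longrightarrow> Li p \<eta> = 0 \<Longrightarrow> \<eta> = 0"
  using Lp_Li_high[of \<eta> k p] by (simp add: Lp_simps)

lemma Linv_L_pow_low:
  assumes "\<xi> \<in> forms (k - 2 * int p - 1)" "k \<le> int (n + p)"
  shows "Li p (Lp p \<xi>) = \<xi>"
  by (rule Li_Lp_low[OF assms(1)]) (use assms(2) in simp)

subsection \<open>The operations are the transferred ones\<close>

lemma to_cone_low:
  assumes "a \<in> filtered_piece p k" "k \<le> int (n + p)"
  shows "to_cone n p \<omega> k a = (a, - Li p (ext_d a))"
  using assms filtered_piece_low[of k p a] local_Linv_forms[OF forms_ext_d, of a k "p + 1"] by (simp add: to_cone_def Li_def)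

lemma to_cone_high:
  assumes "a \<in> filtered_piece p k" "k > int (n + p)"
  shows "to_cone n p \<omega> k a = (0, - lef.star a)"
  using assms filtered_piece_high[of p k a] local_eq(2)[of a "2 * int n + 2 * int p + 1 - k"] by (simp add: to_cone_def)

context
  fixes p :: nat
  assumes p: "p \<le> n"
begin

interpretation dg: dga_contraction "cone_piece p" "cone_ideal p" "cone_diff p" "cone_homotopy n p \<omega>" cone_wedge
  by (rule dga_contraction_cone)

lemma cone_homotopy_eq: "\<eta> \<in> forms k \<Longrightarrow> cone_homotopy n p \<omega> (\<eta>, \<xi>) = (0, Li p \<eta>)"
  by (simp add: cone_homotopy_def local_Linv_forms Li_def)

lemma cone_diff_eq: "cone_diff p (\<eta>, \<xi>) = (ext_d \<eta> + Lp p \<xi>, - ext_d \<xi>)"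
  by (simp only: cone_diff_def fst_conv snd_conv Lp_def)

lemma cone_diff_fst_in: "\<eta> \<in> forms k \<Longrightarrow> \<xi> \<in> forms (k - 2 * int p - 1) \<Longrightarrow> ext_d \<eta> + Lp p \<xi> \<in> forms (k + 1)"
  using forms_closed(1)[OF forms_ext_d Lp_in[of \<xi> "k - 2 * int p - 1" "k + 1" p]] by simp

lemma S_iff: "(\<eta>, \<xi>) \<in> dg.S k \<longleftrightarrow> \<eta> \<in> forms k \<and> \<xi> \<in> forms (k - 2 * int p - 1) \<and> Li p \<eta> = 0 \<and> Li p (ext_d \<eta> + Lp p \<xi>) = 0"
  unfolding dg.S_def
  using cone_diff_fst_in[of \<eta> k \<xi>] by (auto simp: cone_diff_eq cone_homotopy_eq[of _ k] cone_homotopy_eq[of _ "k + 1"] zero_prod_def)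

text \<open>
  In these degrees the second component can be divided: \<open>L\<^bsup>-(p+1)\<^esup> L\<^bsup>p+1\<^esup> \<xi> = \<xi>\<close>. Hence the elements of \<open>S\<close> can
  be compared by their first components.
\<close>

lemma S_low: assumes "(\<eta>, \<xi>) \<in> dg.S k" "k \<le> int (n + p)" shows "\<xi> = - Li p (ext_d \<eta>)"
proof -
  have *: "\<eta> \<in> forms k" "\<xi> \<in> forms (k - 2 * int p - 1)" "Li p (ext_d \<eta> + Lp p \<xi>) = 0" using assms(1) by (auto simp: S_iff)
  have "Li p (ext_d \<eta> + Lp p \<xi>) = Li p (ext_d \<eta>) + \<xi>"
    using Li_linear(1)[OF forms_ext_d[OF *(1)] Lp_in[OF *(2) refl]] Linv_L_pow_low[OF *(2) assms(2)] by simp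
  then show ?thesis using *(3) by (simp add: eq_neg_iff_add_eq_0 add.commute)
qed

lemma S_low_eq:
  assumes "x \<in> dg.S k" "k \<le> int (n + p)" shows "fst x \<in> filtered_piece p k" "to_cone n p \<omega> k (fst x) = x"
proof -
  obtain \<eta> \<xi> where x: "x = (\<eta>, \<xi>)" by (cases x)
  show "fst x \<in> filtered_piece p k"
    using assms by (simp add: x S_iff filtered_piece_low)
  from to_cone_low[OF this assms(2)] show "to_cone n p \<omega> k (fst x) = x"
    using S_low[OF assms(1)[unfolded x] assms(2)] by (simp add: x)
qed

lemma P_fst: "\<eta> \<in> forms k \<Longrightarrow> fst (dg.P (\<eta>, \<xi>)) = Proj p \<eta>"
  by (simp add: dg.P_def cone_homotopy_eq cone_diff_eq Proj_eq) (simp add: cone_homotopy_def)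

lemma P_snd:
  assumes "\<eta> \<in> forms k" "\<xi> \<in> forms (k - 2 * int p - 1)"
  shows "snd (dg.P (\<eta>, \<xi>)) = \<xi> + ext_d (Li p \<eta>) - Li p (ext_d \<eta> + Lp p \<xi>)"
  unfolding dg.P_def cone_diff_eq cone_homotopy_eq[OF assms(1)] cone_homotopy_eq[OF cone_diff_fst_in[OF assms]] by simp

lemma P_ideal: assumes "\<xi> \<in> forms (k - 2 * int p - 1)" shows "dg.P (0, \<xi>) = (0, \<xi> - Li p (Lp p \<xi>))"
  using P_fst[OF forms_closed(5), of \<xi>] P_snd[OF forms_closed(5) assms]
  by (intro prod_eqI) (simp_all add: Proj_eq Lp_simps Li_linear)

text \<open>
  Conjugation by the reflection exchanges the projection onto the kernel of \<open>L\<^bsup>-(p+1)\<^esup>\<close> with the one onto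
  the kernel of \<open>L\<^bsup>p+1\<^esup>\<close>, which is how \<open>P\<close> acts on the multiples of \<open>\<theta>\<close>.
\<close>

lemma star_Proj_star: assumes "y \<in> forms k" shows "lef.star (Proj p (lef.star y)) = y - Li p (Lp p y)"
proof -
  have "lef.star (Lp p (Li p (lef.star y))) = Li p (lef.star (lef.star (Lp p y)))"
    using star_Lp[OF Li_in[OF lef.star_in[OF assms refl] refl], where p = p] star_Lp[OF assms] by simp
  then have "lef.star (Lp p (Li p (lef.star y))) = Li p (Lp p y)"
    using lef.star_star[OF Lp_in[OF assms refl]] by simp
  then show ?thesis
    unfolding Proj_eq lef.star_diff[OF lef.star_in[OF assms refl] Lp_in[OF Li_in[OF lef.star_in[OF assms refl] refl] refl]] lef.star_star[OF assms]
    by simp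
qed

lemma Lp_star: assumes "a \<in> filtered_piece p k" "k > int (n + p)" shows "Lp p (lef.star a) = 0"
  using assms Lp_star_Li[of a "2 * int n + 2 * int p + 1 - k" p] by (simp add: filtered_piece_high)

text \<open>
  Every operation with values in barred forms is \<open>\<Pi>\<^sup>p *\<^sub>r y\<close> for some form \<open>y\<close>, or \<open>*\<^sub>r y\<close> if
  \<open>\<omega>\<^bsup>p+1\<^esup> \<and> y = 0\<close> already.
\<close>

lemma barred:
  assumes y: "y \<in> forms (k - 2 * int p - 1)" and k: "k > int (n + p)"
  shows "Proj p (lef.star y) \<in> filtered_piece p k" "to_cone n p \<omega> k (Proj p (lef.star y)) = (0, - (y - Li p (Lp p y)))"
proof -
  have s: "lef.star y \<in> forms (2 * int n + 2 * int p + 1 - k)" by (rule lef.star_in[OF y]) simp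
  show 1: "Proj p (lef.star y) \<in> filtered_piece p k"
    using Proj_in[OF s] Li_Proj[OF s] k by (simp add: filtered_piece_high)
  show "to_cone n p \<omega> k (Proj p (lef.star y)) = (0, - (y - Li p (Lp p y)))"
    using to_cone_high[OF 1 k] star_Proj_star[OF y] by simp
qed

lemma barred_kernel:
  assumes y: "y \<in> forms (k - 2 * int p - 1)" "Lp p y = 0" and k: "k > int (n + p)"
  shows "lef.star y \<in> filtered_piece p k" "to_cone n p \<omega> k (lef.star y) = (0, - y)"
proof -
  have "Li p (lef.star y) = 0" using star_Lp[OF y(1), of p] y(2) by simp
  then have "Proj p (lef.star y) = lef.star y" unfolding Proj_eq Lp_simps by (simp only: Lp_simps diff_zero)
  then show "lef.star y \<in> filtered_piece p k" "to_cone n p \<omega> k (lef.star y) = (0, - y)"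
    using barred[OF y(1) k] y(2) by (simp_all add: Li_linear)
qed

text \<open>
  Up to degree \<open>n + p\<close>, an element of \<open>S\<close> is determined by its first component, which is filtered. In
  higher degrees division by \<open>\<omega>\<^bsup>p+1\<^esup>\<close> is injective, so that the conditions defining \<open>S\<close> say that the first
  component is zero and the second one is annihilated by \<open>\<omega>\<^bsup>p+1\<^esup>\<close>.
\<close>

lemma to_cone_image: "to_cone n p \<omega> k ` filtered_piece p k = dg.S k"
proof (cases "k \<le> int (n + p)")
  case True
  show ?thesis
  proof
    show "to_cone n p \<omega> k ` filtered_piece p k \<subseteq> dg.S k"
    proof
      fix x assume "x \<in> to_cone n p \<omega> k ` filtered_piece p k"
      then obtain a where a: "a \<in> filtered_piece p k" "x = (a, - Li p (ext_d a))" using to_cone_low True by force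
      then have f: "a \<in> forms k" "Li p a = 0" using True by (simp_all add: filtered_piece_low)
      have d: "ext_d a \<in> forms (k + 1)" by (rule forms_ext_d[OF f(1)])
      have "Li p (ext_d a + Lp p (- Li p (ext_d a))) = Li p (Proj p (ext_d a))" unfolding Proj_eq Lp_simps by simp
      also have "\<dots> = 0" by (rule Li_Proj[OF d])
      finally show "x \<in> dg.S k" unfolding a(2) S_iff using f by (auto intro!: forms_closed(3) Li_in[OF d])
    qed
    show "dg.S k \<subseteq> to_cone n p \<omega> k ` filtered_piece p k"
      using S_low_eq[OF _ True] by force
  qed
next
  case False
  then have k: "k > int (n + p)" by simp
  show ?thesis
  proof
    show "to_cone n p \<omega> k ` filtered_piece p k \<subseteq> dg.S k"
    proof
      fix x assume "x \<in> to_cone n p \<omega> k ` filtered_piece p k"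
      then obtain a where a: "a \<in> filtered_piece p k" "x = (0, - lef.star a)" using to_cone_high k by force
      then show "x \<in> dg.S k"
        using star_high_in[of a p k] Lp_star[OF a(1) k] k
        by (simp add: S_iff filtered_piece_high forms_closed Lp_simps Li_linear(4))
    qed
    show "dg.S k \<subseteq> to_cone n p \<omega> k ` filtered_piece p k"
    proof
      fix x assume x: "x \<in> dg.S k"
      obtain \<eta> \<xi> where x': "x = (\<eta>, \<xi>)" by (cases x)
      then have *: "\<eta> \<in> forms k" "\<xi> \<in> forms (k - 2 * int p - 1)" "Li p \<eta> = 0" "Li p (ext_d \<eta> + Lp p \<xi>) = 0"
        using x by (auto simp: S_iff)
      have "\<eta> = 0" using Linv_zero_high[OF *(1) k *(3)] .
      then have "Li p (Lp p \<xi>) = 0" using *(4) by (simp)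
      moreover have "Lp p \<xi> \<in> forms (k + 1)" by (rule Lp_in[OF *(2)]) simp
      ultimately have "Lp p \<xi> = 0" using Linv_zero_high[of "Lp p \<xi>" "k + 1" p] k by simp
      then have "Lp p (- \<xi>) = 0" by (simp only: Lp_simps) simp
      from barred_kernel[OF forms_closed(3)[OF *(2)] this k]
      show "x \<in> to_cone n p \<omega> k ` filtered_piece p k"
        using \<open>\<eta> = 0\<close> by (force simp: x')
    qed
  qed
qed

lemma D_S: "x \<in> dg.S k \<Longrightarrow> cone_diff p x \<in> dg.S (k + 1)"
  using dg.D_in[of x k "k + 1"] dg.D_D[of x k] dg.h_0 by (simp add: dg.S_def)

lemma to_cone_S: "a \<in> filtered_piece p k \<Longrightarrow> to_cone n p \<omega> k a \<in> dg.S k"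
  using to_cone_image by blast

text \<open>
  Below the middle, both sides lie in \<open>S\<close> and have the first component \<open>\<Pi>\<^sup>p d a\<close>. In the middle, the first
  component of the boundary is zero as \<open>d a\<close> is divisible by \<open>\<omega>\<^bsup>p+1\<^esup>\<close>, and the second one is given by the
  lemma on the second-order operator. Above it, \<open>d\<^sub>-\<close> is the conjugate of \<open>d\<close> by the reflection.
\<close>

lemma transferred_m1:
  assumes a: "a \<in> filtered_piece p k"
  shows "filtered_m1 p (k, a) \<in> filtered_piece p (k + 1) \<and>
    to_cone n p \<omega> (k + 1) (filtered_m1 p (k, a)) = cone_diff p (to_cone n p \<omega> k a)"
proof -
  consider "k < int (n + p)" | "k = int (n + p)" | "k > int (n + p)" by linarith
  then show ?thesis
  proof cases
    case 1
    have f: "a \<in> forms k" using a 1 by (simp add: filtered_piece_low)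
    have "fst (cone_diff p (to_cone n p \<omega> k a)) = Proj p (ext_d a)"
      using to_cone_low[OF a] 1 by (simp add: cone_diff_eq Lp_simps Proj_eq)
    moreover have "cone_diff p (to_cone n p \<omega> k a) \<in> dg.S (k + 1)" by (rule D_S[OF to_cone_S[OF a]])
    ultimately show ?thesis using S_low_eq[of "cone_diff p (to_cone n p \<omega> k a)" "k + 1"] 1
      by (simp add: filtered_m1_def d_plus_def)
  next
    case 2
    have f: "a \<in> forms (int (n + p))" "Lef_inv (p + 1) a = 0" using a by (simp_all add: filtered_piece_low 2 Lef_inv_Li)
    let ?u = "del_plus (del_minus a)"
    have u: "?u \<in> forms (int (n + p))" "Li p ?u = 0" "lef.star ?u = ext_d (Li p (ext_d a))"
      using del_plus_del_minus[OF p f] by (simp_all add: Lef_inv_Li star_r_eq)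
    have mem: "- ?u \<in> filtered_piece p (k + 1)"
      using u by (simp add: filtered_piece_high 2 forms_closed Li_linear(3)[OF u(1)])
    have top: "Lp p (Li p (ext_d a)) = ext_d a"
      using Lp_Li_high[OF forms_ext_d[OF f(1)], of p] by simp
    have "to_cone n p \<omega> (k + 1) (- ?u) = (0, ext_d (Li p (ext_d a)))"
      using to_cone_high[OF mem] u lef.star_minus[OF u(1)] 2 by simp
    moreover have "cone_diff p (to_cone n p \<omega> k a) = (0, ext_d (Li p (ext_d a)))"
      using to_cone_low[OF a] 2 top ext_d_minus[OF Li_in[OF forms_ext_d[OF f(1)] refl]]
      by (simp add: cone_diff_eq Lp_simps)
    ultimately show ?thesis using mem 2 by (simp add: filtered_m1_def)
  next
    case 3
    have y: "lef.star a \<in> forms (k - 2 * int p - 1)" using a 3 star_high_in by (simp add: filtered_piece_high)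
    have L: "Lp p (lef.star a) = 0" by (rule Lp_star[OF a 3])
    have dy: "ext_d (lef.star a) \<in> forms (k + 1 - 2 * int p - 1)" using forms_ext_d[OF y] by simp
    have "Lp p (ext_d (lef.star a)) = 0" unfolding ext_d_Lp[OF y, symmetric] L by simp
    then have "Lp p (- ext_d (lef.star a)) = 0" by (simp only: Lp_simps) simp
    from barred_kernel[OF forms_closed(3)[OF dy] this]
    show ?thesis using 3 to_cone_high[OF a 3] L lef.star_minus[OF dy] ext_d_minus[OF y]
      by (simp add: filtered_m1_def d_minus_def star_r_eq cone_diff_eq Lp_simps)
  qed
qed

lemma to_cone_fst_low: "a \<in> filtered_piece p k \<Longrightarrow> k \<le> int (n + p) \<Longrightarrow> fst (to_cone n p \<omega> k a) = a"
  by (simp add: to_cone_low)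

lemma to_cone_high_ideal: "a \<in> filtered_piece p k \<Longrightarrow> k > int (n + p) \<Longrightarrow> to_cone n p \<omega> k a \<in> cone_ideal p k"
  using star_high_in[of a p k] by (simp add: to_cone_high cone_ideal_def filtered_piece_high forms_closed)

lemma S_C: "x \<in> dg.S k \<Longrightarrow> x \<in> cone_piece p k"
  by (simp add: dg.S_def)

lemma to_cone_C: "a \<in> filtered_piece p k \<Longrightarrow> to_cone n p \<omega> k a \<in> cone_piece p k"
  using to_cone_S S_C by blast

lemma filtered_piece_0: "0 \<in> filtered_piece p k" and to_cone_0: "to_cone n p \<omega> k 0 = 0"
proof -
  show 0: "0 \<in> filtered_piece p k" by (simp add: filtered_piece_eq filtered_forms_zero)
  show "to_cone n p \<omega> k 0 = 0"
    using to_cone_low[OF 0] to_cone_high[OF 0] by (cases "k \<le> int (n + p)") (simp_all add: zero_prod_def Li_linear)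
qed

text \<open>
  If the product is unbarred, first components can be compared. If the factors are unbarred and the
  product is barred, then \<open>a \<and> b\<close> is divisible, and the three terms of the bracket come from \<open>D h\<close> and from
  the second components of the two factors. If one factor is barred, its second component is annihilated
  by \<open>\<omega>\<^bsup>p+1\<^esup>\<close>, hence so is the product, and \<open>P\<close> leaves it unchanged.
\<close>

lemma transferred_m2:
  assumes a: "a \<in> filtered_piece p k" and b: "b \<in> filtered_piece p l"
  shows "filtered_m2 p (k, a) (l, b) \<in> filtered_piece p (k + l) \<and>
    to_cone n p \<omega> (k + l) (filtered_m2 p (k, a) (l, b)) = dg.P (cone_wedge k (to_cone n p \<omega> k a) (to_cone n p \<omega> l b))"
proof -
  let ?z = "cone_wedge k (to_cone n p \<omega> k a) (to_cone n p \<omega> l b)"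
  have z: "?z \<in> cone_piece p (k + l)" by (rule dg.m_in[OF to_cone_C[OF a] to_cone_C[OF b] refl])
  \<comment> \<open>Factors of negative degree, which are zero, are separated: otherwise the product of an unbarred and a barred form need not have a barred degree.\<close>
  consider "k \<le> int (n + p)" "l \<le> int (n + p)" "k + l \<le> int (n + p)"
    | "k \<le> int (n + p)" "l \<le> int (n + p)" "k + l > int (n + p)"
    | "k < 0" "l > int (n + p)" | "k \<ge> 0" "k \<le> int (n + p)" "l > int (n + p)"
    | "k > int (n + p)" "l < 0" | "k > int (n + p)" "l \<ge> 0" "l \<le> int (n + p)"
    | "k > int (n + p)" "l > int (n + p)" by linarith
  then show ?thesis
  proof cases
    case 1
    have ab: "a \<in> forms k" "b \<in> forms l" using a b 1 by (simp_all add: filtered_piece_low)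
    have "fst ?z = a \<and>\<^sub>f b" using a b 1 by (simp add: cone_wedge_def to_cone_fst_low)
    then have "fst (dg.P ?z) = Proj p (a \<and>\<^sub>f b)" using P_fst[OF forms_wedge[OF ab], of "snd ?z"] by (metis prod.collapse)
    then show ?thesis using S_low_eq[OF dg.P_in_S[OF z] 1(3)] 1 by (simp add: filtered_m2_def)
  next
    case 2
    have ab: "a \<in> forms k" "b \<in> forms l" using a b 2 by (simp_all add: filtered_piece_low)
    define da where "da = Li p (ext_d a)"
    define db where "db = Li p (ext_d b)"
    define X where "X = Li p (a \<and>\<^sub>f b)"
    \<comment> \<open>\<open>Y\<close> is the form in the bracket defining the product, and \<open>X\<close> is the quotient of \<open>a \<and> b\<close>.\<close>
    define Y where "Y = - ext_d X + da \<and>\<^sub>f b + sgn_pow k *\<^sub>R (a \<and>\<^sub>f db)"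
    have wab: "a \<and>\<^sub>f b \<in> forms (k + l)" by (rule forms_wedge[OF ab])
    have f: "da \<in> forms (k - 2 * int p - 1)" "db \<in> forms (l - 2 * int p - 1)" "X \<in> forms (k + l - 2 * int p - 2)"
      unfolding da_def db_def X_def by (auto intro: Li_in[OF forms_ext_d[OF ab(1)]] Li_in[OF forms_ext_d[OF ab(2)]] Li_in[OF wab])
    have w: "da \<and>\<^sub>f b \<in> forms (k + l - 2 * int p - 1)" "a \<and>\<^sub>f db \<in> forms (k + l - 2 * int p - 1)" "ext_d X \<in> forms (k + l - 2 * int p - 1)"
      by (auto intro: wedge_in[OF f(1) ab(2)] wedge_in[OF ab(1) f(2)] d_in[OF f(3)])
    have Y: "Y \<in> forms (k + l - 2 * int p - 1)" unfolding Y_def by (intro forms_closed w)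
    have zz: "?z = (a \<and>\<^sub>f b, - ext_d X - Y)"
      using to_cone_low[OF a 2(1)] to_cone_low[OF b 2(2)]
      by (simp add: cone_wedge_def da_def[symmetric] db_def[symmetric] Y_def wedge_minus)
    have LX: "Lp p X = a \<and>\<^sub>f b" unfolding X_def by (rule Lp_Li_high[OF wab 2(3)])
    have fst0: "fst (dg.P ?z) = 0" unfolding zz P_fst[OF wab] Proj_eq X_def[symmetric] LX by simp
    have "ext_d (a \<and>\<^sub>f b) + Lp p (- ext_d X - Y) = Lp p (- Y)"
      unfolding LX[symmetric] ext_d_Lp[OF f(3)] by (simp add: Lp_simps)
    then have "snd (dg.P ?z) = (- ext_d X - Y) + ext_d X - Li p (Lp p (- Y))"
      unfolding zz using P_snd[OF wab, of "- ext_d X - Y"] w(3) Y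
      by (simp add: X_def[symmetric] forms_closed)
    also have "\<dots> = - (Y - Li p (Lp p Y))" unfolding Lp_simps Li_linear(3)[OF Lp_in[OF Y refl]] by simp
    finally have "dg.P ?z = (0, - (Y - Li p (Lp p Y)))" using fst0 by (simp add: prod_eq_iff)
    moreover have "filtered_m2 p (k, a) (l, b) = Proj p (lef.star Y)"
      using 2 by (simp add: filtered_m2_def Lef_inv_Li star_r_eq Y_def X_def da_def db_def)
    ultimately show ?thesis using barred[OF Y 2(3)] by simp
  next
    case 3
    then have "a = 0" using filtered_piece_below[OF a] by simp
    then have "filtered_m2 p (k, a) (l, b) = 0" using 3 by (simp add: filtered_m2_def star_r_eq)
    moreover have "?z = 0" using \<open>a = 0\<close> by (simp add: to_cone_0 dg.m_0)
    ultimately show ?thesis by (simp add: filtered_piece_0 to_cone_0)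
  next
    case 4
    have af: "a \<in> forms k" using a 4 by (simp add: filtered_piece_low)
    have bf: "lef.star b \<in> forms (l - 2 * int p - 1)" using b 4 star_high_in by (simp add: filtered_piece_high)
    define u where "u = sgn_pow k *\<^sub>R (a \<and>\<^sub>f lef.star b)"
    have w: "a \<and>\<^sub>f lef.star b \<in> forms (k + l - 2 * int p - 1)" by (rule wedge_in[OF af bf]) simp
    then have u: "u \<in> forms (k + l - 2 * int p - 1)" unfolding u_def by (rule forms_closed)
    have L: "Lp p u = 0" unfolding u_def Lp_simps Lp_wedge_right Lp_star[OF b 4(3)] by simp
    have zz: "?z = (0, - u)"
      using to_cone_low[OF a 4(2)] to_cone_high[OF b 4(3)] by (simp add: cone_wedge_def u_def wedge_minus)
    have "dg.P ?z = (0, - u)" unfolding zz using P_ideal[OF forms_closed(3)[OF u]] by (simp add: Lp_simps L Li_linear)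
    moreover have "filtered_m2 p (k, a) (l, b) = lef.star u"
      using 4 lef.star_scale[OF w] by (simp add: filtered_m2_def star_r_eq u_def)
    ultimately show ?thesis using barred_kernel[OF u L] 4 by simp
  next
    case 5
    then have "b = 0" using filtered_piece_below[OF b] by simp
    then have "filtered_m2 p (k, a) (l, b) = 0" using 5 by (simp add: filtered_m2_def star_r_eq)
    moreover have "?z = 0" using \<open>b = 0\<close> by (simp add: to_cone_0 dg.m_0)
    ultimately show ?thesis by (simp add: filtered_piece_0 to_cone_0)
  next
    case 6
    have bf: "b \<in> forms l" using b 6 by (simp add: filtered_piece_low)
    have af: "lef.star a \<in> forms (k - 2 * int p - 1)" using a 6 star_high_in by (simp add: filtered_piece_high)
    define u where "u = lef.star a \<and>\<^sub>f b"
    have u: "u \<in> forms (k + l - 2 * int p - 1)" unfolding u_def by (rule wedge_in[OF af bf]) simp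
    have L: "Lp p u = 0" unfolding u_def Lp_wedge_left Lp_star[OF a 6(1)] by simp
    have zz: "?z = (0, - u)"
      using to_cone_high[OF a 6(1)] to_cone_low[OF b 6(3)] by (simp add: cone_wedge_def u_def wedge_minus)
    have "dg.P ?z = (0, - u)" unfolding zz using P_ideal[OF forms_closed(3)[OF u]] by (simp add: Lp_simps L Li_linear)
    moreover have "filtered_m2 p (k, a) (l, b) = lef.star u"
      using 6 by (simp add: filtered_m2_def star_r_eq u_def)
    ultimately show ?thesis using barred_kernel[OF u L] 6 by simp
  next
    case 7
    then have "?z = 0" using dg.m_I_I[OF to_cone_high_ideal[OF a] to_cone_high_ideal[OF b]] by simp
    then show ?thesis using 7 by (simp add: filtered_m2_def filtered_piece_0 to_cone_0)
  qed
qed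

text \<open>
  The element \<open>W\<close> is \<open>- \<theta> Z\<close> with \<open>Z\<close> the bracket defining the triple product; the sign \<open>(-1)\<^sup>k\<close> in \<open>W\<close> is
  compensated by the one in the product with \<open>\<theta>\<close>. If the total degree is too small for a barred value,
  then \<open>Z\<close> has so low a degree that \<open>P\<close> annihilates it.
\<close>

lemma transferred_m3:
  assumes a: "a \<in> filtered_piece p k" and b: "b \<in> filtered_piece p l" and c: "c \<in> filtered_piece p i"
  shows "filtered_m3 p (k, a) (l, b) (i, c) \<in> filtered_piece p (k + l + i - 1) \<and>
    to_cone n p \<omega> (k + l + i - 1) (filtered_m3 p (k, a) (l, b) (i, c)) =
      dg.P (dg.W k l (to_cone n p \<omega> k a) (to_cone n p \<omega> l b) (to_cone n p \<omega> i c))"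
proof (cases "k \<le> int (n + p) \<and> l \<le> int (n + p) \<and> i \<le> int (n + p)")
  case False
  then have "dg.W k l (to_cone n p \<omega> k a) (to_cone n p \<omega> l b) (to_cone n p \<omega> i c) = 0"
    using dg.W_zero[OF to_cone_C[OF a] to_cone_C[OF b] to_cone_C[OF c]]
      to_cone_high_ideal[OF a] to_cone_high_ideal[OF b] to_cone_high_ideal[OF c] by linarith
  moreover have "filtered_m3 p (k, a) (l, b) (i, c) = 0" using False by (auto simp: filtered_m3_def)
  ultimately show ?thesis by (simp add: filtered_piece_0 to_cone_0)
next
  case True
  then have f: "a \<in> forms k" "b \<in> forms l" "c \<in> forms i" using a b c by (simp_all add: filtered_piece_low)
  define Z where "Z = a \<and>\<^sub>f Li p (b \<and>\<^sub>f c) - Li p (a \<and>\<^sub>f b) \<and>\<^sub>f c"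
  have L: "Li p (a \<and>\<^sub>f b) \<in> forms (k + l - 2 * int p - 2)" "Li p (b \<and>\<^sub>f c) \<in> forms (l + i - 2 * int p - 2)"
    by (auto intro: Li_in[OF forms_wedge[OF f(1,2)]] Li_in[OF forms_wedge[OF f(2,3)]])
  have Z: "Z \<in> forms (k + l + i - 1 - 2 * int p - 1)"
    unfolding Z_def by (rule forms_closed(2)[OF wedge_in[OF f(1) L(2)] wedge_in[OF L(1) f(3)]]) simp_all
  have h: "cone_homotopy n p \<omega> (cone_wedge k (to_cone n p \<omega> k a) (to_cone n p \<omega> l b)) = (0, Li p (a \<and>\<^sub>f b))"
    "cone_homotopy n p \<omega> (cone_wedge l (to_cone n p \<omega> l b) (to_cone n p \<omega> i c)) = (0, Li p (b \<and>\<^sub>f c))"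
    using True a b c cone_homotopy_eq[OF forms_wedge[OF f(1,2)]] cone_homotopy_eq[OF forms_wedge[OF f(2,3)]]
    by (simp_all add: cone_wedge_def to_cone_fst_low)
  have W: "dg.W k l (to_cone n p \<omega> k a) (to_cone n p \<omega> l b) (to_cone n p \<omega> i c) = (0, - Z)"
    unfolding dg.W_def h using True a c by (simp add: cone_wedge_def to_cone_fst_low Z_def)
  have PW: "dg.P (dg.W k l (to_cone n p \<omega> k a) (to_cone n p \<omega> l b) (to_cone n p \<omega> i c)) = (0, - (Z - Li p (Lp p Z)))"
    unfolding W P_ideal[OF forms_closed(3)[OF Z]] Lp_simps Li_linear(3)[OF Lp_in[OF Z refl]] by simp
  show ?thesis
  proof (cases "k + l + i \<ge> int (n + p + 2)")
    case True
    then have "filtered_m3 p (k, a) (l, b) (i, c) = Proj p (lef.star Z)"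
      using \<open>k \<le> int (n + p) \<and> l \<le> int (n + p) \<and> i \<le> int (n + p)\<close>
      by (simp add: filtered_m3_def star_r_eq Lef_inv_Li Z_def)
    then show ?thesis unfolding PW using barred[OF Z] True by simp
  next
    case False
    have "Li p (Lp p Z) = Z" by (rule Linv_L_pow_low[OF Z]) (use False in simp)
    moreover have "filtered_m3 p (k, a) (l, b) (i, c) = 0" using False by (simp add: filtered_m3_def)
    ultimately show ?thesis unfolding PW by (simp add: filtered_piece_0 to_cone_0 zero_prod_def)
  qed
qed

lemma filtered_piece_subspace: "subspace (filtered_piece p k)"
proof -
  have "subspace {a \<in> forms j. Li p a = 0}" for j
    using lef.Linv_scale by (auto simp: subspace_def forms_closed Li_def lef.Linv_add[of _ j _ j])
  then show ?thesis by (simp add: filtered_piece_eq filtered_forms_eq)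
qed

lemma to_cone_linear:
  assumes "a \<in> filtered_piece p k" "b \<in> filtered_piece p k"
  shows "to_cone n p \<omega> k (a + b) = to_cone n p \<omega> k a + to_cone n p \<omega> k b"
    "to_cone n p \<omega> k (r *\<^sub>R a) = r *\<^sub>R to_cone n p \<omega> k a"
proof -
  have ab: "a + b \<in> filtered_piece p k" "r *\<^sub>R a \<in> filtered_piece p k"
    using assms filtered_piece_subspace by (auto simp: subspace_add subspace_scale)
  have "to_cone n p \<omega> k (a + b) = to_cone n p \<omega> k a + to_cone n p \<omega> k b \<and> to_cone n p \<omega> k (r *\<^sub>R a) = r *\<^sub>R to_cone n p \<omega> k a"
  proof (cases "k \<le> int (n + p)")
    case True
    then have f: "a \<in> forms k" "b \<in> forms k" using assms by (simp_all add: filtered_piece_low)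
    show ?thesis
      using to_cone_low[OF _ True] assms ab ext_d_add[OF f] Li_linear(1)[OF forms_ext_d[OF f(1)] forms_ext_d[OF f(2)]]
        ext_d_scale[OF f(1)] lef.Linv_scale[OF forms_ext_d[OF f(1)]]
      by (simp add: Li_def)
  next
    case False
    then have f: "a \<in> forms (2 * int n + 2 * int p + 1 - k)" "b \<in> forms (2 * int n + 2 * int p + 1 - k)"
      using assms by (simp_all add: filtered_piece_high)
    show ?thesis
      using to_cone_high assms ab False lef.star_add[OF f] lef.star_scale[OF f(1)] by simp
  qed
  then show "to_cone n p \<omega> k (a + b) = to_cone n p \<omega> k a + to_cone n p \<omega> k b"
    "to_cone n p \<omega> k (r *\<^sub>R a) = r *\<^sub>R to_cone n p \<omega> k a" by auto
qed

lemma to_cone_inj: assumes "a \<in> filtered_piece p k" "to_cone n p \<omega> k a = 0" shows "a = 0"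
proof (cases "k \<le> int (n + p)")
  case True
  then show ?thesis using to_cone_low[OF assms(1)] assms(2) by (simp add: zero_prod_def)
next
  case False
  then have "lef.star a = 0" using to_cone_high[OF assms(1)] assms(2) by (simp add: zero_prod_def)
  moreover have "a \<in> forms (2 * int n + 2 * int p + 1 - k)" using assms(1) False by (simp add: filtered_piece_high)
  ultimately show ?thesis using lef.star_star[of a] by simp
qed

text \<open>
  In particular this proves that the filtered forms satisfy the relations of an \<open>A\<^sub>\<infinity>\<close>-algebra.
\<close>

lemma transferred_ainf_filtered:
  "transferred_ainf (cone_piece p) (cone_ideal p) (cone_diff p) (cone_homotopy n p \<omega>) cone_wedge
    (filtered_algebra p) (cone_algebra p) (to_cone n p \<omega>)"
proof (intro transferred_ainf.intro transferred_ainf_axioms.intro dga_contraction_cone)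
  fix xs :: "(int \<times> ('a, 'b) form) list" assume "length xs > 3"
  then show "mu (filtered_algebra p) xs = 0"
    by (auto simp: filtered_algebra_def split: list.split)
next
  fix zs :: "(int \<times> ('a, 'b) form \<times> ('a, 'b) form) list" assume "length zs > 2"
  then show "mu (cone_algebra p) zs = 0"
    by (auto simp: cone_algebra_def split: list.split)
next
  fix k l :: int and z w :: "('a, 'b) form \<times> ('a, 'b) form"
  show "mu (cone_algebra p) [(k, z)] = cone_diff p z"
    by (cases z) (simp add: cone_algebra_def cone_diff_def omega_pow_wedge)
  show "mu (cone_algebra p) [(k, z), (l, w)] = cone_wedge k z w"
    by (cases z; cases w) (simp add: cone_algebra_def cone_wedge_def)
qed (use transferred_m1 transferred_m2 transferred_m3 filtered_piece_subspace to_cone_linear to_cone_inj to_cone_image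
    in \<open>auto simp: filtered_algebra_def cone_algebra_def\<close>)

lemma ainf_equivalence_natural_map:
  "ainf_equivalence (filtered_algebra p) (cone_algebra p) (natural_map n p \<omega>)"
proof -
  interpret tr: transferred_ainf "cone_piece p" "cone_ideal p" "cone_diff p" "cone_homotopy n p \<omega>" cone_wedge
    "filtered_algebra p" "cone_algebra p" "to_cone n p \<omega>"
    by (rule transferred_ainf_filtered)
  have "tr.g = natural_map n p \<omega>" by (intro ext) (simp add: tr.g_def natural_map_def)
  then show ?thesis using tr.ainf_equivalence_g by simp
qed

end

end

section \<open>Naturality\<close>

text \<open>
  Restriction to an open set and pullback along a diffeomorphism are both of the following form:
  some charts are relabelled, without changing their images, and the others are given the form zero.
\<close>

definition relabel :: "(('a, 'b) chart \<Rightarrow> bool) \<Rightarrow> (('a, 'b) chart \<Rightarrow> ('a, 'b) chart) \<Rightarrow> ('a, 'b) form \<Rightarrow> ('a, 'b) form" where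
  "relabel Q \<sigma> \<eta> = (\<lambda>c. if Q c then \<eta> (\<sigma> c) else 0)"

lemma relabel_simps: "relabel Q \<sigma> 0 = 0" "relabel Q \<sigma> (- \<eta>) = - relabel Q \<sigma> \<eta>"
  "relabel Q \<sigma> (\<eta> + \<xi>) = relabel Q \<sigma> \<eta> + relabel Q \<sigma> \<xi>" "relabel Q \<sigma> (r *\<^sub>R \<eta>) = r *\<^sub>R relabel Q \<sigma> \<eta>"
  "relabel Q \<sigma> (\<eta> \<and>\<^sub>f \<xi>) = relabel Q \<sigma> \<eta> \<and>\<^sub>f relabel Q \<sigma> \<xi>"
  by (auto simp: relabel_def fun_eq_iff wedge_def)

text \<open>
  The operators are computed chart by chart and point by point, and annihilate zero.
\<close>

lemma relabel_Linv: "relabel Q \<sigma> (local_Linv n q \<omega> \<eta>) = local_Linv n q (relabel Q \<sigma> \<omega>) (relabel Q \<sigma> \<eta>)"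
  and relabel_star: "relabel Q \<sigma> (local_star n \<omega> \<eta>) = local_star n (relabel Q \<sigma> \<omega>) (relabel Q \<sigma> \<eta>)"
  by (auto simp: relabel_def local_Linv_def local_star_def pointwise_Linv_def pointwise_star_def fun_eq_iff)

lemma relabel_ext_d:
  fixes \<eta> :: "('a, 'b::euclidean_space) form"
  assumes "\<And>c. Q c \<Longrightarrow> chart_image (\<sigma> c) = chart_image c"
  shows "relabel Q \<sigma> (ext_d \<eta>) = ext_d (relabel Q \<sigma> \<eta>)"
  using assms by (auto simp: relabel_def ext_d_def fun_eq_iff)

lemma relabel_to_cone:
  fixes \<eta> \<omega> :: "('a, 'b::euclidean_space) form"
  assumes "\<And>c. Q c \<Longrightarrow> chart_image (\<sigma> c) = chart_image c"
  shows "map_prod (relabel Q \<sigma>) (relabel Q \<sigma>) (to_cone n p \<omega> k \<eta>) = to_cone n p (relabel Q \<sigma> \<omega>) k (relabel Q \<sigma> \<eta>)"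
  by (simp add: to_cone_def relabel_simps relabel_Linv relabel_star relabel_ext_d[OF assms])

text \<open>
  Relabelling commutes with products, with the exterior derivative, for which the charts must keep their
  images, and with the pointwise operators.
\<close>

lemma relabel_natural_map:
  fixes \<omega> :: "('a, 'b::euclidean_space) form"
  assumes "\<And>c. Q c \<Longrightarrow> chart_image (\<sigma> c) = chart_image c"
  shows "natural_map n p (relabel Q \<sigma> \<omega>) (map (apsnd (relabel Q \<sigma>)) xs) =
    map_prod (relabel Q \<sigma>) (relabel Q \<sigma>) (natural_map n p \<omega> xs)"
proof -
  let ?R = "map_prod (relabel Q \<sigma>) (relabel Q \<sigma>)"
  note R = relabel_to_cone[OF assms, symmetric]
  have wedge: "cone_wedge k (?R z) (?R w) = ?R (cone_wedge k z w)" for k z w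
    by (simp add: cone_wedge_def relabel_simps)
  have homotopy: "- cone_homotopy n p (relabel Q \<sigma> \<omega>) (?R z) = ?R (- cone_homotopy n p \<omega> z)" for z
    by (simp add: cone_homotopy_def relabel_simps relabel_Linv)
  have zero: "0 = ?R 0" by (simp add: zero_prod_def relabel_simps)
  consider "xs = []" | k a where "xs = [(k, a)]" | k a l b where "xs = [(k, a), (l, b)]"
    | k a l b i c ys where "xs = (k, a) # (l, b) # (i, c) # ys"
    by (metis neq_Nil_conv surj_pair)
  then show ?thesis
    by cases (simp_all add: natural_map_def R wedge homotopy zero[symmetric])
qed

lemma natural_family_natural_map: "natural_family n p ((\<lambda>A. natural_map n p) :: ('a, 'b::euclidean_space) ops_family)"
  unfolding natural_family_def
proof
  have restrict: "(restrict_form U :: ('a, 'b) form \<Rightarrow> _) = relabel (\<lambda>c. fst c \<subseteq> U) (\<lambda>c. c)" for U :: "'a set"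
    by (intro ext) (simp add: restrict_form_def relabel_def)
  show "commutes_with_restriction n p ((\<lambda>A. natural_map n p) :: ('a, 'b) ops_family)"
    unfolding commutes_with_restriction_def restrict by (intro allI impI relabel_natural_map) simp
  show "commutes_with_symplectomorphisms n p ((\<lambda>A. natural_map n p) :: ('a, 'b) ops_family)"
    unfolding commutes_with_symplectomorphisms_def
  proof (intro allI impI, elim conjE)
    fix X X' :: "'a topology" and A A' :: "('a, 'b) chart set" and \<omega> \<omega>' :: "('a, 'b) form" and h :: "'a \<Rightarrow> 'a"
      and xs :: "(int \<times> ('a, 'b) form) list"
    assume "symplectic_manifold X A \<omega> n" "symplectomorphism X A \<omega> X' A' \<omega>' h"
    then interpret symplectic_manifold X A \<omega> n by simp
    have h: "inj_on h (topspace X)" "pullback_form A h \<omega>' = \<omega>"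
      using \<open>symplectomorphism X A \<omega> X' A' \<omega>' h\<close> by (auto simp: symplectomorphism_def diffeomorphism_def bij_betw_def)
    have pullback: "pullback_form A h = relabel (\<lambda>c. c \<in> A) (push_chart h)"
      by (intro ext) (simp add: pullback_form_def relabel_def)
    have "chart_image (push_chart h c) = chart_image c" if "c \<in> A" for c
      using inj_on_subset[OF h(1) chart_domain[OF that]]
      by (auto simp: chart_image_def push_chart_def inv_into_f_f image_iff)
    from relabel_natural_map[of "\<lambda>c. c \<in> A", OF this, of n p \<omega>' xs]
    show "natural_map n p \<omega> (map (apsnd (pullback_form A h)) xs) =
        map_prod (pullback_form A h) (pullback_form A h) (natural_map n p \<omega>' xs)"
      unfolding h(2)[symmetric] unfolding pullback .
  qed
qed

theorem theorem1p1:
  fixes n p :: nat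
  assumes "p \<le> n"
  shows "\<exists>g :: ('a, 'b::euclidean_space) ops_family.
    natural_family n p g \<and>
    (\<forall>X A \<omega>. symplectic_manifold X A \<omega> n \<longrightarrow>
      ainf_equivalence
        (symplectic_manifold.filtered_algebra A \<omega> n p)
        (symplectic_manifold.cone_algebra A \<omega> p)
        (g A \<omega>))"
  using natural_family_natural_map symplectic_manifold.ainf_equivalence_natural_map[OF _ assms]
  by (intro exI[of _ "\<lambda>A. natural_map n p"]) blast

end
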